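(* Consider the general discrete memoryless CRAN with $L\ge1$ users, $K\ge1$ relays, fronthaul capacities $C_{\mathcal K}=(C_1,\dots,C_K)$, oblivious relay processing and enabled time-sharing (see context), with arbitrary channel $p(y_{\mathcal K}|x_{\mathcal L})$. If a rate tuple $(R_1,\dots,R_L)$ is achievable, then for all non-empty subsets $\mathcal T\subseteq\mathcal L$ and all subsets $\mathcal S\subseteq\mathcal K$ it holds that $$\sum_{t\in\mathcal T}R_t\le\sum_{s\in\mathcal S}C_s-I(Y_{\mathcal S};U_{\mathcal S}|X_{\mathcal L},U_{\mathcal S^c},Q)+I(X_{\mathcal T};U_{\mathcal S^c}|X_{\mathcal T^c},Q),$$ for some random variables $(Q,X_{\mathcal L},Y_{\mathcal K},U_{\mathcal K},W)$ (the same for all $\mathcal T,\mathcal S$) such that $(Q,X_{\mathcal L},Y_{\mathcal K},W)$ is distributed according to $$p(q)\prod_{l=1}^L p(x_l|q)\;p(y_{\mathcal K}|x_{\mathcal L})\;p(w|q)$$ and $U_k=f_k(W,Y_k,Q)$ for $k\in\mathcal K$, for some random variable $W$ and some deterministic functions $f_k$, $k\in\mathcal K$.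
   Context: Notation: $\mathcal L=\{1,\dots,L\}$, $\mathcal K=\{1,\dots,K\}$, $[1:N]=\{1,\dots,N\}$; for an index set $\mathcal A$, $X_{\mathcal A}=(X_a)_{a\in\mathcal A}$; $\mathcal T^c=\mathcal L\setminus\mathcal T$, $\mathcal S^c=\mathcal K\setminus\mathcal S$; $X^n=(X_1,\dots,X_n)$. $I$ is (conditional) mutual information, logarithms are base 2. Rates and capacities are non-negative; $2^{nR}$ is treated as an integer. Model (discrete memoryless CRAN with oblivious relay processing and enabled time-sharing). There are $L$ users with finite input alphabets $\mathcal X_l$, $K$ relays with finite output alphabets $\mathcal Y_k$, and a central processor (CP). Relay $k$ is connected to the CP by an error-free link of capacity $C_k$. The channel is memoryless: $p(y_{\mathcal K}^n|x_{\mathcal L}^n)=\prod_{i=1}^n p_{Y_{\mathcal K}|X_{\mathcal L}}(y_{\mathcal K,i}|x_{\mathcal L,i})$. An $(n,R_1,\dots,R_L)$ code consists of the following. (i) A time-sharing sequence $Q^n$, i.i.d. according to a pmf $p_Q$ on an alphabet $\mathcal Q$, known to all terminals. (ii) For each user $l$, a conditional pmf $p_{X_l|Q}$ and an encoding map $\phi_l:[1:|\mathcal X_l|^{n2^{nR_l}}]\times[1:2^{nR_l}]\times\mathcal Q^n\to\mathcal X_l^n$. User $l$ sends $X_l^n=\phi_l(F_l,M_l,Q^n)$, where $M_l$ is its message and $F_l$ is a codebook index running over all possible codebooks (for each $q^n$, the index $f_l$ enumerates all $|\mathcal X_l|^{n2^{nR_l}}$ assignments of codewords in $\mathcal X_l^n$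 to the $2^{nR_l}$ messages). The index is chosen at random with $$p_{F_l|Q^n}(f_l|q^n)=\prod_{m_l\in[1:2^{nR_l}]}p_{X_l^n|Q^n}(\phi_l(f_l,m_l,q^n)|q^n),\qquad p_{X_l^n|Q^n}(x_l^n|q^n)=\prod_{i=1}^n p_{X_l|Q}(x_{l,i}|q_i).$$ (iii) For each relay $k$, a map $\phi_k^r:\mathcal Y_k^n\times\mathcal Q^n\to[1:2^{nC_k}]$; the relay does not know $F_{\mathcal L}$ and sends $J_k=\phi_k^r(Y_k^n,Q^n)$ to the CP. (iv) A decoding map $g$ at the CP, which knows all codebook indices: $(\hat M_1,\dots,\hat M_L)=g(F_1,\dots,F_L,J_1,\dots,J_K,Q^n)$. The messages $M_l$ are independent, uniform on $[1:2^{nR_l}]$ and independent of $(F_{\mathcal L},Q^n)$; the $F_l$ are independent across $l$ conditionally on $Q^n$. A rate tuple $(R_1,\dots,R_L)$ is achievable if for every $\epsilon>0$ there is a sequence of $(n,R_1,\dots,R_L)$ codes with $\Pr\{(\hat M_1,\dots,\hat M_L)\ne(M_1,\dots,M_L)\}\le\epsilon$ (for $n$ large enough). *)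

theory Defs
  imports "HOL-Probability.Probability"
begin

text \<open>
  Users and relays are indexed by finite types \<open>'l\<close> and \<open>'k\<close>; the alphabets are sets
  \<open>XX l\<close> and \<open>YY k\<close>, and \<open>ch x\<close> is the conditional pmf of the relay outputs given the
  channel inputs \<open>x\<close>.  Blocks of length \<open>n\<close> are functions on \<open>{1..n}\<close>, equal to
  \<open>undefined\<close> elsewhere.  The time-sharing alphabet is \<open>nat\<close>: a pmf has countable support, so
  this covers every discrete alphabet.
\<close>

text \<open>The index set \<open>[1:2^(n r)]\<close> is \<open>{1..num_idx n r}\<close>, with \<open>2^(n r)\<close> rounded down.\<close>

definition num_idx :: "nat \<Rightarrow> real \<Rightarrow> nat" where
  "num_idx n r = nat \<lfloor>2 powr (real n * r)\<rfloor>"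

record ('l, 'k, 'x, 'y) cran_code =
  time_pmf :: "nat pmf"
  input_pmf :: "'l \<Rightarrow> nat \<Rightarrow> 'x pmf"
  encoder :: "'l \<Rightarrow> nat \<Rightarrow> nat \<Rightarrow> (nat \<Rightarrow> nat) \<Rightarrow> (nat \<Rightarrow> 'x)"
  relay :: "'k \<Rightarrow> (nat \<Rightarrow> 'y) \<Rightarrow> (nat \<Rightarrow> nat) \<Rightarrow> nat"
  decoder :: "('l \<Rightarrow> nat) \<Rightarrow> ('k \<Rightarrow> nat) \<Rightarrow> (nat \<Rightarrow> nat) \<Rightarrow> ('l \<Rightarrow> nat)"

text \<open>
  The arguments of \<open>encoder c l\<close> are the codebook index, the message and the time-sharing
  sequence.  The bijection says that, for every time-sharing sequence, the codebook indices
  enumerate all assignments of codewords to messages.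
\<close>

definition cran_code_valid ::
  "('l::finite \<Rightarrow> 'x set) \<Rightarrow> ('k::finite \<Rightarrow> 'y set) \<Rightarrow> ('k \<Rightarrow> real) \<Rightarrow> ('l \<Rightarrow> real) \<Rightarrow> nat
    \<Rightarrow> ('l, 'k, 'x, 'y) cran_code \<Rightarrow> bool" where
  "cran_code_valid XX YY C R n c \<longleftrightarrow>
     (\<forall>l q. set_pmf (input_pmf c l q) \<subseteq> XX l) \<and>
     (\<forall>l. \<forall>q \<in> {1..n} \<rightarrow>\<^sub>E UNIV.
        bij_betw (\<lambda>f. \<lambda>m\<in>{1..num_idx n (R l)}. encoder c l f m q)
          {1..card (XX l) ^ (n * num_idx n (R l))}
          ({1..num_idx n (R l)} \<rightarrow>\<^sub>E ({1..n} \<rightarrow>\<^sub>E XX l))) \<and>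
     (\<forall>k. \<forall>y \<in> {1..n} \<rightarrow>\<^sub>E YY k. \<forall>q \<in> {1..n} \<rightarrow>\<^sub>E UNIV.
        relay c k y q \<in> {1..num_idx n (C k)})"

text \<open>
  Law of the codebook index of user \<open>l\<close> given the time-sharing sequence.  For a valid code the
  argument of \<^const>\<open>embed_pmf\<close> is nonnegative and sums to one, so this is the pmf with
  exactly that density.
\<close>

definition codebook_pmf ::
  "('l \<Rightarrow> 'x set) \<Rightarrow> ('l \<Rightarrow> real) \<Rightarrow> nat \<Rightarrow> ('l, 'k, 'x, 'y) cran_code \<Rightarrow> 'l \<Rightarrow> (nat \<Rightarrow> nat)
    \<Rightarrow> nat pmf" where
  "codebook_pmf XX R n c l q =
     embed_pmf (\<lambda>f. if f \<in> {1..card (XX l) ^ (n * num_idx n (R l))}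
       then \<Prod>m\<in>{1..num_idx n (R l)}. \<Prod>i\<in>{1..n}. pmf (input_pmf c l (q i)) (encoder c l f m q i)
       else 0)"

text \<open>Joint law of the transmitted and the decoded message tuples.\<close>

definition message_pmf ::
  "('l::finite \<Rightarrow> 'x set) \<Rightarrow> (('l \<Rightarrow> 'x) \<Rightarrow> ('k::finite \<Rightarrow> 'y) pmf) \<Rightarrow> ('l \<Rightarrow> real) \<Rightarrow> nat
    \<Rightarrow> ('l, 'k, 'x, 'y) cran_code \<Rightarrow> (('l \<Rightarrow> nat) \<times> ('l \<Rightarrow> nat)) pmf" where
  "message_pmf XX ch R n c = do {
     q \<leftarrow> Pi_pmf {1..n} undefined (\<lambda>_. time_pmf c);
     m \<leftarrow> Pi_pmf UNIV undefined (\<lambda>l. pmf_of_set {1..num_idx n (R l)});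
     f \<leftarrow> Pi_pmf UNIV undefined (\<lambda>l. codebook_pmf XX R n c l q);
     y \<leftarrow> Pi_pmf {1..n} undefined (\<lambda>i. ch (\<lambda>l. encoder c l (f l) (m l) q i));
     return_pmf (m, decoder c f (\<lambda>k. relay c k (\<lambda>i\<in>{1..n}. y i k) q) q)
   }"

definition error_prob ::
  "('l::finite \<Rightarrow> 'x set) \<Rightarrow> (('l \<Rightarrow> 'x) \<Rightarrow> ('k::finite \<Rightarrow> 'y) pmf) \<Rightarrow> ('l \<Rightarrow> real) \<Rightarrow> nat
    \<Rightarrow> ('l, 'k, 'x, 'y) cran_code \<Rightarrow> real" where
  "error_prob XX ch R n c =
     measure_pmf.prob (message_pmf XX ch R n c) {(m, m'). m' \<noteq> m}"

definition cran_achievable ::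
  "('l::finite \<Rightarrow> 'x set) \<Rightarrow> ('k::finite \<Rightarrow> 'y set) \<Rightarrow> (('l \<Rightarrow> 'x) \<Rightarrow> ('k \<Rightarrow> 'y) pmf)
    \<Rightarrow> ('k \<Rightarrow> real) \<Rightarrow> ('l \<Rightarrow> real) \<Rightarrow> bool" where
  "cran_achievable XX YY ch C R \<longleftrightarrow>
     (\<forall>\<epsilon>>0. \<exists>c :: nat \<Rightarrow> ('l, 'k, 'x, 'y) cran_code.
        \<forall>\<^sub>F n in sequentially.
          cran_code_valid XX YY C R n (c n) \<and> error_prob XX ch R n (c n) \<le> \<epsilon>)"

text \<open>
  In the following, \<open>W\<close> is a general random variable: it takes values in the Polish space
  \<open>nat \<Rightarrow> real\<close>, into which every standard Borel space embeds.
  The factor \<open>p(w|q)\<close> is the kernel \<open>pW\<close>.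
\<close>

definition cran_law ::
  "('l::finite \<Rightarrow> 'x set) \<Rightarrow> ('k::finite \<Rightarrow> 'y set) \<Rightarrow> (('l \<Rightarrow> 'x) \<Rightarrow> ('k \<Rightarrow> 'y) pmf)
    \<Rightarrow> 'w measure \<Rightarrow> ('w \<Rightarrow> nat) \<Rightarrow> ('l \<Rightarrow> 'w \<Rightarrow> 'x) \<Rightarrow> ('k \<Rightarrow> 'w \<Rightarrow> 'y) \<Rightarrow> ('w \<Rightarrow> (nat \<Rightarrow> real))
    \<Rightarrow> bool" where
  "cran_law XX YY ch \<Omega> Q X Y W \<longleftrightarrow>
     prob_space \<Omega> \<and>
     Q \<in> \<Omega> \<rightarrow>\<^sub>M count_space UNIV \<and>
     (\<forall>l. X l \<in> \<Omega> \<rightarrow>\<^sub>M count_space (XX l)) \<and>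
     (\<forall>k. Y k \<in> \<Omega> \<rightarrow>\<^sub>M count_space (YY k)) \<and>
     W \<in> \<Omega> \<rightarrow>\<^sub>M borel \<and>
     (\<exists>(pQ :: nat pmf) (pX :: 'l \<Rightarrow> nat \<Rightarrow> 'x pmf) (pW :: nat \<Rightarrow> (nat \<Rightarrow> real) measure).
        (\<forall>l q. set_pmf (pX l q) \<subseteq> XX l) \<and>
        (\<forall>q. prob_space (pW q) \<and> sets (pW q) = sets borel) \<and>
        (\<forall>q x y. \<forall>A \<in> sets borel.
           measure \<Omega> {\<omega> \<in> space \<Omega>. Q \<omega> = q \<and> (\<forall>l. X l \<omega> = x l) \<and> (\<forall>k. Y k \<omega> = y k) \<and> W \<omega> \<in> A}
           = pmf pQ q * (\<Prod>l\<in>UNIV. pmf (pX l q) (x l)) * pmf (ch x) y * measure (pW q) A))"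

text \<open>
  \<^const>\<open>prob_space.conditional_mutual_information\<close> is a difference of two Kullback--Leibler
  divergences.  It is used below only with a first argument of finite range, so both divergences
  are finite and the difference is meaningful whatever the laws of the other arguments.
\<close>

definition I_fronthaul ::
  "('l::finite \<Rightarrow> 'x set) \<Rightarrow> ('k::finite \<Rightarrow> 'y set) \<Rightarrow> 'w measure \<Rightarrow> ('w \<Rightarrow> nat) \<Rightarrow> ('l \<Rightarrow> 'w \<Rightarrow> 'x)
    \<Rightarrow> ('k \<Rightarrow> 'w \<Rightarrow> 'y) \<Rightarrow> ('k \<Rightarrow> 'w \<Rightarrow> (nat \<Rightarrow> real)) \<Rightarrow> 'k set \<Rightarrow> real" where
    \<comment> \<open>\<open>I(Y\<^sub>S; U\<^sub>S | X\<^sub>L, U\<^sub>S\<^sub>c, Q)\<close>\<close>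
  "I_fronthaul XX YY \<Omega> Q X Y U S =
     prob_space.conditional_mutual_information \<Omega> 2
       (\<Pi>\<^sub>M k\<in>S. count_space (YY k))
       (\<Pi>\<^sub>M k\<in>S. borel)
       ((\<Pi>\<^sub>M l\<in>UNIV. count_space (XX l)) \<Otimes>\<^sub>M (\<Pi>\<^sub>M k\<in>-S. borel) \<Otimes>\<^sub>M count_space UNIV)
       (\<lambda>\<omega>. \<lambda>k\<in>S. Y k \<omega>)
       (\<lambda>\<omega>. \<lambda>k\<in>S. U k \<omega>)
       (\<lambda>\<omega>. (\<lambda>l. X l \<omega>, \<lambda>k\<in>-S. U k \<omega>, Q \<omega>))"

definition I_users ::
  "('l::finite \<Rightarrow> 'x set) \<Rightarrow> 'w measure \<Rightarrow> ('w \<Rightarrow> nat) \<Rightarrow> ('l \<Rightarrow> 'w \<Rightarrow> 'x)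
    \<Rightarrow> ('k::finite \<Rightarrow> 'w \<Rightarrow> (nat \<Rightarrow> real)) \<Rightarrow> 'l set \<Rightarrow> 'k set \<Rightarrow> real" where
    \<comment> \<open>\<open>I(X\<^sub>T; U\<^sub>S\<^sub>c | X\<^sub>T\<^sub>c, Q)\<close>\<close>
  "I_users XX \<Omega> Q X U T S =
     prob_space.conditional_mutual_information \<Omega> 2
       (\<Pi>\<^sub>M l\<in>T. count_space (XX l))
       (\<Pi>\<^sub>M k\<in>-S. borel)
       ((\<Pi>\<^sub>M l\<in>-T. count_space (XX l)) \<Otimes>\<^sub>M count_space UNIV)
       (\<lambda>\<omega>. \<lambda>l\<in>T. X l \<omega>)
       (\<lambda>\<omega>. \<lambda>k\<in>-S. U k \<omega>)
       (\<lambda>\<omega>. (\<lambda>l\<in>-T. X l \<omega>, Q \<omega>))"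

end

theory Submission
  imports Defs
begin

text \<open>
  Because the relays do not know the codebooks, averaging over the codebook indices makes the channel
  inputs independent over time.  Fano's inequality and a telescoping argument then bound the rates of
  any code of length \<open>n\<close> by the average over the letters of a single-letter expression whose message
  variables are functions of a finitely supported random table \<open>w\<close> (a \<open>finite structure\<close>).  The
  error terms vanish only in the limit, so the heart of the matter is that the set of single-letter
  bounds may be closed up.  The bounds depend only on the joint laws of the posteriors of the relay
  outputs given the messages of each set of relays.  A private simultaneous messages protocol replaces
  the messages by finitely many real coordinates that reveal just these posteriors, up to a small
  error, through a fixed continuous decoder.  The number of coordinates depends on the alphabets only,
  so weak compactness (with a space-filling curve to code the coordinates by one real number) yields
  limits that are again of the required form, with real randomness.  Time sharing \<open>Q\<close> provides the
  convex combinations.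
\<close>

section \<open>Entropy of finitely supported random variables\<close>

text \<open>Conditional mutual information is not continuous under weak convergence of the joint law
  of sources and messages, and the message alphabets of a code grow with its length, so compactness
  cannot be applied to the messages directly. It can be applied once the posterior of every set of
  relays is a fixed continuous function of their messages: the bound is then the mean of a bounded
  continuous function. But a joint posterior cannot simply be sent, since each relay sees only its
  own output. The common randomness resolves this: it may contain the table of the posteriors at all
  output vectors, and the messages need only unlock the entry of the actual outputs. They must
  unlock nothing more, for otherwise the true posterior given the messages would differ from the
  decoded one. Correctness of the decoded posterior is an identity linear in the law of the
  messages; it holds approximately along the sequence, can be tested with continuous functions, and
  therefore becomes exact in the weak limit.\<close>

definition eta :: "real \<Rightarrow> real" where
  "eta r = - (r * log 2 r)"

definition pr :: "'a pmf \<Rightarrow> ('a \<Rightarrow> 'b) \<Rightarrow> 'b \<Rightarrow> real" where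
  "pr P f b = measure_pmf.prob P {\<omega>. f \<omega> = b}"

text \<open>The mean surprisal, summed over outcomes instead of values: entropies of different
  functions can then be compared term by term.\<close>

definition entropy_of :: "'a pmf \<Rightarrow> ('a \<Rightarrow> 'b) \<Rightarrow> real" where
  "entropy_of P f = (\<Sum>\<omega>\<in>set_pmf P. pmf P \<omega> * - log 2 (pr P f (f \<omega>)))"

definition cond_entropy_of :: "'a pmf \<Rightarrow> ('a \<Rightarrow> 'b) \<Rightarrow> ('a \<Rightarrow> 'c) \<Rightarrow> real" where
  "cond_entropy_of P f g = entropy_of P (\<lambda>\<omega>. (f \<omega>, g \<omega>)) - entropy_of P g"

lemma pr_eq_pmf_map: "pr P f b = pmf (map_pmf f P) b"
  by (simp add: pr_def pmf_map vimage_def)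

lemma pr_pos: "\<omega> \<in> set_pmf P \<Longrightarrow> 0 < pr P f (f \<omega>)"
  by (simp add: pr_eq_pmf_map pmf_positive_iff)

lemma pr_le_1: "pr P f b \<le> 1"
  by (simp add: pr_def)

lemma pr_nonneg: "0 \<le> pr P f b"
  by (simp add: pr_def)

lemma pr_mono:
  assumes "\<And>\<omega>. \<omega> \<in> set_pmf P \<Longrightarrow> f \<omega> = b \<Longrightarrow> g \<omega> = c"
  shows "pr P f b \<le> pr P g c"
proof -
  have "pr P f b = measure_pmf.prob P ({\<omega>. f \<omega> = b} \<inter> set_pmf P)"
    by (simp add: pr_def measure_Int_set_pmf)
  also have "\<dots> \<le> pr P g c"
    unfolding pr_def by (rule measure_pmf.finite_measure_mono) (use assms in auto)
  finally show ?thesis .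
qed

text \<open>Both sides are the mean of \<open>F\<close> under \<open>map_pmf f P\<close>. It is the
  passage between sums over outcomes and sums over values.\<close>

lemma sum_set_pmf_fibres:
  assumes "finite (set_pmf P)"
  shows "(\<Sum>\<omega>\<in>set_pmf P. pmf P \<omega> * F (f \<omega>)) = (\<Sum>b\<in>f ` set_pmf P. pr P f b * F b)"
proof -
  have "(\<Sum>\<omega>\<in>set_pmf P. pmf P \<omega> * F (f \<omega>)) = measure_pmf.expectation P (\<lambda>\<omega>. F (f \<omega>))"
    by (subst integral_measure_pmf_real[where A = "set_pmf P"]) (use assms in \<open>auto simp: mult.commute\<close>)
  also have "\<dots> = measure_pmf.expectation (map_pmf f P) F"
    by simp
  also have "\<dots> = (\<Sum>b\<in>f ` set_pmf P. pr P f b * F b)"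
    by (subst integral_measure_pmf_real[where A = "f ` set_pmf P"])
       (use assms in \<open>auto simp: mult.commute pr_eq_pmf_map simp del: integral_map_pmf\<close>)
  finally show ?thesis .
qed

lemma sum_pr: 
  assumes "finite (set_pmf P)"
  shows "(\<Sum>b\<in>f ` set_pmf P. pr P f b) = 1"
  using sum_set_pmf_fibres[OF assms, of "\<lambda>_. 1" f] sum_pmf_eq_1[OF assms, of P] by simp

text \<open>The range may be enlarged to any finite \<open>B\<close> because values of probability
  zero contribute \<open>eta 0 = 0\<close>.\<close>

lemma entropy_of_eq_sum:
  assumes "finite (set_pmf P)" "f ` set_pmf P \<subseteq> B" "finite B"
  shows "entropy_of P f = (\<Sum>b\<in>B. eta (pr P f b))"
proof -
  have "entropy_of P f = (\<Sum>b\<in>f ` set_pmf P. eta (pr P f b))"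
    unfolding entropy_of_def using sum_set_pmf_fibres[OF assms(1), of "\<lambda>b. - log 2 (pr P f b)" f]
    by (simp add: eta_def)
  also have "\<dots> = (\<Sum>b\<in>B. eta (pr P f b))"
  proof (rule sum.mono_neutral_left[OF assms(3,2)], safe)
    fix b assume "b \<in> B" "b \<notin> f ` set_pmf P"
    then have "pr P f b = 0"
      by (simp add: pr_eq_pmf_map pmf_eq_0_set_pmf)
    then show "eta (pr P f b) = 0" by (simp add: eta_def)
  qed
  finally show ?thesis .
qed

text \<open>On the support every fibre of \<open>f\<close> lies inside a fibre of \<open>g\<close>,
  so the surprisal of \<open>g\<close> is pointwise at most that of \<open>f\<close>.\<close>

lemma entropy_of_mono:
  assumes "finite (set_pmf P)"
    and "\<And>\<omega> \<omega>'. \<omega> \<in> set_pmf P \<Longrightarrow> \<omega>' \<in> set_pmf P \<Longrightarrow> f \<omega> = f \<omega>' \<Longrightarrow> g \<omega> = g \<omega>'"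
  shows "entropy_of P g \<le> entropy_of P f"
  unfolding entropy_of_def
proof (intro sum_mono mult_left_mono)
  fix \<omega> assume w: "\<omega> \<in> set_pmf P"
  have "pr P f (f \<omega>) \<le> pr P g (g \<omega>)"
    by (rule pr_mono) (use assms w in blast)
  then show "- log 2 (pr P g (g \<omega>)) \<le> - log 2 (pr P f (f \<omega>))"
    using pr_pos[OF w, of f] by (simp add: log_le_cancel_iff)
qed auto

lemma entropy_of_cong:
  assumes "finite (set_pmf P)"
    and "\<And>\<omega> \<omega>'. \<omega> \<in> set_pmf P \<Longrightarrow> \<omega>' \<in> set_pmf P \<Longrightarrow> f \<omega> = f \<omega>' \<longleftrightarrow> g \<omega> = g \<omega>'"
  shows "entropy_of P f = entropy_of P g"
  using assms by (intro antisym entropy_of_mono) blast+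

lemma entropy_of_nonneg: "0 \<le> entropy_of P f"
  unfolding entropy_of_def
  by (intro sum_nonneg mult_nonneg_nonneg) (auto simp: pr_le_1 pr_pos)

lemma pr_map_pmf: "pr (map_pmf \<phi> P) f b = pr P (\<lambda>\<omega>. f (\<phi> \<omega>)) b"
  by (simp add: pr_def vimage_def)

lemma entropy_of_map_pmf:
  assumes "finite (set_pmf P)"
  shows "entropy_of (map_pmf \<phi> P) f = entropy_of P (\<lambda>\<omega>. f (\<phi> \<omega>))"
proof -
  have "entropy_of (map_pmf \<phi> P) f
      = (\<Sum>b\<in>f ` \<phi> ` set_pmf P. eta (pr (map_pmf \<phi> P) f b))"
    using assms by (intro entropy_of_eq_sum) auto
  also have "\<dots> = entropy_of P (\<lambda>\<omega>. f (\<phi> \<omega>))"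
    unfolding pr_map_pmf using assms by (intro entropy_of_eq_sum[symmetric]) auto
  finally show ?thesis .
qed

lemma log2_le: "0 < x \<Longrightarrow> log 2 x \<le> (x - 1) / ln 2"
  using ln_le_minus_one[of x] by (simp add: log_def divide_right_mono)

text \<open>This is \<open>I(f; h | g) >= 0\<close>. The ratio \<open>r\<close> of the Markov-chain
  law \<open>p(f,g) p(g,h) / p(g)\<close> to the true law has mean at most one, and
  \<open>log 2 r \<le> (r - 1) / ln 2\<close>.\<close>

lemma entropy_of_submodular:
  assumes fin: "finite (set_pmf P)"
  shows "entropy_of P (\<lambda>\<omega>. (f \<omega>, g \<omega>, h \<omega>)) + entropy_of P g
    \<le> entropy_of P (\<lambda>\<omega>. (f \<omega>, g \<omega>)) + entropy_of P (\<lambda>\<omega>. (g \<omega>, h \<omega>))"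
proof -
  let ?fgh = "\<lambda>\<omega>. (f \<omega>, g \<omega>, h \<omega>)" and ?fg = "\<lambda>\<omega>. (f \<omega>, g \<omega>)" and ?gh = "\<lambda>\<omega>. (g \<omega>, h \<omega>)"
  define r where "r \<omega> = pr P ?fg (?fg \<omega>) * pr P ?gh (?gh \<omega>) / (pr P ?fgh (?fgh \<omega>) * pr P g (g \<omega>))"
    for \<omega>
  have rpos: "0 < r \<omega>" if "\<omega> \<in> set_pmf P" for \<omega>
    unfolding r_def using that by (intro divide_pos_pos mult_pos_pos) (auto intro!: pr_pos[of \<omega> P ?fg] pr_pos[of \<omega> P ?gh] pr_pos[of \<omega> P ?fgh] pr_pos[of \<omega> P g])
  have logr: "log 2 (r \<omega>) = log 2 (pr P ?fg (?fg \<omega>)) + log 2 (pr P ?gh (?gh \<omega>))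
      - log 2 (pr P ?fgh (?fgh \<omega>)) - log 2 (pr P g (g \<omega>))" if "\<omega> \<in> set_pmf P" for \<omega>
    using pr_pos[OF that, of ?fg] pr_pos[OF that, of ?gh] pr_pos[OF that, of ?fgh] pr_pos[OF that, of g]
    unfolding r_def by (simp add: log_divide log_mult)
  define F where "F = (\<lambda>(a, b, c). pr P ?fg (a, b) * pr P ?gh (b, c) / (pr P ?fgh (a, b, c) * pr P g b))"
  let ?A = "f ` set_pmf P" and ?B = "g ` set_pmf P" and ?C = "h ` set_pmf P"
  have marg: "(\<Sum>a\<in>?A. pr P ?fg (a, b)) = pr P g b" "(\<Sum>c\<in>?C. pr P ?gh (b, c)) = pr P g b" for b
  proof -
    have "(\<Sum>a\<in>?A. pr P ?fg (a, b)) = measure_pmf.prob P (\<Union>a\<in>?A. {\<omega>. ?fg \<omega> = (a, b)})"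
      unfolding pr_def
      by (rule measure_pmf.finite_measure_finite_Union[symmetric]) (use fin in \<open>auto simp: disjoint_family_on_def\<close>)
    also have "\<dots> = measure_pmf.prob P ((\<Union>a\<in>?A. {\<omega>. ?fg \<omega> = (a, b)}) \<inter> set_pmf P)"
      by (simp add: measure_Int_set_pmf)
    also have "(\<Union>a\<in>?A. {\<omega>. ?fg \<omega> = (a, b)}) \<inter> set_pmf P = {\<omega>. g \<omega> = b} \<inter> set_pmf P" by auto
    also have "measure_pmf.prob P \<dots> = pr P g b" by (simp add: pr_def measure_Int_set_pmf)
    finally show "(\<Sum>a\<in>?A. pr P ?fg (a, b)) = pr P g b" .
    have "(\<Sum>c\<in>?C. pr P ?gh (b, c)) = measure_pmf.prob P (\<Union>c\<in>?C. {\<omega>. ?gh \<omega> = (b, c)})"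
      unfolding pr_def
      by (rule measure_pmf.finite_measure_finite_Union[symmetric]) (use fin in \<open>auto simp: disjoint_family_on_def\<close>)
    also have "\<dots> = measure_pmf.prob P ((\<Union>c\<in>?C. {\<omega>. ?gh \<omega> = (b, c)}) \<inter> set_pmf P)"
      by (simp add: measure_Int_set_pmf)
    also have "(\<Union>c\<in>?C. {\<omega>. ?gh \<omega> = (b, c)}) \<inter> set_pmf P = {\<omega>. g \<omega> = b} \<inter> set_pmf P" by auto
    also have "measure_pmf.prob P \<dots> = pr P g b" by (simp add: pr_def measure_Int_set_pmf)
    finally show "(\<Sum>c\<in>?C. pr P ?gh (b, c)) = pr P g b" .
  qed
  have "(\<Sum>\<omega>\<in>set_pmf P. pmf P \<omega> * r \<omega>) = (\<Sum>\<omega>\<in>set_pmf P. pmf P \<omega> * F (?fgh \<omega>))"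
    by (simp add: r_def F_def)
  also have "\<dots> = (\<Sum>t\<in>?fgh ` set_pmf P. pr P ?fgh t * F t)"
    by (rule sum_set_pmf_fibres[OF fin])
  also have "\<dots> \<le> (\<Sum>(a, b, c)\<in>?fgh ` set_pmf P. pr P ?fg (a, b) * pr P ?gh (b, c) / pr P g b)"
    by (rule sum_mono) (auto simp: F_def pr_nonneg)
  \<comment> \<open>The triples added here may have probability zero under \<open>P\<close> while
    the Markov-chain law charges them, so the mean of \<open>r\<close> is only bounded by
    one.\<close>
  also have "\<dots> \<le> (\<Sum>(a, b, c)\<in>?A \<times> ?B \<times> ?C. pr P ?fg (a, b) * pr P ?gh (b, c) / pr P g b)"
    by (rule sum_mono2) (use fin in \<open>auto simp: pr_nonneg\<close>)
  also have "\<dots> = (\<Sum>a\<in>?A. \<Sum>b\<in>?B. \<Sum>c\<in>?C. pr P ?fg (a, b) * pr P ?gh (b, c) / pr P g b)"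
    by (simp add: sum.cartesian_product)
  also have "\<dots> = (\<Sum>a\<in>?A. \<Sum>b\<in>?B. pr P ?fg (a, b) * pr P g b / pr P g b)"
    by (simp add: sum_distrib_left[symmetric] sum_divide_distrib[symmetric] marg)
  also have "\<dots> = (\<Sum>b\<in>?B. \<Sum>a\<in>?A. pr P ?fg (a, b) * pr P g b / pr P g b)"
    by (rule sum.swap)
  also have "\<dots> = (\<Sum>b\<in>?B. pr P g b * pr P g b / pr P g b)"
  proof (rule sum.cong[OF refl])
    fix b
    have "(\<Sum>a\<in>?A. pr P ?fg (a, b) * pr P g b / pr P g b) = (\<Sum>a\<in>?A. pr P ?fg (a, b)) * pr P g b / pr P g b"
      unfolding sum_distrib_right sum_divide_distrib ..
    then show "(\<Sum>a\<in>?A. pr P ?fg (a, b) * pr P g b / pr P g b) = pr P g b * pr P g b / pr P g b"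
      unfolding marg(1) .
  qed
  also have "\<dots> = 1"
    using sum_pr[OF fin, of g] by simp
  finally have "(\<Sum>\<omega>\<in>set_pmf P. pmf P \<omega> * (r \<omega> - 1)) \<le> 0"
    using sum_pmf_eq_1[OF fin, of P] by (simp add: right_diff_distrib sum_subtractf)
  have "entropy_of P ?fgh + entropy_of P g - entropy_of P ?fg - entropy_of P ?gh
      = (\<Sum>\<omega>\<in>set_pmf P. pmf P \<omega> * log 2 (r \<omega>))"
    unfolding entropy_of_def by (simp add: sum.distrib[symmetric] sum_subtractf[symmetric] logr algebra_simps)
  also have "\<dots> \<le> (\<Sum>\<omega>\<in>set_pmf P. pmf P \<omega> * ((r \<omega> - 1) / ln 2))"
    by (intro sum_mono mult_left_mono log2_le rpos) auto
  also have "\<dots> = (\<Sum>\<omega>\<in>set_pmf P. pmf P \<omega> * (r \<omega> - 1)) / ln 2"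
    by (simp add: sum_divide_distrib)
  also have "\<dots> \<le> 0"
    using \<open>(\<Sum>\<omega>\<in>set_pmf P. pmf P \<omega> * (r \<omega> - 1)) \<le> 0\<close> by (simp add: divide_le_0_iff)
  finally show ?thesis by simp
qed

text \<open>Gibbs's inequality against the uniform law on \<open>B\<close>, again by the linear
  bound on the logarithm.\<close>

lemma entropy_of_le_log_card:
  assumes fin: "finite (set_pmf P)" and B: "finite B" "f ` set_pmf P \<subseteq> B"
  shows "entropy_of P f \<le> log 2 (card B)"
proof -
  define N where "N = real (card B)"
  have "B \<noteq> {}" using B(2) set_pmf_not_empty[of P] by auto
  then have N: "0 < N" using B(1) by (simp add: N_def card_gt_0_iff)
  have "entropy_of P f - log 2 N = (\<Sum>\<omega>\<in>set_pmf P. pmf P \<omega> * (- log 2 (pr P f (f \<omega>)) - log 2 N))"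
    using sum_pmf_eq_1[OF fin, of P] unfolding entropy_of_def right_diff_distrib sum_subtractf
    by (simp add: sum_distrib_right[symmetric])
  also have "\<dots> \<le> (\<Sum>\<omega>\<in>set_pmf P. pmf P \<omega> * ((1 / (pr P f (f \<omega>) * N) - 1) / ln 2))"
  proof (intro sum_mono mult_left_mono)
    fix \<omega> assume "\<omega> \<in> set_pmf P"
    then have p: "0 < pr P f (f \<omega>)" by (rule pr_pos)
    have "- log 2 (pr P f (f \<omega>)) - log 2 N = log 2 (1 / (pr P f (f \<omega>) * N))"
      using p N by (simp add: log_divide log_mult)
    also have "\<dots> \<le> (1 / (pr P f (f \<omega>) * N) - 1) / ln 2"
      using p N by (intro log2_le) auto
    finally show "- log 2 (pr P f (f \<omega>)) - log 2 N \<le> (1 / (pr P f (f \<omega>) * N) - 1) / ln 2" .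
  qed auto
  also have "\<dots> = ((\<Sum>\<omega>\<in>set_pmf P. pmf P \<omega> * (1 / (pr P f (f \<omega>) * N))) - 1) / ln 2"
    using sum_pmf_eq_1[OF fin, of P]
    by (simp add: sum_divide_distrib[symmetric] right_diff_distrib sum_subtractf)
  also have "(\<Sum>\<omega>\<in>set_pmf P. pmf P \<omega> * (1 / (pr P f (f \<omega>) * N)))
      = (\<Sum>b\<in>f ` set_pmf P. pr P f b * (1 / (pr P f b * N)))"
    by (rule sum_set_pmf_fibres[OF fin])
  also have "\<dots> = (\<Sum>b\<in>f ` set_pmf P. 1 / N)"
    using pr_pos[of _ P f] by (intro sum.cong) (auto simp: less_imp_neq[symmetric])
  also have "\<dots> \<le> 1"
    using N B card_mono[OF B(1,2)] by (simp add: N_def)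
  finally have "entropy_of P f - log 2 N \<le> (1 - 1) / ln 2"
    by (simp add: divide_right_mono)
  then show ?thesis by (simp add: N_def)
qed

lemma entropy_of_uniform:
  assumes "finite B" "B \<noteq> {}" "finite (set_pmf P)" "map_pmf f P = pmf_of_set B"
  shows "entropy_of P f = log 2 (card B)"
proof -
  have "f ` set_pmf P = B" using assms by (metis set_map_pmf set_pmf_of_set)
  then have "entropy_of P f = (\<Sum>b\<in>B. eta (pr P f b))"
    using assms by (intro entropy_of_eq_sum) auto
  also have "\<dots> = (\<Sum>b\<in>B. eta (1 / card B))"
    using assms by (simp add: pr_eq_pmf_map)
  also have "\<dots> = log 2 (card B)"
    using assms by (simp add: eta_def log_divide)
  finally show ?thesis .
qed

lemma pr_pair_pmf:
  "pr (pair_pmf A B) (\<lambda>(a, b). (f a, g b)) (c, d) = pr A f c * pr B g d"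
  by (simp add: pr_eq_pmf_map map_pair pmf_pair)

lemma entropy_of_pair_pmf:
  assumes fin: "finite (set_pmf A)" "finite (set_pmf B)"
  shows "entropy_of (pair_pmf A B) (\<lambda>(a, b). (f a, g b)) = entropy_of A f + entropy_of B g"
proof -
  have "entropy_of (pair_pmf A B) (\<lambda>(a, b). (f a, g b))
      = (\<Sum>a\<in>set_pmf A. \<Sum>b\<in>set_pmf B. pmf A a * pmf B b * - log 2 (pr A f (f a) * pr B g (g b)))"
    unfolding entropy_of_def sum.cartesian_product set_pair_pmf
    by (rule sum.cong[OF refl]) (auto simp: pr_pair_pmf pmf_pair)
  also have "\<dots> = (\<Sum>a\<in>set_pmf A. \<Sum>b\<in>set_pmf B.
      pmf B b * (pmf A a * - log 2 (pr A f (f a))) + pmf A a * (pmf B b * - log 2 (pr B g (g b))))"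
    using pr_pos[of _ A f] pr_pos[of _ B g]
    by (intro sum.cong refl) (simp add: log_mult less_imp_neq[symmetric] algebra_simps)
  also have "\<dots> = entropy_of A f + entropy_of B g"
    using sum_pmf_eq_1[OF fin(1), of A] sum_pmf_eq_1[OF fin(2), of B] unfolding entropy_of_def
    by (simp only: sum.distrib sum_distrib_left[symmetric] sum_distrib_right[symmetric] mult_1 mult_1_right)
  finally show ?thesis .
qed

text \<open>Ties the difference that defines \<open>cond_entropy_of\<close> to the average over
  conditioned laws; later this allows a conditioning variable to be frozen.\<close>

lemma cond_entropy_of_eq_sum_cond_pmf:
  assumes fin: "finite (set_pmf P)"
  shows "cond_entropy_of P f g
    = (\<Sum>s\<in>g ` set_pmf P. pr P g s * entropy_of (cond_pmf P {\<omega>. g \<omega> = s}) f)"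
proof -
  have c: "pr P g s * entropy_of (cond_pmf P {\<omega>. g \<omega> = s}) f
     = (\<Sum>\<omega>\<in>{\<omega>\<in>set_pmf P. g \<omega> = s}. pmf P \<omega> *
          (log 2 (pr P g (g \<omega>)) - log 2 (pr P (\<lambda>\<omega>. (f \<omega>, g \<omega>)) (f \<omega>, g \<omega>))))"
    if s: "s \<in> g ` set_pmf P" for s
  proof -
    let ?G = "{\<omega>. g \<omega> = s}"
    have ne: "set_pmf P \<inter> ?G \<noteq> {}" using s by auto
    have p: "0 < pr P g s" using s pr_pos by fastforce
    have prc: "pr (cond_pmf P ?G) f (f \<omega>) = pr P (\<lambda>\<omega>. (f \<omega>, g \<omega>)) (f \<omega>, g \<omega>) / pr P g (g \<omega>)"
      if "\<omega> \<in> ?G" for \<omega>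
    proof -
      have "pr (cond_pmf P ?G) f (f \<omega>) = measure_pmf.prob P (?G \<inter> {\<omega>'. f \<omega>' = f \<omega>}) / measure_pmf.prob P ?G"
        unfolding pr_def cond_pmf.rep_eq[OF ne]
        by (rule measure_uniform_measure) (use emeasure_measure_pmf_not_zero[OF ne] in \<open>simp_all\<close>)
      moreover have "?G \<inter> {\<omega>'. f \<omega>' = f \<omega>} = {\<omega>'. (f \<omega>', g \<omega>') = (f \<omega>, g \<omega>)}" "?G = {\<omega>'. g \<omega>' = g \<omega>}"
        using that by auto
      ultimately show ?thesis unfolding pr_def by simp
    qed
    have "entropy_of (cond_pmf P ?G) f = (\<Sum>\<omega>\<in>set_pmf P \<inter> ?G. pmf P \<omega> / pr P g s *
        - log 2 (pr P (\<lambda>\<omega>. (f \<omega>, g \<omega>)) (f \<omega>, g \<omega>) / pr P g (g \<omega>)))"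
      unfolding entropy_of_def using ne by (simp add: pmf_cond prc) (simp add: pr_def)
    also have "\<dots> = (\<Sum>\<omega>\<in>set_pmf P \<inter> ?G. pmf P \<omega> / pr P g s *
        (log 2 (pr P g (g \<omega>)) - log 2 (pr P (\<lambda>\<omega>. (f \<omega>, g \<omega>)) (f \<omega>, g \<omega>))))"
    proof (intro sum.cong refl)
      fix \<omega> assume "\<omega> \<in> set_pmf P \<inter> ?G"
      then have "\<omega> \<in> set_pmf P" by simp
      from pr_pos[OF this, of g] pr_pos[OF this, of "\<lambda>\<omega>. (f \<omega>, g \<omega>)"]
      show "pmf P \<omega> / pr P g s * - log 2 (pr P (\<lambda>\<omega>. (f \<omega>, g \<omega>)) (f \<omega>, g \<omega>) / pr P g (g \<omega>))
        = pmf P \<omega> / pr P g s * (log 2 (pr P g (g \<omega>)) - log 2 (pr P (\<lambda>\<omega>. (f \<omega>, g \<omega>)) (f \<omega>, g \<omega>)))"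
        by (simp add: log_divide)
    qed
    finally have e: "entropy_of (cond_pmf P ?G) f = (\<Sum>\<omega>\<in>set_pmf P \<inter> ?G. pmf P \<omega> / pr P g s *
        (log 2 (pr P g (g \<omega>)) - log 2 (pr P (\<lambda>\<omega>. (f \<omega>, g \<omega>)) (f \<omega>, g \<omega>))))" .
    have "set_pmf P \<inter> ?G = {\<omega>\<in>set_pmf P. g \<omega> = s}" by auto
    then show ?thesis
      unfolding e sum_distrib_left using p by (intro sum.cong) auto
  qed
  have "cond_entropy_of P f g = (\<Sum>\<omega>\<in>set_pmf P. pmf P \<omega> *
      (log 2 (pr P g (g \<omega>)) - log 2 (pr P (\<lambda>\<omega>. (f \<omega>, g \<omega>)) (f \<omega>, g \<omega>))))"
    unfolding cond_entropy_of_def entropy_of_def by (simp add: sum_subtractf[symmetric] algebra_simps)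
  also have "\<dots> = (\<Sum>s\<in>g ` set_pmf P. \<Sum>\<omega>\<in>{\<omega>\<in>set_pmf P. g \<omega> = s}. pmf P \<omega> *
      (log 2 (pr P g (g \<omega>)) - log 2 (pr P (\<lambda>\<omega>. (f \<omega>, g \<omega>)) (f \<omega>, g \<omega>))))"
    by (rule sum.image_gen[OF fin])
  also have "\<dots> = (\<Sum>s\<in>g ` set_pmf P. pr P g s * entropy_of (cond_pmf P {\<omega>. g \<omega> = s}) f)"
    by (intro sum.cong refl c[symmetric])
  finally show ?thesis .
qed

text \<open>Submodularity, applied with \<open>h\<close> a function of \<open>g\<close> on the
  support: further conditioning cannot increase the entropy.\<close>

lemma cond_entropy_of_antimono:
  assumes fin: "finite (set_pmf P)"
    and det: "\<And>\<omega> \<omega>'. \<omega> \<in> set_pmf P \<Longrightarrow> \<omega>' \<in> set_pmf P \<Longrightarrow> g \<omega> = g \<omega>' \<Longrightarrow> h \<omega> = h \<omega>'"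
  shows "cond_entropy_of P f g \<le> cond_entropy_of P f h"
proof -
  have "entropy_of P (\<lambda>\<omega>. (f \<omega>, g \<omega>)) = entropy_of P (\<lambda>\<omega>. (f \<omega>, h \<omega>, g \<omega>))"
    by (rule entropy_of_cong[OF fin]) (use det in blast)
  moreover have "entropy_of P g = entropy_of P (\<lambda>\<omega>. (h \<omega>, g \<omega>))"
    by (rule entropy_of_cong[OF fin]) (use det in blast)
  ultimately show ?thesis
    using entropy_of_submodular[OF fin, of f h g] by (simp add: cond_entropy_of_def)
qed

lemma cond_entropy_of_cong:
  assumes fin: "finite (set_pmf P)"
    and "\<And>\<omega> \<omega>'. \<omega> \<in> set_pmf P \<Longrightarrow> \<omega>' \<in> set_pmf P \<Longrightarrow> g \<omega> = g \<omega>' \<longleftrightarrow> g' \<omega> = g' \<omega>'"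
    and "\<And>\<omega> \<omega>'. \<omega> \<in> set_pmf P \<Longrightarrow> \<omega>' \<in> set_pmf P \<Longrightarrow> g \<omega> = g \<omega>' \<Longrightarrow> f \<omega> = f \<omega>' \<longleftrightarrow> f' \<omega> = f' \<omega>'"
  shows "cond_entropy_of P f g = cond_entropy_of P f' g'"
  unfolding cond_entropy_of_def
  by (intro arg_cong2[where f = "(-)"] entropy_of_cong[OF fin]) (use assms(2-) in blast)+

lemma cond_entropy_of_eq_0:
  assumes fin: "finite (set_pmf P)"
    and "\<And>\<omega> \<omega>'. \<omega> \<in> set_pmf P \<Longrightarrow> \<omega>' \<in> set_pmf P \<Longrightarrow> g \<omega> = g \<omega>' \<Longrightarrow> f \<omega> = f \<omega>'"
  shows "cond_entropy_of P f g = 0"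
proof -
  have "entropy_of P (\<lambda>\<omega>. (f \<omega>, g \<omega>)) = entropy_of P g"
    by (rule entropy_of_cong[OF fin]) (use assms(2) in blast)
  then show ?thesis by (simp add: cond_entropy_of_def)
qed

text \<open>Symmetry of \<open>I(f; h | g)\<close>. It converts increments of the entropy of relay
  messages into entropies of single letters.\<close>

lemma cond_entropy_of_exchange:
  assumes fin: "finite (set_pmf P)"
  shows "cond_entropy_of P f g - cond_entropy_of P f (\<lambda>\<omega>. (g \<omega>, h \<omega>))
    = cond_entropy_of P h g - cond_entropy_of P h (\<lambda>\<omega>. (g \<omega>, f \<omega>))"
proof -
  have "entropy_of P (\<lambda>\<omega>. (f \<omega>, g \<omega>, h \<omega>)) = entropy_of P (\<lambda>\<omega>. (h \<omega>, g \<omega>, f \<omega>))"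
    "entropy_of P (\<lambda>\<omega>. (f \<omega>, g \<omega>)) = entropy_of P (\<lambda>\<omega>. (g \<omega>, f \<omega>))"
    "entropy_of P (\<lambda>\<omega>. (h \<omega>, g \<omega>)) = entropy_of P (\<lambda>\<omega>. (g \<omega>, h \<omega>))"
    by (intro entropy_of_cong[OF fin]; auto)+
  then show ?thesis by (simp add: cond_entropy_of_def)
qed

lemma cond_entropy_of_chain:
  assumes fin: "finite (set_pmf P)"
  shows "cond_entropy_of P (\<lambda>\<omega>. (f \<omega>, h \<omega>)) g
    = cond_entropy_of P f g + cond_entropy_of P h (\<lambda>\<omega>. (g \<omega>, f \<omega>))"
proof -
  have "entropy_of P (\<lambda>\<omega>. ((f \<omega>, h \<omega>), g \<omega>)) = entropy_of P (\<lambda>\<omega>. (h \<omega>, g \<omega>, f \<omega>))"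
    "entropy_of P (\<lambda>\<omega>. (f \<omega>, g \<omega>)) = entropy_of P (\<lambda>\<omega>. (g \<omega>, f \<omega>))"
    by (intro entropy_of_cong[OF fin]; auto)+
  then show ?thesis by (simp add: cond_entropy_of_def)
qed

lemma cond_entropy_of_le_entropy_of:
  assumes fin: "finite (set_pmf P)"
  shows "cond_entropy_of P f g \<le> entropy_of P f"
proof -
  have "cond_entropy_of P f g \<le> cond_entropy_of P f (\<lambda>_. ())"
    by (rule cond_entropy_of_antimono[OF fin]) simp
  also have "\<dots> \<le> entropy_of P (\<lambda>\<omega>. (f \<omega>, ()))"
    by (simp add: cond_entropy_of_def entropy_of_nonneg)
  also have "\<dots> = entropy_of P f"
    by (rule entropy_of_cong[OF fin]) auto
  finally show ?thesis .
qed

lemma cond_entropy_of_le_log_card: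
  assumes "finite (set_pmf P)" "finite B" "f ` set_pmf P \<subseteq> B"
  shows "cond_entropy_of P f g \<le> log 2 (card B)"
  using cond_entropy_of_le_entropy_of[OF assms(1)] entropy_of_le_log_card[OF assms] by (rule order_trans)

lemma cond_entropy_of_map_pmf:
  assumes "finite (set_pmf P)"
  shows "cond_entropy_of (map_pmf \<phi> P) f g = cond_entropy_of P (\<lambda>\<omega>. f (\<phi> \<omega>)) (\<lambda>\<omega>. g (\<phi> \<omega>))"
  using assms by (simp add: cond_entropy_of_def entropy_of_map_pmf)

text \<open>The chain rule writes the left side as a difference of two entropies conditioned on
  \<open>q\<close> alone, and each of these is an average over the values of
  \<open>q\<close>.\<close>

lemma cond_entropy_of_average:
  assumes fin: "finite (set_pmf P)"
  shows "cond_entropy_of P f (\<lambda>\<omega>. (g \<omega>, q \<omega>))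
    = (\<Sum>s\<in>q ` set_pmf P. pr P q s * cond_entropy_of (cond_pmf P {\<omega>. q \<omega> = s}) f g)"
proof -
  have "entropy_of P (\<lambda>\<omega>. (f \<omega>, g \<omega>, q \<omega>)) = entropy_of P (\<lambda>\<omega>. ((f \<omega>, g \<omega>), q \<omega>))"
    by (rule entropy_of_cong[OF fin]) auto
  then have "cond_entropy_of P f (\<lambda>\<omega>. (g \<omega>, q \<omega>))
      = cond_entropy_of P (\<lambda>\<omega>. (f \<omega>, g \<omega>)) q - cond_entropy_of P g q"
    by (simp add: cond_entropy_of_def)
  then show ?thesis
    unfolding cond_entropy_of_eq_sum_cond_pmf[OF fin, of _ q] cond_entropy_of_def[of "cond_pmf P _"]
    by (simp add: right_diff_distrib sum_subtractf)
qed

text \<open>The success indicator \<open>E\<close> costs at most one bit. Given \<open>V\<close> and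
  success, \<open>A\<close> is known and has entropy zero; given failure its entropy is at most
  \<open>log 2 (card B)\<close>.\<close>

lemma cond_entropy_of_fano:
  assumes fin: "finite (set_pmf P)" and B: "finite B" "A ` set_pmf P \<subseteq> B"
  shows "cond_entropy_of P A V \<le> 1 + measure_pmf.prob P {\<omega>. \<gamma> (V \<omega>) \<noteq> A \<omega>} * log 2 (card B)"
proof -
  define E where "E \<omega> = (\<gamma> (V \<omega>) = A \<omega>)" for \<omega>
  let ?EV = "\<lambda>\<omega>. (V \<omega>, E \<omega>)"
  have Bne: "B \<noteq> {}" using B(2) set_pmf_not_empty[of P] by auto
  have logB: "0 \<le> log 2 (card B)"
    using Bne B(1) by (auto simp: card_gt_0_iff Suc_le_eq intro!: zero_le_log_cancel_iff[THEN iffD2])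
  have "cond_entropy_of P A V = cond_entropy_of P (\<lambda>\<omega>. (E \<omega>, A \<omega>)) V"
    by (rule cond_entropy_of_cong[OF fin]) (auto simp: E_def)
  also have "\<dots> = cond_entropy_of P E V + cond_entropy_of P A ?EV"
    by (rule cond_entropy_of_chain[OF fin])
  also have "cond_entropy_of P E V \<le> log 2 (card (UNIV :: bool set))"
    by (rule cond_entropy_of_le_log_card[OF fin]) auto
  also have "cond_entropy_of P A ?EV
      \<le> (\<Sum>s\<in>?EV ` set_pmf P. pr P ?EV s * (if snd s then 0 else log 2 (card B)))"
    unfolding cond_entropy_of_eq_sum_cond_pmf[OF fin]
  proof (intro sum_mono mult_left_mono)
    fix s assume s: "s \<in> ?EV ` set_pmf P"
    let ?C = "cond_pmf P {\<omega>. ?EV \<omega> = s}"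
    have ne: "set_pmf P \<inter> {\<omega>. ?EV \<omega> = s} \<noteq> {}" using s by auto
    have sC: "set_pmf ?C = set_pmf P \<inter> {\<omega>. ?EV \<omega> = s}" by (rule set_cond_pmf[OF ne])
    have finC: "finite (set_pmf ?C)" using fin sC by simp
    show "entropy_of ?C A \<le> (if snd s then 0 else log 2 (card B))"
    proof (cases "snd s")
      case True
      have "entropy_of ?C A \<le> log 2 (card {\<gamma> (fst s)})"
        by (rule entropy_of_le_log_card[OF finC]) (use True sC in \<open>auto simp: E_def\<close>)
      then show ?thesis using True by simp
    next
      case False
      have "entropy_of ?C A \<le> log 2 (card B)"
        by (rule entropy_of_le_log_card[OF finC B(1)]) (use B(2) sC in auto)
      then show ?thesis using False by simp
    qed
  qed (rule pr_nonneg)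
  also have "\<dots> = (\<Sum>\<omega>\<in>set_pmf P. pmf P \<omega> * (if E \<omega> then 0 else log 2 (card B)))"
    using sum_set_pmf_fibres[OF fin, of "\<lambda>s. if snd s then 0 else log 2 (card B)" ?EV] by simp
  also have "\<dots> = (\<Sum>\<omega>\<in>{\<omega>\<in>set_pmf P. \<not> E \<omega>}. pmf P \<omega>) * log 2 (card B)"
    unfolding sum_distrib_right by (intro sum.mono_neutral_cong_right) (use fin in auto)
  also have "(\<Sum>\<omega>\<in>{\<omega>\<in>set_pmf P. \<not> E \<omega>}. pmf P \<omega>) = measure_pmf.prob P {\<omega>\<in>set_pmf P. \<not> E \<omega>}"
    by (rule measure_measure_pmf_finite[symmetric]) (use fin in auto)
  also have "\<dots> = measure_pmf.prob P ({\<omega>. \<not> E \<omega>} \<inter> set_pmf P)"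
    by (rule arg_cong[where f = "measure _"]) auto
  also have "\<dots> = measure_pmf.prob P {\<omega>. \<gamma> (V \<omega>) \<noteq> A \<omega>}"
    by (simp add: measure_Int_set_pmf E_def)
  finally show ?thesis by simp
qed

lemma measure_pair_pmf_snd: "measure_pmf.prob (pair_pmf B N) {\<omega>. R (snd \<omega>)} = measure_pmf.prob N {\<xi>. R \<xi>}"
proof -
  have "measure_pmf.prob (pair_pmf B N) {\<omega>. R (snd \<omega>)} = measure_pmf.prob (map_pmf snd (pair_pmf B N)) {\<xi>. R \<xi>}"
    by (simp add: vimage_def)
  then show ?thesis by (simp add: map_snd_pair_pmf)
qed

lemma cond_pair_pmf_snd:
  fixes B :: "'b pmf" and N :: "'c pmf"
  assumes "set_pmf N \<inter> {\<xi>. R \<xi>} \<noteq> {}"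
  shows "cond_pmf (pair_pmf B N) {\<omega>. R (snd \<omega>)} = pair_pmf B (cond_pmf N {\<xi>. R \<xi>})"
proof (rule pmf_eqI)
  fix p :: "'b \<times> 'c"
  obtain b \<xi> where p: "p = (b, \<xi>)" by (cases p)
  obtain b0 where "b0 \<in> set_pmf B" using set_pmf_not_empty[of B] by auto
  with assms have "set_pmf (pair_pmf B N) \<inter> {\<omega>. R (snd \<omega>)} \<noteq> {}" by force
  then show "pmf (cond_pmf (pair_pmf B N) {\<omega>. R (snd \<omega>)}) p = pmf (pair_pmf B (cond_pmf N {\<xi>. R \<xi>})) p"
    using assms by (simp add: pmf_cond p pmf_pair measure_pair_pmf_snd)
qed

section \<open>The contribution of a single letter\<close>

text \<open>An outcome is a letter (inputs and outputs) together with the drawn table. The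
  restriction removes the messages of relays outside \<open>A\<close> from comparisons.\<close>

definition relay_obs :: "'k set \<Rightarrow> (('x \<times> ('k \<Rightarrow> 'y)) \<times> ('k \<Rightarrow> 'y \<Rightarrow> 'u)) \<Rightarrow> 'k \<Rightarrow> 'u" where
  "relay_obs A \<omega> = restrict (\<lambda>k. snd \<omega> k (snd (fst \<omega>) k)) A"

text \<open>
  The part of the bound contributed by one letter: \<open>B\<close> is the joint law of channel inputs and
  outputs and the random table \<open>w\<close>, of law \<open>\<mu>\<close>, makes relay \<open>k\<close> send \<open>w k (y k)\<close>.
\<close>

definition letter_gain ::
  "(('l \<Rightarrow> 'x) \<times> ('k \<Rightarrow> 'y)) pmf \<Rightarrow> ('k \<Rightarrow> 'y \<Rightarrow> 'u) pmf \<Rightarrow> 'l set \<Rightarrow> 'k set \<Rightarrow> real" where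
  "letter_gain B \<mu> T S = (let P = pair_pmf B \<mu>; X = \<lambda>T \<omega>. restrict (fst (fst \<omega>)) T;
      Y = \<lambda>\<omega>. restrict (snd (fst \<omega>)) S in
    cond_entropy_of P Y (\<lambda>\<omega>. (X UNIV \<omega>, relay_obs UNIV \<omega>))
    - cond_entropy_of P Y (\<lambda>\<omega>. (X UNIV \<omega>, relay_obs (-S) \<omega>))
    + (cond_entropy_of P (X T) (\<lambda>\<omega>. (X (-T) \<omega>, relay_obs {} \<omega>))
    - cond_entropy_of P (X T) (\<lambda>\<omega>. (X (-T) \<omega>, relay_obs (-S) \<omega>))))"

lemma restrict_eq_iff: "restrict f A = restrict g A \<longleftrightarrow> (\<forall>x\<in>A. f x = g x)"
  by (auto simp: restrict_def fun_eq_iff)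

lemma finite_set_Pi_pmf:
  assumes "finite A" "\<And>i. i \<in> A \<Longrightarrow> finite (set_pmf (B i))"
  shows "finite (set_pmf (Pi_pmf A d B))"
proof -
  have "finite (PiE_dflt A d (set_pmf \<circ> B))"
    by (rule finite_PiE_dflt[OF assms(1)]) (simp add: assms(2))
  then show ?thesis by (simp add: set_Pi_pmf[OF assms(1)])
qed

section \<open>Single-letterisation\<close>

text \<open>Given all inputs except the \<open>i\<close>-th and all outputs before time
  \<open>i\<close>, letter \<open>i\<close> still has law \<open>B i\<close>, and the index of a
  relay depends on its own \<open>i\<close>-th output and on its later outputs. The later outputs
  are independent of letter \<open>i\<close>, so their influence is a random table shared by all
  relays; \<open>Q i\<close> is the law of the law of that table.\<close>

lemma single_letter:
  fixes B :: "nat \<Rightarrow> (('l \<Rightarrow> 'x) \<times> ('k \<Rightarrow> 'y)) pmf" and rl :: "'k \<Rightarrow> (nat \<Rightarrow> 'y) \<Rightarrow> 'j"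
    and n :: nat and d :: "('l \<Rightarrow> 'x) \<times> ('k \<Rightarrow> 'y)"
  assumes finB: "\<And>i. finite (set_pmf (B i))"
  defines "P \<equiv> Pi_pmf {1..n} d B"
  defines "J \<equiv> \<lambda>A \<omega>. restrict (\<lambda>k. rl k (\<lambda>j\<in>{1..n}. snd (\<omega> j) k)) A"
  defines "X \<equiv> \<lambda>A \<omega>. \<lambda>j\<in>{1..n}. restrict (fst (\<omega> j)) A"
  shows "\<exists>Q :: nat \<Rightarrow> ('k \<Rightarrow> 'y \<Rightarrow> 'j) pmf pmf.
    (\<forall>i. finite (set_pmf (Q i)) \<and> (\<forall>\<mu>\<in>set_pmf (Q i). finite (set_pmf \<mu>))) \<and>
    (\<forall>T S. cond_entropy_of P (J (-S)) (X (-T)) - cond_entropy_of P (J (-S)) (X UNIV)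
        - cond_entropy_of P (J S) (\<lambda>\<omega>. (J (-S) \<omega>, X UNIV \<omega>))
      \<le> (\<Sum>i=1..n. measure_pmf.expectation (Q i) (\<lambda>\<mu>. letter_gain (B i) \<mu> T S)))"
proof -
  have finP: "finite (set_pmf P)"
    unfolding P_def by (rule finite_set_Pi_pmf) (auto simp: finB)
  \<comment> \<open>All inputs except those at \<open>i\<close> and the outputs of all relays before
    \<open>i\<close>: rich enough to contain the conditions of both telescoping sums below, yet
    independent of letter \<open>i\<close>.\<close>
  define q where "q i \<omega> = (\<lambda>j\<in>{1..n} - {i}. fst (\<omega> j), \<lambda>j\<in>{1..<i}. snd (\<omega> j))"
    for i and \<omega> :: "nat \<Rightarrow> ('l \<Rightarrow> 'x) \<times> ('k \<Rightarrow> 'y)"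
  define x where "x i A \<omega> = restrict (fst (\<omega> i)) A" for i A and \<omega> :: "nat \<Rightarrow> ('l \<Rightarrow> 'x) \<times> ('k \<Rightarrow> 'y)"
  define y where "y i A \<omega> = restrict (snd (\<omega> i)) A" for i A and \<omega> :: "nat \<Rightarrow> ('l \<Rightarrow> 'x) \<times> ('k \<Rightarrow> 'y)"
  define Yp where "Yp i \<omega> = (\<lambda>j\<in>{1..<i}. snd (\<omega> j))" for i and \<omega> :: "nat \<Rightarrow> ('l \<Rightarrow> 'x) \<times> ('k \<Rightarrow> 'y)"
  define Xp where "Xp i T \<omega> = (\<lambda>j\<in>{1..<i}. restrict (fst (\<omega> j)) T)" for i T and \<omega> :: "nat \<Rightarrow> ('l \<Rightarrow> 'x) \<times> ('k \<Rightarrow> 'y)"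
  define N where "N i = Pi_pmf ({1..n} - {i}) d B" for i
  have Jdet: "J A \<omega> = J A \<omega>'" if "J A' \<omega> = J A' \<omega>'" "A \<subseteq> A'" for A A' \<omega> \<omega>'
    using that by (auto simp: J_def restrict_eq_iff)
  have JS: "J UNIV \<omega> = J UNIV \<omega>' \<longleftrightarrow> J S \<omega> = J S \<omega>' \<and> J (-S) \<omega> = J (-S) \<omega>'" for S \<omega> \<omega>'
    by (auto simp: J_def restrict_eq_iff)
  have XU: "X UNIV \<omega> = X UNIV \<omega>' \<longleftrightarrow> (\<forall>j\<in>{1..n}. fst (\<omega> j) = fst (\<omega>' j))" for \<omega> \<omega>'
    by (simp only: X_def restrict_eq_iff restrict_UNIV)
  have xU: "x i UNIV \<omega> = x i UNIV \<omega>' \<longleftrightarrow> fst (\<omega> i) = fst (\<omega>' i)" for i \<omega> \<omega>'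
    by (simp only: x_def restrict_UNIV)
  have xT: "x i T \<omega> = x i T \<omega>' \<longleftrightarrow> (\<forall>l\<in>T. fst (\<omega> i) l = fst (\<omega>' i) l)" for i T \<omega> \<omega>'
    by (simp add: x_def restrict_eq_iff)
  have XT: "X T \<omega> = X T \<omega>' \<longleftrightarrow> (\<forall>j\<in>{1..n}. \<forall>l\<in>T. fst (\<omega> j) l = fst (\<omega>' j) l)" for T \<omega> \<omega>'
    by (simp add: X_def restrict_eq_iff)
  have XpT: "Xp i T \<omega> = Xp i T \<omega>' \<longleftrightarrow> (\<forall>j\<in>{1..<i}. \<forall>l\<in>T. fst (\<omega> j) l = fst (\<omega>' j) l)" for i T \<omega> \<omega>'
    by (simp add: Xp_def restrict_eq_iff)
  have Ypi: "Yp i \<omega> = Yp i \<omega>' \<longleftrightarrow> (\<forall>j\<in>{1..<i}. snd (\<omega> j) = snd (\<omega>' j))" for i \<omega> \<omega>'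
    by (simp add: Yp_def restrict_eq_iff)
  have yS: "y i S \<omega> = y i S \<omega>' \<longleftrightarrow> (\<forall>k\<in>S. snd (\<omega> i) k = snd (\<omega>' i) k)" for i S \<omega> \<omega>'
    by (simp add: y_def restrict_eq_iff)
  have qi: "q i \<omega> = q i \<omega>' \<longleftrightarrow> (\<forall>j\<in>{1..n} - {i}. fst (\<omega> j) = fst (\<omega>' j)) \<and> Yp i \<omega> = Yp i \<omega>'" for i \<omega> \<omega>'
    by (simp add: q_def restrict_eq_iff Ypi)
  define V where "V i T S =
      cond_entropy_of P (y i S) (\<lambda>\<omega>. ((x i UNIV \<omega>, J UNIV \<omega>), q i \<omega>))
      - cond_entropy_of P (y i S) (\<lambda>\<omega>. ((x i UNIV \<omega>, J (-S) \<omega>), q i \<omega>))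
      + (cond_entropy_of P (x i T) (\<lambda>\<omega>. ((x i (-T) \<omega>, J {} \<omega>), q i \<omega>))
      - cond_entropy_of P (x i T) (\<lambda>\<omega>. ((x i (-T) \<omega>, J (-S) \<omega>), q i \<omega>)))" for i T S
  \<comment> \<open>Given \<open>q i = s\<close>, the table sends \<open>z\<close> to the index of
    relay \<open>k\<close> for the block with \<open>z\<close> in place of its \<open>i\<close>-th
    output. All relays share the randomness \<xi>.\<close>
  define \<mu> where "\<mu> i s = map_pmf (\<lambda>\<xi> k z. rl k (\<lambda>j\<in>{1..n}. if j = i then z else snd (\<xi> j) k))
      (cond_pmf (N i) {\<xi>. q i \<xi> = s})" for i s
  define Q where "Q i = map_pmf (\<lambda>\<omega>. \<mu> i (q i \<omega>)) P" for i
  have finN: "finite (set_pmf (N i))" for i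
    unfolding N_def by (rule finite_set_Pi_pmf) (auto simp: finB)
  have split: "P = map_pmf (\<lambda>(b, \<xi>). \<xi>(i := b)) (pair_pmf (B i) (N i))" if "i \<in> {1..n}" for i
  proof -
    have "{1..n} = insert i ({1..n} - {i})" using that by auto
    then show ?thesis
      unfolding P_def N_def by (metis Diff_iff Pi_pmf_insert finite_Diff finite_atLeastAtMost singletonI)
  qed
  have qupd: "q i (\<xi>(i := b)) = q i \<xi>" for i \<xi> b
    by (auto simp: q_def fun_eq_iff)
  have qne: "set_pmf (N i) \<inter> {\<xi>. q i \<xi> = s} \<noteq> {}" if "i \<in> {1..n}" "s \<in> q i ` set_pmf P" for i s
    using that(2) unfolding split[OF that(1)] by (auto simp: qupd)
  have average: "V i T S = (\<Sum>s\<in>q i ` set_pmf P. pr P (q i) s * letter_gain (B i) (\<mu> i s) T S)"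
    if i: "i \<in> {1..n}" for i T S
  proof -
    \<comment> \<open>Since \<open>q i\<close> ignores position \<open>i\<close>, the block given
      \<open>q i = s\<close> is a free letter \<open>b\<close> inserted into a conditioned
      rest.\<close>
    have c: "cond_entropy_of (cond_pmf P {\<omega>. q i \<omega> = s}) F G
        = cond_entropy_of (pair_pmf (B i) (\<mu> i s)) F' G'"
      if s: "s \<in> q i ` set_pmf P"
      and FG: "\<And>b \<xi>. F (\<xi>(i := b)) = F' (b, \<lambda>k z. rl k (\<lambda>j\<in>{1..n}. if j = i then z else snd (\<xi> j) k))"
        "\<And>b \<xi>. G (\<xi>(i := b)) = G' (b, \<lambda>k z. rl k (\<lambda>j\<in>{1..n}. if j = i then z else snd (\<xi> j) k))"
      for s and F :: "_ \<Rightarrow> 'f" and G :: "_ \<Rightarrow> 'g" and F' G'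
    proof -
      note ne = qne[OF i s]
      have finc: "finite (set_pmf (cond_pmf (N i) {\<xi>. q i \<xi> = s}))"
        using finN[of i] by (simp add: set_cond_pmf[OF ne])
      have vi: "(\<lambda>(b, \<xi>). \<xi>(i := b)) -` {\<omega>. q i \<omega> = s} = {\<omega>. q i (snd \<omega>) = s}"
        by (auto simp: qupd)
      have "set_pmf (pair_pmf (B i) (N i)) \<inter> (\<lambda>(b, \<xi>). \<xi>(i := b)) -` {\<omega>. q i \<omega> = s} \<noteq> {}"
        using ne set_pmf_not_empty[of "B i"] unfolding vi by fastforce
      then have "cond_pmf P {\<omega>. q i \<omega> = s}
          = map_pmf (\<lambda>(b, \<xi>). \<xi>(i := b)) (cond_pmf (pair_pmf (B i) (N i)) {\<omega>. q i (snd \<omega>) = s})"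
        unfolding split[OF i] vi[symmetric] by (rule cond_map_pmf)
      also have "cond_pmf (pair_pmf (B i) (N i)) {\<omega>. q i (snd \<omega>) = s}
          = pair_pmf (B i) (cond_pmf (N i) {\<xi>. q i \<xi> = s})"
        by (rule cond_pair_pmf_snd[OF ne])
      finally have 1: "cond_pmf P {\<omega>. q i \<omega> = s}
          = map_pmf (\<lambda>(b, \<xi>). \<xi>(i := b)) (pair_pmf (B i) (cond_pmf (N i) {\<xi>. q i \<xi> = s}))" .
      show ?thesis
        unfolding 1 \<mu>_def pair_map_pmf2 using finc finB
        by (simp add: cond_entropy_of_map_pmf case_prod_unfold FG apsnd_def map_prod_def)
    qed
    have Jc: "J A (\<xi>(i := b)) = relay_obs A (b, \<lambda>k z. rl k (\<lambda>j\<in>{1..n}. if j = i then z else snd (\<xi> j) k))"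
      for A \<xi> b
      unfolding J_def relay_obs_def
      by (intro restrict_ext) (auto intro!: arg_cong2[where f = rl] restrict_ext)
    have g: "letter_gain (B i) (\<mu> i s) T S =
        cond_entropy_of (cond_pmf P {\<omega>. q i \<omega> = s}) (y i S) (\<lambda>\<omega>. (x i UNIV \<omega>, J UNIV \<omega>))
        - cond_entropy_of (cond_pmf P {\<omega>. q i \<omega> = s}) (y i S) (\<lambda>\<omega>. (x i UNIV \<omega>, J (-S) \<omega>))
        + (cond_entropy_of (cond_pmf P {\<omega>. q i \<omega> = s}) (x i T) (\<lambda>\<omega>. (x i (-T) \<omega>, J {} \<omega>))
        - cond_entropy_of (cond_pmf P {\<omega>. q i \<omega> = s}) (x i T) (\<lambda>\<omega>. (x i (-T) \<omega>, J (-S) \<omega>)))"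
      if s: "s \<in> q i ` set_pmf P" for s
      unfolding letter_gain_def Let_def
      by (intro arg_cong2[where f = "(+)"] arg_cong2[where f = "(-)"] c[OF s, symmetric])
         (auto simp: x_def y_def Jc)
    show ?thesis
      unfolding V_def cond_entropy_of_average[OF finP]
      by (simp add: g sum.distrib sum_subtractf algebra_simps)
  qed
  \<comment> \<open>\<open>J {}\<close> is constant, and by independence over time
    \<open>q i\<close> says nothing about the inputs at time \<open>i\<close>.\<close>
  have indep: "cond_entropy_of P (x i T) (\<lambda>\<omega>. ((x i T' \<omega>, J {} \<omega>), q i \<omega>)) = cond_entropy_of P (x i T) (x i T')"
    if i: "i \<in> {1..n}" for i T T'
  proof -
    have J0: "J {} = (\<lambda>\<omega>. \<lambda>_. undefined)" by (auto simp: J_def restrict_def)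
    let ?N = "N i"
    have "entropy_of P (\<lambda>\<omega>. (x i T \<omega>, (x i T' \<omega>, J {} \<omega>), q i \<omega>))
        = entropy_of P (\<lambda>\<omega>. ((x i T \<omega>, x i T' \<omega>), q i \<omega>))"
      "entropy_of P (\<lambda>\<omega>. ((x i T' \<omega>, J {} \<omega>), q i \<omega>)) = entropy_of P (\<lambda>\<omega>. (x i T' \<omega>, q i \<omega>))"
      by (intro entropy_of_cong[OF finP]; auto simp: J0)+
    moreover have sep: "entropy_of P (\<lambda>\<omega>. (F (\<omega> i), q i \<omega>)) = entropy_of P (\<lambda>\<omega>. F (\<omega> i)) + entropy_of ?N (q i)"
      for F :: "_ \<Rightarrow> 'f"
    proof -
      have "entropy_of P (\<lambda>\<omega>. (F (\<omega> i), q i \<omega>))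
          = entropy_of (pair_pmf (B i) ?N) (\<lambda>(b, \<xi>). (F b, q i \<xi>))"
        unfolding split[OF i] using finB finN by (subst entropy_of_map_pmf) (auto simp: case_prod_unfold qupd)
      also have "\<dots> = entropy_of (B i) F + entropy_of ?N (q i)"
        using finB finN by (intro entropy_of_pair_pmf)
      also have "entropy_of (B i) F = entropy_of (map_pmf fst (pair_pmf (B i) ?N)) F"
        by (simp add: map_fst_pair_pmf)
      also have "\<dots> = entropy_of P (\<lambda>\<omega>. F (\<omega> i))"
        unfolding split[OF i] using finB finN by (simp add: entropy_of_map_pmf case_prod_unfold)
      finally show ?thesis .
    qed
    ultimately show ?thesis
      using sep[of "\<lambda>b. (restrict (fst b) T, restrict (fst b) T')"] sep[of "\<lambda>b. restrict (fst b) T'"]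
      by (simp add: cond_entropy_of_def x_def[abs_def])
  qed
  have bound: "cond_entropy_of P (J (-S)) (X (-T)) - cond_entropy_of P (J (-S)) (X UNIV)
        - cond_entropy_of P (J S) (\<lambda>\<omega>. (J (-S) \<omega>, X UNIV \<omega>)) \<le> (\<Sum>i=1..n. V i T S)" for T S
  proof -
    \<comment> \<open>Two telescopes over time. \<open>a\<close> reveals the outputs before
      \<open>i\<close> and vanishes once all of them are known, because the indices are functions of
      the outputs; \<open>b\<close> reveals the inputs of \<open>T\<close> before
      \<open>i\<close>.\<close>
    define a where "a i = cond_entropy_of P (J S) (\<lambda>\<omega>. (J (-S) \<omega>, X UNIV \<omega>, Yp i \<omega>))" for i
    define b where "b i = cond_entropy_of P (J (-S)) (\<lambda>\<omega>. (X (-T) \<omega>, Xp i T \<omega>))" for i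
    have a1: "a 1 = cond_entropy_of P (J S) (\<lambda>\<omega>. (J (-S) \<omega>, X UNIV \<omega>))"
      unfolding a_def by (rule cond_entropy_of_cong[OF finP]) (auto simp: Ypi)
    have an: "a (Suc n) = 0"
      unfolding a_def
    proof (rule cond_entropy_of_eq_0[OF finP])
      fix \<omega> \<omega>' assume "(J (-S) \<omega>, X UNIV \<omega>, Yp (Suc n) \<omega>) = (J (-S) \<omega>', X UNIV \<omega>', Yp (Suc n) \<omega>')"
      then have "\<forall>j\<in>{1..<Suc n}. snd (\<omega> j) = snd (\<omega>' j)" by (simp add: Ypi)
      then have "(\<lambda>j\<in>{1..n}. snd (\<omega> j) k) = (\<lambda>j\<in>{1..n}. snd (\<omega>' j) k)" for k
        by (simp add: restrict_eq_iff)
      then show "J S \<omega> = J S \<omega>'" by (simp add: J_def)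
    qed
    have b1: "b 1 = cond_entropy_of P (J (-S)) (X (-T))"
      unfolding b_def by (rule cond_entropy_of_cong[OF finP]) (auto simp: XpT)
    have bn: "b (Suc n) = cond_entropy_of P (J (-S)) (X UNIV)"
      unfolding b_def
    proof (rule cond_entropy_of_cong[OF finP])
      fix \<omega> \<omega>'
      show "(X (-T) \<omega>, Xp (Suc n) T \<omega>) = (X (-T) \<omega>', Xp (Suc n) T \<omega>') \<longleftrightarrow> X UNIV \<omega> = X UNIV \<omega>'"
        unfolding prod.inject XT XpT by (metis Compl_iff UNIV_I atLeastLessThanSuc_atLeastAtMost)
    qed simp
    \<comment> \<open>The step of \<open>a\<close> reveals the outputs of all relays at time
      \<open>i\<close>; keeping only those of \<open>S\<close> weakens the condition, whence the
      inequality. The loss of entropy of \<open>J S\<close> is then exchanged for a loss of entropy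
      of \<open>y i S\<close>.\<close>
    have ai: "a (Suc i) - a i \<le> cond_entropy_of P (y i S) (\<lambda>\<omega>. ((x i UNIV \<omega>, J UNIV \<omega>), q i \<omega>))
      - cond_entropy_of P (y i S) (\<lambda>\<omega>. ((x i UNIV \<omega>, J (-S) \<omega>), q i \<omega>))" if i: "i \<in> {1..n}" for i
    proof -
      let ?G = "\<lambda>\<omega>. (J (-S) \<omega>, X UNIV \<omega>, Yp i \<omega>)"
      have X_q: "X UNIV \<omega> = X UNIV \<omega>' \<and> Yp i \<omega> = Yp i \<omega>' \<longleftrightarrow> x i UNIV \<omega> = x i UNIV \<omega>' \<and> q i \<omega> = q i \<omega>'" for \<omega> \<omega>'
        unfolding XU qi xU using i by blast
      have "a (Suc i) \<le> cond_entropy_of P (J S) (\<lambda>\<omega>. (?G \<omega>, y i S \<omega>))"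
        unfolding a_def
      proof (rule cond_entropy_of_antimono[OF finP])
        fix \<omega> \<omega>'
        assume h: "(J (-S) \<omega>, X UNIV \<omega>, Yp (Suc i) \<omega>) = (J (-S) \<omega>', X UNIV \<omega>', Yp (Suc i) \<omega>')"
        then have "\<forall>j\<in>{1..<Suc i}. snd (\<omega> j) = snd (\<omega>' j)" by (simp add: Ypi)
        then have "Yp i \<omega> = Yp i \<omega>'" "y i S \<omega> = y i S \<omega>'" using i by (auto simp: Ypi yS)
        with h show "(?G \<omega>, y i S \<omega>) = (?G \<omega>', y i S \<omega>')" by simp
      qed
      moreover have "cond_entropy_of P (J S) ?G - cond_entropy_of P (J S) (\<lambda>\<omega>. (?G \<omega>, y i S \<omega>))
          = cond_entropy_of P (y i S) ?G - cond_entropy_of P (y i S) (\<lambda>\<omega>. (?G \<omega>, J S \<omega>))"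
        by (rule cond_entropy_of_exchange[OF finP])
      moreover have "cond_entropy_of P (y i S) ?G
          = cond_entropy_of P (y i S) (\<lambda>\<omega>. ((x i UNIV \<omega>, J (-S) \<omega>), q i \<omega>))"
        by (rule cond_entropy_of_cong[OF finP]) (use X_q in auto)
      moreover have "cond_entropy_of P (y i S) (\<lambda>\<omega>. (?G \<omega>, J S \<omega>))
          = cond_entropy_of P (y i S) (\<lambda>\<omega>. ((x i UNIV \<omega>, J UNIV \<omega>), q i \<omega>))"
        by (rule cond_entropy_of_cong[OF finP]) (use X_q JS[of _ _ S] in auto)
      ultimately show ?thesis by (simp add: a_def)
    qed
    have bi: "b i - b (Suc i) \<le> cond_entropy_of P (x i T) (\<lambda>\<omega>. ((x i (-T) \<omega>, J {} \<omega>), q i \<omega>))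
      - cond_entropy_of P (x i T) (\<lambda>\<omega>. ((x i (-T) \<omega>, J (-S) \<omega>), q i \<omega>))" if i: "i \<in> {1..n}" for i
    proof -
      let ?G = "\<lambda>\<omega>. (X (-T) \<omega>, Xp i T \<omega>)"
      have "b (Suc i) = cond_entropy_of P (J (-S)) (\<lambda>\<omega>. (?G \<omega>, x i T \<omega>))"
        unfolding b_def
      proof (rule cond_entropy_of_cong[OF finP])
        fix \<omega> \<omega>'
        have "Xp (Suc i) T \<omega> = Xp (Suc i) T \<omega>' \<longleftrightarrow> Xp i T \<omega> = Xp i T \<omega>' \<and> x i T \<omega> = x i T \<omega>'"
          unfolding XpT xT using i by (auto simp: less_Suc_eq)
        then show "(X (-T) \<omega>, Xp (Suc i) T \<omega>) = (X (-T) \<omega>', Xp (Suc i) T \<omega>')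
            \<longleftrightarrow> (?G \<omega>, x i T \<omega>) = (?G \<omega>', x i T \<omega>')" by auto
      qed simp
      moreover have "cond_entropy_of P (J (-S)) ?G - cond_entropy_of P (J (-S)) (\<lambda>\<omega>. (?G \<omega>, x i T \<omega>))
          = cond_entropy_of P (x i T) ?G - cond_entropy_of P (x i T) (\<lambda>\<omega>. (?G \<omega>, J (-S) \<omega>))"
        by (rule cond_entropy_of_exchange[OF finP])
      \<comment> \<open>Dropping the inputs at other times can only increase this entropy; by
        \<open>indep\<close> the result equals the one conditioned on \<open>q i\<close>.\<close>
      moreover have "cond_entropy_of P (x i T) ?G \<le> cond_entropy_of P (x i T) (x i (-T))"
      proof (rule cond_entropy_of_antimono[OF finP])
        fix \<omega> \<omega>' assume "(X (-T) \<omega>, Xp i T \<omega>) = (X (-T) \<omega>', Xp i T \<omega>')"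
        then show "x i (-T) \<omega> = x i (-T) \<omega>'" using i unfolding prod.inject XT xT by blast
      qed
      \<comment> \<open>In the subtracted entropy the condition is enlarged instead:
        \<open>q i\<close> contains the inputs at all other times.\<close>
      moreover have "cond_entropy_of P (x i T) (\<lambda>\<omega>. ((x i (-T) \<omega>, J (-S) \<omega>), q i \<omega>))
          \<le> cond_entropy_of P (x i T) (\<lambda>\<omega>. (?G \<omega>, J (-S) \<omega>))"
      proof (rule cond_entropy_of_antimono[OF finP])
        fix \<omega> \<omega>'
        assume h: "((x i (-T) \<omega>, J (-S) \<omega>), q i \<omega>) = ((x i (-T) \<omega>', J (-S) \<omega>'), q i \<omega>')"
        then have 1: "\<forall>l\<in>-T. fst (\<omega> i) l = fst (\<omega>' i) l" "\<forall>j\<in>{1..n} - {i}. fst (\<omega> j) = fst (\<omega>' j)"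
          by (simp_all add: xT qi)
        have "X (-T) \<omega> = X (-T) \<omega>'" unfolding XT using 1 by (metis Diff_iff singletonD)
        moreover have "Xp i T \<omega> = Xp i T \<omega>'" unfolding XpT using 1(2) i by auto
        ultimately show "(?G \<omega>, J (-S) \<omega>) = (?G \<omega>', J (-S) \<omega>')" using h by simp
      qed
      ultimately show ?thesis using indep[OF i, of T "-T"] by (simp add: b_def)
    qed
    have "(\<Sum>i=1..n. (a (Suc i) - a i) + (b i - b (Suc i))) \<le> (\<Sum>i=1..n. V i T S)"
    proof (rule sum_mono)
      fix i assume "i \<in> {1..n}"
      from ai[OF this] bi[OF this] show "(a (Suc i) - a i) + (b i - b (Suc i)) \<le> V i T S"
        unfolding V_def by linarith
    qed
    moreover have "(\<Sum>i=1..n. (a (Suc i) - a i) + (b i - b (Suc i))) = (a (Suc n) - a 1) + (b 1 - b (Suc n))"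
      using sum_Suc_diff[of 1 n a] sum_Suc_diff[of 1 n "\<lambda>i. - b i"] by (simp add: sum.distrib)
    ultimately show ?thesis using a1 an b1 bn by simp
  qed
  have finQ: "finite (set_pmf (Q i))" for i
    using finP by (simp add: Q_def)
  show ?thesis
  proof (intro exI[of _ "\<lambda>i. if i \<in> {1..n} then Q i else return_pmf (return_pmf undefined)"] conjI allI)
    fix i
    show "finite (set_pmf (if i \<in> {1..n} then Q i else return_pmf (return_pmf undefined)))"
      using finQ by simp
    have "finite (set_pmf \<mu>')" if i: "i \<in> {1..n}" and "\<mu>' \<in> set_pmf (Q i)" for \<mu>'
    proof -
      from that(2) obtain \<omega> where "\<omega> \<in> set_pmf P" "\<mu>' = \<mu> i (q i \<omega>)" by (auto simp: Q_def)
      then obtain s where s: "s \<in> q i ` set_pmf P" "\<mu>' = \<mu> i s" by blast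
      show ?thesis unfolding s(2) \<mu>_def using finN[of i] by (simp add: set_cond_pmf[OF qne[OF i s(1)]])
    qed
    then show "\<forall>\<mu>'\<in>set_pmf (if i \<in> {1..n} then Q i else return_pmf (return_pmf undefined)). finite (set_pmf \<mu>')"
      by auto
  next
    fix T S
    have "measure_pmf.expectation (Q i) (\<lambda>\<mu>'. letter_gain (B i) \<mu>' T S) = V i T S"
      if i: "i \<in> {1..n}" for i
    proof -
      have "measure_pmf.expectation (Q i) (\<lambda>\<mu>'. letter_gain (B i) \<mu>' T S)
          = (\<Sum>\<omega>\<in>set_pmf P. pmf P \<omega> * letter_gain (B i) (\<mu> i (q i \<omega>)) T S)"
        unfolding Q_def integral_map_pmf
        by (subst integral_measure_pmf_real[OF finP]) (auto simp: mult.commute)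
      also have "\<dots> = V i T S"
        unfolding average[OF i] by (rule sum_set_pmf_fibres[OF finP])
      finally show ?thesis .
    qed
    then show "cond_entropy_of P (J (-S)) (X (-T)) - cond_entropy_of P (J (-S)) (X UNIV)
        - cond_entropy_of P (J S) (\<lambda>\<omega>. (J (-S) \<omega>, X UNIV \<omega>))
      \<le> (\<Sum>i=1..n. measure_pmf.expectation (if i \<in> {1..n} then Q i else return_pmf (return_pmf undefined))
          (\<lambda>\<mu>. letter_gain (B i) \<mu> T S))"
      using bound[of S T] by simp
  qed
qed

section \<open>Random codebooks and the bound for one block\<close>

text \<open>\<open>d'\<close> is the default value before the map and \<open>d\<close> the one after
  it; the default has to be reset since \<open>h\<close> acts on \<open>A\<close> only.\<close>

lemma Pi_pmf_map_dep:
  assumes "finite A"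
  shows "Pi_pmf A d (\<lambda>x. map_pmf (h x) (p x))
    = map_pmf (\<lambda>f x. if x \<in> A then h x (f x) else d) (Pi_pmf A d' p)"
  unfolding map_pmf_def by (subst Pi_pmf_bind[OF assms, of _ _ _ d']) (simp add: assms)

text \<open>On the fibre \<open>g a = s\<close> the kernel does not vary, so the joint probability
  of a source value and an output factorises.\<close>

lemma pr_bind_pmf:
  assumes "\<And>a. a \<in> set_pmf A \<Longrightarrow> g a = s \<Longrightarrow> K a = K'"
  shows "pr (A \<bind> (\<lambda>a. map_pmf (Pair a) (K a))) (\<lambda>\<omega>. (j (snd \<omega>), g (fst \<omega>))) (v, s)
    = pr A g s * pr K' j v"
proof -
  let ?F = "\<lambda>\<omega>. (j (snd \<omega>), g (fst \<omega>))"
  have "map_pmf ?F (A \<bind> (\<lambda>a. map_pmf (Pair a) (K a)))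
      = A \<bind> (\<lambda>a. map_pmf (\<lambda>v. (v, g a)) (map_pmf j (K a)))"
    by (simp add: map_bind_pmf map_pmf_comp)
  then have "pr (A \<bind> (\<lambda>a. map_pmf (Pair a) (K a))) ?F (v, s)
      = measure_pmf.expectation A (\<lambda>a. pmf (map_pmf (\<lambda>v. (v, g a)) (map_pmf j (K a))) (v, s))"
    by (simp add: pr_eq_pmf_map pmf_bind)
  also have "\<dots> = measure_pmf.expectation A (\<lambda>a. indicator {a. g a = s} a * pr K' j v)"
  proof (rule integral_cong_AE)
    show "AE a in measure_pmf A. pmf (map_pmf (\<lambda>v. (v, g a)) (map_pmf j (K a))) (v, s)
        = indicator {a. g a = s} a * pr K' j v"
    proof (rule AE_pmfI)
      fix a assume a: "a \<in> set_pmf A"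
      show "pmf (map_pmf (\<lambda>v. (v, g a)) (map_pmf j (K a))) (v, s) = indicator {a. g a = s} a * pr K' j v"
      proof (cases "g a = s")
        case True
        have "pmf (map_pmf (\<lambda>v. (v, g a)) (map_pmf j (K a))) (v, g a) = pmf (map_pmf j (K a)) v"
          by (rule pmf_map_inj') (auto intro: injI)
        then show ?thesis using assms[OF a True] True by (simp add: pr_eq_pmf_map)
      next
        case False
        have "(v, s) \<notin> set_pmf (map_pmf (\<lambda>v. (v, g a)) (map_pmf j (K a)))" using False by auto
        then show ?thesis using False by (simp add: pmf_eq_0_set_pmf)
      qed
    qed
  qed auto
  also have "\<dots> = pr A g s * pr K' j v" by (simp add: pr_def)
  finally show ?thesis .
qed

lemma cond_entropy_of_eq_log:
  "cond_entropy_of P f g = (\<Sum>\<omega>\<in>set_pmf P. pmf P \<omega> *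
      (log 2 (pr P g (g \<omega>)) - log 2 (pr P (\<lambda>\<omega>. (f \<omega>, g \<omega>)) (f \<omega>, g \<omega>))))"
  unfolding cond_entropy_of_def entropy_of_def by (simp add: sum_subtractf[symmetric] algebra_simps)

lemma cond_entropy_of_bind_pmf:
  assumes "\<And>a a'. a \<in> set_pmf A \<Longrightarrow> a' \<in> set_pmf A \<Longrightarrow> g a = g a' \<Longrightarrow> K a = K a'"
  defines "P \<equiv> A \<bind> (\<lambda>a. map_pmf (Pair a) (K a))"
  shows "cond_entropy_of P (\<lambda>\<omega>. j (snd \<omega>)) (\<lambda>\<omega>. g (fst \<omega>))
    = (\<Sum>\<omega>\<in>set_pmf P. pmf P \<omega> * - log 2 (pr (K (fst \<omega>)) j (j (snd \<omega>))))"
  unfolding cond_entropy_of_eq_log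
proof (intro sum.cong refl)
  fix \<omega> assume w: "\<omega> \<in> set_pmf P"
  then have a: "fst \<omega> \<in> set_pmf A" and v: "snd \<omega> \<in> set_pmf (K (fst \<omega>))" by (auto simp: P_def)
  have 1: "pr P (\<lambda>\<omega>. (j (snd \<omega>), g (fst \<omega>))) (j (snd \<omega>), g (fst \<omega>))
      = pr A g (g (fst \<omega>)) * pr (K (fst \<omega>)) j (j (snd \<omega>))"
    unfolding P_def by (rule pr_bind_pmf) (use assms(1) a in blast)
  have "map_pmf fst P = A"
    by (simp add: P_def map_bind_pmf map_pmf_comp map_pmf_const bind_return_pmf')
  then have 2: "pr P (\<lambda>\<omega>. g (fst \<omega>)) (g (fst \<omega>)) = pr A g (g (fst \<omega>))"
    using pr_map_pmf[of fst P g] by simp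
  show "pmf P \<omega> * (log 2 (pr P (\<lambda>\<omega>. g (fst \<omega>)) (g (fst \<omega>)))
      - log 2 (pr P (\<lambda>\<omega>. (j (snd \<omega>), g (fst \<omega>))) (j (snd \<omega>), g (fst \<omega>))))
    = pmf P \<omega> * - log 2 (pr (K (fst \<omega>)) j (j (snd \<omega>)))"
    unfolding 1 2 using pr_pos[OF a, of g] pr_pos[OF v, of j] by (simp add: log_mult)
qed

text \<open>Both sides are the mean surprisal under the kernel, which depends on \<open>a\<close>
  through \<open>g a\<close> only. It will say that, given the channel inputs, messages and
  codebooks tell nothing more about the relay indices.\<close>

lemma cond_entropy_of_markov:
  assumes "\<And>a a'. a \<in> set_pmf A \<Longrightarrow> a' \<in> set_pmf A \<Longrightarrow> g a = g a' \<Longrightarrow> K a = K a'"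
  defines "P \<equiv> A \<bind> (\<lambda>a. map_pmf (Pair a) (K a))"
  shows "cond_entropy_of P (\<lambda>\<omega>. j (snd \<omega>)) (\<lambda>\<omega>. g (fst \<omega>)) = cond_entropy_of P (\<lambda>\<omega>. j (snd \<omega>)) fst"
proof -
  have "cond_entropy_of P (\<lambda>\<omega>. j (snd \<omega>)) (\<lambda>\<omega>. fst \<omega>)
    = (\<Sum>\<omega>\<in>set_pmf P. pmf P \<omega> * - log 2 (pr (K (fst \<omega>)) j (j (snd \<omega>))))"
    unfolding P_def by (rule cond_entropy_of_bind_pmf) simp
  moreover have "cond_entropy_of P (\<lambda>\<omega>. j (snd \<omega>)) (\<lambda>\<omega>. g (fst \<omega>))
    = (\<Sum>\<omega>\<in>set_pmf P. pmf P \<omega> * - log 2 (pr (K (fst \<omega>)) j (j (snd \<omega>))))"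
    unfolding P_def by (rule cond_entropy_of_bind_pmf) (rule assms(1))
  ultimately show ?thesis by simp
qed

lemma in_set_Pi_pmf:
  assumes "finite A"
  shows "f \<in> set_pmf (Pi_pmf A d p) \<longleftrightarrow> (\<forall>i\<in>A. f i \<in> set_pmf (p i)) \<and> (\<forall>i. i \<notin> A \<longrightarrow> f i = d)"
  by (auto simp: set_Pi_pmf[OF assms] PiE_dflt_def)

text \<open>Both sides describe a matrix with independent entries. The work lies in the default
  values outside \<open>I\<close>, which belong to different indices on the two sides.\<close>

lemma Pi_pmf_transpose:
  fixes p :: "'l::finite \<Rightarrow> 'i \<Rightarrow> 'x pmf"
  assumes fin: "finite I"
  shows "map_pmf (\<lambda>x i. if i \<in> I then \<lambda>l. x l i else d)
      (Pi_pmf UNIV d'' (\<lambda>l. Pi_pmf I d' (p l)))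
    = Pi_pmf I d (\<lambda>i. Pi_pmf UNIV d' (\<lambda>l. p l i))"
proof (rule pmf_eqI)
  fix z :: "'i \<Rightarrow> 'l \<Rightarrow> 'x"
  let ?T = "\<lambda>x i. if i \<in> I then \<lambda>l. x l i else d"
  let ?P = "Pi_pmf UNIV d'' (\<lambda>l. Pi_pmf I d' (p l))"
  have sub: "set_pmf ?P \<subseteq> {x. \<forall>l i. i \<notin> I \<longrightarrow> x l i = d'}"
    by (simp add: in_set_Pi_pmf fin subset_iff)
  show "pmf (map_pmf ?T ?P) z = pmf (Pi_pmf I d (\<lambda>i. Pi_pmf UNIV d' (\<lambda>l. p l i))) z"
  proof (cases "\<forall>i. i \<notin> I \<longrightarrow> z i = d")
    case True
    define x where "x = (\<lambda>l i. if i \<in> I then z i l else d')"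
    have eq: "?T -` {z} \<inter> {x. \<forall>l i. i \<notin> I \<longrightarrow> x l i = d'} = {x}"
      using True by (auto simp: x_def fun_eq_iff split: if_splits)
    have "pmf (map_pmf ?T ?P) z = measure_pmf.prob ?P (?T -` {z})"
      by (simp add: pmf_map)
    also have "\<dots> = measure_pmf.prob ?P (?T -` {z} \<inter> set_pmf ?P)"
      by (simp add: measure_Int_set_pmf)
    also have "?T -` {z} \<inter> set_pmf ?P = {x} \<inter> set_pmf ?P"
      using eq sub by blast
    also have "measure_pmf.prob ?P \<dots> = pmf ?P x"
      by (simp add: measure_Int_set_pmf measure_pmf_single)
    also have "\<dots> = (\<Prod>l\<in>UNIV. \<Prod>i\<in>I. pmf (p l i) (z i l))"
      by (auto simp: pmf_Pi fin x_def intro!: prod.cong)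
    also have "\<dots> = (\<Prod>i\<in>I. \<Prod>l\<in>UNIV. pmf (p l i) (z i l))"
      by (rule prod.swap)
    also have "\<dots> = pmf (Pi_pmf I d (\<lambda>i. Pi_pmf UNIV d' (\<lambda>l. p l i))) z"
      using True by (subst pmf_Pi[OF fin]) (auto simp: pmf_Pi intro!: prod.cong)
    finally show ?thesis .
  next
    case False
    then have "z \<notin> set_pmf (map_pmf ?T ?P)" by auto
    then show ?thesis using False by (subst pmf_Pi[OF fin]) (auto simp: pmf_eq_0_set_pmf)
  qed
qed

text \<open>\<open>embed_pmf\<close> is meaningful only for functions of total mass one; this one is
  recognised as the density of the image of \<open>P\<close> under the inverse of \<beta>.\<close>

lemma embed_pmf_bij_betw:
  assumes bij: "bij_betw \<beta> M B" and sub: "set_pmf P \<subseteq> B"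
  defines "E \<equiv> embed_pmf (\<lambda>f. if f \<in> M then pmf P (\<beta> f) else 0)"
  shows "map_pmf \<beta> E = P" "set_pmf E \<subseteq> M"
proof -
  let ?inv = "the_inv_into M \<beta>"
  have inj: "inj_on \<beta> M" using bij by (rule bij_betw_imp_inj_on)
  have invB: "?inv g \<in> M" if "g \<in> B" for g
    by (rule the_inv_into_into[OF inj _ subset_refl]) (use that bij_betw_imp_surj_on[OF bij] in blast)
  have sM: "set_pmf (map_pmf ?inv P) \<subseteq> M"
    using sub invB unfolding set_map_pmf by blast
  have "(\<lambda>f. if f \<in> M then pmf P (\<beta> f) else 0) = pmf (map_pmf ?inv P)" (is "?L = _")
  proof
    fix f
    show "?L f = pmf (map_pmf ?inv P) f"
    proof (cases "f \<in> M")
      case True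
      have bf: "\<beta> f \<in> B" using bij True by (meson bij_betwE)
      have eq: "?inv -` {f} \<inter> B = {\<beta> f}"
      proof (intro equalityI subsetI)
        fix g assume "g \<in> ?inv -` {f} \<inter> B"
        then have "?inv g = f" "g \<in> B" by simp_all
        then show "g \<in> {\<beta> f}" using f_the_inv_into_f_bij_betw[OF bij, of g] by simp
      next
        fix g assume "g \<in> {\<beta> f}"
        then show "g \<in> ?inv -` {f} \<inter> B" using bf the_inv_into_f_f[OF inj True] by simp
      qed
      have "pmf (map_pmf ?inv P) f = measure_pmf.prob P (?inv -` {f})"
        by (simp add: pmf_map)
      also have "\<dots> = measure_pmf.prob P (?inv -` {f} \<inter> set_pmf P)"
        by (simp add: measure_Int_set_pmf)
      also have "?inv -` {f} \<inter> set_pmf P = {\<beta> f} \<inter> set_pmf P"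
        using eq sub by blast
      also have "measure_pmf.prob P \<dots> = pmf P (\<beta> f)"
        by (simp add: measure_Int_set_pmf measure_pmf_single)
      finally show ?thesis using True by simp
    next
      case False
      then have "f \<notin> set_pmf (map_pmf ?inv P)"
        using sM by blast
      then have 0: "pmf (map_pmf ?inv P) f = 0" by (rule iffD2[OF pmf_eq_0_set_pmf])
      show ?thesis using False by (simp only: 0 if_False)
    qed
  qed
  then have E: "E = map_pmf ?inv P"
    unfolding E_def using type_definition.Rep_inverse[OF td_pmf_embed_pmf, of "map_pmf ?inv P"]
    by simp
  have "map_pmf \<beta> (map_pmf ?inv P) = map_pmf (\<lambda>x. x) P"
    unfolding map_pmf_comp
  proof (rule map_pmf_cong[OF refl])
    fix g assume "g \<in> set_pmf P"
    then show "\<beta> (?inv g) = g" using sub f_the_inv_into_f_bij_betw[OF bij, of g] by blast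
  qed
  then show "map_pmf \<beta> E = P"
    by (simp add: E)
  show "set_pmf E \<subseteq> M"
    using sM unfolding E .
qed

text \<open>Renaming indices to codebooks by the bijection, the prescribed index weights are the
  density of a codebook with independent letters: drawing the index means drawing all codewords
  independently.\<close>

lemma codebook_pmf_law:
  assumes sup: "\<And>i. set_pmf (input_pmf c l (q i)) \<subseteq> XX l"
    and bij: "bij_betw (\<lambda>f. \<lambda>m\<in>{1..num_idx n (R l)}. encoder c l f m q)
          {1..card (XX l) ^ (n * num_idx n (R l))}
          ({1..num_idx n (R l)} \<rightarrow>\<^sub>E ({1..n} \<rightarrow>\<^sub>E XX l))"
  shows "map_pmf (\<lambda>f. \<lambda>m\<in>{1..num_idx n (R l)}. encoder c l f m q) (codebook_pmf XX R n c l q)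
    = Pi_pmf {1..num_idx n (R l)} undefined (\<lambda>_. Pi_pmf {1..n} undefined (\<lambda>i. input_pmf c l (q i)))"
    (is "map_pmf ?\<beta> _ = ?P")
    and "set_pmf (codebook_pmf XX R n c l q) \<subseteq> {1..card (XX l) ^ (n * num_idx n (R l))}"
proof -
  let ?N = "{1..num_idx n (R l)}" and ?M = "{1..card (XX l) ^ (n * num_idx n (R l))}"
  let ?B = "?N \<rightarrow>\<^sub>E ({1..n} \<rightarrow>\<^sub>E XX l)"
  have sub: "set_pmf ?P \<subseteq> ?B"
  proof
    fix g assume "g \<in> set_pmf ?P"
    then have "\<forall>m\<in>?N. \<forall>i\<in>{1..n}. g m i \<in> XX l" "\<forall>m\<in>?N. \<forall>i. i \<notin> {1..n} \<longrightarrow> g m i = undefined"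
      "\<forall>m. m \<notin> ?N \<longrightarrow> g m = undefined"
      using sup unfolding in_set_Pi_pmf[OF finite_atLeastAtMost] by blast+
    then show "g \<in> ?B" by (simp add: PiE_iff extensional_def)
  qed
  have val: "pmf ?P (?\<beta> f) = (\<Prod>m\<in>?N. \<Prod>i\<in>{1..n}. pmf (input_pmf c l (q i)) (encoder c l f m q i))"
    if f: "f \<in> ?M" for f
  proof -
    have bf: "?\<beta> f \<in> ?B" using bij f by (meson bij_betwE)
    have "pmf ?P (?\<beta> f) = (\<Prod>m\<in>?N. pmf (Pi_pmf {1..n} undefined (\<lambda>i. input_pmf c l (q i))) (?\<beta> f m))"
      by (rule pmf_Pi') auto
    also have "\<dots> = (\<Prod>m\<in>?N. \<Prod>i\<in>{1..n}. pmf (input_pmf c l (q i)) (encoder c l f m q i))"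
    proof (rule prod.cong[OF refl])
      fix m assume m: "m \<in> ?N"
      then have e: "?\<beta> f m = encoder c l f m q" by simp
      have "?\<beta> f m \<in> {1..n} \<rightarrow>\<^sub>E XX l"
        using bf m by (rule PiE_mem)
      then have "\<forall>i. i \<notin> {1..n} \<longrightarrow> encoder c l f m q i = undefined"
        unfolding e by (simp add: PiE_iff extensional_def)
      then show "pmf (Pi_pmf {1..n} undefined (\<lambda>i. input_pmf c l (q i))) (?\<beta> f m)
          = (\<Prod>i\<in>{1..n}. pmf (input_pmf c l (q i)) (encoder c l f m q i))"
        unfolding e by (intro pmf_Pi') blast+
    qed
    finally show ?thesis .
  qed
  have "(\<lambda>f. if f \<in> ?M then pmf ?P (?\<beta> f) else 0)
    = (\<lambda>f. if f \<in> ?M then \<Prod>m\<in>?N. \<Prod>i\<in>{1..n}. pmf (input_pmf c l (q i)) (encoder c l f m q i) else 0)"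
    (is "?l = ?r")
  proof
    fix f show "?l f = ?r f" using val[of f] by (cases "f \<in> ?M") (simp_all only: if_True if_False)
  qed
  then have "codebook_pmf XX R n c l q = embed_pmf (\<lambda>f. if f \<in> ?M then pmf ?P (?\<beta> f) else 0)"
    unfolding codebook_pmf_def by (simp only:)
  then show "map_pmf ?\<beta> (codebook_pmf XX R n c l q) = ?P" "set_pmf (codebook_pmf XX R n c l q) \<subseteq> ?M"
    using embed_pmf_bij_betw[OF bij sub] by (simp_all only:)
qed

lemma log_card_PiE_dflt:
  assumes "finite A" "\<And>a. a \<in> A \<Longrightarrow> finite (B a)" "\<And>a. a \<in> A \<Longrightarrow> B a \<noteq> {}"
  shows "log 2 (card (PiE_dflt A d B)) = (\<Sum>a\<in>A. log 2 (card (B a)))"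
proof -
  have "ln (\<Prod>a\<in>A. real (card (B a))) = (\<Sum>a\<in>A. ln (real (card (B a))))"
    by (rule ln_prod) (use assms in \<open>auto simp: card_eq_0_iff\<close>)
  then show ?thesis
    using card_PiE_dflt[of A B d] assms by (simp add: log_def sum_divide_distrib)
qed

lemma num_idx_ge_1:
  assumes "0 \<le> r"
  shows "1 \<le> num_idx n r"
proof -
  have "1 \<le> 2 powr (real n * r)" using assms by (intro ge_one_powr_ge_zero) auto
  then have "1 \<le> \<lfloor>2 powr (real n * r)\<rfloor>" by simp
  then have "nat 1 \<le> nat \<lfloor>2 powr (real n * r)\<rfloor>" by (rule nat_mono)
  then show ?thesis by (simp only: num_idx_def nat_1 One_nat_def)
qed

lemma log_num_idx_le:
  assumes "0 \<le> r"
  shows "log 2 (num_idx n r) \<le> real n * r"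
proof -
  have "real (num_idx n r) \<le> 2 powr (real n * r)"
    by (simp add: num_idx_def)
  then have "log 2 (num_idx n r) \<le> log 2 (2 powr (real n * r))"
    using num_idx_ge_1[OF assms, of n] by (subst log_le_cancel_iff) auto
  then show ?thesis by simp
qed

text \<open>Rounding down a number that is at least one loses at most a factor of two, hence at most
  one bit.\<close>

lemma log_num_idx_ge:
  assumes "0 \<le> r"
  shows "real n * r - 1 \<le> log 2 (num_idx n r)"
proof -
  let ?z = "2 powr (real n * r)"
  have z: "1 \<le> ?z" using assms by (intro ge_one_powr_ge_zero) auto
  have "?z < real (num_idx n r) + 1"
    unfolding num_idx_def using z by simp
  then have "?z / 2 \<le> real (num_idx n r)"
    using num_idx_ge_1[OF assms, of n] by simp
  then have "log 2 (?z / 2) \<le> log 2 (num_idx n r)"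
    using z num_idx_ge_1[OF assms, of n] by (subst log_le_cancel_iff) auto
  then show ?thesis using z by (simp add: log_divide)
qed

text \<open>The time-sharing sequence \<open>q\<close> is fixed. Whatever the messages, the random
  codebook gives the transmitted words a law that is a product over time, so inputs and outputs have
  the law \<open>P\<close>; the relay indices depend on the outputs and \<open>q\<close> alone
  because the relays ignore the codebook. Fano's inequality then bounds the entropy of the messages
  of \<open>T\<close> by \<open>I(M_T; J | M_(T^c), F)\<close> plus the error terms.\<close>

lemma oblivious_block_bound:
  fixes XX :: "'l::finite \<Rightarrow> 'x set" and YY :: "'k::finite \<Rightarrow> 'y set"
    and ch :: "('l \<Rightarrow> 'x) \<Rightarrow> ('k \<Rightarrow> 'y) pmf" and C :: "'k \<Rightarrow> real" and R :: "'l \<Rightarrow> real"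
    and c :: "('l, 'k, 'x, 'y) cran_code" and n :: nat and q :: "nat \<Rightarrow> nat"
  assumes finX: "\<And>l. finite (XX l)" and finY: "\<And>k. finite (YY k)"
    and chS: "\<And>x. (\<forall>l. x l \<in> XX l) \<Longrightarrow> set_pmf (ch x) \<subseteq> {y. \<forall>k. y k \<in> YY k}"
    and C0: "\<And>k. 0 \<le> C k" and R0: "\<And>l. 0 \<le> R l"
    and valid: "cran_code_valid XX YY C R n c" and q: "q \<in> {1..n} \<rightarrow>\<^sub>E UNIV"
  defines "B \<equiv> \<lambda>i. Pi_pmf UNIV undefined (\<lambda>l. input_pmf c l (q i)) \<bind> (\<lambda>x. map_pmf (Pair x) (ch x))"
  defines "P \<equiv> Pi_pmf {1..n} undefined B"
  defines "J \<equiv> \<lambda>A \<omega>. restrict (\<lambda>k. relay c k (\<lambda>j\<in>{1..n}. snd (\<omega> j) k) q) A"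
  defines "X \<equiv> \<lambda>A \<omega>. \<lambda>j\<in>{1..n}. restrict (fst (\<omega> j)) A"
  defines "Pe \<equiv> measure_pmf.prob (do {
     m \<leftarrow> Pi_pmf UNIV undefined (\<lambda>l. pmf_of_set {1..num_idx n (R l)});
     f \<leftarrow> Pi_pmf UNIV undefined (\<lambda>l. codebook_pmf XX R n c l q);
     y \<leftarrow> Pi_pmf {1..n} undefined (\<lambda>i. ch (\<lambda>l. encoder c l (f l) (m l) q i));
     return_pmf (m, decoder c f (\<lambda>k. relay c k (\<lambda>i\<in>{1..n}. y i k) q) q)
   }) {(m, m'). m' \<noteq> m}"
  shows "finite (set_pmf (B i))"
    and "(\<Sum>t\<in>T. log 2 (num_idx n (R t))) * (1 - Pe) - 1
      \<le> (\<Sum>s\<in>S. log 2 (num_idx n (C s)))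
        + (cond_entropy_of P (J (-S)) (X (-T)) - cond_entropy_of P (J (-S)) (X UNIV)
        - cond_entropy_of P (J S) (\<lambda>\<omega>. (J (-S) \<omega>, X UNIV \<omega>)))"
proof -
  note v = valid[unfolded cran_code_valid_def]
  have sup: "set_pmf (input_pmf c l i) \<subseteq> XX l" for l i using v by blast
  have bij: "bij_betw (\<lambda>f. \<lambda>m\<in>{1..num_idx n (R l)}. encoder c l f m q)
          {1..card (XX l) ^ (n * num_idx n (R l))}
          ({1..num_idx n (R l)} \<rightarrow>\<^sub>E ({1..n} \<rightarrow>\<^sub>E XX l))" for l
    using v q by blast
  have rel: "relay c k y q \<in> {1..num_idx n (C k)}" if "y \<in> {1..n} \<rightarrow>\<^sub>E YY k" for k y
    using v q that by blast
  note book = codebook_pmf_law[where XX = XX and R = R and n = n and c = c and q = q, OF sup bij]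
  define Y where "Y = {y. \<forall>k. y k \<in> YY k}"
  have finYs: "finite Y"
  proof -
    have "Y = PiE UNIV YY" by (auto simp: Y_def PiE_iff)
    then show ?thesis using finY by (simp add: finite_PiE)
  qed
  have finp: "finite (set_pmf (input_pmf c l i))" for l i
    using sup finX finite_subset by blast
  have Bx: "\<forall>l. fst b l \<in> XX l" "snd b \<in> Y" if "b \<in> set_pmf (B i)" for b i
  proof -
    from that obtain x y where b: "b = (x, y)" "x \<in> set_pmf (Pi_pmf UNIV undefined (\<lambda>l. input_pmf c l (q i)))"
      "y \<in> set_pmf (ch x)" unfolding B_def by auto
    have "\<forall>l. x l \<in> set_pmf (input_pmf c l (q i))" using b(2) by (simp add: in_set_Pi_pmf)
    then have "\<forall>l. x l \<in> XX l" using sup by blast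
    then show "\<forall>l. fst b l \<in> XX l" "snd b \<in> Y" using b chS unfolding Y_def by auto
  qed
  show finB: "finite (set_pmf (B i))" for i
  proof (rule finite_subset)
    show "set_pmf (B i) \<subseteq> PiE UNIV XX \<times> Y" using Bx by (fastforce simp: PiE_iff)
    show "finite (PiE UNIV XX \<times> Y)" using finX finYs by (auto intro!: finite_PiE)
  qed
  define Mp where "Mp = Pi_pmf UNIV undefined (\<lambda>l. pmf_of_set {1..num_idx n (R l)})"
  define Fp where "Fp = Pi_pmf UNIV undefined (\<lambda>l. codebook_pmf XX R n c l q)"
  define \<phi> where "\<phi> a = (\<lambda>i. if i \<in> {1..n} then \<lambda>l. encoder c l (snd a l) (fst a l) q i else undefined)"
    for a :: "('l \<Rightarrow> nat) \<times> ('l \<Rightarrow> nat)"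
  define K where "K a = Pi_pmf {1..n} undefined (\<lambda>i. ch (\<phi> a i))" for a
  \<comment> \<open>The actual experiment: messages and codebook indices, followed by the channel
    outputs. \<open>Om\<close> forgets everything except inputs and outputs.\<close>
  define G where "G = pair_pmf Mp Fp \<bind> (\<lambda>a. map_pmf (Pair a) (K a))"
  define dec where "dec g = decoder c (snd (fst g)) (\<lambda>k. relay c k (\<lambda>i\<in>{1..n}. snd g i k) q) q"
    for g :: "(('l \<Rightarrow> nat) \<times> ('l \<Rightarrow> nat)) \<times> (nat \<Rightarrow> 'k \<Rightarrow> 'y)"
  define Om where "Om g = (\<lambda>i. if i \<in> {1..n} then (\<phi> (fst g) i, snd g i) else undefined)"
    for g :: "(('l \<Rightarrow> nat) \<times> ('l \<Rightarrow> nat)) \<times> (nat \<Rightarrow> 'k \<Rightarrow> 'y)"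
  have num1: "1 \<le> num_idx n (R l)" for l by (rule num_idx_ge_1[OF R0])
  have mset: "m l \<in> {1..num_idx n (R l)}" if "m \<in> set_pmf Mp" for m l
    using that num1 unfolding Mp_def by (simp add: in_set_Pi_pmf)
  have finM: "finite (set_pmf Mp)"
    unfolding Mp_def by (rule finite_set_Pi_pmf) (use num1 in auto)
  have finF: "finite (set_pmf Fp)"
    unfolding Fp_def by (rule finite_set_Pi_pmf) (auto intro: finite_subset[OF book(2)])
  have Pe: "Pe = measure_pmf.prob G {g. dec g \<noteq> fst (fst g)}"
  proof -
    have k: "K (m, f) = Pi_pmf {1..n} undefined (\<lambda>i. ch (\<lambda>l. encoder c l (f l) (m l) q i))" for m f
      unfolding K_def by (rule Pi_pmf_cong) (auto simp: \<phi>_def)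
    have "do { m \<leftarrow> Mp; f \<leftarrow> Fp; y \<leftarrow> Pi_pmf {1..n} undefined (\<lambda>i. ch (\<lambda>l. encoder c l (f l) (m l) q i));
       return_pmf (m, decoder c f (\<lambda>k. relay c k (\<lambda>i\<in>{1..n}. y i k) q) q) }
      = map_pmf (\<lambda>g. (fst (fst g), dec g)) G"
      unfolding G_def pair_pmf_def k[symmetric]
      by (simp add: map_pmf_def bind_assoc_pmf bind_return_pmf dec_def)
    then show ?thesis
      unfolding Pe_def Mp_def[symmetric] Fp_def[symmetric] by (simp add: vimage_def)
  qed
  \<comment> \<open>Here obliviousness pays off: for each fixed message tuple the transmitted words,
    averaged over the codebooks, are independent over time.\<close>
  have lawX: "map_pmf (\<lambda>f. \<phi> (m, f)) Fp = Pi_pmf {1..n} undefined (\<lambda>i. Pi_pmf UNIV undefined (\<lambda>l. input_pmf c l (q i)))"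
    if m: "m \<in> set_pmf Mp" for m
  proof -
    have 1: "map_pmf (\<lambda>f. encoder c l f (m l) q) (codebook_pmf XX R n c l q)
        = Pi_pmf {1..n} undefined (\<lambda>i. input_pmf c l (q i))" for l
    proof -
      have "map_pmf (\<lambda>f. encoder c l f (m l) q) (codebook_pmf XX R n c l q)
          = map_pmf (\<lambda>g. g (m l)) (map_pmf (\<lambda>f. \<lambda>m\<in>{1..num_idx n (R l)}. encoder c l f m q) (codebook_pmf XX R n c l q))"
        unfolding map_pmf_comp using mset[OF m] by simp
      also have "\<dots> = Pi_pmf {1..n} undefined (\<lambda>i. input_pmf c l (q i))"
        unfolding book(1) using mset[OF m] by (subst Pi_pmf_component) auto
      finally show ?thesis .
    qed
    have "map_pmf (\<lambda>f. \<phi> (m, f)) Fp = map_pmf (\<lambda>x i. if i \<in> {1..n} then \<lambda>l. x l i else undefined)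
        (map_pmf (\<lambda>f l. encoder c l (f l) (m l) q) Fp)"
      unfolding map_pmf_comp \<phi>_def by (simp cong: if_cong)
    also have "map_pmf (\<lambda>f l. encoder c l (f l) (m l) q) Fp
        = Pi_pmf UNIV undefined (\<lambda>l. map_pmf (\<lambda>f. encoder c l f (m l) q) (codebook_pmf XX R n c l q))"
      unfolding Fp_def by (subst Pi_pmf_map_dep[where d' = undefined]) simp_all
    finally show ?thesis
      unfolding 1 by (simp only: Pi_pmf_transpose[OF finite_atLeastAtMost])
  qed
  have map_G: "map_pmf Om G = P"
  proof -
    have Pb: "P = do { x \<leftarrow> Pi_pmf {1..n} undefined (\<lambda>i. Pi_pmf UNIV undefined (\<lambda>l. input_pmf c l (q i)));
        y \<leftarrow> Pi_pmf {1..n} undefined (\<lambda>i. ch (x i));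
        return_pmf (\<lambda>i. if i \<in> {1..n} then (x i, y i) else undefined) }"
      unfolding P_def B_def
      unfolding Pi_pmf_bind[OF finite_atLeastAtMost, where d' = undefined]
        Pi_pmf_map_dep[OF finite_atLeastAtMost, where d' = undefined]
      unfolding map_pmf_def ..
    have "map_pmf Om G = do { m \<leftarrow> Mp; x \<leftarrow> map_pmf (\<lambda>f. \<phi> (m, f)) Fp;
        y \<leftarrow> Pi_pmf {1..n} undefined (\<lambda>i. ch (x i));
        return_pmf (\<lambda>i. if i \<in> {1..n} then (x i, y i) else undefined) }"
      unfolding G_def K_def Om_def pair_pmf_def
      by (simp add: map_pmf_def bind_assoc_pmf bind_return_pmf cong: if_cong)
    also have "\<dots> = Mp \<bind> (\<lambda>m. P)"
      unfolding Pb by (intro bind_pmf_cong refl) (simp add: lawX)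
    finally show ?thesis by simp
  qed
  have finG: "finite (set_pmf G)"
  proof -
    have "finite (set_pmf (K a))" if "a \<in> set_pmf (pair_pmf Mp Fp)" for a
      unfolding K_def
    proof (rule finite_set_Pi_pmf)
      fix i assume i: "i \<in> {1..n}"
      obtain m f where a: "a = (m, f)" by (cases a)
      have "\<phi> (m, f) \<in> set_pmf (map_pmf (\<lambda>f. \<phi> (m, f)) Fp)" using that a by auto
      moreover have "m \<in> set_pmf Mp" using that a by auto
      ultimately have "\<phi> (m, f) \<in> set_pmf (Pi_pmf {1..n} undefined (\<lambda>i. Pi_pmf UNIV undefined (\<lambda>l. input_pmf c l (q i))))"
        using lawX[of m] by simp
      then have "\<phi> a i \<in> set_pmf (Pi_pmf UNIV undefined (\<lambda>l. input_pmf c l (q i)))"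
        using i unfolding in_set_Pi_pmf[OF finite_atLeastAtMost] a by blast
      then have "\<forall>l. \<phi> a i l \<in> XX l" using sup unfolding in_set_Pi_pmf[OF finite] by blast
      then show "finite (set_pmf (ch (\<phi> a i)))" using chS finYs unfolding Y_def by (blast intro: finite_subset)
    qed simp
    then show ?thesis unfolding G_def using finM finF by auto
  qed
  have finP: "finite (set_pmf P)" using finG unfolding map_G[symmetric] by simp
  define j where "j A y = restrict (\<lambda>k. relay c k (\<lambda>j\<in>{1..n}. y j k) q) A" for A and y :: "nat \<Rightarrow> 'k \<Rightarrow> 'y"
  define x where "x A a = (\<lambda>j\<in>{1..n}. restrict (\<phi> a j) A)" for A a
  have JOm: "J A (Om g) = j A (snd g)" "X A' (Om g) = x A' (fst g)" for A A' g
    unfolding J_def X_def j_def x_def Om_def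
    by (auto intro!: restrict_ext arg_cong2[where f = "relay c _"])
  have ceP: "cond_entropy_of P (F1 :: _ \<Rightarrow> 'f) (F2 :: _ \<Rightarrow> 'g) = cond_entropy_of G (\<lambda>g. F1 (Om g)) (\<lambda>g. F2 (Om g))"
    for F1 F2
    unfolding map_G[symmetric] by (rule cond_entropy_of_map_pmf[OF finG])
  have fstG: "map_pmf fst G = pair_pmf Mp Fp"
    unfolding G_def by (simp add: map_bind_pmf map_pmf_comp map_pmf_const bind_return_pmf')
  define e where "e A = (\<Sum>l\<in>A. log 2 (num_idx n (R l)))" for A
  have HM: "entropy_of Mp (\<lambda>m. restrict m A) = e A" for A
  proof -
    have "map_pmf (\<lambda>m. restrict m A) Mp = Pi_pmf A undefined (\<lambda>l. pmf_of_set {1..num_idx n (R l)})"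
      unfolding Mp_def restrict_def by (rule Pi_pmf_subset[symmetric]) auto
    also have "\<dots> = pmf_of_set (PiE_dflt A undefined (\<lambda>l. {1..num_idx n (R l)}))"
      by (rule Pi_pmf_of_set) (use num1 in auto)
    finally have "entropy_of Mp (\<lambda>m. restrict m A) = log 2 (card (PiE_dflt A undefined (\<lambda>l. {1..num_idx n (R l)})))"
      by (intro entropy_of_uniform finM) (use num1 in auto)
    also have "\<dots> = (\<Sum>l\<in>A. log 2 (card {1..num_idx n (R l)}))"
      by (rule log_card_PiE_dflt) (use num1 in auto)
    finally show ?thesis by (simp add: e_def)
  qed
  have HMF: "entropy_of G (\<lambda>g. (restrict (fst (fst g)) A, snd (fst g))) = e A + entropy_of Fp (\<lambda>f. f)" for A
  proof -
    have "entropy_of G (\<lambda>g. (restrict (fst (fst g)) A, snd (fst g)))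
        = entropy_of (map_pmf fst G) (\<lambda>a. (restrict (fst a) A, snd a))"
      by (rule entropy_of_map_pmf[OF finG, symmetric])
    also have "\<dots> = entropy_of (pair_pmf Mp Fp) (\<lambda>(m, f). (restrict m A, f))"
      unfolding fstG by (simp add: case_prod_unfold)
    also have "\<dots> = e A + entropy_of Fp (\<lambda>f. f)"
      by (subst entropy_of_pair_pmf[OF finM finF]) (simp add: HM)
    finally show ?thesis .
  qed
  let ?M = "\<lambda>A g. restrict (fst (fst g)) A" and ?F = "\<lambda>g :: (('l \<Rightarrow> nat) \<times> ('l \<Rightarrow> nat)) \<times> (nat \<Rightarrow> 'k \<Rightarrow> 'y). snd (fst g)"
  let ?J = "\<lambda>A (g :: (('l \<Rightarrow> nat) \<times> ('l \<Rightarrow> nat)) \<times> (nat \<Rightarrow> 'k \<Rightarrow> 'y)). j A (snd g)"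
  have MTF: "cond_entropy_of G (?M T) (\<lambda>g. (?M (-T) g, ?F g)) = e T"
  proof -
    have "entropy_of G (\<lambda>g. (?M T g, ?M (-T) g, ?F g)) = entropy_of G (\<lambda>g. (?M UNIV g, ?F g))"
      by (rule entropy_of_cong[OF finG]) (auto simp: restrict_eq_iff fun_eq_iff)
    then have "cond_entropy_of G (?M T) (\<lambda>g. (?M (-T) g, ?F g)) = e UNIV - e (-T)"
      using HMF[of UNIV] HMF[of "-T"] by (simp add: cond_entropy_of_def)
    also have "\<dots> = e T"
      using sum.union_disjoint[of T "-T" "\<lambda>l. log 2 (num_idx n (R l))"] by (simp add: e_def Compl_partition)
    finally show ?thesis .
  qed
  have fano: "cond_entropy_of G (?M T) (\<lambda>g. (?J UNIV g, ?F g)) \<le> 1 + Pe * e T"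
  proof -
    let ?B = "PiE_dflt T undefined (\<lambda>l. {1..num_idx n (R l)})"
    let ?\<gamma> = "\<lambda>(z, f). restrict (decoder c f z q) T"
    have "cond_entropy_of G (?M T) (\<lambda>g. (?J UNIV g, ?F g))
        \<le> 1 + measure_pmf.prob G {g. ?\<gamma> (?J UNIV g, ?F g) \<noteq> ?M T g} * log 2 (card ?B)"
    proof (rule cond_entropy_of_fano[OF finG])
      show "finite ?B" by (rule finite_PiE_dflt) auto
      show "?M T ` set_pmf G \<subseteq> ?B"
        using mset by (auto simp: G_def PiE_dflt_def)
    qed
    moreover have "log 2 (card ?B) = e T"
      unfolding e_def by (subst log_card_PiE_dflt) (use num1 in auto)
    \<comment> \<open>An error in the messages of \<open>T\<close> is an error of the whole
      tuple.\<close>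
    moreover have "measure_pmf.prob G {g. ?\<gamma> (?J UNIV g, ?F g) \<noteq> ?M T g} \<le> Pe"
      unfolding Pe by (rule measure_pmf.finite_measure_mono) (auto simp: dec_def j_def restrict_UNIV)
    moreover have "0 \<le> log 2 (num_idx n (R l))" for l
      using num1[of l] by (subst zero_le_log_cancel_iff) auto
    then have "0 \<le> e T" unfolding e_def by (intro sum_nonneg) auto
    ultimately show ?thesis by (smt (verit) mult_right_mono)
  qed
  \<comment> \<open>\<open>I(M_T; J | M_(T^c), F)\<close> equals
    \<open>H(J | M_(T^c), F) - H(J | M, F)\<close>. The first entropy grows when only the codewords
    of the complement of \<open>T\<close> are kept, being functions of the condition; the second is
    \<open>H(J | X)\<close> by the Markov property.\<close>
  have main: "e T - cond_entropy_of G (?M T) (\<lambda>g. (?J UNIV g, ?F g))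
      \<le> cond_entropy_of G (?J UNIV) (\<lambda>g. x (-T) (fst g)) - cond_entropy_of G (?J UNIV) (\<lambda>g. x UNIV (fst g))"
  proof -
    have 1: "cond_entropy_of G (?M T) (\<lambda>g. ((?M (-T) g, ?F g), ?J UNIV g))
        \<le> cond_entropy_of G (?M T) (\<lambda>g. (?J UNIV g, ?F g))"
      by (rule cond_entropy_of_antimono[OF finG]) simp
    have 2: "cond_entropy_of G (?M T) (\<lambda>g. (?M (-T) g, ?F g))
        - cond_entropy_of G (?M T) (\<lambda>g. ((?M (-T) g, ?F g), ?J UNIV g))
      = cond_entropy_of G (?J UNIV) (\<lambda>g. (?M (-T) g, ?F g))
        - cond_entropy_of G (?J UNIV) (\<lambda>g. ((?M (-T) g, ?F g), ?M T g))"
      by (rule cond_entropy_of_exchange[OF finG])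
    have 3: "cond_entropy_of G (?J UNIV) (\<lambda>g. (?M (-T) g, ?F g)) \<le> cond_entropy_of G (?J UNIV) (\<lambda>g. x (-T) (fst g))"
      by (rule cond_entropy_of_antimono[OF finG]) (auto simp: x_def restrict_eq_iff \<phi>_def)
    have 4: "cond_entropy_of G (?J UNIV) (\<lambda>g. ((?M (-T) g, ?F g), ?M T g)) = cond_entropy_of G (?J UNIV) fst"
    proof (rule cond_entropy_of_cong[OF finG])
      fix g g' :: "(('l \<Rightarrow> nat) \<times> ('l \<Rightarrow> nat)) \<times> (nat \<Rightarrow> 'k \<Rightarrow> 'y)"
      have "(\<forall>l. fst (fst g) l = fst (fst g') l) \<longleftrightarrow> fst (fst g) = fst (fst g')" by auto
      moreover have "fst g = fst g' \<longleftrightarrow> fst (fst g) = fst (fst g') \<and> snd (fst g) = snd (fst g')"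
        by (simp add: prod_eq_iff)
      ultimately show "((?M (-T) g, ?F g), ?M T g) = ((?M (-T) g', ?F g'), ?M T g') \<longleftrightarrow> fst g = fst g'"
        unfolding prod.inject restrict_eq_iff by blast
    qed simp
    have 5: "cond_entropy_of G (?J UNIV) (\<lambda>g. x UNIV (fst g)) = cond_entropy_of G (?J UNIV) fst"
      unfolding G_def
    proof (rule cond_entropy_of_markov)
      fix a a' assume "x UNIV a = x UNIV a'"
      then have "\<forall>i\<in>{1..n}. \<phi> a i = \<phi> a' i" by (simp only: x_def restrict_eq_iff restrict_UNIV)
      then show "K a = K a'" unfolding K_def by (intro Pi_pmf_cong) auto
    qed
    show ?thesis using 1 2 3 4 5 MTF by linarith
  qed
  \<comment> \<open>Splits off the indices of \<open>S\<close>, so that the capacity bound is spent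
    on \<open>S\<close> alone.\<close>
  have P1: "cond_entropy_of P (J UNIV) (X A) = cond_entropy_of P (J (-S)) (X A) + cond_entropy_of P (J S) (\<lambda>\<omega>. (X A \<omega>, J (-S) \<omega>))"
    for A
  proof -
    have "cond_entropy_of P (J UNIV) (X A) = cond_entropy_of P (\<lambda>\<omega>. (J (-S) \<omega>, J S \<omega>)) (X A)"
    proof (rule cond_entropy_of_cong[OF finP])
      fix \<omega> \<omega>'
      show "J UNIV \<omega> = J UNIV \<omega>' \<longleftrightarrow> (J (-S) \<omega>, J S \<omega>) = (J (-S) \<omega>', J S \<omega>')"
        unfolding J_def prod.inject restrict_eq_iff by blast
    qed simp
    also have "\<dots> = cond_entropy_of P (J (-S)) (X A) + cond_entropy_of P (J S) (\<lambda>\<omega>. (X A \<omega>, J (-S) \<omega>))"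
      by (rule cond_entropy_of_chain[OF finP])
    finally show ?thesis .
  qed
  have card: "cond_entropy_of P (J S) (\<lambda>\<omega>. (X (-T) \<omega>, J (-S) \<omega>)) \<le> (\<Sum>s\<in>S. log 2 (num_idx n (C s)))"
  proof -
    let ?B = "PiE_dflt S undefined (\<lambda>k. {1..num_idx n (C k)})"
    have "cond_entropy_of P (J S) (\<lambda>\<omega>. (X (-T) \<omega>, J (-S) \<omega>)) \<le> log 2 (card ?B)"
    proof (rule cond_entropy_of_le_log_card[OF finP])
      show "finite ?B" by (rule finite_PiE_dflt) auto
      show "J S ` set_pmf P \<subseteq> ?B"
      proof clarify
        fix \<omega> assume "\<omega> \<in> set_pmf P"
        then have "\<forall>i\<in>{1..n}. \<omega> i \<in> set_pmf (B i)" unfolding P_def by (simp add: in_set_Pi_pmf)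
        then have "\<forall>i\<in>{1..n}. snd (\<omega> i) \<in> Y" using Bx(2) by blast
        then have "(\<lambda>j\<in>{1..n}. snd (\<omega> j) k) \<in> {1..n} \<rightarrow>\<^sub>E YY k" for k
          by (auto simp: Y_def)
        then show "J S \<omega> \<in> ?B" using rel by (simp add: J_def PiE_dflt_def)
      qed
    qed
    also have "\<dots> = (\<Sum>s\<in>S. log 2 (num_idx n (C s)))"
      by (subst log_card_PiE_dflt) (use num_idx_ge_1[OF C0] in auto)
    finally show ?thesis .
  qed
  have swap: "cond_entropy_of P (J S) (\<lambda>\<omega>. (X UNIV \<omega>, J (-S) \<omega>)) = cond_entropy_of P (J S) (\<lambda>\<omega>. (J (-S) \<omega>, X UNIV \<omega>))"
    by (rule cond_entropy_of_cong[OF finP]) auto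
  have "cond_entropy_of G (?J UNIV) (\<lambda>g. x A (fst g)) = cond_entropy_of P (J UNIV) (X A)" for A
    unfolding ceP JOm ..
  then have "e T * (1 - Pe) - 1 \<le> cond_entropy_of P (J UNIV) (X (-T)) - cond_entropy_of P (J UNIV) (X UNIV)"
    using fano main by (simp add: algebra_simps)
  then show "(\<Sum>t\<in>T. log 2 (num_idx n (R t))) * (1 - Pe) - 1
      \<le> (\<Sum>s\<in>S. log 2 (num_idx n (C s)))
        + (cond_entropy_of P (J (-S)) (X (-T)) - cond_entropy_of P (J (-S)) (X UNIV)
        - cond_entropy_of P (J S) (\<lambda>\<omega>. (J (-S) \<omega>, X UNIV \<omega>)))"
    using P1[of "-T"] P1[of UNIV] card swap by (simp add: e_def)
qed

section \<open>Posterior tables\<close>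

text \<open>Entropy for unnormalised weights. Its conditional version below is homogeneous of degree
  one for non-negative weights, which spares all normalisations.\<close>

definition weight_entropy :: "'a set \<Rightarrow> ('a \<Rightarrow> real) \<Rightarrow> ('a \<Rightarrow> 'b) \<Rightarrow> real" where
  "weight_entropy D b \<psi> = (\<Sum>c\<in>\<psi> ` D. eta (\<Sum>p\<in>{p\<in>D. \<psi> p = c}. b p))"

definition cond_weight_entropy :: "'a set \<Rightarrow> ('a \<Rightarrow> real) \<Rightarrow> ('a \<Rightarrow> 'b) \<Rightarrow> ('a \<Rightarrow> 'c) \<Rightarrow> real" where
  "cond_weight_entropy D b \<theta> \<phi> = weight_entropy D b (\<lambda>p. (\<theta> p, \<phi> p)) - weight_entropy D b \<phi>"

definition lik :: "('k \<Rightarrow> 'y \<Rightarrow> 'u) pmf \<Rightarrow> 'k set \<Rightarrow> ('k \<Rightarrow> 'u) \<Rightarrow> ('k \<Rightarrow> 'y) \<Rightarrow> real" where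
  "lik \<mu> A u y = measure_pmf.prob \<mu> {w. \<forall>k\<in>A. w k (y k) = u k}"

text \<open>
  The posterior of \<open>y\<close> given the messages \<open>u\<close> of the relays in \<open>A\<close>, for the uniform prior on
  \<open>Ys\<close>.  It does not involve the channel inputs.
\<close>

definition posterior :: "('k \<Rightarrow> 'y) set \<Rightarrow> ('k \<Rightarrow> 'y \<Rightarrow> 'u) pmf \<Rightarrow> 'k set \<Rightarrow> ('k \<Rightarrow> 'u) \<Rightarrow> ('k \<Rightarrow> 'y) \<Rightarrow> real" where
  "posterior Ys \<mu> A u y = lik \<mu> A u y / (\<Sum>y'\<in>Ys. lik \<mu> A u y')"

text \<open>All that the single-letter bound needs to know about the drawn table \<open>w\<close>:
  the posteriors of every set \<open>A\<close> of relays at every output vector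
  \<open>y\<close>.\<close>

definition post_table :: "('k \<Rightarrow> 'y) set \<Rightarrow> ('k \<Rightarrow> 'y \<Rightarrow> 'u) pmf \<Rightarrow> ('k \<Rightarrow> 'y \<Rightarrow> 'u) \<Rightarrow> 'k set
    \<Rightarrow> ('k \<Rightarrow> 'y) \<Rightarrow> ('k \<Rightarrow> 'y) \<Rightarrow> real" where
  "post_table Ys \<mu> w A y = posterior Ys \<mu> A (\<lambda>k. w k (y k))"

lemma lik_cong: "(\<And>k. k \<in> A \<Longrightarrow> u k = u' k) \<Longrightarrow> lik \<mu> A u y = lik \<mu> A u' y"
  by (simp add: lik_def cong: ball_cong)

lemma posterior_cong: "(\<And>k. k \<in> A \<Longrightarrow> u k = u' k) \<Longrightarrow> posterior Ys \<mu> A u y = posterior Ys \<mu> A u' y"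
  using lik_cong[of A u u' \<mu>] by (simp add: posterior_def)

lemma lik_eq_pr: "lik \<mu> A (restrict u A) y = pr \<mu> (\<lambda>w. restrict (\<lambda>k. w k (y k)) A) (restrict u A)"
  by (simp add: lik_def pr_def restrict_eq_iff)

lemma lik_nonneg: "0 \<le> lik \<mu> A u y"
  by (simp add: lik_def)

lemma posterior_nonneg: "0 \<le> posterior Ys \<mu> A u y"
  unfolding posterior_def by (intro divide_nonneg_nonneg sum_nonneg lik_nonneg)

lemma posterior_le_1:
  assumes "finite Ys" "y \<in> Ys"
  shows "posterior Ys \<mu> A u y \<le> 1"
proof -
  have "lik \<mu> A u y \<le> (\<Sum>y'\<in>Ys. lik \<mu> A u y')"
    by (rule member_le_sum) (use assms lik_nonneg in auto)
  then show ?thesis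
    unfolding posterior_def by (intro divide_le_eq_1[THEN iffD2]) (use lik_nonneg[of \<mu> A u y] in linarith)
qed

text \<open>Bayes's rule in product form, which survives a vanishing denominator of
  \<open>posterior\<close>: then every likelihood is zero.\<close>

lemma lik_eq_posterior:
  assumes "finite Ys" "y \<in> Ys"
  shows "lik \<mu> A u y = posterior Ys \<mu> A u y * (\<Sum>y'\<in>Ys. lik \<mu> A u y')"
proof (cases "(\<Sum>y'\<in>Ys. lik \<mu> A u y') = 0")
  case True
  then have "lik \<mu> A u y = 0"
    using assms lik_nonneg by (subst (asm) sum_nonneg_eq_0_iff) auto
  then show ?thesis using True by simp
qed (simp add: posterior_def)

definition obs_range :: "('k \<Rightarrow> 'y) set \<Rightarrow> ('k \<Rightarrow> 'y \<Rightarrow> 'u) pmf \<Rightarrow> 'k set \<Rightarrow> ('k \<Rightarrow> 'u) set" where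
  "obs_range Ys \<mu> A = (\<lambda>(y, w). restrict (\<lambda>k. w k (y k)) A) ` (Ys \<times> set_pmf \<mu>)"

lemma expectation_obs:
  assumes "finite Ys" "finite (set_pmf \<mu>)" "y \<in> Ys"
  shows "measure_pmf.expectation \<mu> (\<lambda>w. F (restrict (\<lambda>k. w k (y k)) A))
    = (\<Sum>u\<in>obs_range Ys \<mu> A. lik \<mu> A u y * F u)"
proof -
  let ?f = "\<lambda>w. restrict (\<lambda>k. w k (y k)) A"
  have fin: "finite (obs_range Ys \<mu> A)" unfolding obs_range_def using assms by auto
  have "measure_pmf.expectation \<mu> (\<lambda>w. F (?f w)) = (\<Sum>w\<in>set_pmf \<mu>. pmf \<mu> w * F (?f w))"
    by (subst integral_measure_pmf_real[OF assms(2)]) (auto simp: mult.commute)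
  also have "\<dots> = (\<Sum>u\<in>?f ` set_pmf \<mu>. pr \<mu> ?f u * F u)"
    by (rule sum_set_pmf_fibres[OF assms(2)])
  also have "\<dots> = (\<Sum>u\<in>obs_range Ys \<mu> A. pr \<mu> ?f u * F u)"
  proof (rule sum.mono_neutral_left[OF fin])
    show "?f ` set_pmf \<mu> \<subseteq> obs_range Ys \<mu> A" unfolding obs_range_def using assms(3) by force
    show "\<forall>u\<in>obs_range Ys \<mu> A - ?f ` set_pmf \<mu>. pr \<mu> ?f u * F u = 0"
      by (simp add: pr_eq_pmf_map pmf_eq_0_set_pmf)
  qed
  also have "\<dots> = (\<Sum>u\<in>obs_range Ys \<mu> A. lik \<mu> A u y * F u)"
  proof (rule sum.cong[OF refl])
    fix u assume "u \<in> obs_range Ys \<mu> A"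
    then obtain v where "u = restrict v A" by (auto simp: obs_range_def)
    then show "pr \<mu> ?f u * F u = lik \<mu> A u y * F u" by (simp add: lik_eq_pr)
  qed
  finally show ?thesis .
qed

lemma eta_mult: "0 \<le> a \<Longrightarrow> 0 \<le> b \<Longrightarrow> eta (a * b) = a * eta b + b * eta a"
  by (cases "a = 0 \<or> b = 0") (auto simp: eta_def log_mult algebra_simps)

lemma sum_fibres:
  assumes "finite D"
  shows "(\<Sum>c\<in>\<psi> ` D. \<Sum>p\<in>{p\<in>D. \<psi> p = c}. b p) = (\<Sum>p\<in>D. b p)"
  by (rule sum.image_gen[OF assms, symmetric])

lemma prob_bind_pmf:
  "measure_pmf.prob (A \<bind> K) E = measure_pmf.expectation A (\<lambda>a. measure_pmf.prob (K a) E)"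
proof -
  have i: "integrable (measure_pmf A) (\<lambda>a. measure_pmf.prob (K a) E)"
    by (rule measure_pmf.integrable_const_bound[of _ 1]) auto
  have "ennreal (measure_pmf.prob (A \<bind> K) E) = (\<integral>\<^sup>+a. emeasure (measure_pmf (K a)) E \<partial>measure_pmf A)"
    by (simp add: measure_pmf.emeasure_eq_measure[symmetric] emeasure_bind_pmf)
  also have "\<dots> = (\<integral>\<^sup>+a. ennreal (measure_pmf.prob (K a) E) \<partial>measure_pmf A)"
    by (simp add: measure_pmf.emeasure_eq_measure)
  also have "\<dots> = ennreal (measure_pmf.expectation A (\<lambda>a. measure_pmf.prob (K a) E))"
    by (rule nn_integral_eq_integral[OF i]) simp
  finally show ?thesis by (subst (asm) ennreal_inj) (auto intro: integral_nonneg_AE)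
qed

text \<open>The joint weight of a letter \<open>p\<close> and messages \<open>u\<close> is the total
  likelihood \<open>\<Lambda> u\<close> times \<open>pmf B p\<close> times the posterior of the
  output of \<open>p\<close>. By homogeneity \<open>\<Lambda> u\<close> leaves the conditional
  entropy; being a sum of likelihoods over \<open>Ys\<close>, it turns the sum over messages into a
  sum of means over the table.\<close>

lemma cond_entropy_of_eq_table:
  fixes \<mu> :: "('k \<Rightarrow> 'y \<Rightarrow> 'u) pmf" and B :: "('a \<times> ('k \<Rightarrow> 'y)) pmf"
  assumes fin: "finite Ys" "finite (set_pmf \<mu>)" "finite D" and BD: "set_pmf B \<subseteq> D" and DY: "snd ` D \<subseteq> Ys"
  shows "cond_entropy_of (pair_pmf B \<mu>) (\<lambda>\<omega>. \<theta> (fst \<omega>)) (\<lambda>\<omega>. (\<phi> (fst \<omega>), relay_obs A \<omega>))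
    = (\<Sum>y\<in>Ys. measure_pmf.expectation \<mu> (\<lambda>w.
        cond_weight_entropy D (\<lambda>p. pmf B p * post_table Ys \<mu> w A y (snd p)) \<theta> \<phi>))"
proof -
  let ?P = "pair_pmf B \<mu>"
  let ?U = "obs_range Ys \<mu> A"
  have finB: "finite (set_pmf B)" using BD fin(3) by (rule finite_subset)
  have finP: "finite (set_pmf ?P)" using finB fin(2) by simp
  have finU: "finite ?U" unfolding obs_range_def using fin by auto
  define \<Lambda> where "\<Lambda> u = (\<Sum>y\<in>Ys. lik \<mu> A u y)" for u
  define b where "b u p = pmf B p * posterior Ys \<mu> A u (snd p)" for u and p :: "'a \<times> ('k \<Rightarrow> 'y)"
  have \<Lambda>0: "0 \<le> \<Lambda> u" for u unfolding \<Lambda>_def by (intro sum_nonneg lik_nonneg)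
  have b0: "0 \<le> b u p" for u p unfolding b_def by (intro mult_nonneg_nonneg posterior_nonneg) simp
  have joint: "pr ?P (\<lambda>\<omega>. (\<psi> (fst \<omega>), relay_obs A \<omega>)) (c, u) = \<Lambda> u * (\<Sum>p\<in>{p\<in>D. \<psi> p = c}. b u p)"
    if u: "u \<in> ?U" for \<psi> :: "_ \<Rightarrow> 'd" and c u
  proof -
    obtain v where v: "u = restrict v A" using u by (auto simp: obs_range_def)
    have "pr ?P (\<lambda>\<omega>. (\<psi> (fst \<omega>), relay_obs A \<omega>)) (c, u)
        = measure_pmf.prob ?P {\<omega>. \<psi> (fst \<omega>) = c \<and> relay_obs A \<omega> = u}"
      by (simp add: pr_def)
    also have "\<dots> = measure_pmf.prob (B \<bind> (\<lambda>p. map_pmf (Pair p) \<mu>)) {\<omega>. \<psi> (fst \<omega>) = c \<and> relay_obs A \<omega> = u}"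
      by (simp add: pair_pmf_def map_pmf_def)
    also have "measure_pmf.prob (B \<bind> (\<lambda>p. map_pmf (Pair p) \<mu>)) {\<omega>. \<psi> (fst \<omega>) = c \<and> relay_obs A \<omega> = u}
        = measure_pmf.expectation B (\<lambda>p. measure_pmf.prob (map_pmf (Pair p) \<mu>) {\<omega>. \<psi> (fst \<omega>) = c \<and> relay_obs A \<omega> = u})"
      by (rule prob_bind_pmf)
    also have "\<dots> = measure_pmf.expectation B (\<lambda>p. if \<psi> p = c then lik \<mu> A u (snd p) else 0)"
      by (intro Bochner_Integration.integral_cong refl) (auto simp: vimage_def relay_obs_def lik_def v restrict_eq_iff)
    also have "\<dots> = (\<Sum>p\<in>D. (if \<psi> p = c then lik \<mu> A u (snd p) else 0) * pmf B p)"
      by (rule integral_measure_pmf_real[OF fin(3)]) (use BD in auto)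
    also have "\<dots> = (\<Sum>p\<in>{p\<in>D. \<psi> p = c}. lik \<mu> A u (snd p) * pmf B p)"
      by (intro sum.mono_neutral_cong_right) (use fin in auto)
    also have "\<dots> = (\<Sum>p\<in>{p\<in>D. \<psi> p = c}. \<Lambda> u * b u p)"
    proof (rule sum.cong[OF refl])
      fix p assume "p \<in> {p\<in>D. \<psi> p = c}"
      then have "snd p \<in> Ys" using DY by auto
      from lik_eq_posterior[OF fin(1) this, of \<mu> A u]
      show "lik \<mu> A u (snd p) * pmf B p = \<Lambda> u * b u p" by (simp add: b_def \<Lambda>_def)
    qed
    finally show ?thesis by (simp add: sum_distrib_left)
  qed
  have ent: "entropy_of ?P (\<lambda>\<omega>. (\<psi> (fst \<omega>), relay_obs A \<omega>))
      = (\<Sum>u\<in>?U. \<Lambda> u * weight_entropy D (b u) \<psi> + eta (\<Lambda> u) * (\<Sum>p\<in>D. b u p))" for \<psi> :: "_ \<Rightarrow> 'd"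
  proof -
    have "entropy_of ?P (\<lambda>\<omega>. (\<psi> (fst \<omega>), relay_obs A \<omega>))
        = (\<Sum>t\<in>\<psi> ` D \<times> ?U. eta (pr ?P (\<lambda>\<omega>. (\<psi> (fst \<omega>), relay_obs A \<omega>)) t))"
    proof (rule entropy_of_eq_sum[OF finP])
      show "(\<lambda>\<omega>. (\<psi> (fst \<omega>), relay_obs A \<omega>)) ` set_pmf ?P \<subseteq> \<psi> ` D \<times> ?U"
        using BD DY by (force simp: relay_obs_def obs_range_def)
      show "finite (\<psi> ` D \<times> ?U)" using fin finU by auto
    qed
    also have "\<dots> = (\<Sum>c\<in>\<psi> ` D. \<Sum>u\<in>?U. eta (pr ?P (\<lambda>\<omega>. (\<psi> (fst \<omega>), relay_obs A \<omega>)) (c, u)))"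
      by (simp add: sum.cartesian_product)
    also have "\<dots> = (\<Sum>u\<in>?U. \<Sum>c\<in>\<psi> ` D. eta (pr ?P (\<lambda>\<omega>. (\<psi> (fst \<omega>), relay_obs A \<omega>)) (c, u)))"
      by (rule sum.swap)
    also have "\<dots> = (\<Sum>u\<in>?U. \<Sum>c\<in>\<psi> ` D. \<Lambda> u * eta (\<Sum>p\<in>{p\<in>D. \<psi> p = c}. b u p)
        + (\<Sum>p\<in>{p\<in>D. \<psi> p = c}. b u p) * eta (\<Lambda> u))"
      by (intro sum.cong refl) (simp add: joint eta_mult \<Lambda>0 b0 sum_nonneg)
    also have "\<dots> = (\<Sum>u\<in>?U. \<Lambda> u * weight_entropy D (b u) \<psi> + eta (\<Lambda> u) * (\<Sum>p\<in>D. b u p))"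
      unfolding weight_entropy_def sum_fibres[OF fin(3), where \<psi> = \<psi>, symmetric]
      by (simp add: sum.distrib sum_distrib_left sum_distrib_right mult.commute)
    finally show ?thesis .
  qed
  have "cond_entropy_of ?P (\<lambda>\<omega>. \<theta> (fst \<omega>)) (\<lambda>\<omega>. (\<phi> (fst \<omega>), relay_obs A \<omega>))
      = entropy_of ?P (\<lambda>\<omega>. ((\<theta> (fst \<omega>), \<phi> (fst \<omega>)), relay_obs A \<omega>))
        - entropy_of ?P (\<lambda>\<omega>. (\<phi> (fst \<omega>), relay_obs A \<omega>))"
    unfolding cond_entropy_of_def
    by (intro arg_cong2[where f = "(-)"] refl entropy_of_cong[OF finP]) auto
  \<comment> \<open>The terms with \<open>eta (\<Lambda> u)\<close> cancel, because both entropies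
    carry the same total weight.\<close>
  also have "\<dots> = (\<Sum>u\<in>?U. \<Lambda> u * cond_weight_entropy D (b u) \<theta> \<phi>)"
    unfolding ent[of "\<lambda>p. (\<theta> p, \<phi> p)"] ent cond_weight_entropy_def
    by (simp add: sum_subtractf[symmetric] algebra_simps)
  also have "\<dots> = (\<Sum>u\<in>?U. \<Sum>y\<in>Ys. lik \<mu> A u y * cond_weight_entropy D (b u) \<theta> \<phi>)"
    by (simp add: \<Lambda>_def sum_distrib_right)
  also have "\<dots> = (\<Sum>y\<in>Ys. \<Sum>u\<in>?U. lik \<mu> A u y * cond_weight_entropy D (b u) \<theta> \<phi>)"
    by (rule sum.swap)
  also have "\<dots> = (\<Sum>y\<in>Ys. measure_pmf.expectation \<mu> (\<lambda>w.
      cond_weight_entropy D (b (restrict (\<lambda>k. w k (y k)) A)) \<theta> \<phi>))"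
    by (intro sum.cong refl)
       (rule expectation_obs[OF fin(1,2), of _ "\<lambda>u. cond_weight_entropy D (b u) \<theta> \<phi>" A, symmetric])
  also have "\<dots> = (\<Sum>y\<in>Ys. measure_pmf.expectation \<mu> (\<lambda>w.
        cond_weight_entropy D (\<lambda>p. pmf B p * post_table Ys \<mu> w A y (snd p)) \<theta> \<phi>))"
  proof -
    have "b (restrict (\<lambda>k. w k (y k)) A) = (\<lambda>p. pmf B p * post_table Ys \<mu> w A y (snd p))" for w y
      unfolding b_def post_table_def by (intro ext arg_cong2[where f = "(*)"] refl posterior_cong) simp
    then show ?thesis by simp
  qed
  finally show ?thesis .
qed

text \<open>\<open>z A y y'\<close> stands for the posterior of \<open>y'\<close> after the relays
  in \<open>A\<close> have sent their messages for \<open>y\<close>. The sum over \<open>y\<close>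
  reflects the uniform reference measure on the outputs.\<close>

definition table_entropy :: "('a \<times> ('k \<Rightarrow> 'y)) set \<Rightarrow> ('a \<times> ('k \<Rightarrow> 'y) \<Rightarrow> real) \<Rightarrow> ('k \<Rightarrow> 'y) set
    \<Rightarrow> ('k set \<Rightarrow> ('k \<Rightarrow> 'y) \<Rightarrow> ('k \<Rightarrow> 'y) \<Rightarrow> real) \<Rightarrow> 'k set
    \<Rightarrow> ('a \<times> ('k \<Rightarrow> 'y) \<Rightarrow> 'b) \<Rightarrow> ('a \<times> ('k \<Rightarrow> 'y) \<Rightarrow> 'c) \<Rightarrow> real" where
  "table_entropy D b Ys z A \<theta> \<phi>
    = (\<Sum>y\<in>Ys. cond_weight_entropy D (\<lambda>p. b p * z A y (snd p)) \<theta> \<phi>)"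

definition table_gain :: "(('l \<Rightarrow> 'x) \<times> ('k \<Rightarrow> 'y)) set \<Rightarrow> (('l \<Rightarrow> 'x) \<times> ('k \<Rightarrow> 'y) \<Rightarrow> real) \<Rightarrow> ('k \<Rightarrow> 'y) set
    \<Rightarrow> ('k set \<Rightarrow> ('k \<Rightarrow> 'y) \<Rightarrow> ('k \<Rightarrow> 'y) \<Rightarrow> real) \<Rightarrow> 'l set \<Rightarrow> 'k set \<Rightarrow> real" where
  "table_gain D b Ys z T S =
    (let X = \<lambda>T p. restrict (fst p) T; Y = \<lambda>p. restrict (snd p) S in
    table_entropy D b Ys z UNIV Y (X UNIV) - table_entropy D b Ys z (-S) Y (X UNIV)
    + (table_entropy D b Ys z {} (X T) (X (-T)) - table_entropy D b Ys z (-S) (X T) (X (-T))))"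

text \<open>The form in which the gain is carried to the limit: a fixed function of the letter law
  and the posteriors, averaged over the table.\<close>

lemma letter_gain_eq_table:
  fixes B :: "(('l \<Rightarrow> 'x) \<times> ('k \<Rightarrow> 'y)) pmf"
  assumes fin: "finite Ys" "finite (set_pmf \<mu>)" "finite D" and BD: "set_pmf B \<subseteq> D" and DY: "snd ` D \<subseteq> Ys"
  shows "letter_gain B \<mu> T S
    = measure_pmf.expectation \<mu> (\<lambda>w. table_gain D (pmf B) Ys (post_table Ys \<mu> w) T S)"
proof -
  have i[simp]: "integrable (measure_pmf \<mu>) (f :: _ \<Rightarrow> real)" for f
    using fin(2) by (rule integrable_measure_pmf_finite)
  show ?thesis
    unfolding letter_gain_def table_gain_def table_entropy_def Let_def
      cond_entropy_of_eq_table[OF assms, of "\<lambda>p. restrict (snd p) S" "\<lambda>p. restrict (fst p) UNIV"]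
      cond_entropy_of_eq_table[OF assms, of "\<lambda>p. restrict (fst p) T" "\<lambda>p. restrict (fst p) (-T)"]
    by simp
qed

text \<open>Bayes's rule as a change of measure: under \<open>y\<close>, the messages of
  \<open>A\<close> have the posterior of \<open>y\<close> as density against the sum of their laws
  under all \<open>y'\<close>. The test function may use the posteriors of all subsets of
  \<open>A\<close>, for these are functions of the messages of \<open>A\<close>.\<close>

lemma post_table_exchange:
  assumes fin: "finite Ys" "finite (set_pmf \<mu>)" and y: "y \<in> Ys"
  shows "measure_pmf.expectation \<mu> (\<lambda>w. g (\<lambda>B\<in>Pow A. post_table Ys \<mu> w B y))
    = (\<Sum>y'\<in>Ys. measure_pmf.expectation \<mu> (\<lambda>w. g (\<lambda>B\<in>Pow A. post_table Ys \<mu> w B y') * post_table Ys \<mu> w A y' y))"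
proof -
  let ?U = "obs_range Ys \<mu> A"
  define G where "G u = g (\<lambda>B\<in>Pow A. posterior Ys \<mu> B u)" for u
  have 1: "(\<lambda>B\<in>Pow A. post_table Ys \<mu> w B y) = (\<lambda>B\<in>Pow A. posterior Ys \<mu> B (restrict (\<lambda>k. w k (y k)) A))" for w y
    unfolding post_table_def by (intro restrict_ext ext posterior_cong) auto
  have 2: "post_table Ys \<mu> w A y' y = posterior Ys \<mu> A (restrict (\<lambda>k. w k (y' k)) A) y" for w y'
    unfolding post_table_def by (intro posterior_cong) auto
  have "measure_pmf.expectation \<mu> (\<lambda>w. g (\<lambda>B\<in>Pow A. post_table Ys \<mu> w B y)) = (\<Sum>u\<in>?U. lik \<mu> A u y * G u)"
    unfolding 1 using expectation_obs[OF fin y, of G A] by (simp add: G_def)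
  also have "\<dots> = (\<Sum>u\<in>?U. \<Sum>y'\<in>Ys. lik \<mu> A u y' * (G u * posterior Ys \<mu> A u y))"
    by (subst lik_eq_posterior[OF fin(1) y]) (simp add: sum_distrib_right sum_distrib_left mult_ac)
  also have "\<dots> = (\<Sum>y'\<in>Ys. \<Sum>u\<in>?U. lik \<mu> A u y' * (G u * posterior Ys \<mu> A u y))"
    by (rule sum.swap)
  also have "\<dots> = (\<Sum>y'\<in>Ys. measure_pmf.expectation \<mu> (\<lambda>w. g (\<lambda>B\<in>Pow A. post_table Ys \<mu> w B y') * post_table Ys \<mu> w A y' y))"
    unfolding 1 2 using expectation_obs[OF fin, of _ "\<lambda>u. G u * posterior Ys \<mu> A u y" A]
    by (intro sum.cong refl) (simp add: G_def)
  finally show ?thesis .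
qed

lemma post_table_local: "(\<And>k. k \<in> A \<Longrightarrow> y k = y' k) \<Longrightarrow> post_table Ys \<mu> w A y = post_table Ys \<mu> w A y'"
  unfolding post_table_def by (intro ext posterior_cong) simp

section \<open>Private simultaneous messages\<close>

text \<open>Labels are sent as indicators, one for each possible label, so that a polynomial can
  test them. Table entries and pads are indexed by a set of relays, a label vector and an output
  vector.\<close>

datatype ('k, 'y) coord =
    Label 'y
  | Masked "'k set" "'k \<Rightarrow> 'y" "'k \<Rightarrow> 'y"
  | Pad "'k set" "'k \<Rightarrow> 'y" "'k \<Rightarrow> 'y"

definition pad_index :: "('k \<Rightarrow> 'y) set \<Rightarrow> ('k \<times> 'k set \<times> ('k \<Rightarrow> 'y) \<times> ('k \<Rightarrow> 'y)) set" where
  "pad_index Ys = UNIV \<times> UNIV \<times> Ys \<times> Ys"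

definition pads :: "('k::finite \<Rightarrow> 'y) set \<Rightarrow> int \<Rightarrow> ('k \<times> 'k set \<times> ('k \<Rightarrow> 'y) \<times> ('k \<Rightarrow> 'y) \<Rightarrow> int) pmf" where
  "pads Ys M = pmf_of_set (PiE_dflt (pad_index Ys) 0 (\<lambda>_. {0..<M}))"

text \<open>
  The message of relay \<open>k\<close> with label \<open>a\<close>.  For every set \<open>B\<close> of relays containing \<open>k\<close> it shows
  the whole table \<open>tab B\<close>, every entry masked modulo \<open>M\<close> by the sum of the pads of all relays in
  \<open>B\<close>, and its own pads of the entries whose label vector agrees with \<open>a\<close> at \<open>k\<close>.  Hence the
  relays in \<open>A\<close> together unmask precisely the entries at their own labels of the \<open>tab B\<close> with
  \<open>B \<subseteq> A\<close>.
\<close>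

definition message :: "('k \<Rightarrow> 'y) set \<Rightarrow> int \<Rightarrow> 'k \<Rightarrow> 'y \<Rightarrow> ('k set \<Rightarrow> ('k \<Rightarrow> 'y) \<Rightarrow> ('k \<Rightarrow> 'y) \<Rightarrow> int)
    \<Rightarrow> ('k \<times> 'k set \<times> ('k \<Rightarrow> 'y) \<times> ('k \<Rightarrow> 'y) \<Rightarrow> int) \<Rightarrow> ('k, 'y) coord \<Rightarrow> real" where
  "message Ys M k a tab \<rho> cd = (case cd of
      Label b \<Rightarrow> if b = a then 1 else 0
    | Masked B v y \<Rightarrow> if k \<in> B \<and> v \<in> Ys \<and> y \<in> Ys then ((tab B v y + (\<Sum>j\<in>B. \<rho> (j, B, v, y))) mod M) / M else 0
    | Pad B v y \<Rightarrow> if k \<in> B \<and> v \<in> Ys \<and> y \<in> Ys \<and> v k = a then \<rho> (k, B, v, y) / M else 0)"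

lemma finite_pad_set:
  fixes Ys :: "('k::finite \<Rightarrow> 'y) set"
  assumes "finite Ys" "0 < M"
  shows "finite (PiE_dflt (pad_index Ys) 0 (\<lambda>_. {0..<M::int}))" "PiE_dflt (pad_index Ys) 0 (\<lambda>_. {0..<M}) \<noteq> {}"
proof -
  have "finite (pad_index Ys)" unfolding pad_index_def using assms(1) by simp
  then show "finite (PiE_dflt (pad_index Ys) 0 (\<lambda>_. {0..<M}))" by (rule finite_PiE_dflt) simp
  show "PiE_dflt (pad_index Ys) 0 (\<lambda>_. {0..<M}) \<noteq> {}" using assms(2) by simp
qed

lemma set_pads:
  fixes Ys :: "('k::finite \<Rightarrow> 'y) set"
  assumes "finite Ys" "0 < M"
  shows "set_pmf (pads Ys M) = PiE_dflt (pad_index Ys) 0 (\<lambda>_. {0..<M})"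
  unfolding pads_def using finite_pad_set[OF assms] by simp

text \<open>Shifting a pad that stays hidden absorbs any change of the masked value.\<close>

lemma message_pads_hiding:
  fixes Ys :: "('k::finite \<Rightarrow> 'y) set"
  assumes fin: "finite Ys" and M: "0 < M"
    and agree: "\<And>B v y. B \<subseteq> A \<Longrightarrow> (\<forall>k\<in>B. v k = a k) \<Longrightarrow> v \<in> Ys \<Longrightarrow> y \<in> Ys \<Longrightarrow> tab B v y = tab' B v y"
  shows "map_pmf (\<lambda>\<rho>. \<lambda>k\<in>A. message Ys M k (a k) tab \<rho>) (pads Ys M)
    = map_pmf (\<lambda>\<rho>. \<lambda>k\<in>A. message Ys M k (a k) tab' \<rho>) (pads Ys M)"
proof -
  \<comment> \<open>The relays of \<open>B\<close> whose pad for the entries at \<open>v\<close>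
    stays out of sight of \<open>A\<close>. If there is none, then \<open>B \<subseteq> A\<close>
    and \<open>v\<close> agrees with \<open>a\<close> on \<open>B\<close>, so \<open>agree\<close>
    applies.\<close>
  define hid where "hid B v k \<longleftrightarrow> k \<in> B \<and> \<not> (k \<in> A \<and> v k = a k)" for B v k
  \<comment> \<open>Just one hidden pad is shifted, picked by \<open>Eps\<close>, so the sum of the
    pads changes by \<open>t - t'\<close> modulo \<open>M\<close>. Exchanging \<open>t\<close> and
    \<open>t'\<close> undoes the shift on reduced pads.\<close>
  define sh where "sh t t' \<rho> = (\<lambda>(k, B, v, y). if v \<in> Ys \<and> y \<in> Ys \<and> Ex (hid B v) \<and> k = Eps (hid B v)
      then (\<rho> (k, B, v, y) + t B v y - t' B v y) mod M else \<rho> (k, B, v, y))"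
    for t t' :: "'k set \<Rightarrow> ('k \<Rightarrow> 'y) \<Rightarrow> ('k \<Rightarrow> 'y) \<Rightarrow> int" and \<rho> :: "'k \<times> 'k set \<times> ('k \<Rightarrow> 'y) \<times> ('k \<Rightarrow> 'y) \<Rightarrow> int"
  let ?S = "PiE_dflt (pad_index Ys) 0 (\<lambda>_. {0..<M})"
  have sh_in: "sh t t' \<rho> \<in> ?S" if "\<rho> \<in> ?S" for t t' \<rho>
    using that M by (auto simp: PiE_dflt_def sh_def pad_index_def)
  have sh_inv: "sh t' t (sh t t' \<rho>) = \<rho>" if "\<rho> \<in> ?S" for t t' \<rho>
  proof
    fix i :: "'k \<times> 'k set \<times> ('k \<Rightarrow> 'y) \<times> ('k \<Rightarrow> 'y)"
    obtain k B v y where i: "i = (k, B, v, y)" by (cases i) auto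
    show "sh t' t (sh t t' \<rho>) i = \<rho> i"
    proof (cases "v \<in> Ys \<and> y \<in> Ys \<and> Ex (hid B v) \<and> k = Eps (hid B v)")
      case True
      have "0 \<le> \<rho> i" "\<rho> i < M" using that True by (auto simp: i PiE_dflt_def pad_index_def)
      have "sh t' t (sh t t' \<rho>) i = ((\<rho> i + t B v y - t' B v y) mod M + t' B v y - t B v y) mod M"
        using True by (simp add: i sh_def)
      also have "\<dots> = ((\<rho> i + t B v y - t' B v y) mod M + (t' B v y - t B v y)) mod M"
        by (simp add: algebra_simps)
      also have "\<dots> = \<rho> i mod M" by (simp add: mod_add_left_eq)
      also have "\<dots> = \<rho> i" using \<open>0 \<le> \<rho> i\<close> \<open>\<rho> i < M\<close> by simp
      finally show ?thesis .
    qed (auto simp: i sh_def)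
  qed
  have bij: "bij_betw (sh tab tab') ?S ?S"
    by (rule bij_betwI[where g = "sh tab' tab"]) (use sh_in sh_inv in auto)
  have view: "message Ys M k (a k) tab \<rho> = message Ys M k (a k) tab' (sh tab tab' \<rho>)" if k: "k \<in> A" for k \<rho>
  proof
    fix cd :: "('k, 'y) coord"
    show "message Ys M k (a k) tab \<rho> cd = message Ys M k (a k) tab' (sh tab tab' \<rho>) cd"
    proof (cases cd)
      case (Label b)
      then show ?thesis by (simp add: message_def)
    next
      case (Masked B v y)
      have "(tab B v y + (\<Sum>j\<in>B. \<rho> (j, B, v, y))) mod M
          = (tab' B v y + (\<Sum>j\<in>B. sh tab tab' \<rho> (j, B, v, y))) mod M" if vy: "v \<in> Ys" "y \<in> Ys"
      proof (cases "Ex (hid B v)")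
        case True
        define h where "h = Eps (hid B v)"
        have "hid B v h" unfolding h_def using True by (rule someI_ex)
        then have hB: "h \<in> B" by (simp add: hid_def)
        have e: "(\<Sum>j\<in>B. r j) = r h + (\<Sum>j\<in>B - {h}. r j)" for r :: "'k \<Rightarrow> int"
          by (rule sum.remove) (use hB in auto)
        have r: "(\<Sum>j\<in>B - {h}. sh tab tab' \<rho> (j, B, v, y)) = (\<Sum>j\<in>B - {h}. \<rho> (j, B, v, y))"
          by (rule sum.cong) (auto simp: sh_def h_def)
        have s: "sh tab tab' \<rho> (h, B, v, y) = (\<rho> (h, B, v, y) + tab B v y - tab' B v y) mod M"
          using True vy by (simp add: sh_def h_def)
        have "(tab' B v y + (\<Sum>j\<in>B. sh tab tab' \<rho> (j, B, v, y))) mod M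
            = ((\<rho> (h, B, v, y) + tab B v y - tab' B v y) mod M + (tab' B v y + (\<Sum>j\<in>B - {h}. \<rho> (j, B, v, y)))) mod M"
          unfolding e[of "\<lambda>j. sh tab tab' \<rho> (j, B, v, y)"] r s by (simp add: algebra_simps)
        also have "\<dots> = ((\<rho> (h, B, v, y) + tab B v y - tab' B v y) + (tab' B v y + (\<Sum>j\<in>B - {h}. \<rho> (j, B, v, y)))) mod M"
          by (rule mod_add_left_eq)
        also have "\<dots> = (tab B v y + (\<Sum>j\<in>B. \<rho> (j, B, v, y))) mod M"
          unfolding e[of "\<lambda>j. \<rho> (j, B, v, y)"] by (simp add: algebra_simps)
        finally show ?thesis by simp
      next
        case False
        then have "B \<subseteq> A" "\<forall>k\<in>B. v k = a k" by (auto simp: hid_def)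
        then have "tab B v y = tab' B v y" using agree vy by blast
        moreover have "sh tab tab' \<rho> (j, B, v, y) = \<rho> (j, B, v, y)" for j using False by (auto simp: sh_def)
        ultimately show ?thesis by simp
      qed
      then show ?thesis by (simp add: message_def Masked)
    next
      case (Pad B v y)
      have "sh tab tab' \<rho> (k, B, v, y) = \<rho> (k, B, v, y)" if "k \<in> B" "v k = a k"
      proof (cases "Ex (hid B v)")
        case True
        then have "hid B v (Eps (hid B v))" by (rule someI_ex)
        then have "k \<noteq> Eps (hid B v)" using that k by (auto simp: hid_def)
        then show ?thesis by (auto simp: sh_def)
      qed (auto simp: sh_def)
      then show ?thesis by (simp add: message_def Pad)
    qed
  qed
  have "pads Ys M = map_pmf (sh tab tab') (pads Ys M)"
    unfolding pads_def using map_pmf_of_set_bij_betw[OF bij] finite_pad_set[OF fin M] by simp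
  then have "map_pmf (\<lambda>\<rho>. \<lambda>k\<in>A. message Ys M k (a k) tab' \<rho>) (pads Ys M)
      = map_pmf (\<lambda>\<rho>. \<lambda>k\<in>A. message Ys M k (a k) tab' \<rho>) (map_pmf (sh tab tab') (pads Ys M))"
    by simp
  also have "\<dots> = map_pmf (\<lambda>\<rho>. \<lambda>k\<in>A. message Ys M k (a k) tab \<rho>) (pads Ys M)"
    unfolding map_pmf_comp by (intro map_pmf_cong refl restrict_ext) (simp add: view)
  finally show ?thesis by simp
qed

section \<open>Random relabelling of the outputs\<close>

text \<open>The label of an output is its image under a uniformly random permutation of the
  alphabet. Unpermuted labels would disclose the outputs themselves.\<close>

definition perms :: "('k::finite \<Rightarrow> 'y set) \<Rightarrow> ('k \<Rightarrow> 'y \<Rightarrow> 'y) set" where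
  "perms YY = PiE UNIV (\<lambda>k. {p. p permutes YY k})"

lemma perms_ne: "perms YY \<noteq> {}"
proof -
  have "(\<lambda>_. id) \<in> perms YY" by (auto simp: perms_def PiE_iff permutes_id)
  then show ?thesis by blast
qed

lemma finite_perms: "(\<And>k. finite (YY k)) \<Longrightarrow> finite (perms YY)"
  unfolding perms_def by (intro finite_PiE) (auto intro: finite_permutations)

text \<open>Composition with the transpositions of \<open>y k\<close> and \<open>y' k\<close>
  preserves the uniform law and exchanges the two label vectors.\<close>

lemma perms_labels_hiding:
  assumes finY: "\<And>k. finite (YY k)" and y: "y \<in> PiE UNIV YY" "y' \<in> PiE UNIV YY"
  shows "map_pmf (\<lambda>\<pi> k. \<pi> k (y k)) (pmf_of_set (perms YY)) = map_pmf (\<lambda>\<pi> k. \<pi> k (y' k)) (pmf_of_set (perms YY))"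
proof -
  let ?s = "\<lambda>\<pi> k. \<pi> k \<circ> Transposition.transpose (y k) (y' k)"
  have t: "Transposition.transpose (y k) (y' k) permutes YY k" for k
    using y by (intro permutes_swap_id) (auto simp: PiE_iff)
  have in': "?s \<pi> \<in> perms YY" if "\<pi> \<in> perms YY" for \<pi>
    using that t by (auto simp: perms_def PiE_iff intro: permutes_compose)
  have inv: "?s (?s \<pi>) = \<pi>" for \<pi> :: "'a \<Rightarrow> 'b \<Rightarrow> 'b"
    by (auto simp: fun_eq_iff)
  have bij: "bij_betw ?s (perms YY) (perms YY)"
    by (rule bij_betwI[where g = ?s]) (use in' inv in auto)
  have "map_pmf (\<lambda>\<pi> k. \<pi> k (y k)) (pmf_of_set (perms YY))
      = map_pmf (\<lambda>\<pi> k. \<pi> k (y k)) (map_pmf ?s (pmf_of_set (perms YY)))"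
    using map_pmf_of_set_bij_betw[OF bij perms_ne finite_perms[OF finY]] by simp
  also have "\<dots> = map_pmf (\<lambda>\<pi> k. \<pi> k (y' k)) (pmf_of_set (perms YY))"
    unfolding map_pmf_comp by simp
  finally show ?thesis .
qed

lemma expectation_bind_pmf_finite:
  fixes f :: "'b \<Rightarrow> real"
  assumes "finite (set_pmf A)" "\<And>a. a \<in> set_pmf A \<Longrightarrow> finite (set_pmf (K a))"
  shows "measure_pmf.expectation (A \<bind> K) f = measure_pmf.expectation A (\<lambda>a. measure_pmf.expectation (K a) f)"
proof -
  have fin: "finite (set_pmf (A \<bind> K))" using assms by simp
  have "measure_pmf.expectation (A \<bind> K) f = (\<Sum>x\<in>set_pmf (A \<bind> K). f x * pmf (A \<bind> K) x)"
    by (rule integral_measure_pmf_real[OF fin])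
  also have "\<dots> = (\<Sum>x\<in>set_pmf (A \<bind> K). \<Sum>a\<in>set_pmf A. f x * (pmf (K a) x * pmf A a))"
  proof (rule sum.cong[OF refl])
    fix x
    have "pmf (A \<bind> K) x = (\<Sum>a\<in>set_pmf A. pmf (K a) x * pmf A a)"
      unfolding pmf_bind by (rule integral_measure_pmf_real[OF assms(1)])
    then show "f x * pmf (A \<bind> K) x = (\<Sum>a\<in>set_pmf A. f x * (pmf (K a) x * pmf A a))"
      by (simp add: sum_distrib_left)
  qed
  also have "\<dots> = (\<Sum>a\<in>set_pmf A. (\<Sum>x\<in>set_pmf (A \<bind> K). f x * pmf (K a) x) * pmf A a)"
    by (subst sum.swap, unfold sum_distrib_right, intro sum.cong refl) simp
  also have "\<dots> = (\<Sum>a\<in>set_pmf A. measure_pmf.expectation (K a) f * pmf A a)"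
  proof (rule sum.cong[OF refl])
    fix a assume a: "a \<in> set_pmf A"
    have "measure_pmf.expectation (K a) f = (\<Sum>x\<in>set_pmf (A \<bind> K). f x * pmf (K a) x)"
      by (rule integral_measure_pmf_real[OF fin]) (use a in auto)
    then show "(\<Sum>x\<in>set_pmf (A \<bind> K). f x * pmf (K a) x) * pmf A a = measure_pmf.expectation (K a) f * pmf A a"
      by simp
  qed
  also have "\<dots> = measure_pmf.expectation A (\<lambda>a. measure_pmf.expectation (K a) f)"
    by (rule integral_measure_pmf_real[OF assms(1), symmetric])
  finally show ?thesis .
qed

section \<open>The continuous decoder\<close>

text \<open>The triangle wave of period one that equals \<open>2 * t\<close> on
  \<open>[0, 1/2]\<close>: a continuous substitute for reduction modulo one, injective on half a
  period.\<close>

definition unwrap :: "real \<Rightarrow> real" where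
  "unwrap t = arccos (cos (2 * pi * t)) / pi"

text \<open>The product of label indicators selects the label vector seen by \<open>A\<close>;
  fixing a default outside \<open>A\<close> ensures that just one vector matches. The masked entry
  may be read from any relay of \<open>A\<close>, since all of them show the same one. With empty
  \<open>A\<close> the posterior is the uniform prior.\<close>

definition decode :: "('k \<Rightarrow> 'y) set \<Rightarrow> 'k set \<Rightarrow> ('k \<Rightarrow> ('k, 'y) coord \<Rightarrow> real) \<Rightarrow> ('k \<Rightarrow> 'y) \<Rightarrow> real" where
  "decode Ys A u y = (if A = {} then 1 / card Ys else
    \<Sum>v\<in>{v\<in>Ys. \<forall>k. k \<notin> A \<longrightarrow> v k = (SOME v. v \<in> Ys) k}.
      (\<Prod>k\<in>A. u k (Label (v k))) * unwrap (u (SOME k. k \<in> A) (Masked A v y) - (\<Sum>k\<in>A. u k (Pad A v y))))"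

text \<open>The modulus \<open>2 * N\<close> puts \<open>t \<le> N\<close> into the increasing half
  of the triangle wave, and the integer \<open>z\<close>, which stems from the wraparound, is
  invisible to a function of period one.\<close>

lemma unwrap_eq:
  assumes "0 \<le> t" "t \<le> N" "0 < N"
  shows "unwrap (real_of_int t / real_of_int (2 * N) - real_of_int z) = real_of_int t / real_of_int N"
proof -
  have "cos (2 * pi * (real_of_int t / real_of_int (2 * N) - real_of_int z))
      = cos (pi * t / N - real_of_int z * (2 * pi))"
    using assms by (intro arg_cong[where f = cos]) (simp add: field_simps)
  also have "\<dots> = cos (pi * t / N)"
    using cos.plus_of_int[of "pi * t / N" "- z"] by simp
  finally have "unwrap (real_of_int t / real_of_int (2 * N) - real_of_int z) = arccos (cos (pi * t / N)) / pi"
    by (simp add: unwrap_def)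
  also have "arccos (cos (pi * t / N)) = pi * t / N"
    using assms by (intro arccos_cos) (auto simp: divide_le_eq)
  finally show ?thesis by simp
qed

text \<open>Only the summand of the actual labels survives, and subtracting the pads from the masked
  entry leaves \<open>t / (2 * N)\<close> up to an integer.\<close>

lemma decode_message:
  fixes Ys :: "('k::finite \<Rightarrow> 'y) set" and a :: "'k \<Rightarrow> 'y"
  assumes YsE: "Ys = PiE UNIV YY" and finY: "\<And>k. finite (YY k)"
    and a: "a \<in> Ys" and y: "y \<in> Ys" and A: "A \<noteq> {}" and N: "0 < N"
    and tab: "\<And>v. v \<in> Ys \<Longrightarrow> (\<forall>k\<in>A. v k = a k) \<Longrightarrow> tab A v y = t" "0 \<le> t" "t \<le> N"
  shows "decode Ys A (\<lambda>k. message Ys (2 * N) k (a k) tab \<rho>) y = real_of_int t / real_of_int N"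
proof -
  define y0 where "y0 = (SOME v. v \<in> Ys)"
  have y0: "y0 \<in> Ys" unfolding y0_def by (rule someI[of "\<lambda>v. v \<in> Ys", OF y])
  \<comment> \<open>The labels seen in \<open>A\<close>, completed by the same default outside
    \<open>A\<close> that \<open>decode\<close> uses.\<close>
  define v where "v = (\<lambda>k. if k \<in> A then a k else y0 k)"
  have v: "v \<in> Ys" using a y0 unfolding YsE by (auto simp: v_def PiE_iff)
  have va: "\<forall>k\<in>A. v k = a k" by (simp add: v_def)
  let ?V = "{v\<in>Ys. \<forall>k. k \<notin> A \<longrightarrow> v k = y0 k}"
  let ?u = "\<lambda>k. message Ys (2 * N) k (a k) tab \<rho>"
  have finYs: "finite Ys" unfolding YsE by (intro finite_PiE) (auto simp: finY)
  have kA: "(SOME k. k \<in> A) \<in> A" using A by (simp add: some_in_eq)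
  have "decode Ys A ?u y = (\<Sum>v'\<in>?V. (\<Prod>k\<in>A. ?u k (Label (v' k))) * unwrap (?u (SOME k. k \<in> A) (Masked A v' y) - (\<Sum>k\<in>A. ?u k (Pad A v' y))))"
    using A by (simp add: decode_def y0_def)
  also have "\<dots> = (\<Sum>v'\<in>{v}. (\<Prod>k\<in>A. ?u k (Label (v' k))) * unwrap (?u (SOME k. k \<in> A) (Masked A v' y) - (\<Sum>k\<in>A. ?u k (Pad A v' y))))"
  proof (rule sum.mono_neutral_right)
    show "finite ?V" using finYs by simp
    show "{v} \<subseteq> ?V" using v by (simp add: v_def)
    show "\<forall>v'\<in>?V - {v}. (\<Prod>k\<in>A. ?u k (Label (v' k))) * unwrap (?u (SOME k. k \<in> A) (Masked A v' y) - (\<Sum>k\<in>A. ?u k (Pad A v' y))) = 0"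
    proof
      fix v' assume v': "v' \<in> ?V - {v}"
      then obtain k where "k \<in> A" "v' k \<noteq> a k" unfolding v_def by fastforce
      then have "(\<Prod>k\<in>A. ?u k (Label (v' k))) = 0"
        by (intro prod_zero) (auto simp: message_def)
      then show "(\<Prod>k\<in>A. ?u k (Label (v' k))) * unwrap (?u (SOME k. k \<in> A) (Masked A v' y) - (\<Sum>k\<in>A. ?u k (Pad A v' y))) = 0"
        by simp
    qed
  qed
  also have "\<dots> = unwrap (?u (SOME k. k \<in> A) (Masked A v y) - (\<Sum>k\<in>A. ?u k (Pad A v y)))"
    using va by (simp add: message_def)
  also have "?u (SOME k. k \<in> A) (Masked A v y) = real_of_int ((t + (\<Sum>j\<in>A. \<rho> (j, A, v, y))) mod (2 * N)) / real_of_int (2 * N)"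
    using kA v y tab(1)[OF v va] by (simp add: message_def)
  also have "(\<Sum>k\<in>A. ?u k (Pad A v y)) = (\<Sum>j\<in>A. real_of_int (\<rho> (j, A, v, y)) / real_of_int (2 * N))"
    using va v y by (intro sum.cong refl) (simp add: message_def)
  also have "\<dots> = real_of_int (\<Sum>j\<in>A. \<rho> (j, A, v, y)) / real_of_int (2 * N)"
    by (simp add: sum_divide_distrib)
  also have "real_of_int ((t + (\<Sum>j\<in>A. \<rho> (j, A, v, y))) mod (2 * N)) / real_of_int (2 * N)
        - real_of_int (\<Sum>j\<in>A. \<rho> (j, A, v, y)) / real_of_int (2 * N)
      = real_of_int t / real_of_int (2 * N) - real_of_int ((t + (\<Sum>j\<in>A. \<rho> (j, A, v, y))) div (2 * N))"
  proof -
    let ?s = "\<Sum>j\<in>A. \<rho> (j, A, v, y)"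
    have "(t + ?s) mod (2 * N) = t + ?s - 2 * N * ((t + ?s) div (2 * N))"
      by (simp add: minus_mult_div_eq_mod)
    then have "real_of_int ((t + ?s) mod (2 * N)) = real_of_int t + real_of_int ?s - real_of_int (2 * N) * real_of_int ((t + ?s) div (2 * N))"
      by simp
    then show ?thesis using N by (simp add: field_simps)
  qed
  also have "unwrap \<dots> = real_of_int t / real_of_int N"
    by (rule unwrap_eq) (use tab N in auto)
  finally show ?thesis .
qed

lemma post_table_empty: "post_table Ys \<mu> w {} y y' = 1 / card Ys"
  by (simp add: post_table_def posterior_def lik_def)

lemma abs_expectation_le:
  fixes f :: "'a \<Rightarrow> real"
  assumes "finite (set_pmf p)" "\<And>x. \<bar>f x\<bar> \<le> c"
  shows "\<bar>measure_pmf.expectation p f\<bar> \<le> c"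
proof -
  have "\<bar>measure_pmf.expectation p f\<bar> \<le> measure_pmf.expectation p (\<lambda>x. \<bar>f x\<bar>)"
    by (rule integral_abs_bound)
  also have "\<dots> \<le> measure_pmf.expectation p (\<lambda>x. c)"
    by (intro integral_mono integrable_measure_pmf_finite assms)
  finally show ?thesis by simp
qed

text \<open>
  Any finite structure can be replaced by one whose messages have a bounded number of real
  coordinates and whose posteriors are a fixed continuous function (\<open>decode\<close>) of the messages.
  This is a private simultaneous messages protocol for the table of posteriors, quantised to
  multiples of \<open>1/N\<close>.
\<close>

lemma finite_structure_approx:
  fixes YY :: "'k::finite \<Rightarrow> 'y set" and \<mu> :: "('k \<Rightarrow> 'y \<Rightarrow> 'u) pmf" and N :: int
  assumes finY: "\<And>k. finite (YY k)" and Ys: "Ys = PiE UNIV YY" and fin\<mu>: "finite (set_pmf \<mu>)" and N: "0 < N"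
  shows "\<exists>P :: (('k \<Rightarrow> 'y \<Rightarrow> ('k, 'y) coord \<Rightarrow> real) \<times> ('k set \<Rightarrow> ('k \<Rightarrow> 'y) \<Rightarrow> ('k \<Rightarrow> 'y) \<Rightarrow> real)) pmf.
    finite (set_pmf P) \<and>
    (\<forall>\<omega>\<in>set_pmf P. (\<forall>k v cd. fst \<omega> k v cd \<in> {0..1}) \<and>
      (\<forall>A. \<forall>y\<in>Ys. \<forall>y'\<in>Ys. snd \<omega> A y y' \<in> {0..1} \<and> \<bar>decode Ys A (\<lambda>k. fst \<omega> k (y k)) y' - snd \<omega> A y y'\<bar> \<le> 1 / N)) \<and>
    map_pmf snd P = map_pmf (post_table Ys \<mu>) \<mu> \<and>
    (\<forall>A h. \<forall>y\<in>Ys. (\<forall>u. \<bar>h u\<bar> \<le> 1) \<longrightarrow>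
      \<bar>measure_pmf.expectation P (\<lambda>\<omega>. h (\<lambda>k\<in>A. fst \<omega> k (y k)))
       - (\<Sum>y'\<in>Ys. measure_pmf.expectation P (\<lambda>\<omega>. h (\<lambda>k\<in>A. fst \<omega> k (y' k)) * decode Ys A (\<lambda>k. fst \<omega> k (y' k)) y))\<bar>
      \<le> card Ys / N)"
proof -
  have finYs: "finite Ys" unfolding Ys by (intro finite_PiE) (auto simp: finY)
  have M: "0 < 2 * N" using N by simp
  \<comment> \<open>Quantised posteriors stored at label vectors; the inverse permutations lead from
    labels back to outputs.\<close>
  define T where "T w \<pi> B v y' = \<lfloor>real_of_int N * post_table Ys \<mu> w B (\<lambda>k. inv (\<pi> k) (v k)) y'\<rfloor>"
    for w and \<pi> :: "'k \<Rightarrow> 'y \<Rightarrow> 'y" and B v y'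
  \<comment> \<open>The second component keeps the exact posteriors, so the gain of \<mu> can be
    read off without quantisation error.\<close>
  define F where "F w \<pi> \<rho> = (\<lambda>k z. message Ys (2 * N) k (\<pi> k z) (T w \<pi>) \<rho>, post_table Ys \<mu> w)" for w \<pi> \<rho>
  define Perm where "Perm = pmf_of_set (perms YY)"
  define Rho where "Rho = pads Ys (2 * N)"
  define P where "P = \<mu> \<bind> (\<lambda>w. Perm \<bind> (\<lambda>\<pi>. map_pmf (F w \<pi>) Rho))"
  have setPerm: "set_pmf Perm = perms YY" and finPerm: "finite (set_pmf Perm)"
    unfolding Perm_def using perms_ne[of YY] finite_perms[of YY, OF finY] by simp_all
  have setRho: "set_pmf Rho = PiE_dflt (pad_index Ys) 0 (\<lambda>_. {0..<2 * N})"
    unfolding Rho_def by (rule set_pads[OF finYs M])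
  have finRho: "finite (set_pmf Rho)" unfolding setRho by (rule finite_pad_set(1)[OF finYs M])
  have finP: "finite (set_pmf P)" unfolding P_def using fin\<mu> finPerm finRho by simp
  have expP: "measure_pmf.expectation P f = measure_pmf.expectation \<mu> (\<lambda>w. measure_pmf.expectation Perm
      (\<lambda>\<pi>. measure_pmf.expectation Rho (\<lambda>\<rho>. f (F w \<pi> \<rho>))))" for f :: "_ \<Rightarrow> real"
    unfolding P_def using fin\<mu> finPerm finRho by (simp add: expectation_bind_pmf_finite)
  have z01: "post_table Ys \<mu> w A y y' \<in> {0..1}" if "y' \<in> Ys" for w A y y'
    unfolding post_table_def by (auto intro: posterior_nonneg posterior_le_1[OF finYs that])
  have Tloc: "T w \<pi> B v y' = \<lfloor>real_of_int N * post_table Ys \<mu> w B y y'\<rfloor>"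
    if \<pi>: "\<pi> \<in> perms YY" and v: "\<forall>k\<in>B. v k = \<pi> k (y k)" for w \<pi> B v y y'
  proof -
    have "inv (\<pi> k) (v k) = y k" if "k \<in> B" for k
    proof -
      have "\<pi> k permutes YY k" using \<pi> by (auto simp: perms_def PiE_iff)
      then show ?thesis using v that by (simp add: permutes_inverses)
    qed
    then have "post_table Ys \<mu> w B (\<lambda>k. inv (\<pi> k) (v k)) = post_table Ys \<mu> w B y"
      by (rule post_table_local)
    then show ?thesis unfolding T_def by simp
  qed
  have lab: "(\<lambda>k. \<pi> k (y k)) \<in> Ys" if "\<pi> \<in> perms YY" "y \<in> Ys" for \<pi> y
    using that unfolding Ys perms_def by (auto simp: PiE_iff permutes_in_image)
  \<comment> \<open>What \<open>decode\<close> yields for the messages at \<open>y\<close>: exact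
    for empty \<open>A\<close>, otherwise rounded down to a multiple of
    \<open>1 / N\<close>.\<close>
  define dq where "dq w A y y' = (if A = {} then 1 / card Ys else real_of_int \<lfloor>real_of_int N * post_table Ys \<mu> w A y y'\<rfloor> / N)"
    for w A y y'
  have dq: "\<bar>dq w A y y' - post_table Ys \<mu> w A y y'\<bar> \<le> 1 / N" for w A y y'
  proof (cases "A = {}")
    case False
    let ?x = "real_of_int N * post_table Ys \<mu> w A y y'"
    have "\<bar>real_of_int \<lfloor>?x\<rfloor> - ?x\<bar> \<le> 1" by linarith
    moreover have "dq w A y y' - post_table Ys \<mu> w A y y' = (real_of_int \<lfloor>?x\<rfloor> - ?x) / N"
      using N False by (simp add: dq_def diff_divide_distrib)
    ultimately show ?thesis using N by (simp add: abs_divide divide_right_mono)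
  qed (use N in \<open>simp add: dq_def post_table_empty\<close>)
  have dec: "decode Ys A (\<lambda>k. fst (F w \<pi> \<rho>) k (y k)) y' = dq w A y y'"
    if \<pi>: "\<pi> \<in> perms YY" and y: "y \<in> Ys" "y' \<in> Ys" for w \<pi> \<rho> A y y'
  proof (cases "A = {}")
    case True then show ?thesis by (simp add: decode_def dq_def)
  next
    case False
    have "decode Ys A (\<lambda>k. message Ys (2 * N) k (\<pi> k (y k)) (T w \<pi>) \<rho>) y'
        = real_of_int \<lfloor>real_of_int N * post_table Ys \<mu> w A y y'\<rfloor> / real_of_int N"
    proof (rule decode_message[OF Ys finY lab[OF \<pi> y(1)] y(2) False N])
      show "T w \<pi> A v y' = \<lfloor>real_of_int N * post_table Ys \<mu> w A y y'\<rfloor>" if "\<forall>k\<in>A. v k = \<pi> k (y k)" for v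
        by (rule Tloc[OF \<pi> that])
      show "0 \<le> \<lfloor>real_of_int N * post_table Ys \<mu> w A y y'\<rfloor>" using z01[OF y(2), of w A y] N by simp
      have "real_of_int N * post_table Ys \<mu> w A y y' \<le> real_of_int N * 1"
        using z01[OF y(2), of w A y] N by (intro mult_left_mono) auto
      then show "\<lfloor>real_of_int N * post_table Ys \<mu> w A y y'\<rfloor> \<le> N" by (simp add: floor_le_iff)
    qed
    then show ?thesis using False by (simp add: dq_def F_def)
  qed
  have inP: "\<exists>w\<in>set_pmf \<mu>. \<exists>\<pi>\<in>perms YY. \<exists>\<rho>\<in>set_pmf Rho. \<omega> = F w \<pi> \<rho>" if "\<omega> \<in> set_pmf P" for \<omega>
    using that unfolding P_def by (auto simp: setPerm)
  have frac01: "real_of_int a / real_of_int (2 * N) \<in> {0..1}" if "0 \<le> a" "a \<le> 2 * N" for a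
    using that N by (simp add: divide_le_eq)
  have range01: "fst (F w \<pi> \<rho>) k v cd \<in> {0..1}" if "\<rho> \<in> set_pmf Rho" for w \<pi> \<rho> k v cd
  proof (cases cd)
    case (Masked B x y)
    have "real_of_int (i mod (2 * N)) / real_of_int (2 * N) \<in> {0..1}" for i
      by (rule frac01) (use pos_mod_bound[OF M, of i] pos_mod_sign[OF M, of i] in auto)
    then show ?thesis
      by (cases "k \<in> B \<and> x \<in> Ys \<and> y \<in> Ys") (simp_all add: F_def message_def Masked del: of_int_mult)
  next
    case (Pad B x y)
    show ?thesis
    proof (cases "k \<in> B \<and> x \<in> Ys \<and> y \<in> Ys \<and> x k = \<pi> k v")
      case True
      then have "(k, B, x, y) \<in> pad_index Ys" by (simp add: pad_index_def)
      then have "\<rho> (k, B, x, y) \<in> {0..<2 * N}" using that unfolding setRho PiE_dflt_def by blast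
      then have "real_of_int (\<rho> (k, B, x, y)) / real_of_int (2 * N) \<in> {0..1}"
        by (intro frac01) auto
      then show ?thesis using True by (simp add: F_def message_def Pad del: of_int_mult)
    qed (auto simp: F_def message_def Pad)
  qed (simp add: F_def message_def)
  have exch: "\<bar>measure_pmf.expectation P (\<lambda>\<omega>. h (\<lambda>k\<in>A. fst \<omega> k (y k)))
       - (\<Sum>y'\<in>Ys. measure_pmf.expectation P (\<lambda>\<omega>. h (\<lambda>k\<in>A. fst \<omega> k (y' k)) * decode Ys A (\<lambda>k. fst \<omega> k (y' k)) y))\<bar>
      \<le> card Ys / N" if y: "y \<in> Ys" and h: "\<forall>u. \<bar>h u\<bar> \<le> 1" for A h y
  proof -
    \<comment> \<open>A simulated table with only those entries that \<open>A\<close> can unmask at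
      the labels \<open>a\<close>; it is built from the posteriors \<tau> of the subsets of
      \<open>A\<close> and zero elsewhere.\<close>
    define sim where "sim \<tau> a B v y' = (if B \<subseteq> A \<and> (\<forall>k\<in>B. v k = a k) then \<lfloor>real_of_int N * \<tau> B y'\<rfloor> else 0)"
      for \<tau> :: "'k set \<Rightarrow> ('k \<Rightarrow> 'y) \<Rightarrow> real" and a :: "'k \<Rightarrow> 'y" and B v y'
    define G where "G \<tau> a = measure_pmf.expectation Rho (\<lambda>\<rho>. h (\<lambda>k\<in>A. message Ys (2 * N) k (a k) (sim \<tau> a) \<rho>))" for \<tau> a
    define H where "H \<tau> = measure_pmf.expectation Perm (\<lambda>\<pi>. G \<tau> (\<lambda>k. \<pi> k (y k)))" for \<tau>
    let ?\<tau> = "\<lambda>w y'. \<lambda>B\<in>Pow A. post_table Ys \<mu> w B y'"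
    \<comment> \<open>Given \<open>w\<close>, the mean of a test of the messages of \<open>A\<close>
      depends on \<open>y'\<close> only through the posteriors of the subsets of \<open>A\<close>:
      the pads hide the other entries, then the permutations hide the outputs behind the
      labels.\<close>
    have hide: "measure_pmf.expectation Perm (\<lambda>\<pi>. measure_pmf.expectation Rho (\<lambda>\<rho>. h (\<lambda>k\<in>A. fst (F w \<pi> \<rho>) k (y' k)))) = H (?\<tau> w y')"
      if y': "y' \<in> Ys" for w y'
    proof -
      have "measure_pmf.expectation Rho (\<lambda>\<rho>. h (\<lambda>k\<in>A. fst (F w \<pi> \<rho>) k (y' k))) = G (?\<tau> w y') (\<lambda>k. \<pi> k (y' k))"
        if \<pi>: "\<pi> \<in> perms YY" for \<pi>
      proof -
        have "map_pmf (\<lambda>\<rho>. \<lambda>k\<in>A. message Ys (2 * N) k (\<pi> k (y' k)) (T w \<pi>) \<rho>) Rho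
          = map_pmf (\<lambda>\<rho>. \<lambda>k\<in>A. message Ys (2 * N) k (\<pi> k (y' k)) (sim (?\<tau> w y') (\<lambda>k. \<pi> k (y' k))) \<rho>) Rho"
          unfolding Rho_def
        proof (rule message_pads_hiding[OF finYs M, of A "\<lambda>k. \<pi> k (y' k)"])
          fix B v z assume "B \<subseteq> A" "\<forall>k\<in>B. v k = \<pi> k (y' k)"
          then show "T w \<pi> B v z = sim (?\<tau> w y') (\<lambda>k. \<pi> k (y' k)) B v z"
            using Tloc[OF \<pi>, of B v y' w z] by (simp add: sim_def)
        qed
        from arg_cong[OF this, of "\<lambda>p. measure_pmf.expectation p h"] show ?thesis by (simp add: F_def G_def)
      qed
      then have "measure_pmf.expectation Perm (\<lambda>\<pi>. measure_pmf.expectation Rho (\<lambda>\<rho>. h (\<lambda>k\<in>A. fst (F w \<pi> \<rho>) k (y' k))))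
          = measure_pmf.expectation Perm (\<lambda>\<pi>. G (?\<tau> w y') (\<lambda>k. \<pi> k (y' k)))"
        by (intro integral_cong_AE) (auto simp: AE_measure_pmf_iff setPerm)
      also have "\<dots> = measure_pmf.expectation (map_pmf (\<lambda>\<pi> k. \<pi> k (y' k)) Perm) (G (?\<tau> w y'))" by simp
      also have "map_pmf (\<lambda>\<pi> k. \<pi> k (y' k)) Perm = map_pmf (\<lambda>\<pi> k. \<pi> k (y k)) Perm"
        unfolding Perm_def by (rule perms_labels_hiding[OF finY]) (use y y' in \<open>simp_all add: Ys\<close>)
      finally show ?thesis unfolding H_def integral_map_pmf .
    qed
    have H1: "\<bar>H \<tau>\<bar> \<le> 1" for \<tau>
      unfolding H_def G_def by (intro abs_expectation_le finPerm finRho) (use h in auto)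
    have 1: "measure_pmf.expectation P (\<lambda>\<omega>. h (\<lambda>k\<in>A. fst \<omega> k (y k))) = measure_pmf.expectation \<mu> (\<lambda>w. H (?\<tau> w y))"
      unfolding expP hide[OF y] ..
    have 2: "measure_pmf.expectation P (\<lambda>\<omega>. h (\<lambda>k\<in>A. fst \<omega> k (y' k)) * decode Ys A (\<lambda>k. fst \<omega> k (y' k)) y)
        = measure_pmf.expectation \<mu> (\<lambda>w. H (?\<tau> w y') * dq w A y' y)" if y': "y' \<in> Ys" for y'
    proof -
      have "measure_pmf.expectation Perm (\<lambda>\<pi>. measure_pmf.expectation Rho (\<lambda>\<rho>.
          h (\<lambda>k\<in>A. fst (F w \<pi> \<rho>) k (y' k)) * decode Ys A (\<lambda>k. fst (F w \<pi> \<rho>) k (y' k)) y))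
        = measure_pmf.expectation Perm (\<lambda>\<pi>. measure_pmf.expectation Rho (\<lambda>\<rho>. h (\<lambda>k\<in>A. fst (F w \<pi> \<rho>) k (y' k))) * dq w A y' y)" for w
        by (intro integral_cong_AE) (auto simp: AE_measure_pmf_iff setPerm dec[OF _ y' y])
      also have "\<dots> w = H (?\<tau> w y') * dq w A y' y" for w
        by (simp add: hide[OF y'])
      finally show ?thesis unfolding expP by simp
    qed
    \<comment> \<open>The exact exchange identity, with \<open>H\<close> as its test function. What
      remains is the quantisation error, at most \<open>1 / N\<close> for each of the
      \<open>card Ys\<close> terms.\<close>
    have 3: "measure_pmf.expectation \<mu> (\<lambda>w. H (?\<tau> w y)) = (\<Sum>y'\<in>Ys. measure_pmf.expectation \<mu> (\<lambda>w. H (?\<tau> w y') * post_table Ys \<mu> w A y' y))"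
      by (rule post_table_exchange[OF finYs fin\<mu> y])
    have i: "integrable (measure_pmf \<mu>) f" for f :: "_ \<Rightarrow> real" using fin\<mu> by (rule integrable_measure_pmf_finite)
    have "\<bar>measure_pmf.expectation \<mu> (\<lambda>w. H (?\<tau> w y)) - (\<Sum>y'\<in>Ys. measure_pmf.expectation \<mu> (\<lambda>w. H (?\<tau> w y') * dq w A y' y))\<bar>
        = \<bar>\<Sum>y'\<in>Ys. measure_pmf.expectation \<mu> (\<lambda>w. H (?\<tau> w y') * (post_table Ys \<mu> w A y' y - dq w A y' y))\<bar>"
      unfolding 3 by (simp add: right_diff_distrib i sum_subtractf)
    also have "\<dots> \<le> (\<Sum>y'\<in>Ys. \<bar>measure_pmf.expectation \<mu> (\<lambda>w. H (?\<tau> w y') * (post_table Ys \<mu> w A y' y - dq w A y' y))\<bar>)"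
      by (rule sum_abs)
    also have "\<dots> \<le> (\<Sum>y'\<in>Ys. 1 / N)"
    proof (intro sum_mono abs_expectation_le[OF fin\<mu>])
      fix y' w
      have "\<bar>H (?\<tau> w y')\<bar> * \<bar>post_table Ys \<mu> w A y' y - dq w A y' y\<bar> \<le> 1 * (1 / N)"
        using H1 dq[of w A y' y] by (intro mult_mono) (auto simp: abs_minus_commute)
      then show "\<bar>H (?\<tau> w y') * (post_table Ys \<mu> w A y' y - dq w A y' y)\<bar> \<le> 1 / N"
        by (simp add: abs_mult)
    qed
    finally show ?thesis unfolding 1 by (simp add: 2)
  qed
  have "map_pmf snd P = map_pmf (post_table Ys \<mu>) \<mu>"
    unfolding P_def by (simp add: map_bind_pmf map_pmf_comp F_def map_pmf_const) (simp add: map_pmf_def)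
  moreover have "\<forall>\<omega>\<in>set_pmf P. (\<forall>k v cd. fst \<omega> k v cd \<in> {0..1}) \<and>
      (\<forall>A. \<forall>y\<in>Ys. \<forall>y'\<in>Ys. snd \<omega> A y y' \<in> {0..1} \<and> \<bar>decode Ys A (\<lambda>k. fst \<omega> k (y k)) y' - snd \<omega> A y y'\<bar> \<le> 1 / N)"
  proof
    fix \<omega> assume "\<omega> \<in> set_pmf P"
    then obtain w \<pi> \<rho> where \<omega>: "\<omega> = F w \<pi> \<rho>" "\<pi> \<in> perms YY" "\<rho> \<in> set_pmf Rho" using inP by blast
    have snd: "snd \<omega> = post_table Ys \<mu> w" by (simp add: \<omega> F_def)
    show "(\<forall>k v cd. fst \<omega> k v cd \<in> {0..1}) \<and>
      (\<forall>A. \<forall>y\<in>Ys. \<forall>y'\<in>Ys. snd \<omega> A y y' \<in> {0..1} \<and> \<bar>decode Ys A (\<lambda>k. fst \<omega> k (y k)) y' - snd \<omega> A y y'\<bar> \<le> 1 / N)"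
      unfolding snd using range01[OF \<omega>(3)] z01 dec[OF \<omega>(2)] dq unfolding \<omega>(1) by metis
  qed
  ultimately show ?thesis
    using finP exch by (intro exI[of _ P]) blast
qed

section \<open>A space-filling curve and weak limits\<close>

text \<open>Continuous with period two, zero on \<open>[0, 1/3]\<close> and one on
  \<open>[2/3, 1]\<close>: it reads a ternary digit that is \<open>0\<close> or \<open>2\<close>,
  and the gap between the two cases leaves room for continuity.\<close>

definition step_fun :: "real \<Rightarrow> real" where
  "step_fun t = max 0 (min 1 (1/2 - cos (pi * t)))"

lemma step_fun_eq:
  fixes b :: nat
  assumes "b \<le> 1" "0 \<le> r" "r \<le> 1/3"
  shows "step_fun (2 * real_of_int m + 2 * b / 3 + r) = b"
proof -
  have "cos (pi * (2 * real_of_int m + 2 * b / 3 + r)) = cos (pi * (2 * b / 3 + r) + real_of_int m * (2 * pi))"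
    by (simp add: algebra_simps)
  also have "\<dots> = cos (pi * (2 * b / 3 + r))"
    using cos.plus_of_int[of "pi * (2 * b / 3 + r)" m] by simp
  finally have c: "cos (pi * (2 * real_of_int m + 2 * b / 3 + r)) = cos (pi * (2 * b / 3 + r))" .
  consider "b = 0" | "b = 1" using assms(1) by linarith
  then show ?thesis
  proof cases
    case 1
    have "cos (pi / 3) \<le> cos (pi * r)"
      using assms by (intro cos_monotone_0_pi_le) auto
    then show ?thesis using 1 c by (simp add: step_fun_def cos_60)
  next
    case 2
    have "cos (pi * (2 / 3 + r)) \<le> cos (pi * (2 / 3))"
    proof (rule cos_monotone_0_pi_le)
      have "pi * (2 / 3 + r) \<le> pi * 1" using assms by (intro mult_left_mono) auto
      then show "pi * (2 / 3 + r) \<le> pi" by simp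
    qed (use assms in auto)
    moreover have "pi * (2 / 3) = 2 * pi / 3" by simp
    ultimately have "cos (pi * (2 / 3 + r)) \<le> - 1 / 2" by (simp only: cos_120)
    then show ?thesis using 2 c by (simp add: step_fun_def)
  qed
qed

text \<open>Multiplication by \<open>3 ^ k\<close> turns the earlier digits, which are all even,
  into an even integer absorbed by the period, and the later ones into a remainder of at most
  \<open>1/3\<close>.\<close>

lemma ternary_digits:
  fixes b :: "nat \<Rightarrow> nat"
  assumes b: "\<And>n. b n \<le> 1"
  defines "t \<equiv> (\<Sum>n. 2 * real (b n) / 3 ^ Suc n)"
  shows "step_fun (3 ^ k * t) = b k"
proof -
  let ?f = "\<lambda>n. 2 * real (b n) / 3 ^ Suc n"
  have g: "summable (\<lambda>n. 2 * (1/3) ^ Suc n :: real)" "(\<Sum>n. 2 * (1/3) ^ Suc n :: real) = 1"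
    using sums_mult[OF geometric_sums[of "1/3 :: real"], of "2/3"] by (auto simp: sums_iff)
  have le: "?f n \<le> 2 * (1/3) ^ Suc n" for n
    using b[of n] by (auto simp: power_divide divide_right_mono)
  have f0: "0 \<le> ?f n" for n by simp
  have sf: "summable ?f" by (rule summable_comparison_test'[OF g(1), of 0]) (use le in auto)
  define r where "r = 3 ^ k * (\<Sum>n. ?f (n + Suc k))"
  have sk: "summable (\<lambda>n. ?f (n + Suc k))" using sf by (subst summable_iff_shift)
  have r0: "0 \<le> r" unfolding r_def by (intro mult_nonneg_nonneg suminf_nonneg[OF sk]) auto
  have r1: "r \<le> 1/3"
  proof -
    have "(\<Sum>n. ?f (n + Suc k)) \<le> (\<Sum>n. 2 * (1/3) ^ Suc n * (1/3) ^ Suc k)"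
    proof (rule suminf_le[OF _ sk])
      show "?f (n + Suc k) \<le> 2 * (1/3) ^ Suc n * (1/3) ^ Suc k" for n
        using le[of "n + Suc k"] by (simp add: power_add)
      show "summable (\<lambda>n. 2 * (1/3) ^ Suc n * (1/3::real) ^ Suc k)" by (rule summable_mult2[OF g(1)])
    qed
    also have "\<dots> = 1 * (1/3) ^ Suc k"
      using suminf_mult2[OF g(1), of "(1/3) ^ Suc k"] g(2) by simp
    finally have "r \<le> 3 ^ k * ((1/3) ^ Suc k)" unfolding r_def by simp
    also have "\<dots> = 1/3" by (simp add: power_divide)
    finally show ?thesis .
  qed
  have "t = (\<Sum>n. ?f (n + Suc k)) + (\<Sum>n<Suc k. ?f n)"
    unfolding t_def by (rule suminf_split_initial_segment[OF sf])
  then have "3 ^ k * t = r + 3 ^ k * (\<Sum>n<k. ?f n) + 2 * b k / 3"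
    by (simp add: r_def algebra_simps)
  also have "3 ^ k * (\<Sum>n<k. ?f n) = 2 * real_of_int (\<Sum>n<k. int (b n) * 3 ^ (k - Suc n))"
    unfolding sum_distrib_left of_int_sum
  proof (rule sum.cong[OF refl])
    fix n assume "n \<in> {..<k}"
    then have "(3::real) ^ k = 3 ^ Suc n * 3 ^ (k - Suc n)"
      unfolding power_add[symmetric] by simp
    then show "3 ^ k * ?f n = 2 * real_of_int (int (b n) * 3 ^ (k - Suc n))" by simp
  qed
  finally have e: "3 ^ k * t = 2 * real_of_int (\<Sum>n<k. int (b n) * 3 ^ (k - Suc n)) + 2 * b k / 3 + r" by simp
  show ?thesis unfolding e by (rule step_fun_eq[OF b r0 r1])
qed

text \<open>The partial sums are the dyadic truncations \<open>f n\<close> of \<open>z\<close>, so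
  the series telescopes; \<open>z < 1\<close> makes \<open>f 0\<close> vanish.\<close>

lemma binary_digits:
  fixes z :: real
  assumes "0 \<le> z" "z < 1"
  shows "\<exists>b :: nat \<Rightarrow> nat. (\<forall>n. b n \<le> 1) \<and> (\<lambda>n. real (b n) / 2 ^ Suc n) sums z"
proof -
  define f where "f n = real_of_int \<lfloor>2 ^ n * z\<rfloor> / 2 ^ n" for n
  define b where "b n = nat (\<lfloor>2 ^ Suc n * z\<rfloor> - 2 * \<lfloor>2 ^ n * z\<rfloor>)" for n
  have d: "\<lfloor>2 ^ Suc n * z\<rfloor> - 2 * \<lfloor>2 ^ n * z\<rfloor> \<in> {0, 1}" for n
  proof -
    have "2 * \<lfloor>x\<rfloor> \<le> \<lfloor>2 * x\<rfloor>" "\<lfloor>2 * x\<rfloor> \<le> 2 * \<lfloor>x\<rfloor> + 1" for x :: real by linarith+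
    from this[of "2 ^ n * z"] show ?thesis by (auto simp: mult.assoc)
  qed
  have "real (b n) / 2 ^ Suc n = f (Suc n) - f n" for n
  proof -
    have "real (b n) = real_of_int (\<lfloor>2 ^ Suc n * z\<rfloor> - 2 * \<lfloor>2 ^ n * z\<rfloor>)"
      unfolding b_def using d[of n] by auto
    then show ?thesis by (simp add: f_def field_simps)
  qed
  moreover have "f \<longlonglongrightarrow> z"
  proof (rule tendsto_sandwich)
    show "\<forall>\<^sub>F n in sequentially. z - (1/2) ^ n \<le> f n"
    proof (rule always_eventually, rule allI)
      fix n
      have "2 ^ n * z - 1 \<le> real_of_int \<lfloor>2 ^ n * z\<rfloor>" by linarith
      then have "(2 ^ n * z - 1) / 2 ^ n \<le> f n" unfolding f_def by (rule divide_right_mono) simp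
      then show "z - (1/2) ^ n \<le> f n" by (simp add: diff_divide_distrib power_divide)
    qed
    show "\<forall>\<^sub>F n in sequentially. f n \<le> z"
      by (rule always_eventually) (auto simp: f_def divide_le_eq mult.commute)
    have "(\<lambda>n. z - (1/2) ^ n) \<longlonglongrightarrow> z - 0" by (intro tendsto_intros LIMSEQ_power_zero) auto
    then show "(\<lambda>n. z - (1/2) ^ n) \<longlonglongrightarrow> z" by simp
  qed simp
  then have "(\<lambda>n. f (Suc n) - f n) sums (z - f 0)" by (rule telescope_sums)
  moreover have "f 0 = 0" using assms by (simp add: f_def floor_eq_iff)
  ultimately have "(\<lambda>n. real (b n) / 2 ^ Suc n) sums z" by simp
  moreover have "b n \<le> 1" for n using d[of n] by (auto simp: b_def)
  ultimately show ?thesis by blast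
qed

text \<open>Schoenberg's curve.\<close>

lemma space_filling_curve:
  "\<exists>\<gamma> :: real \<Rightarrow> nat \<Rightarrow> real. (\<forall>i. continuous_on UNIV (\<lambda>t. \<gamma> t i)) \<and> (\<forall>t i. \<gamma> t i \<in> {0..1}) \<and>
    (\<forall>z. (\<forall>i<d. z i \<in> {0..1}) \<longrightarrow> (\<exists>t\<in>{0..1}. \<forall>i<d. \<gamma> t i = z i))"
proof -
  \<comment> \<open>Coordinate \<open>i\<close> takes the ternary digits of \<open>t\<close> at the
    places \<open>i + d * j\<close> and reads them as binary digits.\<close>
  define F where "F i j t = step_fun (3 ^ (i + d * j) * t) / 2 ^ Suc j" for i j and t :: real
  \<comment> \<open>The digits code \<open>z i / 2\<close>, which is below one even for
    \<open>z i = 1\<close>; hence the factor two. The minimum keeps the curve in the cube at all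
    other \<open>t\<close>.\<close>
  define \<gamma> where "\<gamma> t i = min 1 (2 * (\<Sum>j. F i j t))" for t i
  have s01: "0 \<le> step_fun t" "step_fun t \<le> 1" for t by (auto simp: step_fun_def)
  have g: "summable (\<lambda>j. (1/2) ^ Suc j :: real)"
    using sums_mult[OF geometric_sums[of "1/2 :: real"], of "1/2"] by (auto simp: sums_iff)
  have F: "0 \<le> F i j t" "norm (F i j t) \<le> (1/2) ^ Suc j" for i j t
    using s01[of "3 ^ (i + d * j) * t"] by (auto simp: F_def power_divide divide_right_mono)
  have sF: "summable (\<lambda>j. F i j t)" for i t
    by (rule summable_comparison_test'[OF g, of 0]) (use F in auto)
  have cF: "continuous_on UNIV (F i j)" for i j
    unfolding F_def step_fun_def by (intro continuous_intros) auto
  have c: "continuous_on UNIV (\<lambda>t. \<Sum>j. F i j t)" for i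
  proof (rule uniform_limit_theorem)
    show "uniform_limit UNIV (\<lambda>n t. \<Sum>j<n. F i j t) (\<lambda>t. \<Sum>j. F i j t) sequentially"
      by (rule Weierstrass_m_test[OF _ g]) (use F in auto)
    show "\<forall>\<^sub>F n in sequentially. continuous_on UNIV (\<lambda>t. \<Sum>j<n. F i j t)"
      by (intro always_eventually allI continuous_intros cF)
  qed simp
  have "continuous_on UNIV (\<lambda>t. \<gamma> t i)" for i
    unfolding \<gamma>_def by (intro continuous_intros c)
  moreover have "\<gamma> t i \<in> {0..1}" for t i
    unfolding \<gamma>_def using suminf_nonneg[OF sF F(1)] by auto
  moreover have "\<exists>t\<in>{0..1}. \<forall>i<d. \<gamma> t i = z i" if z: "\<forall>i<d. z i \<in> {0..1}" for z
  proof -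
    have "\<exists>b :: nat \<Rightarrow> nat. (\<forall>n. b n \<le> 1) \<and> (\<lambda>n. real (b n) / 2 ^ Suc n) sums (z i / 2)" if "i < d" for i
      by (rule binary_digits) (use z that in auto)
    then obtain \<beta> :: "nat \<Rightarrow> nat \<Rightarrow> nat" where \<beta>: "\<And>i n. i < d \<Longrightarrow> \<beta> i n \<le> 1"
      "\<And>i. i < d \<Longrightarrow> (\<lambda>n. real (\<beta> i n) / 2 ^ Suc n) sums (z i / 2)" by metis
    \<comment> \<open>Interleaves the \<open>d\<close> digit sequences; the case
      \<open>d = 0\<close>, with nothing to code, is separated because of the division by
      \<open>d\<close>.\<close>
    define b where "b n = (if d = 0 then 0 else \<beta> (n mod d) (n div d))" for n
    have b1: "b n \<le> 1" for n using \<beta>(1)[of "n mod d"] by (auto simp: b_def)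
    define t where "t = (\<Sum>n. 2 * real (b n) / 3 ^ Suc n)"
    have g3: "summable (\<lambda>n. 2 * (1/3) ^ Suc n :: real)" "(\<Sum>n. 2 * (1/3) ^ Suc n :: real) = 1"
      using sums_mult[OF geometric_sums[of "1/3 :: real"], of "2/3"] by (auto simp: sums_iff)
    have le: "2 * real (b n) / 3 ^ Suc n \<le> 2 * (1/3) ^ Suc n" for n
      using b1[of n] by (auto simp: power_divide divide_right_mono)
    have st: "summable (\<lambda>n. 2 * real (b n) / 3 ^ Suc n)"
      by (rule summable_comparison_test'[OF g3(1), of 0]) (use le in auto)
    have "0 \<le> t" unfolding t_def by (rule suminf_nonneg[OF st]) simp
    moreover have "t \<le> 1" unfolding t_def using suminf_le[OF le st g3(1)] g3(2) by simp
    moreover have "\<gamma> t i = z i" if i: "i < d" for i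
    proof -
      have "F i j t = real (\<beta> i j) / 2 ^ Suc j" for j
      proof -
        have "step_fun (3 ^ (i + d * j) * t) = b (i + d * j)"
          unfolding t_def by (rule ternary_digits[OF b1])
        also have "b (i + d * j) = \<beta> i j" using i by (simp add: b_def)
        finally show ?thesis by (simp add: F_def)
      qed
      then have "2 * (\<Sum>j. F i j t) = z i" using \<beta>(2)[OF i] by (simp add: sums_iff)
      moreover have "z i \<le> 1" using z i by auto
      ultimately show ?thesis by (simp only: \<gamma>_def min_absorb2)
    qed
    ultimately show ?thesis by (intro bexI[of _ t]) auto
  qed
  ultimately show ?thesis by blast
qed

text \<open>A right inverse \<open>s\<close> of a space-filling curve carries laws on the cube to
  laws on \<open>[0, 1]\<close>, where tightness is immediate, and a test function \<open>F\<close>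
  becomes the continuous function \<open>F (\<gamma> t)\<close> of a real variable. The randomness
  of the limit is thus a single real number from which \<gamma> recovers all coordinates.\<close>

lemma limit_law:
  fixes V :: "nat \<Rightarrow> ('i \<Rightarrow> real) pmf"
  assumes fin: "finite I" and V: "\<And>n v i. v \<in> set_pmf (V n) \<Longrightarrow> i \<in> I \<Longrightarrow> v i \<in> {0..1}"
  shows "\<exists>(\<gamma> :: real \<Rightarrow> 'i \<Rightarrow> real) (r :: nat \<Rightarrow> nat) M. continuous_on UNIV \<gamma> \<and> (\<forall>t i. \<gamma> t i \<in> {0..1}) \<and> strict_mono r \<and>
    real_distribution M \<and>
    (\<forall>F :: ('i \<Rightarrow> real) \<Rightarrow> real. continuous_on UNIV F \<longrightarrow> bounded (range F) \<longrightarrow> (\<forall>v v'. (\<forall>i\<in>I. v i = v' i) \<longrightarrow> F v = F v') \<longrightarrow>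
      (\<lambda>n. measure_pmf.expectation (V (r n)) F) \<longlonglongrightarrow> (\<integral>t. F (\<gamma> t) \<partial>M))"
proof -
  obtain e where e: "bij_betw e I {..<card I}"
    using ex_bij_betw_finite_nat[OF fin] by (auto simp: atLeast0LessThan)
  obtain \<gamma>0 :: "real \<Rightarrow> nat \<Rightarrow> real" where g0: "\<And>i. continuous_on UNIV (\<lambda>t. \<gamma>0 t i)" "\<And>t i. \<gamma>0 t i \<in> {0..1}"
    "\<And>z. (\<forall>i<card I. z i \<in> {0..1}) \<Longrightarrow> \<exists>t\<in>{0..1}. \<forall>i<card I. \<gamma>0 t i = z i"
    using space_filling_curve[of "card I"] by blast
  define \<gamma> where "\<gamma> t i = \<gamma>0 t (e i)" for t i
  have "\<exists>t\<in>{0..1}. \<forall>i\<in>I. \<gamma> t i = v i" if "\<forall>i\<in>I. v i \<in> {0..1}" for v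
  proof -
    define inv where "inv = the_inv_into I e"
    have "inv j \<in> I" if "j < card I" for j
      using that e unfolding inv_def by (metis bij_betw_imp_surj_on bij_betw_the_inv_into imageI lessThan_iff)
    with that have "\<forall>j<card I. v (inv j) \<in> {0..1}" by auto
    from g0(3)[OF this] obtain t where "t \<in> {0..1}" "\<forall>j<card I. \<gamma>0 t j = v (inv j)" by blast
    moreover have "inv (e i) = i" "e i < card I" if "i \<in> I" for i
      using that e by (auto simp: inv_def the_inv_into_f_f bij_betw_def)
    ultimately show ?thesis by (intro bexI[of _ t]) (auto simp: \<gamma>_def)
  qed
  then obtain s where s: "\<And>v. \<forall>i\<in>I. v i \<in> {0..1} \<Longrightarrow> s v \<in> {0..1} \<and> (\<forall>i\<in>I. \<gamma> (s v) i = v i)" by metis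
  have c: "continuous_on UNIV \<gamma>"
    by (rule continuous_on_coordinatewise_then_product) (simp add: \<gamma>_def g0)
  \<comment> \<open>The right inverse was chosen pointwise; on a discrete law every function is
    measurable.\<close>
  define \<mu> where "\<mu> n = distr (measure_pmf (V n)) borel s" for n
  have rd: "real_distribution (\<mu> n)" for n
    unfolding real_distribution_def real_distribution_axioms_def \<mu>_def
    by (auto intro!: measure_pmf.prob_space_distr)
  \<comment> \<open>The left end \<open>-1\<close> keeps the point \<open>0\<close> inside the
    half-open interval.\<close>
  have m1: "measure (\<mu> n) {-1<..1} = 1" for n
  proof -
    have "measure (\<mu> n) {-1<..1} = measure_pmf.prob (V n) (s -` {-1<..1})"
      unfolding \<mu>_def by (subst measure_distr) auto
    also have "\<dots> = 1"
    proof (rule measure_pmf.prob_eq_1[THEN iffD2])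
      have "s v \<in> {0..1}" if "v \<in> set_pmf (V n)" for v using s V[OF that] by blast
      then show "AE v in V n. v \<in> s -` {-1<..1}" by (fastforce simp: AE_measure_pmf_iff)
    qed auto
    finally show ?thesis .
  qed
  have "tight \<mu>"
    unfolding tight_def using rd
  proof (intro conjI allI impI)
    fix \<epsilon> :: real assume "0 < \<epsilon>"
    then show "\<exists>a b. a < b \<and> (\<forall>n. 1 - \<epsilon> < measure (\<mu> n) {a<..b})"
      using m1 by (intro exI[of _ "-1"] exI[of _ "1"]) auto
  qed
  from tight_imp_convergent_subsubsequence[OF this strict_mono_id]
  obtain r M where r: "strict_mono r" "real_distribution M" "weak_conv_m (\<mu> \<circ> id \<circ> r) M" by auto
  have "(\<lambda>n. measure_pmf.expectation (V (r n)) F) \<longlonglongrightarrow> (\<integral>t. F (\<gamma> t) \<partial>M)"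
    if F: "continuous_on UNIV F" "bounded (range F)" "\<forall>v v'. (\<forall>i\<in>I. v i = v' i) \<longrightarrow> F v = F v'" for F :: "('i \<Rightarrow> real) \<Rightarrow> real"
  proof -
    have cF: "continuous_on UNIV (\<lambda>t. F (\<gamma> t))"
      by (rule continuous_on_compose2[OF F(1) c]) auto
    obtain B where B: "\<And>v. norm (F v) \<le> B" using F(2) by (auto simp: bounded_iff)
    have "(\<lambda>n. integral\<^sup>L ((\<mu> \<circ> id \<circ> r) n) (\<lambda>t. F (\<gamma> t))) \<longlonglongrightarrow> integral\<^sup>L M (\<lambda>t. F (\<gamma> t))"
    proof (rule weak_conv_imp_integral_bdd_continuous_conv[where B = B])
      show "\<And>n. real_distribution ((\<mu> \<circ> id \<circ> r) n)" using rd by simp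
      show "isCont (\<lambda>t. F (\<gamma> t)) x" for x using cF by (simp add: continuous_on_eq_continuous_at)
    qed (use r B in \<open>auto simp: o_def\<close>)
    moreover have "integral\<^sup>L (\<mu> n) (\<lambda>t. F (\<gamma> t)) = measure_pmf.expectation (V n) F" for n
    proof -
      have "(\<lambda>t. F (\<gamma> t)) \<in> borel_measurable borel" using cF by (rule borel_measurable_continuous_onI)
      then have "integral\<^sup>L (\<mu> n) (\<lambda>t. F (\<gamma> t)) = measure_pmf.expectation (V n) (\<lambda>v. F (\<gamma> (s v)))"
        unfolding \<mu>_def by (subst integral_distr) auto
      also have "\<dots> = measure_pmf.expectation (V n) F"
      proof (rule integral_cong_AE)
        show "AE v in V n. F (\<gamma> (s v)) = F v"
        proof (rule AE_pmfI)
          fix v assume "v \<in> set_pmf (V n)"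
          then have "\<forall>i\<in>I. \<gamma> (s v) i = v i" using s[of v] V by blast
          then show "F (\<gamma> (s v)) = F v" using F(3) by blast
        qed
      qed auto
      finally show ?thesis .
    qed
    ultimately show ?thesis by simp
  qed
  moreover have "\<gamma> t i \<in> {0..1}" for t i unfolding \<gamma>_def by (rule g0(2))
  ultimately show ?thesis using c r by blast
qed

section \<open>Continuity and boundedness of the gains\<close>

text \<open>Only the point zero is delicate: \<open>ln (1 / sqrt r) \<le> 1 / sqrt r - 1\<close>
  yields the bound \<open>2 * sqrt r / ln 2\<close> on \<open>[0, 1]\<close>.\<close>

lemma continuous_on_eta: "continuous_on {0..} eta"
proof -
  have "(eta \<longlongrightarrow> eta x) (at x within {0..})" if x: "0 \<le> x" for x
  proof (cases "x = 0")
    case False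
    then have "isCont (\<lambda>r. - (r * log 2 r)) x" using x by (intro continuous_intros) auto
    then have "isCont eta x" by (simp add: eta_def[abs_def])
    then show ?thesis by (auto intro: Lim_at_imp_Lim_at_within simp: isCont_def)
  next
    case True
    have bound: "\<bar>eta r\<bar> \<le> 2 * sqrt r / ln 2" if r: "r \<in> {0..1}" for r
    proof (cases "r = 0")
      case False
      then have r0: "0 < r" "r \<le> 1" using r by auto
      have "ln (1 / sqrt r) \<le> 1 / sqrt r - 1" using r0 by (intro ln_le_minus_one) auto
      then have "- ln r \<le> 2 * (1 / sqrt r)" using r0 by (simp add: ln_div ln_sqrt)
      then have "r * - ln r \<le> r * (2 * (1 / sqrt r))" using r0 by (intro mult_left_mono) auto
      also have "\<dots> = 2 * (r / sqrt r)" by simp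
      also have "\<dots> = 2 * sqrt r" using r0 by (subst real_div_sqrt) auto
      finally have "r * - ln r / ln 2 \<le> 2 * sqrt r / ln 2" by (intro divide_right_mono) auto
      moreover have "0 \<le> r * - ln r / ln 2" using r0 by (intro divide_nonneg_nonneg mult_nonneg_nonneg) auto
      ultimately show ?thesis by (simp add: eta_def log_def)
    qed (simp add: eta_def)
    have "((\<lambda>r. 2 * sqrt r / ln 2) \<longlongrightarrow> 2 * sqrt 0 / ln 2) (at 0 within {0..})"
      by (intro tendsto_intros) auto
    then have "((\<lambda>r. 2 * sqrt r / ln 2) \<longlongrightarrow> 0) (at 0 within {0..})" by simp
    moreover have "eventually (\<lambda>r. norm (eta r) \<le> 2 * sqrt r / ln 2) (at 0 within {0..})"
      unfolding eventually_at by (rule exI[of _ 1]) (auto intro!: bound simp: dist_real_def)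
    ultimately have "(eta \<longlongrightarrow> 0) (at 0 within {0..})"
      by (rule Lim_null_comparison[rotated])
    then show ?thesis using True by (simp add: eta_def)
  qed
  then show ?thesis by (auto simp: continuous_on_def)
qed

lemma eta_bounded:
  obtains C where "\<And>r. 0 \<le> r \<Longrightarrow> r \<le> c \<Longrightarrow> \<bar>eta r\<bar> \<le> C"
proof -
  have "compact (eta ` {0..c})"
    by (intro compact_continuous_image continuous_on_subset[OF continuous_on_eta]) auto
  then have "bounded (eta ` {0..c})" by (rule compact_imp_bounded)
  then obtain C where "\<forall>x\<in>eta ` {0..c}. norm x \<le> C" by (auto simp: bounded_iff)
  then show ?thesis by (intro that[of C]) auto
qed

lemma continuous_on_weight_entropy:
  fixes b :: "'z::topological_space \<Rightarrow> 'a \<Rightarrow> real"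
  assumes "\<And>p. p \<in> D \<Longrightarrow> continuous_on UNIV (\<lambda>v. b v p)" "\<And>v p. p \<in> D \<Longrightarrow> 0 \<le> b v p"
  shows "continuous_on UNIV (\<lambda>v. weight_entropy D (b v) \<psi>)"
  unfolding weight_entropy_def
  by (intro continuous_on_sum continuous_on_compose2[OF continuous_on_eta])
     (auto intro!: continuous_on_sum assms sum_nonneg)

lemma continuous_on_table_entropy:
  fixes z :: "'z::topological_space \<Rightarrow> 'k set \<Rightarrow> ('k \<Rightarrow> 'y) \<Rightarrow> ('k \<Rightarrow> 'y) \<Rightarrow> real"
  assumes D: "snd ` D \<subseteq> Ys"
    and b: "\<And>p. p \<in> D \<Longrightarrow> continuous_on UNIV (\<lambda>v. b v p)" "\<And>v p. p \<in> D \<Longrightarrow> 0 \<le> b v p"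
    and z: "\<And>A y y'. y \<in> Ys \<Longrightarrow> y' \<in> Ys \<Longrightarrow> continuous_on UNIV (\<lambda>v. z v A y y')"
      "\<And>v A y y'. y \<in> Ys \<Longrightarrow> y' \<in> Ys \<Longrightarrow> 0 \<le> z v A y y'"
  shows "continuous_on UNIV (\<lambda>v. table_entropy D (b v) Ys (z v) A \<theta> \<phi>)"
  unfolding table_entropy_def cond_weight_entropy_def
  by (intro continuous_on_sum continuous_on_diff continuous_on_weight_entropy continuous_on_mult mult_nonneg_nonneg b z)
     (use D in auto)

lemma continuous_on_table_gain:
  fixes z :: "'z::topological_space \<Rightarrow> 'k set \<Rightarrow> ('k \<Rightarrow> 'y) \<Rightarrow> ('k \<Rightarrow> 'y) \<Rightarrow> real"
  assumes "snd ` D \<subseteq> Ys"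
    and "\<And>p. p \<in> D \<Longrightarrow> continuous_on UNIV (\<lambda>v. b v p)" "\<And>v p. p \<in> D \<Longrightarrow> 0 \<le> b v p"
    and "\<And>A y y'. y \<in> Ys \<Longrightarrow> y' \<in> Ys \<Longrightarrow> continuous_on UNIV (\<lambda>v. z v A y y')"
      "\<And>v A y y'. y \<in> Ys \<Longrightarrow> y' \<in> Ys \<Longrightarrow> 0 \<le> z v A y y'"
  shows "continuous_on UNIV (\<lambda>v. table_gain D (b v) Ys (z v) T S)"
  unfolding table_gain_def Let_def
  by (intro continuous_intros continuous_on_table_entropy assms)

lemma weight_entropy_bounded:
  assumes "finite D"
  obtains C where "\<And>b. (\<And>p. p \<in> D \<Longrightarrow> 0 \<le> b p \<and> b p \<le> 1) \<Longrightarrow> \<bar>weight_entropy D b \<psi>\<bar> \<le> C"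
proof -
  obtain C where C: "\<And>r. 0 \<le> r \<Longrightarrow> r \<le> real (card D) \<Longrightarrow> \<bar>eta r\<bar> \<le> C" using eta_bounded by blast
  have "\<bar>weight_entropy D b \<psi>\<bar> \<le> (\<Sum>c\<in>\<psi> ` D. C)" if b: "\<And>p. p \<in> D \<Longrightarrow> 0 \<le> b p \<and> b p \<le> 1" for b
    unfolding weight_entropy_def
  proof (rule order_trans[OF sum_abs], intro sum_mono C)
    fix c
    show "0 \<le> (\<Sum>p | p \<in> D \<and> \<psi> p = c. b p)" using b by (intro sum_nonneg) auto
    have "(\<Sum>p | p \<in> D \<and> \<psi> p = c. b p) \<le> (\<Sum>p\<in>D. b p)"
      using assms b by (intro sum_mono2) auto
    also have "\<dots> \<le> (\<Sum>p\<in>D. 1)" using b by (intro sum_mono) auto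
    finally show "(\<Sum>p | p \<in> D \<and> \<psi> p = c. b p) \<le> real (card D)" by simp
  qed
  then show ?thesis by (rule that)
qed

lemma table_entropy_bounded:
  fixes D :: "('a \<times> ('k \<Rightarrow> 'y)) set" and \<theta> :: "'a \<times> ('k \<Rightarrow> 'y) \<Rightarrow> 'b" and \<phi> :: "'a \<times> ('k \<Rightarrow> 'y) \<Rightarrow> 'c"
    and A :: "'k set"
  assumes "finite D" "snd ` D \<subseteq> Ys"
  obtains C where "\<And>b z. (\<And>p. p \<in> D \<Longrightarrow> 0 \<le> b p \<and> b p \<le> 1) \<Longrightarrow>
    (\<And>y y'. y \<in> Ys \<Longrightarrow> y' \<in> Ys \<Longrightarrow> 0 \<le> z A y y' \<and> z A y y' \<le> 1) \<Longrightarrow> \<bar>table_entropy D b Ys z A \<theta> \<phi>\<bar> \<le> C"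
proof -
  obtain C1 where C1: "\<And>b. (\<And>p. p \<in> D \<Longrightarrow> 0 \<le> b p \<and> b p \<le> 1) \<Longrightarrow> \<bar>weight_entropy D b (\<lambda>p. (\<theta> p, \<phi> p))\<bar> \<le> C1"
    using weight_entropy_bounded[OF assms(1)] by blast
  obtain C2 where C2: "\<And>b. (\<And>p. p \<in> D \<Longrightarrow> 0 \<le> b p \<and> b p \<le> 1) \<Longrightarrow> \<bar>weight_entropy D b \<phi>\<bar> \<le> C2"
    using weight_entropy_bounded[OF assms(1)] by blast
  have "\<bar>table_entropy D b Ys z A \<theta> \<phi>\<bar> \<le> (\<Sum>y\<in>Ys. C1 + C2)"
    if b: "\<And>p. p \<in> D \<Longrightarrow> 0 \<le> b p \<and> b p \<le> 1"
      and z: "\<And>y y'. y \<in> Ys \<Longrightarrow> y' \<in> Ys \<Longrightarrow> 0 \<le> z A y y' \<and> z A y y' \<le> 1" for b z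
    unfolding table_entropy_def
  proof (rule order_trans[OF sum_abs], rule sum_mono)
    fix y assume y: "y \<in> Ys"
    have "0 \<le> b p * z A y (snd p) \<and> b p * z A y (snd p) \<le> 1" if p: "p \<in> D" for p
    proof -
      have "snd p \<in> Ys" using assms(2) p by auto
      then show ?thesis using b[OF p] z[OF y] by (auto intro: mult_le_one)
    qed
    from C1[of "\<lambda>p. b p * z A y (snd p)", OF this] C2[of "\<lambda>p. b p * z A y (snd p)", OF this]
    show "\<bar>cond_weight_entropy D (\<lambda>p. b p * z A y (snd p)) \<theta> \<phi>\<bar> \<le> C1 + C2"
      unfolding cond_weight_entropy_def by linarith
  qed
  then show ?thesis by (rule that)
qed

text \<open>The constant is uniform over all weights and tables with entries in the unit interval.
  This makes the gain an admissible test function for weak limits and the set \<open>gains\<close>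
  bounded.\<close>

lemma table_gain_bounded:
  fixes D :: "(('l \<Rightarrow> 'x) \<times> ('k \<Rightarrow> 'y)) set"
  assumes "finite D" "snd ` D \<subseteq> Ys"
  obtains C where "\<And>b z. (\<And>p. p \<in> D \<Longrightarrow> 0 \<le> b p \<and> b p \<le> 1) \<Longrightarrow>
    (\<And>A y y'. y \<in> Ys \<Longrightarrow> y' \<in> Ys \<Longrightarrow> 0 \<le> z A y y' \<and> z A y y' \<le> 1) \<Longrightarrow> \<bar>table_gain D b Ys z T S\<bar> \<le> C"
proof -
  let ?X = "\<lambda>T p. restrict (fst p) T" and ?Y = "\<lambda>p. restrict (snd p) S"
  let ?ok = "\<lambda>(b :: ('l \<Rightarrow> 'x) \<times> ('k \<Rightarrow> 'y) \<Rightarrow> real) (z :: 'k set \<Rightarrow> ('k \<Rightarrow> 'y) \<Rightarrow> ('k \<Rightarrow> 'y) \<Rightarrow> real). (\<forall>p\<in>D. 0 \<le> b p \<and> b p \<le> 1) \<and> (\<forall>A. \<forall>y\<in>Ys. \<forall>y'\<in>Ys. 0 \<le> z A y y' \<and> z A y y' \<le> 1)"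
  obtain C1 where C1: "\<And>b z. ?ok b z \<Longrightarrow> \<bar>table_entropy D b Ys z UNIV ?Y (?X UNIV)\<bar> \<le> C1"
    using table_entropy_bounded[OF assms, of UNIV ?Y "?X UNIV"] by metis
  obtain C2 where C2: "\<And>b z. ?ok b z \<Longrightarrow> \<bar>table_entropy D b Ys z (-S) ?Y (?X UNIV)\<bar> \<le> C2"
    using table_entropy_bounded[OF assms, of "-S" ?Y "?X UNIV"] by metis
  obtain C3 where C3: "\<And>b z. ?ok b z \<Longrightarrow> \<bar>table_entropy D b Ys z {} (?X T) (?X (-T))\<bar> \<le> C3"
    using table_entropy_bounded[OF assms, of "{}" "?X T" "?X (-T)"] by metis
  obtain C4 where C4: "\<And>b z. ?ok b z \<Longrightarrow> \<bar>table_entropy D b Ys z (-S) (?X T) (?X (-T))\<bar> \<le> C4"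
    using table_entropy_bounded[OF assms, of "-S" "?X T" "?X (-T)"] by metis
  show ?thesis
  proof (rule that[of "C1 + C2 + C3 + C4"])
    fix b :: "('l \<Rightarrow> 'x) \<times> ('k \<Rightarrow> 'y) \<Rightarrow> real" and z :: "'k set \<Rightarrow> ('k \<Rightarrow> 'y) \<Rightarrow> ('k \<Rightarrow> 'y) \<Rightarrow> real"
    assume "\<And>p. p \<in> D \<Longrightarrow> 0 \<le> b p \<and> b p \<le> 1"
      "\<And>A y y'. y \<in> Ys \<Longrightarrow> y' \<in> Ys \<Longrightarrow> 0 \<le> z A y y' \<and> z A y y' \<le> 1"
    then have "?ok b z" by blast
    from C1[OF this] C2[OF this] C3[OF this] C4[OF this]
    show "\<bar>table_gain D b Ys z T S\<bar> \<le> C1 + C2 + C3 + C4"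
      unfolding table_gain_def Let_def by linarith
  qed
qed

lemma weight_entropy_cong: "(\<And>p. p \<in> D \<Longrightarrow> b p = b' p) \<Longrightarrow> weight_entropy D b \<psi> = weight_entropy D b' \<psi>"
  unfolding weight_entropy_def by (intro sum.cong refl arg_cong[where f = eta]) auto

lemma table_entropy_cong:
  assumes "snd ` D \<subseteq> Ys" "\<And>p. p \<in> D \<Longrightarrow> b p = b' p" "\<And>y y'. y \<in> Ys \<Longrightarrow> y' \<in> Ys \<Longrightarrow> z A y y' = z' A y y'"
  shows "table_entropy D b Ys z A \<theta> \<phi> = table_entropy D b' Ys z' A \<theta> \<phi>"
  unfolding table_entropy_def cond_weight_entropy_def
  by (intro sum.cong refl arg_cong2[where f = "(-)"] weight_entropy_cong) (use assms in auto)

lemma table_gain_cong: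
  assumes "snd ` D \<subseteq> Ys" "\<And>p. p \<in> D \<Longrightarrow> b p = b' p" "\<And>A y y'. y \<in> Ys \<Longrightarrow> y' \<in> Ys \<Longrightarrow> z A y y' = z' A y y'"
  shows "table_gain D b Ys z T S = table_gain D b' Ys z' T S"
  unfolding table_gain_def Let_def
  by (intro arg_cong2[where f = "(-)"] arg_cong2[where f = "(+)"] table_entropy_cong assms)

section \<open>Finite measures determined by continuous functions\<close>

text \<open>The integrands are continuous and decrease to the indicator of \<open>K\<close>, since
  off a closed set the distance to it is positive.\<close>

lemma integral_infdist_tendsto_measure:
  fixes K :: "'a::metric_space set"
  assumes L: "sets L = sets borel" "finite_measure L" and K: "closed K" "K \<noteq> {}"
  shows "(\<lambda>n. integral\<^sup>L L (\<lambda>x. max 0 (1 - real n * infdist x K))) \<longlonglongrightarrow> measure L K"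
proof -
  interpret L: finite_measure L by fact
  have cont: "continuous_on UNIV (\<lambda>x. max 0 (1 - real n * infdist x K))" for n
    by (intro continuous_intros)
  have "(\<lambda>n. integral\<^sup>L L (\<lambda>x. max 0 (1 - real n * infdist x K))) \<longlonglongrightarrow> integral\<^sup>L L (indicator K)"
  proof (rule integral_dominated_convergence[where w = "\<lambda>_. 1"])
    show "(\<lambda>x. max 0 (1 - real n * infdist x K)) \<in> borel_measurable L" for n
      using borel_measurable_continuous_onI[OF cont] L(1) by (simp cong: measurable_cong_sets)
    show "indicator K \<in> borel_measurable L" using L(1) K(1) by (intro borel_measurable_indicator) simp
    show "AE x in L. norm (max 0 (1 - real n * infdist x K)) \<le> 1" for n
      by (auto simp: infdist_nonneg)
    show "AE x in L. (\<lambda>n. max 0 (1 - real n * infdist x K)) \<longlonglongrightarrow> indicator K x"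
    proof (rule AE_I2)
      fix x
      show "(\<lambda>n. max 0 (1 - real n * infdist x K)) \<longlonglongrightarrow> indicator K x"
      proof (cases "x \<in> K")
        case False
        then have pos: "0 < infdist x K" using K by (metis in_closed_iff_infdist_zero infdist_nonneg order_le_less)
        obtain n0 :: nat where n0: "1 / infdist x K < n0" using reals_Archimedean2 by blast
        have "\<forall>\<^sub>F n in sequentially. max 0 (1 - real n * infdist x K) = 0"
        proof (rule eventually_sequentiallyI[of n0])
          fix n assume "n0 \<le> n"
          then have "1 / infdist x K < n" using n0 by linarith
          then have "1 < real n * infdist x K" using pos by (simp add: field_simps)
          then show "max 0 (1 - real n * infdist x K) = 0" by simp
        qed
        then show ?thesis using False by (simp add: tendsto_eventually)
      qed simp
    qed
  qed simp
  moreover have "integral\<^sup>L L (indicator K) = measure L K"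
    using L(1) K(1) by (simp add: sets_eq_imp_space_eq[OF L(1)])
  ultimately show ?thesis by simp
qed

text \<open>Closed sets form an intersection-stable generator and their indicators are limits of
  continuous functions. The sum on the right suits the exchange identity, which the weak limit
  supplies for continuous functions and which is wanted for Borel sets.\<close>

lemma measure_eq_sum_if_integral_eq:
  fixes N :: "'i \<Rightarrow> 'a::metric_space measure" and L :: "'a measure"
  assumes J: "finite J" and L: "sets L = sets borel" "finite_measure L"
    and N: "\<And>i. i \<in> J \<Longrightarrow> sets (N i) = sets borel" "\<And>i. i \<in> J \<Longrightarrow> finite_measure (N i)"
    and int: "\<And>h :: 'a \<Rightarrow> real. continuous_on UNIV h \<Longrightarrow> (\<And>x. 0 \<le> h x \<and> h x \<le> 1) \<Longrightarrow>
      integral\<^sup>L L h = (\<Sum>i\<in>J. integral\<^sup>L (N i) h)"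
    and B: "B \<in> sets borel"
  shows "measure L B = (\<Sum>i\<in>J. measure (N i) B)"
proof -
  interpret L: finite_measure L by fact
  have closed: "measure L K = (\<Sum>i\<in>J. measure (N i) K)" if K: "closed K" for K
  proof (cases "K = {}")
    case False
    have "(\<lambda>n. \<Sum>i\<in>J. integral\<^sup>L (N i) (\<lambda>x. max 0 (1 - real n * infdist x K))) \<longlonglongrightarrow> (\<Sum>i\<in>J. measure (N i) K)"
      by (intro tendsto_sum integral_infdist_tendsto_measure N K False)
    moreover have "integral\<^sup>L L (\<lambda>x. max 0 (1 - real n * infdist x K))
        = (\<Sum>i\<in>J. integral\<^sup>L (N i) (\<lambda>x. max 0 (1 - real n * infdist x K)))" for n
      by (rule int) (auto intro!: continuous_intros simp: infdist_nonneg)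
    ultimately have "(\<lambda>n. integral\<^sup>L L (\<lambda>x. max 0 (1 - real n * infdist x K))) \<longlonglongrightarrow> (\<Sum>i\<in>J. measure (N i) K)"
      by simp
    with integral_infdist_tendsto_measure[OF L K False] show ?thesis by (rule LIMSEQ_unique)
  qed simp
  have UL: "space L = UNIV" using sets_eq_imp_space_eq[OF L(1)] by simp
  have UN: "space (N i) = UNIV" if "i \<in> J" for i using sets_eq_imp_space_eq[OF N(1)[OF that]] by simp
  have gen: "sets (borel :: 'a measure) = sigma_sets UNIV (Collect closed)"
    by (subst borel_eq_closed) (simp add: sets_measure_of)
  have "Int_stable (Collect closed :: 'a set set)" "Collect closed \<subseteq> Pow (UNIV :: 'a set)"
    by (auto simp: Int_stable_def)
  moreover have "B \<in> sigma_sets UNIV (Collect closed)" using B gen by simp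
  ultimately show ?thesis
  proof (induction rule: sigma_sets_induct_disjoint)
    case (compl A)
    have A: "A \<in> sets borel" using compl(1) gen by simp
    have "measure L (UNIV - A) = measure L UNIV - measure L A"
      using L.finite_measure_compl[of A] A L(1) UL by simp
    also have "\<dots> = (\<Sum>i\<in>J. measure (N i) UNIV - measure (N i) A)"
      using closed[of UNIV] compl(2) by (simp add: sum_subtractf)
    also have "\<dots> = (\<Sum>i\<in>J. measure (N i) (UNIV - A))"
      using finite_measure.finite_measure_compl[OF N(2)] A N(1) UN by (intro sum.cong refl) simp
    finally show ?case .
  next
    case (union A)
    have A: "range A \<subseteq> sets borel" using union(2) gen by auto
    have "(\<lambda>n. measure L (A n)) sums measure L (\<Union>n. A n)"
      by (rule L.finite_measure_UNION) (use A L(1) union(1) in auto)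
    moreover have "(\<lambda>n. \<Sum>i\<in>J. measure (N i) (A n)) sums (\<Sum>i\<in>J. measure (N i) (\<Union>n. A n))"
      by (intro sums_sum finite_measure.finite_measure_UNION N(2)) (use A N(1) union(1) in auto)
    ultimately show ?case using union(3) sums_unique2 by auto
  qed (simp_all add: closed)
qed

section \<open>Limits of finite structures\<close>

definition joint_law :: "('l::finite \<Rightarrow> 'x pmf) \<Rightarrow> (('l \<Rightarrow> 'x) \<Rightarrow> ('k \<Rightarrow> 'y) pmf) \<Rightarrow> (('l \<Rightarrow> 'x) \<times> ('k \<Rightarrow> 'y)) pmf" where
  "joint_law p ch = Pi_pmf UNIV undefined p \<bind> (\<lambda>x. map_pmf (Pair x) (ch x))"

lemma pmf_joint_law: "pmf (joint_law p ch) (x, y) = (\<Prod>l\<in>UNIV. pmf (p l) (x l)) * pmf (ch x) y"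
proof -
  have "pmf (joint_law p ch) (x, y) = pr (joint_law p ch) (\<lambda>\<omega>. (snd \<omega>, fst \<omega>)) (y, x)"
    unfolding pr_def measure_pmf_single[symmetric] by (intro arg_cong[where f = "measure _"]) auto
  also have "\<dots> = pr (Pi_pmf UNIV undefined p) (\<lambda>x. x) x * pr (ch x) (\<lambda>y. y) y"
    unfolding joint_law_def
    using pr_bind_pmf[of "Pi_pmf UNIV undefined p" "\<lambda>x. x" x ch "ch x" "\<lambda>y. y" y] by simp
  also have "\<dots> = pmf (Pi_pmf UNIV undefined p) x * pmf (ch x) y"
    by (simp add: pr_eq_pmf_map)
  finally show ?thesis by (simp add: pmf_Pi)
qed

lemma set_joint_law:
  assumes "\<And>l. set_pmf (p l) \<subseteq> XX l"
    and "\<And>x. (\<forall>l. x l \<in> XX l) \<Longrightarrow> set_pmf (ch x) \<subseteq> {y. \<forall>k. y k \<in> YY k}"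
  shows "set_pmf (joint_law p ch) \<subseteq> PiE UNIV XX \<times> PiE UNIV YY"
proof
  fix \<omega> assume "\<omega> \<in> set_pmf (joint_law p ch)"
  then obtain x y where \<omega>: "\<omega> = (x, y)" "x \<in> set_pmf (Pi_pmf UNIV undefined p)" "y \<in> set_pmf (ch x)"
    unfolding joint_law_def by auto
  then have "\<forall>l. x l \<in> set_pmf (p l)" by (simp add: in_set_Pi_pmf)
  then have "\<forall>l. x l \<in> XX l" using assms(1) by blast
  then show "\<omega> \<in> PiE UNIV XX \<times> PiE UNIV YY" using assms(2)[of x] \<omega> by (auto simp: PiE_iff)
qed

text \<open>The type \<open>coord\<close> may be infinite; these finitely many coordinates are the
  ones that the decoder reads.\<close>

definition coords :: "('k \<Rightarrow> 'y set) \<Rightarrow> ('k, 'y) coord set" where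
  "coords YY = Label ` (\<Union>k. YY k) \<union> (\<lambda>(B, v, y). Masked B v y) ` (UNIV \<times> PiE UNIV YY \<times> PiE UNIV YY)
    \<union> (\<lambda>(B, v, y). Pad B v y) ` (UNIV \<times> PiE UNIV YY \<times> PiE UNIV YY)"

lemma finite_coords:
  fixes YY :: "'k::finite \<Rightarrow> 'y set"
  assumes "\<And>k. finite (YY k)"
  shows "finite (coords YY)"
proof -
  have "finite (PiE UNIV YY)" by (intro finite_PiE) (auto simp: assms)
  then show ?thesis unfolding coords_def using assms by simp
qed

lemma decode_cong:
  fixes YY :: "'k::finite \<Rightarrow> 'y set"
  assumes "\<And>k cd. k \<in> A \<Longrightarrow> cd \<in> coords YY \<Longrightarrow> u k cd = u' k cd" and y: "y \<in> PiE UNIV YY"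
  shows "decode (PiE UNIV YY) A u y = decode (PiE UNIV YY) A u' y"
proof (cases "A = {}")
  case False
  then have s: "(SOME k. k \<in> A) \<in> A" by (simp add: some_in_eq)
  have "u k (Label (v k)) = u' k (Label (v k))" "u k (Masked A v y) = u' k (Masked A v y)"
    "u k (Pad A v y) = u' k (Pad A v y)" if "k \<in> A" "v \<in> PiE UNIV YY" for k v
  proof -
    have "Label (v k) \<in> coords YY" "Masked A v y \<in> coords YY" "Pad A v y \<in> coords YY"
      unfolding coords_def using that(2) y by (auto simp: PiE_iff image_iff)
    then show "u k (Label (v k)) = u' k (Label (v k))" "u k (Masked A v y) = u' k (Masked A v y)"
      "u k (Pad A v y) = u' k (Pad A v y)" using assms(1) that(1) by blast+
  qed
  then show ?thesis
    unfolding decode_def using False s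
    by (auto intro!: sum.cong prod.cong arg_cong2[where f = "(*)"] arg_cong[where f = unwrap] arg_cong2[where f = "(-)"])
qed (simp add: decode_def)

lemma continuous_on_unwrap: "continuous_on UNIV unwrap"
  unfolding unwrap_def by (intro continuous_intros) auto

lemma continuous_on_decode:
  fixes u :: "'z::topological_space \<Rightarrow> 'k \<Rightarrow> ('k, 'y) coord \<Rightarrow> real"
  assumes "\<And>k cd. continuous_on UNIV (\<lambda>v. u v k cd)"
  shows "continuous_on UNIV (\<lambda>v. decode Ys A (u v) y)"
proof (cases "A = {}")
  case False
  then show ?thesis
    unfolding decode_def
    by (simp, intro continuous_on_sum continuous_on_mult continuous_on_prod assms
        continuous_on_compose2[OF continuous_on_unwrap] continuous_on_diff) auto
qed (simp add: decode_def)

lemma borel_measurable_decode: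
  fixes u :: "'z \<Rightarrow> 'k \<Rightarrow> ('k, 'y) coord \<Rightarrow> real"
  assumes "\<And>k cd. k \<in> A \<Longrightarrow> (\<lambda>v. u v k cd) \<in> borel_measurable M"
  shows "(\<lambda>v. decode Ys A (u v) y) \<in> borel_measurable M"
proof (cases "A = {}")
  case False
  then have s: "(SOME k. k \<in> A) \<in> A" by (simp add: some_in_eq)
  have [measurable]: "unwrap \<in> borel_measurable borel"
    by (rule borel_measurable_continuous_onI[OF continuous_on_unwrap])
  have m: "(\<lambda>v. unwrap (u v (SOME k. k \<in> A) c - (\<Sum>k\<in>A. u v k c'))) \<in> borel_measurable M" for c c'
    by (rule measurable_compose[OF _ \<open>unwrap \<in> borel_measurable borel\<close>])
       (intro borel_measurable_diff borel_measurable_sum assms s)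
  show ?thesis
    unfolding decode_def using False
    by (simp, intro borel_measurable_sum borel_measurable_times borel_measurable_prod m assms)
qed (simp add: decode_def)

text \<open>Names of the real coordinates whose joint law goes to the limit: messages at all
  outputs, posteriors, and the input pmfs. The last are constant for each \<open>n\<close>;
  including them lets everything converge along one subsequence.\<close>

datatype ('k, 'y, 'l, 'x) var =
    Msg 'k 'y "('k, 'y) coord"
  | Post "'k set" "'k \<Rightarrow> 'y" "'k \<Rightarrow> 'y"
  | Inp 'l 'x

text \<open>The identity on the unit interval; it makes test functions bounded on the whole function
  space, as \<open>limit_law\<close> demands.\<close>

definition clip :: "real \<Rightarrow> real" where "clip r = max 0 (min 1 r)"

lemma clip_simps: "0 \<le> clip r" "clip r \<le> 1" "0 \<le> r \<Longrightarrow> r \<le> 1 \<Longrightarrow> clip r = r"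
  by (auto simp: clip_def)

lemma continuous_on_clip: "continuous_on S f \<Longrightarrow> continuous_on S (\<lambda>v. clip (f v))"
  unfolding clip_def by (intro continuous_intros)

definition input_weight :: "('l::finite \<Rightarrow> 'x \<Rightarrow> real) \<Rightarrow> (('l \<Rightarrow> 'x) \<Rightarrow> ('k \<Rightarrow> 'y) pmf) \<Rightarrow> ('l \<Rightarrow> 'x) \<times> ('k \<Rightarrow> 'y) \<Rightarrow> real" where
  "input_weight c ch p = (\<Prod>l\<in>UNIV. c l (fst p l)) * pmf (ch (fst p)) (snd p)"

lemma pmf_joint_law_input_weight: "pmf (joint_law p ch) = input_weight (\<lambda>l. pmf (p l)) ch"
  by (auto simp: fun_eq_iff pmf_joint_law input_weight_def)

text \<open>
  \<open>U k t y\<close> is the message of relay \<open>k\<close> when it observes \<open>y\<close> and the common randomness is \<open>t\<close>,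
  and \<open>dec A y u\<close> is the posterior of \<open>y\<close> given the messages \<open>u\<close> of the relays in \<open>A\<close>, for the
  uniform prior.
\<close>

lemma limit_structure:
  fixes XX :: "'l::finite \<Rightarrow> 'x set" and YY :: "'k::finite \<Rightarrow> 'y set"
    and ch :: "('l \<Rightarrow> 'x) \<Rightarrow> ('k \<Rightarrow> 'y) pmf" and p :: "nat \<Rightarrow> 'l \<Rightarrow> 'x pmf" and \<mu> :: "nat \<Rightarrow> ('k \<Rightarrow> 'y \<Rightarrow> 'u) pmf"
  assumes finX: "\<And>l. finite (XX l)" and finY: "\<And>k. finite (YY k)"
    and chS: "\<And>x. (\<forall>l. x l \<in> XX l) \<Longrightarrow> set_pmf (ch x) \<subseteq> {y. \<forall>k. y k \<in> YY k}"
    and pX: "\<And>n l. set_pmf (p n l) \<subseteq> XX l" and fin\<mu>: "\<And>n. finite (set_pmf (\<mu> n))"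
    and lim: "\<And>T S. (\<lambda>n. letter_gain (joint_law (p n) ch) (\<mu> n) T S) \<longlonglongrightarrow> v T S"
  defines "Ys \<equiv> PiE UNIV YY" and "D \<equiv> PiE UNIV XX \<times> PiE UNIV YY"
  shows "\<exists>(p' :: 'l \<Rightarrow> 'x pmf) M (U :: 'k \<Rightarrow> real \<Rightarrow> 'y \<Rightarrow> nat \<Rightarrow> real) dec.
    (\<forall>l. set_pmf (p' l) \<subseteq> XX l) \<and> real_distribution M \<and>
    (\<forall>k y. (\<lambda>t. U k t y) \<in> borel \<rightarrow>\<^sub>M borel) \<and>
    (\<forall>A y. dec A y \<in> borel_measurable (Pi\<^sub>M A (\<lambda>_. borel))) \<and> (\<forall>A y u. 0 \<le> dec A y u) \<and>
    (\<forall>A. \<forall>y\<in>Ys. \<forall>y'\<in>Ys. AE t in M. dec A y (\<lambda>k\<in>A. U k t (y' k)) \<le> 1) \<and>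
    (\<forall>A. \<forall>y\<in>Ys. \<forall>B\<in>sets (Pi\<^sub>M A (\<lambda>_. borel)). measure M {t. (\<lambda>k\<in>A. U k t (y k)) \<in> B}
      = (\<Sum>y'\<in>Ys. \<integral>t. indicator B (\<lambda>k\<in>A. U k t (y' k)) * dec A y (\<lambda>k\<in>A. U k t (y' k)) \<partial>M)) \<and>
    (\<forall>T S. v T S = (\<integral>t. table_gain D (pmf (joint_law p' ch)) Ys (\<lambda>A y y'. dec A y' (\<lambda>k\<in>A. U k t (y k))) T S \<partial>M))"
proof -
  have finYs: "finite Ys" unfolding Ys_def by (intro finite_PiE) (auto simp: finY)
  have finD: "finite D" unfolding D_def using finYs finX by (auto simp: Ys_def intro!: finite_PiE)
  have DY: "snd ` D \<subseteq> Ys" by (auto simp: D_def Ys_def)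
  have setJ: "set_pmf (joint_law (p n) ch) \<subseteq> D" for n
    unfolding D_def by (rule set_joint_law) (use pX chS in blast)+
  \<comment> \<open>The quantisation step \<open>1 / (n + 1)\<close> tends to zero, so decoding
    becomes exact in the limit.\<close>
  let ?N = "\<lambda>n. real_of_int (int n + 1)"
  define ok where "ok n P \<longleftrightarrow> finite (set_pmf P) \<and>
    (\<forall>\<omega>\<in>set_pmf P. (\<forall>k v cd. fst \<omega> k v cd \<in> {0..1}) \<and>
      (\<forall>A. \<forall>y\<in>Ys. \<forall>y'\<in>Ys. snd \<omega> A y y' \<in> {0..1} \<and> \<bar>decode Ys A (\<lambda>k. fst \<omega> k (y k)) y' - snd \<omega> A y y'\<bar> \<le> 1 / ?N n)) \<and>
    map_pmf snd P = map_pmf (post_table Ys (\<mu> n)) (\<mu> n) \<and>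
    (\<forall>A h. \<forall>y\<in>Ys. (\<forall>u. \<bar>h u\<bar> \<le> 1) \<longrightarrow>
      \<bar>measure_pmf.expectation P (\<lambda>\<omega>. h (\<lambda>k\<in>A. fst \<omega> k (y k)))
       - (\<Sum>y'\<in>Ys. measure_pmf.expectation P (\<lambda>\<omega>. h (\<lambda>k\<in>A. fst \<omega> k (y' k)) * decode Ys A (\<lambda>k. fst \<omega> k (y' k)) y))\<bar>
      \<le> card Ys / ?N n)"
    for n and P :: "(('k \<Rightarrow> 'y \<Rightarrow> ('k, 'y) coord \<Rightarrow> real) \<times> ('k set \<Rightarrow> ('k \<Rightarrow> 'y) \<Rightarrow> ('k \<Rightarrow> 'y) \<Rightarrow> real)) pmf"
  have "\<exists>P. ok n P" for n
    unfolding ok_def by (rule finite_structure_approx[OF finY _ fin\<mu>]) (auto simp: Ys_def)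
  then obtain P where okP: "\<And>n. ok n (P n)" by metis
  note okP' = okP[unfolded ok_def]
  have finP: "finite (set_pmf (P n))" for n using okP'[of n] by (rule conjunct1)
  have Pset: "(\<forall>k v cd. fst \<omega> k v cd \<in> {0..1}) \<and>
      (\<forall>A. \<forall>y\<in>Ys. \<forall>y'\<in>Ys. snd \<omega> A y y' \<in> {0..1} \<and> \<bar>decode Ys A (\<lambda>k. fst \<omega> k (y k)) y' - snd \<omega> A y y'\<bar> \<le> 1 / ?N n)"
    if "\<omega> \<in> set_pmf (P n)" for n \<omega>
    by (rule bspec[OF conjunct1[OF conjunct2[OF okP'[of n]]] that])
  have Pmsg: "fst \<omega> k v cd \<in> {0..1}" if "\<omega> \<in> set_pmf (P n)" for n \<omega> k v cd
    using conjunct1[OF Pset[OF that]] by blast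
  have Ppost: "snd \<omega> A y y' \<in> {0..1}" "\<bar>decode Ys A (\<lambda>k. fst \<omega> k (y k)) y' - snd \<omega> A y y'\<bar> \<le> 1 / ?N n"
    if "\<omega> \<in> set_pmf (P n)" "y \<in> Ys" "y' \<in> Ys" for n \<omega> A y y'
    using conjunct2[OF Pset[OF that(1)]] that(2,3) by blast+
  have Psnd: "map_pmf snd (P n) = map_pmf (post_table Ys (\<mu> n)) (\<mu> n)" for n
    by (rule conjunct1[OF conjunct2[OF conjunct2[OF okP'[of n]]]])
  have Pexch: "\<bar>measure_pmf.expectation (P n) (\<lambda>\<omega>. h (\<lambda>k\<in>A. fst \<omega> k (y k)))
       - (\<Sum>y'\<in>Ys. measure_pmf.expectation (P n) (\<lambda>\<omega>. h (\<lambda>k\<in>A. fst \<omega> k (y' k)) * decode Ys A (\<lambda>k. fst \<omega> k (y' k)) y))\<bar>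
      \<le> card Ys / ?N n" if "y \<in> Ys" "\<forall>u. \<bar>h u\<bar> \<le> 1" for n A h y
    by (rule mp[OF bspec[OF spec[OF spec[OF conjunct2[OF conjunct2[OF conjunct2[OF okP'[of n]]]]]] that(1)] that(2)])
  define vec where "vec n \<omega> i = (case i of Msg k y cd \<Rightarrow> fst \<omega> k y cd | Post A y y' \<Rightarrow> snd \<omega> A y y' | Inp l x \<Rightarrow> pmf (p n l) x)"
    for n and \<omega> :: "('k \<Rightarrow> 'y \<Rightarrow> ('k, 'y) coord \<Rightarrow> real) \<times> ('k set \<Rightarrow> ('k \<Rightarrow> 'y) \<Rightarrow> ('k \<Rightarrow> 'y) \<Rightarrow> real)"
      and i :: "('k, 'y, 'l, 'x) var"
  define V where "V n = map_pmf (vec n) (P n)" for n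
  define I :: "('k, 'y, 'l, 'x) var set" where
    "I = {i. case i of Msg k y cd \<Rightarrow> y \<in> YY k \<and> cd \<in> coords YY | Post A y y' \<Rightarrow> y \<in> Ys \<and> y' \<in> Ys | Inp l x \<Rightarrow> x \<in> XX l}"
  have I: "\<And>k y cd. Msg k y cd \<in> I \<longleftrightarrow> y \<in> YY k \<and> cd \<in> coords YY" "\<And>A y y'. Post A y y' \<in> I \<longleftrightarrow> y \<in> Ys \<and> y' \<in> Ys"
    "\<And>l x. Inp l x \<in> I \<longleftrightarrow> x \<in> XX l"
    by (simp_all add: I_def)
  have finI: "finite I"
  proof (rule finite_subset)
    show "I \<subseteq> (\<lambda>(k, y, cd). Msg k y cd) ` (SIGMA k:UNIV. YY k \<times> coords YY) \<union> (\<lambda>(A, y, y'). Post A y y') ` (UNIV \<times> Ys \<times> Ys)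
      \<union> (\<lambda>(l, x). Inp l x) ` (SIGMA l:UNIV. XX l)"
    proof
      fix i assume "i \<in> I"
      then show "i \<in> (\<lambda>(k, y, cd). Msg k y cd) ` (SIGMA k:UNIV. YY k \<times> coords YY) \<union> (\<lambda>(A, y, y'). Post A y y') ` (UNIV \<times> Ys \<times> Ys)
        \<union> (\<lambda>(l, x). Inp l x) ` (SIGMA l:UNIV. XX l)"
        by (cases i) (auto simp: I image_iff)
    qed
  qed (use finY finX finYs finite_coords[of YY, OF finY] in \<open>auto intro!: finite_SigmaI\<close>)
  have V01: "w i \<in> {0..1}" if w: "w \<in> set_pmf (V n)" and i: "i \<in> I" for n w i
  proof -
    obtain \<omega> where \<omega>: "\<omega> \<in> set_pmf (P n)" "w = vec n \<omega>" using w unfolding V_def set_map_pmf by blast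
    show ?thesis
    proof (cases i)
      case (Msg k y cd) then show ?thesis using Pmsg[OF \<omega>(1)] \<omega>(2) by (simp add: vec_def del: atLeastAtMost_iff)
    next
      case (Post A y y') then show ?thesis using Ppost(1)[OF \<omega>(1)] \<omega>(2) i by (simp add: vec_def I del: atLeastAtMost_iff)
    next
      case (Inp l x) then show ?thesis using \<omega> by (simp add: vec_def pmf_le_1)
    qed
  qed
  obtain \<gamma> r M where \<gamma>: "continuous_on UNIV \<gamma>" and \<gamma>01: "\<And>t i. \<gamma> t i \<in> {0..1}" and r: "strict_mono r"
    and M: "real_distribution M"
    and conv: "\<And>F :: (('k, 'y, 'l, 'x) var \<Rightarrow> real) \<Rightarrow> real. continuous_on UNIV F \<Longrightarrow> bounded (range F) \<Longrightarrow>
      (\<forall>v v'. (\<forall>i\<in>I. v i = v' i) \<longrightarrow> F v = F v') \<Longrightarrow>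
      (\<lambda>n. measure_pmf.expectation (V (r n)) F) \<longlonglongrightarrow> (\<integral>t. F (\<gamma> t) \<partial>M)"
  proof -
    have "\<exists>\<gamma> r M. continuous_on UNIV \<gamma> \<and> (\<forall>t i. \<gamma> t i \<in> {0..1}) \<and> strict_mono r \<and> real_distribution M \<and>
      (\<forall>F :: (('k, 'y, 'l, 'x) var \<Rightarrow> real) \<Rightarrow> real. continuous_on UNIV F \<longrightarrow> bounded (range F) \<longrightarrow> (\<forall>v v'. (\<forall>i\<in>I. v i = v' i) \<longrightarrow> F v = F v') \<longrightarrow>
         (\<lambda>n. measure_pmf.expectation (V (r n)) F) \<longlonglongrightarrow> (\<integral>t. F (\<gamma> t) \<partial>M))"
      by (rule limit_law[of I V]) (rule finI, rule V01)
    then show thesis using that by blast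
  qed
  interpret M: real_distribution M by fact
  have mM: "f \<in> borel_measurable M \<longleftrightarrow> f \<in> borel_measurable borel" for f :: "real \<Rightarrow> real"
    by (simp only: measurable_cong_sets[OF M.events_eq_borel refl])
  have contI[continuous_intros]: "continuous_on UNIV (\<lambda>w :: ('k, 'y, 'l, 'x) var \<Rightarrow> real. w i)" for i
    by (rule continuous_on_product_coordinates)
  have contG: "continuous_on UNIV (\<lambda>t. F (\<gamma> t))" if "continuous_on UNIV F" for F :: "_ \<Rightarrow> 'z::topological_space"
    by (rule continuous_on_compose2[OF that \<gamma>]) auto
  have measG: "(\<lambda>t. F (\<gamma> t)) \<in> borel_measurable borel" if "continuous_on UNIV F" for F :: "_ \<Rightarrow> real"
    by (rule borel_measurable_continuous_onI[OF contG[OF that]])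
  have meas\<gamma>: "(\<lambda>t. \<gamma> t i) \<in> borel_measurable borel" for i by (rule measG[OF contI])
  have EV: "measure_pmf.expectation (V n) F = measure_pmf.expectation (P n) (\<lambda>\<omega>. F (vec n \<omega>))" for n and F :: "_ \<Rightarrow> real"
    by (simp add: V_def)
  have r_ge: "n \<le> r n" for n by (rule seq_suble[OF r])
  have rN: "(\<lambda>n. c / ?N (r n)) \<longlonglongrightarrow> 0" for c
  proof -
    have "(\<lambda>n. c / real (Suc n)) \<longlonglongrightarrow> 0" by (rule LIMSEQ_Suc[OF lim_const_over_n])
    then have "((\<lambda>n. c / real (Suc n)) \<circ> r) \<longlonglongrightarrow> 0" by (rule LIMSEQ_subseq_LIMSEQ[OF _ r])
    then show ?thesis by (simp add: o_def algebra_simps)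
  qed
  have intM: "integrable M f" if "f \<in> borel_measurable borel" "\<And>t. \<bar>f t\<bar> \<le> c" for f :: "real \<Rightarrow> real" and c
    by (rule M.integrable_const_bound[of _ c]) (use that in auto)
  \<comment> \<open>Approximate identities along the sequence become almost sure identities in the
    limit: a non-negative function of mean zero vanishes almost surely.\<close>
  have AE0: "AE t in M. F (\<gamma> t) = 0"
    if F: "continuous_on UNIV F" "\<And>w. 0 \<le> F w \<and> F w \<le> 1" "\<forall>v v'. (\<forall>i\<in>I. v i = v' i) \<longrightarrow> F v = F v'"
      and z: "(\<lambda>n. measure_pmf.expectation (V (r n)) F) \<longlonglongrightarrow> 0" for F :: "_ \<Rightarrow> real"
  proof -
    have "bounded (range F)" unfolding bounded_iff using F(2) by (intro exI[of _ 1]) auto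
    from conv[OF F(1) this F(3)] z have "(\<integral>t. F (\<gamma> t) \<partial>M) = 0" by (rule LIMSEQ_unique)
    moreover have "integrable M (\<lambda>t. F (\<gamma> t))" by (rule intM[of _ 1]) (use measG[OF F(1)] F(2) in auto)
    ultimately show ?thesis using integral_nonneg_eq_0_iff_AE[of M "\<lambda>t. F (\<gamma> t)"] F(2) by auto
  qed
  define dv where "dv A y y' w = decode Ys A (\<lambda>k cd. w (Msg k (y k) cd)) y'"
    for A y y' and w :: "('k, 'y, 'l, 'x) var \<Rightarrow> real"
  have dv_cont: "continuous_on UNIV (dv A y y')" for A y y'
    unfolding dv_def by (rule continuous_on_decode) (rule contI)
  have dv_I: "dv A y y' w = dv A y y' w'" if "y \<in> Ys" "y' \<in> Ys" "\<forall>i\<in>I. w i = w' i" for A y y' w w'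
    unfolding dv_def Ys_def by (rule decode_cong) (use that in \<open>auto simp: I Ys_def PiE_iff\<close>)
  have dv_vec: "dv A y y' (vec n \<omega>) = decode Ys A (\<lambda>k. fst \<omega> k (y k)) y'" for A y y' n \<omega>
    by (simp add: dv_def vec_def)
  \<comment> \<open>The squared decoding error, cut at one to make it bounded, has mean at most
    \<open>1 / ?N n\<close> along the sequence.\<close>
  have post: "AE t in M. dv A y y' (\<gamma> t) = \<gamma> t (Post A y y')" if y: "y \<in> Ys" "y' \<in> Ys" for A y y'
  proof -
    let ?F = "\<lambda>w. min 1 ((dv A y y' w - w (Post A y y'))\<^sup>2)"
    have "AE t in M. ?F (\<gamma> t) = 0"
    proof (rule AE0)
      show "continuous_on UNIV ?F" by (intro continuous_intros dv_cont)
      show "\<forall>v v'. (\<forall>i\<in>I. v i = v' i) \<longrightarrow> ?F v = ?F v'"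
      proof (intro allI impI)
        fix w w' :: "('k, 'y, 'l, 'x) var \<Rightarrow> real" assume h: "\<forall>i\<in>I. w i = w' i"
        then have "w (Post A y y') = w' (Post A y y')" using y by (simp add: I)
        then show "?F w = ?F w'" using dv_I[OF y h] by simp
      qed
      have le: "measure_pmf.expectation (V n) ?F \<in> {0..1 / ?N n}" for n
      proof -
        have "measure_pmf.expectation (P n) (\<lambda>\<omega>. ?F (vec n \<omega>)) \<le> measure_pmf.expectation (P n) (\<lambda>\<omega>. 1 / ?N n)"
        proof (rule integral_mono_AE)
          show "AE \<omega> in P n. ?F (vec n \<omega>) \<le> 1 / ?N n"
          proof (rule AE_pmfI)
            fix \<omega> assume "\<omega> \<in> set_pmf (P n)"
            then have d: "\<bar>decode Ys A (\<lambda>k. fst \<omega> k (y k)) y' - snd \<omega> A y y'\<bar> \<le> 1 / ?N n" by (rule Ppost(2)[OF _ y])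
            have n1: "1 / ?N n \<le> 1" by simp
            have "(decode Ys A (\<lambda>k. fst \<omega> k (y k)) y' - snd \<omega> A y y')\<^sup>2 \<le> (1 / ?N n)\<^sup>2"
              using power_mono[OF d abs_ge_zero, of 2] by (simp only: power2_abs)
            also have "\<dots> \<le> 1 / ?N n" unfolding power2_eq_square by (rule mult_left_le) (use n1 in simp_all)
            finally show "?F (vec n \<omega>) \<le> 1 / ?N n" by (simp add: dv_vec) (simp add: vec_def)
          qed
        qed (auto intro: integrable_measure_pmf_finite finP)
        moreover have "0 \<le> measure_pmf.expectation (P n) (\<lambda>\<omega>. ?F (vec n \<omega>))" by (rule integral_nonneg_AE) auto
        ultimately show ?thesis unfolding EV by simp
      qed
      show "(\<lambda>n. measure_pmf.expectation (V (r n)) ?F) \<longlonglongrightarrow> 0"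
        by (rule tendsto_sandwich[OF _ _ tendsto_const rN[of 1]]) (use le in \<open>auto intro!: always_eventually\<close>)
    qed auto
    then show ?thesis by (rule AE_mp) (auto simp: min_def split: if_splits)
  qed
  define c where "c l x = (\<integral>t. clip (\<gamma> t (Inp l x)) \<partial>M)" for l x
  have clim: "(\<lambda>n. pmf (p (r n) l) x) \<longlonglongrightarrow> c l x" if x: "x \<in> XX l" for l x
  proof -
    have "(\<lambda>n. measure_pmf.expectation (V (r n)) (\<lambda>w. clip (w (Inp l x)))) \<longlonglongrightarrow> (\<integral>t. clip (\<gamma> t (Inp l x)) \<partial>M)"
      by (rule conv) (use x I(3) in \<open>auto intro!: continuous_on_clip contI boundedI[of _ 1] simp: clip_simps\<close>)
    moreover have "measure_pmf.expectation (V n) (\<lambda>w. clip (w (Inp l x))) = pmf (p n l) x" for n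
      unfolding EV by (simp add: vec_def clip_simps pmf_le_1)
    ultimately show ?thesis by (simp add: c_def)
  qed
  \<comment> \<open>The input coordinates are deterministic along the sequence and converge, so
    their mean squared distance from the limit \<open>c l x\<close> tends to zero.\<close>
  have cAE: "AE t in M. \<gamma> t (Inp l x) = c l x" if x: "x \<in> XX l" for l x
  proof -
    let ?F = "\<lambda>w :: ('k, 'y, 'l, 'x) var \<Rightarrow> real. min 1 ((clip (w (Inp l x)) - c l x)\<^sup>2)"
    have "AE t in M. ?F (\<gamma> t) = 0"
    proof (rule AE0)
      show "continuous_on UNIV ?F" by (intro continuous_intros continuous_on_clip)
      show "\<forall>v v'. (\<forall>i\<in>I. v i = v' i) \<longrightarrow> ?F v = ?F v'" using x I(3) by metis
      have "measure_pmf.expectation (V n) ?F = min 1 ((pmf (p n l) x - c l x)\<^sup>2)" for n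
        unfolding EV by (simp add: vec_def clip_simps pmf_le_1)
      moreover have "(\<lambda>n. min 1 ((pmf (p (r n) l) x - c l x)\<^sup>2)) \<longlonglongrightarrow> min 1 ((c l x - c l x)\<^sup>2)"
        by (intro tendsto_intros clim x)
      ultimately show "(\<lambda>n. measure_pmf.expectation (V (r n)) ?F) \<longlonglongrightarrow> 0" by simp
    qed auto
    moreover have "clip (\<gamma> t (Inp l x)) = \<gamma> t (Inp l x)" for t using \<gamma>01[of t "Inp l x"] by (simp add: clip_simps)
    ultimately show ?thesis by (auto elim!: AE_mp simp: min_def split: if_splits)
  qed
  have c0: "0 \<le> c l x" for l x unfolding c_def by (intro integral_nonneg_AE) (auto simp: clip_simps)
  have c1: "(\<Sum>x\<in>XX l. c l x) = 1" for l
  proof -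
    have "(\<lambda>n. \<Sum>x\<in>XX l. pmf (p (r n) l) x) \<longlonglongrightarrow> (\<Sum>x\<in>XX l. c l x)" by (intro tendsto_sum clim)
    moreover have "(\<Sum>x\<in>XX l. pmf (p (r n) l) x) = 1" for n by (rule sum_pmf_eq_1[OF finX pX])
    ultimately show ?thesis using LIMSEQ_unique[OF _ tendsto_const] by simp
  qed
  define p' where "p' l = embed_pmf (\<lambda>x. if x \<in> XX l then c l x else 0)" for l
  have p': "pmf (p' l) x = (if x \<in> XX l then c l x else 0)" for l x
    unfolding p'_def
  proof (rule pmf_embed_pmf)
    have "(\<integral>\<^sup>+x. ennreal (if x \<in> XX l then c l x else 0) \<partial>count_space UNIV) = (\<Sum>x\<in>XX l. ennreal (if x \<in> XX l then c l x else 0))"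
      by (rule nn_integral_count_space') (auto simp: finX)
    also have "\<dots> = (\<Sum>x\<in>XX l. ennreal (c l x))" by simp
    also have "\<dots> = 1" using c0 c1[of l] by (simp add: sum_ennreal)
    finally show "(\<integral>\<^sup>+x. ennreal (if x \<in> XX l then c l x else 0) \<partial>count_space UNIV) = 1" .
  qed (simp add: c0)
  have setp': "set_pmf (p' l) \<subseteq> XX l" for l by (auto simp: set_pmf_iff p' split: if_splits)
  obtain e where e: "bij_betw e (coords YY) {..<card (coords YY)}"
    using ex_bij_betw_finite_nat[OF finite_coords[of YY, OF finY]] by (auto simp: atLeast0LessThan)
  define en where "en = the_inv_into (coords YY) e"
  define d where "d = card (coords YY)"
  have en: "en (e cd) = cd" "e cd < d" if "cd \<in> coords YY" for cd
    using e that by (auto simp: en_def d_def the_inv_into_f_f bij_betw_def)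
  have en_in: "en j \<in> coords YY" if "j < d" for j
    using e that unfolding en_def d_def by (metis bij_betw_imp_surj_on bij_betw_the_inv_into imageI lessThan_iff)
  \<comment> \<open>A message becomes a real sequence by enumerating \<open>coords YY\<close>, with
    zeros from \<open>d\<close> on.\<close>
  define U where "U k t y = (\<lambda>j. if j < d then \<gamma> t (Msg k y (en j)) else 0)" for k :: 'k and t and y :: 'y
  \<comment> \<open>For arbitrary \<open>u\<close> the decoded value may be negative; the cut at
    zero makes \<open>dec\<close> non-negative everywhere and not just almost surely.\<close>
  define dec where "dec A y u = max 0 (decode Ys A (\<lambda>k cd. if cd \<in> coords YY then u k (e cd) else 0) y)"
    for A y and u :: "'k \<Rightarrow> nat \<Rightarrow> real"
  have Umeas: "(\<lambda>t. U k t y) \<in> borel \<rightarrow>\<^sub>M borel" for k y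
  proof -
    have "continuous_on UNIV (\<lambda>t. U k t y j)" for j
      by (cases "j < d") (simp_all add: U_def contG[OF contI])
    then have "continuous_on UNIV (\<lambda>t. U k t y)" by (rule continuous_on_coordinatewise_then_product)
    then show ?thesis by (rule borel_measurable_continuous_onI)
  qed
  have decU: "dec A y' (\<lambda>k\<in>A. U k t (y k)) = max 0 (dv A y y' (\<gamma> t))" if "y' \<in> Ys" for A y y' t
    unfolding dec_def dv_def Ys_def
    by (intro arg_cong2[where f = max] refl decode_cong) (use that en in \<open>auto simp: U_def Ys_def\<close>)
  have decAE: "AE t in M. dec A y' (\<lambda>k\<in>A. U k t (y k)) = \<gamma> t (Post A y y')" if y: "y \<in> Ys" "y' \<in> Ys" for A y y'
    using post[OF y, of A] by (rule AE_mp) (use \<gamma>01 in \<open>auto simp: decU[OF y(2)]\<close>)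
  have decmeas: "dec A y \<in> borel_measurable (Pi\<^sub>M A (\<lambda>_. borel))" for A y
  proof -
    have "(\<lambda>u :: 'k \<Rightarrow> nat \<Rightarrow> real. if cd \<in> coords YY then u k (e cd) else 0) \<in> borel_measurable (Pi\<^sub>M A (\<lambda>_. borel))"
      if k: "k \<in> A" for k cd
    proof -
      have "(\<lambda>u. u k) \<in> Pi\<^sub>M A (\<lambda>_. borel :: (nat \<Rightarrow> real) measure) \<rightarrow>\<^sub>M borel" using k by (rule measurable_component_singleton)
      moreover have "(\<lambda>w. w (e cd)) \<in> borel_measurable (borel :: (nat \<Rightarrow> real) measure)"
        by (rule borel_measurable_continuous_onI) (rule continuous_on_product_coordinates)
      ultimately have "(\<lambda>u. u k (e cd)) \<in> borel_measurable (Pi\<^sub>M A (\<lambda>_. borel :: (nat \<Rightarrow> real) measure))"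
        by (rule measurable_compose)
      then show ?thesis by (cases "cd \<in> coords YY") auto
    qed
    then show ?thesis
      unfolding dec_def[abs_def] by (intro borel_measurable_max borel_measurable_const borel_measurable_decode)
  qed
  \<comment> \<open>The limit of the exchange identity: under \<open>y\<close>, the messages of
    \<open>A\<close> have density \<open>dec A y\<close> against the sum of their laws under all
    \<open>y'\<close>.\<close>
  have density: "measure M {t. (\<lambda>k\<in>A. U k t (y k)) \<in> B}
      = (\<Sum>y'\<in>Ys. \<integral>t. indicator B (\<lambda>k\<in>A. U k t (y' k)) * dec A y (\<lambda>k\<in>A. U k t (y' k)) \<partial>M)"
    if y: "y \<in> Ys" and B: "B \<in> sets (Pi\<^sub>M A (\<lambda>_. borel))" for A y B
  proof -
    \<comment> \<open>The messages of \<open>A\<close>, extended by zeros to total functions, all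
      lie in one metric space, where continuous functions can test their laws.\<close>
    define uA where "uA y w = (\<lambda>k j. if k \<in> A \<and> j < d then w (Msg k (y k) (en j)) else 0)"
      for y and w :: "('k, 'y, 'l, 'x) var \<Rightarrow> real"
    have uA_cont: "continuous_on UNIV (uA y)" for y
      
    proof (unfold uA_def, intro continuous_on_coordinatewise_then_product)
      fix k j
      show "continuous_on UNIV (\<lambda>w :: ('k, 'y, 'l, 'x) var \<Rightarrow> real. if k \<in> A \<and> j < d then w (Msg k (y k) (en j)) else 0)"
        by (cases "k \<in> A"; cases "j < d") (simp_all add: contI)
    qed
    have uA_meas: "(\<lambda>t. uA y (\<gamma> t)) \<in> borel_measurable borel" for y
      by (rule borel_measurable_continuous_onI[OF contG[OF uA_cont]])
    have uA_I: "uA y w = uA y w'" if "y \<in> Ys" "\<forall>i\<in>I. w i = w' i" for y w w'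
      using that en_in by (auto simp: uA_def fun_eq_iff I Ys_def PiE_iff)
    let ?g = "\<lambda>y' t. \<gamma> t (Post A y' y)"
    have main: "(\<integral>t. h (uA y (\<gamma> t)) \<partial>M) = (\<Sum>y'\<in>Ys. \<integral>t. ?g y' t * h (uA y' (\<gamma> t)) \<partial>M)"
      if h: "continuous_on UNIV h" "\<And>u. 0 \<le> h u \<and> h u \<le> 1" for h :: "('k \<Rightarrow> nat \<Rightarrow> real) \<Rightarrow> real"
    proof -
      \<comment> \<open>The defect of the exchange identity, with the posterior coordinate in the
        place of the decoder.\<close>
      define G where "G w = h (uA y w) - (\<Sum>y'\<in>Ys. clip (w (Post A y' y)) * h (uA y' w))" for w
      have hu: "continuous_on UNIV (\<lambda>w. h (uA y w))" for y
        by (rule continuous_on_compose2[OF h(1) uA_cont]) auto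
      have "(\<lambda>n. measure_pmf.expectation (V (r n)) G) \<longlonglongrightarrow> (\<integral>t. G (\<gamma> t) \<partial>M)"
      proof (rule conv)
        show "continuous_on UNIV G" unfolding G_def by (intro continuous_intros hu continuous_on_clip)
        show "bounded (range G)"
        proof (rule boundedI)
          fix x assume "x \<in> range G"
          then obtain w where x: "x = G w" by auto
          have "0 \<le> clip (w (Post A y' y)) * h (uA y' w) \<and> clip (w (Post A y' y)) * h (uA y' w) \<le> 1" for y'
            using h(2) clip_simps by (auto intro!: mult_le_one)
          then have "0 \<le> (\<Sum>y'\<in>Ys. clip (w (Post A y' y)) * h (uA y' w))" "(\<Sum>y'\<in>Ys. clip (w (Post A y' y)) * h (uA y' w)) \<le> (\<Sum>y'\<in>Ys. 1)"
            by (blast intro: sum_nonneg, blast intro: sum_mono)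
          then show "norm x \<le> 1 + card Ys" using h(2)[of "uA y w"] unfolding x G_def by auto
        qed
        show "\<forall>v v'. (\<forall>i\<in>I. v i = v' i) \<longrightarrow> G v = G v'"
        proof (intro allI impI)
          fix w w' :: "('k, 'y, 'l, 'x) var \<Rightarrow> real" assume ww: "\<forall>i\<in>I. w i = w' i"
          show "G w = G w'"
            unfolding G_def using uA_I[OF y ww] uA_I[OF _ ww] ww y by (auto simp: I intro!: sum.cong)
        qed
      qed
      moreover have "(\<lambda>n. measure_pmf.expectation (V (r n)) G) \<longlonglongrightarrow> 0"
      proof (rule Lim_null_comparison)
        \<comment> \<open>One \<open>card Ys / ?N\<close> is the error of the exchange identity, the
          other comes from replacing the decoder by the posterior coordinate.\<close>
        show "(\<lambda>n. (2 * card Ys) / ?N (r n)) \<longlonglongrightarrow> 0" by (rule rN)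
        have "\<bar>measure_pmf.expectation (V n) G\<bar> \<le> (2 * card Ys) / ?N n" for n
        proof -
          define h' where "h' u = h (\<lambda>k j. if k \<in> A \<and> j < d then u k (en j) else 0)" for u :: "'k \<Rightarrow> ('k, 'y) coord \<Rightarrow> real"
          have hv: "h (uA y (vec n \<omega>)) = h' (\<lambda>k\<in>A. fst \<omega> k (y k))" for y \<omega>
            unfolding h'_def uA_def vec_def by (intro arg_cong[where f = h]) (auto simp: fun_eq_iff)
          have h'1: "\<bar>h' u\<bar> \<le> 1" for u using h(2) by (auto simp: h'_def)
          let ?E = "measure_pmf.expectation (P n)"
          have ig: "integrable (measure_pmf (P n)) f" for f :: "_ \<Rightarrow> real" by (rule integrable_measure_pmf_finite[OF finP])
          let ?dd = "\<lambda>\<omega> y'. decode Ys A (\<lambda>k. fst \<omega> k (y' k)) y"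
          have "measure_pmf.expectation (V n) G = ?E (\<lambda>\<omega>. h' (\<lambda>k\<in>A. fst \<omega> k (y k)))
              - (\<Sum>y'\<in>Ys. ?E (\<lambda>\<omega>. clip (snd \<omega> A y' y) * h' (\<lambda>k\<in>A. fst \<omega> k (y' k))))"
            unfolding EV G_def hv by (simp add: ig vec_def)
          also have "\<dots> = (?E (\<lambda>\<omega>. h' (\<lambda>k\<in>A. fst \<omega> k (y k))) - (\<Sum>y'\<in>Ys. ?E (\<lambda>\<omega>. h' (\<lambda>k\<in>A. fst \<omega> k (y' k)) * ?dd \<omega> y')))
              + (\<Sum>y'\<in>Ys. ?E (\<lambda>\<omega>. h' (\<lambda>k\<in>A. fst \<omega> k (y' k)) * (?dd \<omega> y' - clip (snd \<omega> A y' y))))"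
            by (simp add: ig right_diff_distrib sum_subtractf mult.commute)
          finally have eq: "measure_pmf.expectation (V n) G = \<dots>" .
          have "\<bar>?E (\<lambda>\<omega>. h' (\<lambda>k\<in>A. fst \<omega> k (y' k)) * (?dd \<omega> y' - clip (snd \<omega> A y' y)))\<bar> \<le> 1 / ?N n"
            if y': "y' \<in> Ys" for y'
          proof -
            have "\<bar>?E (\<lambda>\<omega>. h' (\<lambda>k\<in>A. fst \<omega> k (y' k)) * (?dd \<omega> y' - clip (snd \<omega> A y' y)))\<bar>
                \<le> ?E (\<lambda>\<omega>. \<bar>h' (\<lambda>k\<in>A. fst \<omega> k (y' k)) * (?dd \<omega> y' - clip (snd \<omega> A y' y))\<bar>)"
              by (rule integral_abs_bound)
            also have "\<dots> \<le> ?E (\<lambda>\<omega>. 1 / ?N n)"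
            proof (rule integral_mono_AE)
              show "AE \<omega> in P n. \<bar>h' (\<lambda>k\<in>A. fst \<omega> k (y' k)) * (?dd \<omega> y' - clip (snd \<omega> A y' y))\<bar> \<le> 1 / ?N n"
              proof (rule AE_pmfI)
                fix \<omega> assume "\<omega> \<in> set_pmf (P n)"
                then have "snd \<omega> A y' y \<in> {0..1} \<and> \<bar>?dd \<omega> y' - snd \<omega> A y' y\<bar> \<le> 1 / ?N n" using Ppost[OF _ y' y] by blast
                then have "\<bar>?dd \<omega> y' - clip (snd \<omega> A y' y)\<bar> \<le> 1 / ?N n" by (simp add: clip_simps)
                then have "\<bar>h' (\<lambda>k\<in>A. fst \<omega> k (y' k))\<bar> * \<bar>?dd \<omega> y' - clip (snd \<omega> A y' y)\<bar> \<le> 1 * (1 / ?N n)"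
                  using h'1 by (intro mult_mono) auto
                then show "\<bar>h' (\<lambda>k\<in>A. fst \<omega> k (y' k)) * (?dd \<omega> y' - clip (snd \<omega> A y' y))\<bar> \<le> 1 / ?N n"
                  by (simp add: abs_mult)
              qed
            qed (rule ig)+
            finally show ?thesis by simp
          qed
          then have "(\<Sum>y'\<in>Ys. \<bar>?E (\<lambda>\<omega>. h' (\<lambda>k\<in>A. fst \<omega> k (y' k)) * (?dd \<omega> y' - clip (snd \<omega> A y' y)))\<bar>) \<le> (\<Sum>y'\<in>Ys. 1 / ?N n)"
            by (rule sum_mono)
          then have "\<bar>\<Sum>y'\<in>Ys. ?E (\<lambda>\<omega>. h' (\<lambda>k\<in>A. fst \<omega> k (y' k)) * (?dd \<omega> y' - clip (snd \<omega> A y' y)))\<bar> \<le> card Ys / ?N n"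
            by (intro order.trans[OF sum_abs]) simp
          moreover have "\<bar>?E (\<lambda>\<omega>. h' (\<lambda>k\<in>A. fst \<omega> k (y k)))
             - (\<Sum>y'\<in>Ys. ?E (\<lambda>\<omega>. h' (\<lambda>k\<in>A. fst \<omega> k (y' k)) * ?dd \<omega> y'))\<bar> \<le> card Ys / ?N n"
            by (rule Pexch[OF y]) (use h'1 in blast)
          ultimately show ?thesis unfolding eq by (simp add: add_divide_distrib)
        qed
        then show "\<forall>\<^sub>F n in sequentially. norm (measure_pmf.expectation (V (r n)) G) \<le> (2 * card Ys) / ?N (r n)"
          by (intro always_eventually) auto
      qed
      ultimately have z: "(\<integral>t. G (\<gamma> t) \<partial>M) = 0" by (rule LIMSEQ_unique)
      have cg: "clip (\<gamma> t i) = \<gamma> t i" for t i using \<gamma>01[of t i] by (simp add: clip_simps)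
      have i1: "integrable M (\<lambda>t. h (uA y (\<gamma> t)))" by (rule intM[of _ 1]) (use measG[OF hu] h(2) in auto)
      have i2: "integrable M (\<lambda>t. ?g y' t * h (uA y' (\<gamma> t)))" for y'
      proof (rule intM[of _ 1])
        show "(\<lambda>t. ?g y' t * h (uA y' (\<gamma> t))) \<in> borel_measurable borel"
          by (intro borel_measurable_times meas\<gamma> measG[OF hu])
        show "\<bar>?g y' t * h (uA y' (\<gamma> t))\<bar> \<le> 1" for t
          using h(2)[of "uA y' (\<gamma> t)"] \<gamma>01[of t "Post A y' y"] by (simp add: abs_mult mult_le_one)
      qed
      show ?thesis using z unfolding G_def cg by (simp add: i1 i2)
    qed
    let ?L = "distr M borel (\<lambda>t. uA y (\<gamma> t))"
    let ?Ni = "\<lambda>y'. distr (density M (\<lambda>t. ennreal (?g y' t))) borel (\<lambda>t. uA y' (\<gamma> t))"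
    define C where "C = {u :: 'k \<Rightarrow> nat \<Rightarrow> real. restrict u A \<in> B}"
    have C: "C \<in> sets borel"
    proof -
      have "(\<lambda>u :: 'k \<Rightarrow> nat \<Rightarrow> real. restrict u A) \<in> borel \<rightarrow>\<^sub>M Pi\<^sub>M A (\<lambda>_. borel)"
        by (rule measurable_restrict) (rule borel_measurable_continuous_onI, rule continuous_on_product_coordinates)
      from measurable_sets[OF this B] show ?thesis by (simp add: C_def vimage_def)
    qed
    have dmeas: "(\<lambda>t. uA y' (\<gamma> t)) \<in> measurable (density M (\<lambda>t. ennreal (?g y' t))) borel" for y'
      using uA_meas by simp
    have gm: "(\<lambda>t. ennreal (?g y' t)) \<in> borel_measurable M" for y' using meas\<gamma> by simp
    have fm: "finite_measure (density M (\<lambda>t. ennreal (?g y' t)))" for y'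
    proof (rule finite_measureI)
      have "(\<integral>\<^sup>+t. ennreal (?g y' t) \<partial>M) \<le> (\<integral>\<^sup>+t. 1 \<partial>M)"
        by (rule nn_integral_mono) (use \<gamma>01 in auto)
      also have "\<dots> = 1" using M.emeasure_space_1 by simp
      finally have "(\<integral>\<^sup>+t. ennreal (?g y' t) \<partial>M) < \<infinity>" by (rule order.strict_trans1) simp
      then show "emeasure (density M (\<lambda>t. ennreal (?g y' t))) (space (density M (\<lambda>t. ennreal (?g y' t)))) \<noteq> \<infinity>"
        by (subst emeasure_density) (use gm in \<open>auto simp: nn_set_integral_space\<close>)
    qed
    \<comment> \<open>By \<open>main\<close> both sides agree on continuous test functions, hence on
      Borel sets.\<close>
    have "measure ?L C = (\<Sum>y'\<in>Ys. measure (?Ni y') C)"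
    proof (rule measure_eq_sum_if_integral_eq[OF finYs _ _ _ _ _ C])
      show "finite_measure ?L" by (intro M.finite_measure_distr) (use uA_meas in simp)
      show "finite_measure (?Ni y')" for y' by (rule finite_measure.finite_measure_distr[OF fm dmeas])
      fix h :: "('k \<Rightarrow> nat \<Rightarrow> real) \<Rightarrow> real"
      assume h: "continuous_on UNIV h" "\<And>x. 0 \<le> h x \<and> h x \<le> 1"
      have hm: "h \<in> borel_measurable borel" by (rule borel_measurable_continuous_onI[OF h(1)])
      have "integral\<^sup>L ?L h = (\<integral>t. h (uA y (\<gamma> t)) \<partial>M)" using uA_meas hm by (subst integral_distr) auto
      also have "\<dots> = (\<Sum>y'\<in>Ys. \<integral>t. ?g y' t * h (uA y' (\<gamma> t)) \<partial>M)" by (rule main[OF h])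
      also have "\<dots> = (\<Sum>y'\<in>Ys. integral\<^sup>L (?Ni y') h)"
      proof (rule sum.cong[OF refl])
        fix y'
        have "integral\<^sup>L (?Ni y') h = integral\<^sup>L (density M (\<lambda>t. ennreal (?g y' t))) (\<lambda>t. h (uA y' (\<gamma> t)))"
          by (rule integral_distr[OF dmeas hm])
        also have "\<dots> = (\<integral>t. ?g y' t *\<^sub>R h (uA y' (\<gamma> t)) \<partial>M)"
          by (rule integral_density) (use meas\<gamma> \<gamma>01 measurable_compose[OF uA_meas hm] in auto)
        finally show "(\<integral>t. ?g y' t * h (uA y' (\<gamma> t)) \<partial>M) = integral\<^sup>L (?Ni y') h" by simp
      qed
      finally show "integral\<^sup>L ?L h = (\<Sum>y'\<in>Ys. integral\<^sup>L (?Ni y') h)" .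
    qed auto
    moreover have uAC: "uA y (\<gamma> t) \<in> C \<longleftrightarrow> (\<lambda>k\<in>A. U k t (y k)) \<in> B" for y t
    proof -
      have "restrict (uA y (\<gamma> t)) A = (\<lambda>k\<in>A. U k t (y k))" by (auto simp: uA_def U_def restrict_def fun_eq_iff)
      then show ?thesis by (simp add: C_def)
    qed
    moreover have "measure ?L C = measure M {t. (\<lambda>k\<in>A. U k t (y k)) \<in> B}"
      using C uA_meas by (subst measure_distr) (auto simp: vimage_def uAC)
    moreover have "measure (?Ni y') C = (\<integral>t. indicator B (\<lambda>k\<in>A. U k t (y' k)) * dec A y (\<lambda>k\<in>A. U k t (y' k)) \<partial>M)"
      if y': "y' \<in> Ys" for y'
    proof -
      have "measure (?Ni y') C = integral\<^sup>L (?Ni y') (indicator C)" using C by simp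
      also have "\<dots> = integral\<^sup>L (density M (\<lambda>t. ennreal (?g y' t))) (\<lambda>t. indicator C (uA y' (\<gamma> t)))"
        by (rule integral_distr[OF dmeas]) (use C in simp)
      also have "\<dots> = (\<integral>t. ?g y' t *\<^sub>R indicator C (uA y' (\<gamma> t)) \<partial>M)"
      proof (rule integral_density)
        show "(\<lambda>t. indicator C (uA y' (\<gamma> t)) :: real) \<in> borel_measurable M"
          unfolding mM by (rule measurable_compose[OF uA_meas borel_measurable_indicator[OF C]])
      qed (use meas\<gamma> \<gamma>01 in auto)
      also have "\<dots> = (\<integral>t. indicator B (\<lambda>k\<in>A. U k t (y' k)) * dec A y (\<lambda>k\<in>A. U k t (y' k)) \<partial>M)"
      proof (rule integral_cong_AE)
        have i: "indicator C (uA y' (\<gamma> t)) = (indicator B (\<lambda>k\<in>A. U k t (y' k)) :: real)" for t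
          using uAC[of y' t] by (simp add: indicator_def)
        have m: "(\<lambda>t. indicator C (uA y' (\<gamma> t)) :: real) \<in> borel_measurable M"
          unfolding mM by (rule measurable_compose[OF uA_meas borel_measurable_indicator[OF C]])
        show "(\<lambda>t. ?g y' t *\<^sub>R (indicator C (uA y' (\<gamma> t)) :: real)) \<in> borel_measurable M"
          unfolding real_scaleR_def using m meas\<gamma>[of "Post A y' y"] by (intro borel_measurable_times) (simp_all only: mM)
        show "(\<lambda>t. indicator B (\<lambda>k\<in>A. U k t (y' k)) * dec A y (\<lambda>k\<in>A. U k t (y' k))) \<in> borel_measurable M"
          unfolding i[symmetric] decU[OF y] using m measG[OF dv_cont]
          by (intro borel_measurable_times borel_measurable_max) auto
        show "AE t in M. ?g y' t *\<^sub>R (indicator C (uA y' (\<gamma> t)) :: real) = indicator B (\<lambda>k\<in>A. U k t (y' k)) * dec A y (\<lambda>k\<in>A. U k t (y' k))"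
          using decAE[OF y' y, of A] by (rule AE_mp) (auto simp: i)
      qed
      finally show ?thesis .
    qed
    ultimately show ?thesis by simp
  qed
  \<comment> \<open>The gain is a bounded continuous function of the input and posterior
    coordinates. Along the sequence it is evaluated without error; in the limit these coordinates
    are almost surely the values of \<open>p'\<close> and of \<open>dec\<close>.\<close>
  have gain: "v T S = (\<integral>t. table_gain D (pmf (joint_law p' ch)) Ys (\<lambda>A y y'. dec A y' (\<lambda>k\<in>A. U k t (y k))) T S \<partial>M)" for T S
  proof -
    define F where "F w = table_gain D (input_weight (\<lambda>l x. clip (w (Inp l x))) ch) Ys (\<lambda>A y y'. clip (w (Post A y y'))) T S"
      for w :: "('k, 'y, 'l, 'x) var \<Rightarrow> real"
    have w0: "0 \<le> input_weight (\<lambda>l x. clip (w (Inp l x))) ch q \<and> input_weight (\<lambda>l x. clip (w (Inp l x))) ch q \<le> 1"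
      for q and w :: "('k, 'y, 'l, 'x) var \<Rightarrow> real"
      unfolding input_weight_def by (auto intro!: mult_le_one prod_le_1 mult_nonneg_nonneg prod_nonneg simp: clip_simps pmf_le_1)
    have contF: "continuous_on UNIV F"
      unfolding F_def
      by (rule continuous_on_table_gain[OF DY])
         (auto intro!: continuous_intros continuous_on_clip contI continuous_on_prod simp: input_weight_def clip_simps w0[unfolded input_weight_def])
    obtain C where C: "\<And>b z. (\<And>p. p \<in> D \<Longrightarrow> 0 \<le> b p \<and> b p \<le> 1) \<Longrightarrow>
      (\<And>A y y'. y \<in> Ys \<Longrightarrow> y' \<in> Ys \<Longrightarrow> 0 \<le> z A y y' \<and> z A y y' \<le> 1) \<Longrightarrow> \<bar>table_gain D b Ys z T S\<bar> \<le> C"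
      using table_gain_bounded[OF finD DY] by blast
    have FC: "\<bar>F w\<bar> \<le> C" for w unfolding F_def by (rule C) (auto simp: w0 clip_simps)
    have "(\<lambda>n. measure_pmf.expectation (V (r n)) F) \<longlonglongrightarrow> (\<integral>t. F (\<gamma> t) \<partial>M)"
    proof (rule conv[OF contF])
      show "bounded (range F)" using FC by (auto intro!: boundedI[of _ C])
      show "\<forall>v v'. (\<forall>i\<in>I. v i = v' i) \<longrightarrow> F v = F v'"
      proof (intro allI impI)
        fix w w' :: "('k, 'y, 'l, 'x) var \<Rightarrow> real" assume ww: "\<forall>i\<in>I. w i = w' i"
        show "F w = F w'"
          unfolding F_def input_weight_def
          by (rule table_gain_cong[OF DY]) (use ww in \<open>auto simp: I D_def PiE_iff intro!: prod.cong arg_cong2[where f = "(*)"]\<close>)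
      qed
    qed
    moreover have "measure_pmf.expectation (V n) F = letter_gain (joint_law (p n) ch) (\<mu> n) T S" for n
    proof -
      have "measure_pmf.expectation (V n) F
          = measure_pmf.expectation (P n) (\<lambda>\<omega>. table_gain D (pmf (joint_law (p n) ch)) Ys (snd \<omega>) T S)"
        unfolding EV
      proof (rule integral_cong_AE)
        show "AE \<omega> in P n. F (vec n \<omega>) = table_gain D (pmf (joint_law (p n) ch)) Ys (snd \<omega>) T S"
        proof (rule AE_pmfI)
          fix \<omega> assume \<omega>: "\<omega> \<in> set_pmf (P n)"
          have z: "snd \<omega> A y y' \<in> {0..1}" if "y \<in> Ys" "y' \<in> Ys" for A y y' using Ppost(1)[OF \<omega> that] .
          show "F (vec n \<omega>) = table_gain D (pmf (joint_law (p n) ch)) Ys (snd \<omega>) T S"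
            unfolding F_def pmf_joint_law_input_weight
          proof (rule table_gain_cong[OF DY])
            show "input_weight (\<lambda>l x. clip (vec n \<omega> (Inp l x))) ch q = input_weight (\<lambda>l. pmf (p n l)) ch q" for q
              by (simp add: input_weight_def vec_def clip_simps pmf_le_1)
            show "clip (vec n \<omega> (Post A y y')) = snd \<omega> A y y'" if "y \<in> Ys" "y' \<in> Ys" for A y y'
              using z[OF that] by (simp add: vec_def clip_simps)
          qed
        qed
      qed auto
      also have "\<dots> = measure_pmf.expectation (map_pmf snd (P n)) (\<lambda>z. table_gain D (pmf (joint_law (p n) ch)) Ys z T S)"
        by simp
      also have "map_pmf snd (P n) = map_pmf (post_table Ys (\<mu> n)) (\<mu> n)" by (rule Psnd)
      also have "measure_pmf.expectation \<dots> (\<lambda>z. table_gain D (pmf (joint_law (p n) ch)) Ys z T S)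
          = letter_gain (joint_law (p n) ch) (\<mu> n) T S"
        using letter_gain_eq_table[OF finYs fin\<mu>[of n] finD setJ[of n] DY] by simp
      finally show ?thesis .
    qed
    moreover have "(\<lambda>n. letter_gain (joint_law (p (r n)) ch) (\<mu> (r n)) T S) \<longlonglongrightarrow> v T S"
      using LIMSEQ_subseq_LIMSEQ[OF lim r] by (simp add: o_def)
    ultimately have "v T S = (\<integral>t. F (\<gamma> t) \<partial>M)" using LIMSEQ_unique by simp
    also have "\<dots> = (\<integral>t. table_gain D (pmf (joint_law p' ch)) Ys (\<lambda>A y y'. dec A y' (\<lambda>k\<in>A. U k t (y k))) T S \<partial>M)"
    proof (rule integral_cong_AE)
      show "(\<lambda>t. F (\<gamma> t)) \<in> borel_measurable M" using measG[OF contF] by simp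
      have "continuous_on UNIV (\<lambda>w. table_gain D (pmf (joint_law p' ch)) Ys (\<lambda>A y y'. max 0 (dv A y y' w)) T S)"
        by (rule continuous_on_table_gain[OF DY]) (auto intro!: continuous_intros dv_cont)
      from measG[OF this]
      have "(\<lambda>t. table_gain D (pmf (joint_law p' ch)) Ys (\<lambda>A y y'. max 0 (dv A y y' (\<gamma> t))) T S) \<in> borel_measurable M" by simp
      moreover have "table_gain D (pmf (joint_law p' ch)) Ys (\<lambda>A y y'. max 0 (dv A y y' (\<gamma> t))) T S
          = table_gain D (pmf (joint_law p' ch)) Ys (\<lambda>A y y'. dec A y' (\<lambda>k\<in>A. U k t (y k))) T S" for t
        by (rule table_gain_cong[OF DY]) (simp_all add: decU)
      ultimately show "(\<lambda>t. table_gain D (pmf (joint_law p' ch)) Ys (\<lambda>A y y'. dec A y' (\<lambda>k\<in>A. U k t (y k))) T S) \<in> borel_measurable M"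
        by simp
      have "AE t in M. \<forall>l\<in>UNIV. \<forall>x\<in>XX l. \<gamma> t (Inp l x) = c l x"
        by (intro AE_finite_allI finX cAE) auto
      moreover have "AE t in M. \<forall>A\<in>UNIV. \<forall>y\<in>Ys. \<forall>y'\<in>Ys. dec A y' (\<lambda>k\<in>A. U k t (y k)) = \<gamma> t (Post A y y')"
        by (intro AE_finite_allI finYs decAE) auto
      ultimately show "AE t in M. F (\<gamma> t) = table_gain D (pmf (joint_law p' ch)) Ys (\<lambda>A y y'. dec A y' (\<lambda>k\<in>A. U k t (y k))) T S"
      proof eventually_elim
        case (elim t)
        show ?case
          unfolding F_def pmf_joint_law_input_weight
        proof (rule table_gain_cong[OF DY])
          fix q assume "q \<in> D"
          then have "\<forall>l. fst q l \<in> XX l" by (auto simp: D_def PiE_iff)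
          then have "clip (\<gamma> t (Inp l (fst q l))) = pmf (p' l) (fst q l)" for l
            using elim(1) \<gamma>01[of t "Inp l (fst q l)"] by (simp add: p' clip_simps)
          then show "input_weight (\<lambda>l x. clip (\<gamma> t (Inp l x))) ch q = input_weight (\<lambda>l. pmf (p' l)) ch q"
            unfolding input_weight_def by simp
        next
          fix A y y' assume "y \<in> Ys" "y' \<in> Ys"
          then show "clip (\<gamma> t (Post A y y')) = dec A y' (\<lambda>k\<in>A. U k t (y k))"
            using elim(2) \<gamma>01[of t "Post A y y'"] by (simp add: clip_simps)
        qed
      qed
    qed
    finally show ?thesis .
  qed
  have dec0: "0 \<le> dec A y u" for A y u by (simp add: dec_def)
  have dec1: "AE t in M. dec A y (\<lambda>k\<in>A. U k t (y' k)) \<le> 1" if "y \<in> Ys" "y' \<in> Ys" for A y y'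
    using decAE[OF that(2,1), of A] by (rule AE_mp) (use \<gamma>01 in auto)
  show ?thesis
    using setp' M Umeas decmeas dec0 dec1 density gain by blast
qed

section \<open>Mutual information from posteriors\<close>

text \<open>Induction from events over simple functions to monotone limits; it extends the density
  identity to integrals.\<close>

lemma nn_integral_eq_sum_if_measure_eq_sum:
  assumes J: "finite J" and sets: "\<And>i. i \<in> J \<Longrightarrow> sets (N i) = sets L"
    and eq: "\<And>B. B \<in> sets L \<Longrightarrow> emeasure L B = (\<Sum>i\<in>J. emeasure (N i) B)"
    and F: "F \<in> borel_measurable L"
  shows "(\<integral>\<^sup>+u. F u \<partial>L) = (\<Sum>i\<in>J. \<integral>\<^sup>+u. F u \<partial>N i)"
proof -
  have mN: "g \<in> borel_measurable (N i)" if "g \<in> borel_measurable L" "i \<in> J" for i and g :: "_ \<Rightarrow> ennreal"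
    using that(1) measurable_cong_sets[OF sets[OF that(2)] refl] by blast
  show ?thesis using F
  proof (induction rule: borel_measurable_induct)
    case (cong f g)
    have "(\<integral>\<^sup>+u. f u \<partial>L) = (\<integral>\<^sup>+u. g u \<partial>L)" by (rule nn_integral_cong) (use cong in auto)
    moreover have "(\<integral>\<^sup>+u. f u \<partial>N i) = (\<integral>\<^sup>+u. g u \<partial>N i)" if "i \<in> J" for i
      by (rule nn_integral_cong) (use cong sets_eq_imp_space_eq[OF sets[OF that]] in auto)
    ultimately show ?case using cong by simp
  next
    case (set A)
    then show ?case using eq[OF set] sets by simp
  next
    case (mult u c)
    have "(\<integral>\<^sup>+x. c * u x \<partial>N i) = c * (\<integral>\<^sup>+x. u x \<partial>N i)" if "i \<in> J" for i
      by (rule nn_integral_cmult) (use mult mN that in blast)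
    then show ?case using mult by (simp add: nn_integral_cmult sum_distrib_left)
  next
    case (add u v)
    have "(\<integral>\<^sup>+x. v x + u x \<partial>N i) = (\<integral>\<^sup>+x. v x \<partial>N i) + (\<integral>\<^sup>+x. u x \<partial>N i)" if "i \<in> J" for i
      by (rule nn_integral_add) (use add mN that in blast)+
    then show ?case using add by (simp add: nn_integral_add sum.distrib)
  next
    case (seq f)
    have s: "(\<Squnion>i. f i) = (\<lambda>x. SUP i. f i x)" by (auto simp: fun_eq_iff image_comp)
    have L: "(\<integral>\<^sup>+x. (SUP i. f i x) \<partial>L) = (SUP i. \<integral>\<^sup>+x. f i x \<partial>L)"
      by (rule nn_integral_monotone_convergence_SUP) (use seq in auto)
    have N: "(\<integral>\<^sup>+x. (SUP n. f n x) \<partial>N i) = (SUP n. \<integral>\<^sup>+x. f n x \<partial>N i)" if "i \<in> J" for i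
      by (rule nn_integral_monotone_convergence_SUP) (use seq mN that in blast)+
    have "(SUP n. \<Sum>i\<in>J. \<integral>\<^sup>+x. f n x \<partial>N i) = (\<Sum>i\<in>J. SUP n. \<integral>\<^sup>+x. f n x \<partial>N i)"
      by (rule ennreal_SUP_sum) (use seq(3) in \<open>auto intro!: incseq_nn_integral\<close>)
    then show ?case unfolding s L using seq by (simp add: N image_comp)
  qed
qed

lemma (in prob_space) expectation_finite_range:
  fixes g :: "'b \<Rightarrow> real"
  assumes F: "finite F" and X: "X \<in> M \<rightarrow>\<^sub>M count_space F"
  shows "expectation (\<lambda>\<omega>. g (X \<omega>)) = (\<Sum>b\<in>F. measure M {\<omega>\<in>space M. X \<omega> = b} * g b)"
proof -
  have m: "{\<omega>\<in>space M. X \<omega> = b} \<in> sets M" if "b \<in> F" for b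
  proof -
    have "X -` {b} \<inter> space M \<in> sets M" using X that by (intro measurable_sets[OF X]) auto
    moreover have "X -` {b} \<inter> space M = {\<omega>\<in>space M. X \<omega> = b}" by auto
    ultimately show ?thesis by simp
  qed
  have "expectation (\<lambda>\<omega>. g (X \<omega>)) = expectation (\<lambda>\<omega>. \<Sum>b\<in>F. g b * indicator {\<omega>\<in>space M. X \<omega> = b} \<omega>)"
  proof (rule Bochner_Integration.integral_cong[OF refl])
    fix \<omega> assume w: "\<omega> \<in> space M"
    then have "X \<omega> \<in> F" using measurable_space[OF X w] by simp
    have "(\<Sum>b\<in>F. g b * indicator {\<omega>\<in>space M. X \<omega> = b} \<omega>) = (\<Sum>b\<in>F. if b = X \<omega> then g b else 0)"
      by (intro sum.cong refl) (use w in \<open>auto simp: indicator_def\<close>)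
    also have "\<dots> = g (X \<omega>)" using F \<open>X \<omega> \<in> F\<close> by simp
    finally show "g (X \<omega>) = (\<Sum>b\<in>F. g b * indicator {\<omega>\<in>space M. X \<omega> = b} \<omega>)" by simp
  qed
  also have "\<dots> = (\<Sum>b\<in>F. expectation (\<lambda>\<omega>. g b * indicator {\<omega>\<in>space M. X \<omega> = b} \<omega>))"
    by (rule Bochner_Integration.integral_sum) (use m in \<open>auto intro!: integrable_real_indicator simp: emeasure_eq_measure\<close>)
  also have "\<dots> = (\<Sum>b\<in>F. measure M {\<omega>\<in>space M. X \<omega> = b} * g b)"
    using m by (intro sum.cong refl) (simp add: mult.commute)
  finally show ?thesis .
qed

lemma (in prob_space) nn_integral_finite_range:
  fixes g :: "'b \<Rightarrow> ennreal"
  assumes F: "finite F" and X: "X \<in> M \<rightarrow>\<^sub>M count_space F"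
  shows "(\<integral>\<^sup>+b. g b \<partial>distr M (count_space F) X) = (\<Sum>b\<in>F. g b * emeasure M {\<omega>\<in>space M. X \<omega> = b})"
proof -
  have m: "emeasure (distr M (count_space F) X) {b} = emeasure M {\<omega>\<in>space M. X \<omega> = b}" if "b \<in> F" for b
    using X that by (subst emeasure_distr) (auto intro!: arg_cong[where f = "emeasure M"])
  have "(\<integral>\<^sup>+b. g b \<partial>distr M (count_space F) X) = (\<integral>\<^sup>+b. (\<Sum>c\<in>F. g c * indicator {c} b) \<partial>distr M (count_space F) X)"
    by (rule nn_integral_cong) (use F in \<open>simp add: indicator_def sum.If_cases if_distrib cong: if_cong\<close>)
  also have "\<dots> = (\<Sum>c\<in>F. \<integral>\<^sup>+b. g c * indicator {c} b \<partial>distr M (count_space F) X)"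
    by (rule nn_integral_sum) auto
  also have "\<dots> = (\<Sum>c\<in>F. g c * emeasure M {\<omega>\<in>space M. X \<omega> = c})"
    by (intro sum.cong refl) (subst nn_integral_cmult_indicator, auto simp: m)
  finally show ?thesis .
qed

text \<open>The joint law has density \<open>\<pi> b v / p b\<close> with respect to the product of
  the marginals, so its divergence is the entropy of \<open>X\<close> minus the mean entropy of the
  posterior. This form allows \<open>V\<close> to take values in any measurable space.\<close>

lemma (in prob_space) mutual_information_posterior:
  fixes \<pi> :: "'b \<Rightarrow> 'c \<Rightarrow> real"
  assumes F: "finite F" and X: "X \<in> M \<rightarrow>\<^sub>M count_space F" and V: "V \<in> M \<rightarrow>\<^sub>M T"
    and \<pi>m: "\<And>b. b \<in> F \<Longrightarrow> \<pi> b \<in> borel_measurable T" and \<pi>01: "\<And>b v. 0 \<le> \<pi> b v \<and> \<pi> b v \<le> 1"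
    and post: "\<And>b B. b \<in> F \<Longrightarrow> B \<in> sets T \<Longrightarrow>
      measure M {\<omega>\<in>space M. X \<omega> = b \<and> V \<omega> \<in> B} = expectation (\<lambda>\<omega>. \<pi> b (V \<omega>) * indicator B (V \<omega>))"
  shows "mutual_information 2 (count_space F) T X V
    = (\<Sum>b\<in>F. eta (measure M {\<omega>\<in>space M. X \<omega> = b})) - expectation (\<lambda>\<omega>. \<Sum>b\<in>F. eta (\<pi> b (V \<omega>)))"
proof -
  let ?P = "distr M (count_space F) X" and ?R = "distr M T V"
  define p where "p b = measure M {\<omega>\<in>space M. X \<omega> = b}" for b
  have p0: "0 \<le> p b" for b by (simp add: p_def)
  interpret P: prob_space ?P by (rule prob_space_distr[OF X])
  interpret R: prob_space ?R by (rule prob_space_distr[OF V])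
  interpret PR: pair_prob_space ?P ?R ..
  have [measurable]: "X \<in> M \<rightarrow>\<^sub>M count_space F" "V \<in> M \<rightarrow>\<^sub>M T" by fact+
  have \<pi>V: "(\<lambda>\<omega>. \<pi> b (V \<omega>)) \<in> borel_measurable M" if "b \<in> F" for b
    using measurable_compose[OF V \<pi>m[OF that]] .
  have i\<pi>: "integrable M (\<lambda>\<omega>. \<pi> b (V \<omega>))" if "b \<in> F" for b
    by (rule integrable_const_bound[of _ 1]) (use \<pi>V[OF that] \<pi>01 in auto)
  have pE: "p b = expectation (\<lambda>\<omega>. \<pi> b (V \<omega>))" if b: "b \<in> F" for b
  proof -
    have "p b = measure M {\<omega>\<in>space M. X \<omega> = b \<and> V \<omega> \<in> space T}"
      unfolding p_def by (rule arg_cong[where f = "measure M"]) (use measurable_space[OF V] in auto)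
    also have "\<dots> = expectation (\<lambda>\<omega>. \<pi> b (V \<omega>) * indicator (space T) (V \<omega>))" by (rule post[OF b sets.top])
    also have "\<dots> = expectation (\<lambda>\<omega>. \<pi> b (V \<omega>))"
      by (rule Bochner_Integration.integral_cong) (use measurable_space[OF V] in auto)
    finally show ?thesis .
  qed
  \<comment> \<open>For \<open>p b = 0\<close> the quotient is zero, which is the right value
    because \<open>\<pi> b (V \<omega>)\<close> is then almost surely zero.\<close>
  define f where "f = (\<lambda>(b, v). \<pi> b v / p b)"
  have sPR: "sets (?P \<Otimes>\<^sub>M ?R) = sets (count_space F \<Otimes>\<^sub>M T)" by (rule sets_pair_measure_cong) (rule sets_distr)+
  have f_meas: "f \<in> borel_measurable (?P \<Otimes>\<^sub>M ?R)"
  proof -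
    have "(\<lambda>(b, v). \<pi> b v / p b) \<in> borel_measurable (count_space F \<Otimes>\<^sub>M T)"
    proof (rule measurable_pair_measure_countable1)
      show "countable F" using F by (rule countable_finite)
      show "(\<lambda>v. (\<lambda>(b, v). \<pi> b v / p b) (b, v)) \<in> borel_measurable T" if "b \<in> F" for b
        using \<pi>m[OF that] by simp
    qed
    moreover note sPR
    ultimately show ?thesis unfolding f_def by (simp cong: measurable_cong_sets)
  qed
  have f0: "0 \<le> f z" for z using \<pi>01 p0 by (auto simp: f_def split: prod.split)
  have dens: "distr M (count_space F \<Otimes>\<^sub>M T) (\<lambda>\<omega>. (X \<omega>, V \<omega>)) = density (?P \<Otimes>\<^sub>M ?R) f"
  proof (rule measure_eqI)
    show "sets (distr M (count_space F \<Otimes>\<^sub>M T) (\<lambda>\<omega>. (X \<omega>, V \<omega>))) = sets (density (?P \<Otimes>\<^sub>M ?R) f)"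
      by (simp only: sets_distr sets_density sPR)
    fix A assume "A \<in> sets (distr M (count_space F \<Otimes>\<^sub>M T) (\<lambda>\<omega>. (X \<omega>, V \<omega>)))"
    then have A: "A \<in> sets (count_space F \<Otimes>\<^sub>M T)" by simp
    have A': "A \<in> sets (?P \<Otimes>\<^sub>M ?R)" using A by (simp only: sPR)
    define Ab where "Ab b = Pair b -` A" for b
    have Ab: "Ab b \<in> sets T" for b unfolding Ab_def by (rule sets_Pair1[OF A])
    have set_meas: "{\<omega>\<in>space M. X \<omega> = b \<and> V \<omega> \<in> B} \<in> sets M" if "b \<in> F" "B \<in> sets T" for b B
    proof -
      have "X -` {b} \<inter> space M \<in> sets M" "V -` B \<inter> space M \<in> sets M"
        using that by (auto intro: measurable_sets[OF X] measurable_sets[OF V])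
      then have "(X -` {b} \<inter> space M) \<inter> (V -` B \<inter> space M) \<in> sets M" by (rule sets.Int)
      moreover have "(X -` {b} \<inter> space M) \<inter> (V -` B \<inter> space M) = {\<omega>\<in>space M. X \<omega> = b \<and> V \<omega> \<in> B}" by auto
      ultimately show ?thesis by simp
    qed
    have slice: "(\<integral>\<^sup>+v. ennreal (f (b, v)) * indicator A (b, v) \<partial>?R) * emeasure M {\<omega>\<in>space M. X \<omega> = b}
        = emeasure M {\<omega>\<in>space M. X \<omega> = b \<and> V \<omega> \<in> Ab b}" if b: "b \<in> F" for b
    proof -
      have m: "(\<lambda>v. ennreal (f (b, v)) * indicator A (b, v)) \<in> borel_measurable T"
      proof -
        have "(\<lambda>v. ennreal (f (b, v)) * indicator A (b, v)) = (\<lambda>v. ennreal (\<pi> b v / p b) * indicator (Ab b) v)"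
          by (auto simp: Ab_def indicator_def f_def)
        then show ?thesis using \<pi>m[OF b] Ab[of b] by simp
      qed
      have "(\<integral>\<^sup>+v. ennreal (f (b, v)) * indicator A (b, v) \<partial>?R)
          = (\<integral>\<^sup>+\<omega>. ennreal (\<pi> b (V \<omega>) * indicator (Ab b) (V \<omega>) / p b) \<partial>M)"
        using m by (subst nn_integral_distr) (auto simp: f_def Ab_def indicator_def intro!: nn_integral_cong)
      also have "\<dots> = ennreal (expectation (\<lambda>\<omega>. \<pi> b (V \<omega>) * indicator (Ab b) (V \<omega>) / p b))"
      proof (rule nn_integral_eq_integral)
        have "(\<lambda>\<omega>. \<pi> b (V \<omega>) * indicator (Ab b) (V \<omega>)) \<in> borel_measurable M"
          using \<pi>V[OF b] measurable_compose[OF V borel_measurable_indicator[OF Ab[of b]]] by (rule borel_measurable_times)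
        then have "integrable M (\<lambda>\<omega>. \<pi> b (V \<omega>) * indicator (Ab b) (V \<omega>))"
          by (rule integrable_const_bound[of _ 1, rotated]) (use \<pi>01 in \<open>auto simp: indicator_def\<close>)
        then show "integrable M (\<lambda>\<omega>. \<pi> b (V \<omega>) * indicator (Ab b) (V \<omega>) / p b)" by simp
        show "AE \<omega> in M. 0 \<le> \<pi> b (V \<omega>) * indicator (Ab b) (V \<omega>) / p b" using \<pi>01 p0 by auto
      qed
      also have "\<dots> = ennreal (measure M {\<omega>\<in>space M. X \<omega> = b \<and> V \<omega> \<in> Ab b} / p b)"
        using post[OF b Ab] by simp
      finally have 1: "(\<integral>\<^sup>+v. ennreal (f (b, v)) * indicator A (b, v) \<partial>?R)
          = ennreal (measure M {\<omega>\<in>space M. X \<omega> = b \<and> V \<omega> \<in> Ab b} / p b)" .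
      have le: "measure M {\<omega>\<in>space M. X \<omega> = b \<and> V \<omega> \<in> Ab b} \<le> p b"
      proof -
        have "{\<omega>\<in>space M. X \<omega> = b} = {\<omega>\<in>space M. X \<omega> = b \<and> V \<omega> \<in> space T}" using measurable_space[OF V] by auto
        then have "{\<omega>\<in>space M. X \<omega> = b} \<in> sets M" using set_meas[OF b sets.top] by simp
        then show ?thesis unfolding p_def by (intro finite_measure_mono) auto
      qed
      have "measure M {\<omega>\<in>space M. X \<omega> = b \<and> V \<omega> \<in> Ab b} / p b * p b = measure M {\<omega>\<in>space M. X \<omega> = b \<and> V \<omega> \<in> Ab b}"
        using le by (cases "p b = 0") (auto intro: antisym)
      then show ?thesis
        unfolding 1 emeasure_eq_measure p_def[symmetric] using p0 by (simp add: ennreal_mult[symmetric])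
    qed
    have "emeasure (density (?P \<Otimes>\<^sub>M ?R) f) A = (\<integral>\<^sup>+z. ennreal (f z) * indicator A z \<partial>(?P \<Otimes>\<^sub>M ?R))"
      by (rule emeasure_density) (use f_meas A' in auto)
    also have "\<dots> = (\<integral>\<^sup>+b. \<integral>\<^sup>+v. ennreal (f (b, v)) * indicator A (b, v) \<partial>?R \<partial>?P)"
      by (rule R.nn_integral_fst[symmetric]) (use f_meas A' in measurable)
    also have "\<dots> = (\<Sum>b\<in>F. (\<integral>\<^sup>+v. ennreal (f (b, v)) * indicator A (b, v) \<partial>?R) * emeasure M {\<omega>\<in>space M. X \<omega> = b})"
      by (rule nn_integral_finite_range[OF F X])
    also have "\<dots> = (\<Sum>b\<in>F. emeasure M {\<omega>\<in>space M. X \<omega> = b \<and> V \<omega> \<in> Ab b})"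
      by (intro sum.cong refl slice)
    also have "\<dots> = emeasure M (\<Union>b\<in>F. {\<omega>\<in>space M. X \<omega> = b \<and> V \<omega> \<in> Ab b})"
      by (rule sum_emeasure) (use F set_meas Ab in \<open>auto simp: disjoint_family_on_def\<close>)
    also have "(\<Union>b\<in>F. {\<omega>\<in>space M. X \<omega> = b \<and> V \<omega> \<in> Ab b}) = (\<lambda>\<omega>. (X \<omega>, V \<omega>)) -` A \<inter> space M"
      using measurable_space[OF X] by (auto simp: Ab_def)
    also have "emeasure M \<dots> = emeasure (distr M (count_space F \<Otimes>\<^sub>M T) (\<lambda>\<omega>. (X \<omega>, V \<omega>))) A"
      by (rule emeasure_distr[symmetric]) (use A in measurable)
    finally show "emeasure (distr M (count_space F \<Otimes>\<^sub>M T) (\<lambda>\<omega>. (X \<omega>, V \<omega>))) A = emeasure (density (?P \<Otimes>\<^sub>M ?R) f) A" ..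
  qed
  have pb0: "AE \<omega> in M. \<pi> b (V \<omega>) = 0" if "b \<in> F" "p b = 0" for b
    using integral_nonneg_eq_0_iff_AE[OF i\<pi>[OF that(1)]] pE[OF that(1)] that(2) \<pi>01 by auto
  have eta_m: "eta \<in> borel_measurable borel" unfolding eta_def[abs_def] by measurable
  have eta_le: "\<exists>C. \<forall>b v. \<bar>eta (\<pi> b v)\<bar> \<le> C"
    using eta_bounded[of 1] \<pi>01 by metis
  have eta_i: "integrable M (\<lambda>\<omega>. eta (\<pi> b (V \<omega>)))" if b: "b \<in> F" for b
  proof -
    obtain C where "\<And>b v. \<bar>eta (\<pi> b v)\<bar> \<le> C" using eta_le by blast
    then show ?thesis
      by (intro integrable_const_bound[of _ C]) (use measurable_compose[OF \<pi>V[OF b] eta_m] in auto)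
  qed
  define g where "g b v = f (b, v) * log 2 (f (b, v))" for b v
  have gterm: "p b * expectation (\<lambda>\<omega>. g b (V \<omega>)) = eta (p b) - expectation (\<lambda>\<omega>. eta (\<pi> b (V \<omega>)))" if b: "b \<in> F" for b
  proof (cases "p b = 0")
    case True
    have "expectation (\<lambda>\<omega>. eta (\<pi> b (V \<omega>))) = expectation (\<lambda>\<omega>. 0)"
    proof (rule integral_cong_AE)
      show "AE \<omega> in M. eta (\<pi> b (V \<omega>)) = 0" using pb0[OF b True] by (rule AE_mp) (auto simp: eta_def)
    qed (use measurable_compose[OF \<pi>V[OF b] eta_m] in auto)
    then show ?thesis using True by (simp add: eta_def)
  next
    case False
    then have pos: "0 < p b" using p0[of b] by simp
    have "p b * g b v = - eta (\<pi> b v) - \<pi> b v * log 2 (p b)" for v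
      using pos \<pi>01[of b v] by (cases "\<pi> b v = 0") (auto simp: g_def f_def eta_def log_divide algebra_simps)
    then have "expectation (\<lambda>\<omega>. p b * g b (V \<omega>)) = expectation (\<lambda>\<omega>. - eta (\<pi> b (V \<omega>)) - \<pi> b (V \<omega>) * log 2 (p b))" by simp
    also have "\<dots> = - expectation (\<lambda>\<omega>. eta (\<pi> b (V \<omega>))) - expectation (\<lambda>\<omega>. \<pi> b (V \<omega>)) * log 2 (p b)"
      using eta_i[OF b] i\<pi>[OF b] by simp
    finally show ?thesis unfolding pE[OF b, symmetric] by (simp add: eta_def)
  qed
  have "mutual_information 2 (count_space F) T X V = KL_divergence 2 (?P \<Otimes>\<^sub>M ?R) (density (?P \<Otimes>\<^sub>M ?R) f)"
    unfolding mutual_information_def dens ..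
  also have "\<dots> = (\<integral>z. f z * log 2 (f z) \<partial>(?P \<Otimes>\<^sub>M ?R))"
    by (rule PR.KL_density) (use f_meas f0 in auto)
  also have "\<dots> = (\<integral>b. \<integral>v. g b v \<partial>?R \<partial>?P)"
  proof -
    obtain C where C: "\<And>b v. \<bar>eta (\<pi> b v)\<bar> \<le> C" using eta_le by blast
    have "integrable (?P \<Otimes>\<^sub>M ?R) (\<lambda>z. f z * log 2 (f z))"
    proof (rule PR.integrable_const_bound)
      show "(\<lambda>z. f z * log 2 (f z)) \<in> borel_measurable (?P \<Otimes>\<^sub>M ?R)" using f_meas by measurable
      \<comment> \<open>A bound uniform in \<open>b\<close> and \<open>v\<close> gives
        integrability; the sum over \<open>F\<close> dominates the bound for each single
        letter.\<close>
      have b: "\<bar>g b v\<bar> \<le> (\<Sum>b\<in>F. (C + \<bar>log 2 (p b)\<bar>) / p b)" if b: "b \<in> F" for b v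
      proof -
        have C0: "0 \<le> C" using C[of b v] by linarith
        have "\<bar>g b v\<bar> \<le> (C + \<bar>log 2 (p b)\<bar>) / p b"
        proof (cases "p b = 0")
          case False
          then have pos: "0 < p b" using p0[of b] by simp
          have "p b * g b v = - eta (\<pi> b v) - \<pi> b v * log 2 (p b)"
            using pos \<pi>01[of b v] by (cases "\<pi> b v = 0") (auto simp: g_def f_def eta_def log_divide algebra_simps)
          then have "p b * \<bar>g b v\<bar> = \<bar>- eta (\<pi> b v) - \<pi> b v * log 2 (p b)\<bar>" using pos by (metis abs_mult abs_of_pos)
          also have "\<dots> \<le> \<bar>eta (\<pi> b v)\<bar> + \<bar>\<pi> b v * log 2 (p b)\<bar>" by linarith
          also have "\<bar>\<pi> b v * log 2 (p b)\<bar> \<le> 1 * \<bar>log 2 (p b)\<bar>"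
            unfolding abs_mult using \<pi>01[of b v] by (intro mult_right_mono) auto
          finally have "p b * \<bar>g b v\<bar> \<le> C + \<bar>log 2 (p b)\<bar>" using C[of b v] by linarith
          then show ?thesis using pos by (simp add: pos_le_divide_eq mult.commute)
        qed (simp add: g_def f_def)
        also have "\<dots> \<le> (\<Sum>b\<in>F. (C + \<bar>log 2 (p b)\<bar>) / p b)"
          by (rule member_le_sum[OF b _ F]) (use C0 p0 in auto)
        finally show ?thesis .
      qed
      show "AE z in ?P \<Otimes>\<^sub>M ?R. norm (f z * log 2 (f z)) \<le> (\<Sum>b\<in>F. (C + \<bar>log 2 (p b)\<bar>) / p b)"
        by (rule AE_I2) (use b in \<open>auto simp: space_pair_measure g_def\<close>)
    qed
    from PR.integral_fst'[OF this] show ?thesis by (simp add: g_def)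
  qed
  also have "\<dots> = expectation (\<lambda>\<omega>. \<integral>v. g (X \<omega>) v \<partial>?R)"
    by (rule integral_distr[OF X]) simp
  also have "\<dots> = (\<Sum>b\<in>F. p b * (\<integral>v. g b v \<partial>?R))"
    unfolding p_def by (rule expectation_finite_range[OF F X])
  also have "\<dots> = (\<Sum>b\<in>F. p b * expectation (\<lambda>\<omega>. g b (V \<omega>)))"
  proof (rule sum.cong[OF refl])
    fix b assume b: "b \<in> F"
    have "g b \<in> borel_measurable T" unfolding g_def f_def using \<pi>m[OF b] by simp
    then show "p b * (\<integral>v. g b v \<partial>?R) = p b * expectation (\<lambda>\<omega>. g b (V \<omega>))" by (simp add: integral_distr)
  qed
  also have "\<dots> = (\<Sum>b\<in>F. eta (p b) - expectation (\<lambda>\<omega>. eta (\<pi> b (V \<omega>))))"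
    by (intro sum.cong refl gterm)
  also have "\<dots> = (\<Sum>b\<in>F. eta (p b)) - expectation (\<lambda>\<omega>. \<Sum>b\<in>F. eta (\<pi> b (V \<omega>)))"
    using eta_i by (simp add: sum_subtractf Bochner_Integration.integral_sum)
  finally show ?thesis by (simp add: p_def)
qed

lemma eta_nonneg: "0 \<le> r \<Longrightarrow> r \<le> 1 \<Longrightarrow> 0 \<le> eta r"
  by (cases "r = 0") (auto simp: eta_def mult_nonneg_nonpos)

text \<open>The entropy of the normalised weights, scaled back by the total; for total zero all
  weights vanish and so do both sides.\<close>

lemma weighted_eta_sum:
  fixes w :: "'b \<Rightarrow> real"
  assumes "finite F" "\<And>b. b \<in> F \<Longrightarrow> 0 \<le> w b"
  shows "(\<Sum>b\<in>F. w b) * (\<Sum>b\<in>F. eta (w b / (\<Sum>b\<in>F. w b))) = (\<Sum>b\<in>F. eta (w b)) - eta (\<Sum>b\<in>F. w b)"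
proof (cases "(\<Sum>b\<in>F. w b) = 0")
  case True
  then have "w b = 0" if "b \<in> F" for b using assms that by (simp add: sum_nonneg_eq_0_iff)
  then show ?thesis by (simp add: eta_def)
next
  case False
  define s where "s = (\<Sum>b\<in>F. w b)"
  have s: "0 < s" using False sum_nonneg[of F w] assms by (simp add: s_def)
  have "s * eta (w b / s) = eta (w b) + w b * log 2 s" if "b \<in> F" for b
    using s assms(2)[OF that] by (cases "w b = 0") (auto simp: eta_def log_divide algebra_simps)
  then have "s * (\<Sum>b\<in>F. eta (w b / s)) = (\<Sum>b\<in>F. eta (w b)) + (\<Sum>b\<in>F. w b) * log 2 s"
    by (simp add: sum_distrib_left sum.distrib sum_distrib_right)
  then show ?thesis by (simp add: s_def eta_def)
qed

section \<open>Random variables for a mixture of limit structures\<close>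

text \<open>One limit structure for each value \<open>q\<close> of the time-sharing variable. The
  assumption \<open>density\<close> is the defining property of a posterior for the uniform prior,
  and with it all conditional laws given the messages can be computed.\<close>

locale real_structure =
  fixes XX :: "'l::finite \<Rightarrow> 'x set" and YY :: "'k::finite \<Rightarrow> 'y set"
    and ch :: "('l \<Rightarrow> 'x) \<Rightarrow> ('k \<Rightarrow> 'y) pmf" and pQ :: "nat pmf" and pX :: "nat \<Rightarrow> 'l \<Rightarrow> 'x pmf"
    and M :: "nat \<Rightarrow> real measure" and U :: "nat \<Rightarrow> 'k \<Rightarrow> real \<Rightarrow> 'y \<Rightarrow> nat \<Rightarrow> real"
    and dec :: "nat \<Rightarrow> 'k set \<Rightarrow> ('k \<Rightarrow> 'y) \<Rightarrow> ('k \<Rightarrow> nat \<Rightarrow> real) \<Rightarrow> real"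
    and Ys :: "('k \<Rightarrow> 'y) set" and D :: "(('l \<Rightarrow> 'x) \<times> ('k \<Rightarrow> 'y)) set"
  assumes finX: "\<And>l. finite (XX l)" and neX: "\<And>l. XX l \<noteq> {}" and finY: "\<And>k. finite (YY k)" and neY: "\<And>k. YY k \<noteq> {}"
    and chS: "\<And>x. (\<forall>l. x l \<in> XX l) \<Longrightarrow> set_pmf (ch x) \<subseteq> {y. \<forall>k. y k \<in> YY k}"
    and finQ: "finite (set_pmf pQ)" and pXS: "\<And>q l. set_pmf (pX q l) \<subseteq> XX l" and M: "\<And>q. real_distribution (M q)"
    and Um: "\<And>q k y. (\<lambda>t. U q k t y) \<in> borel \<rightarrow>\<^sub>M borel"
    and decm: "\<And>q A y. dec q A y \<in> borel_measurable (Pi\<^sub>M A (\<lambda>_. borel))" and dec0: "\<And>q A y u. 0 \<le> dec q A y u"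
    and dec1: "\<And>q A y y'. y \<in> Ys \<Longrightarrow> y' \<in> Ys \<Longrightarrow> AE t in M q. dec q A y (\<lambda>k\<in>A. U q k t (y' k)) \<le> 1"
    and density: "\<And>q A y B. y \<in> Ys \<Longrightarrow> B \<in> sets (Pi\<^sub>M A (\<lambda>_. borel)) \<Longrightarrow> measure (M q) {t. (\<lambda>k\<in>A. U q k t (y k)) \<in> B}
      = (\<Sum>y'\<in>Ys. \<integral>t. indicator B (\<lambda>k\<in>A. U q k t (y' k)) * dec q A y (\<lambda>k\<in>A. U q k t (y' k)) \<partial>M q)"
    and Ys: "Ys = PiE UNIV YY" and D: "D = PiE UNIV XX \<times> PiE UNIV YY"
begin

sublocale M: real_distribution "M q" for q by (rule M)

definition base :: "(nat \<times> ('l \<Rightarrow> 'x) \<times> ('k \<Rightarrow> 'y)) pmf" where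
  "base = pQ \<bind> (\<lambda>q. map_pmf (Pair q) (joint_law (pX q) ch))"

text \<open>Independent randomness for all values of \<open>Q\<close> at once. The component with
  index \<open>q\<close> is used when \<open>Q = q\<close>, so \<open>W\<close> can have the same
  law for every \<open>q\<close> although the structures differ.\<close>

definition W0 :: "(nat \<Rightarrow> real) measure" where "W0 = Pi\<^sub>M UNIV M"

definition \<Omega> :: "(nat \<times> ('l \<Rightarrow> 'x) \<times> ('k \<Rightarrow> 'y) \<times> (nat \<Rightarrow> real)) measure" where
  "\<Omega> = distr (measure_pmf base \<Otimes>\<^sub>M W0) (count_space UNIV \<Otimes>\<^sub>M count_space UNIV \<Otimes>\<^sub>M count_space UNIV \<Otimes>\<^sub>M borel)
    (\<lambda>(p, w). (fst p, fst (snd p), snd (snd p), w))"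

definition Q :: "nat \<times> ('l \<Rightarrow> 'x) \<times> ('k \<Rightarrow> 'y) \<times> (nat \<Rightarrow> real) \<Rightarrow> nat" where "Q \<omega> = fst \<omega>"

text \<open>Off the alphabets, an event of probability zero, the values are replaced by arbitrary letters.\<close>

definition X :: "'l \<Rightarrow> nat \<times> ('l \<Rightarrow> 'x) \<times> ('k \<Rightarrow> 'y) \<times> (nat \<Rightarrow> real) \<Rightarrow> 'x" where
  "X l \<omega> = (if fst (snd \<omega>) l \<in> XX l then fst (snd \<omega>) l else SOME x. x \<in> XX l)"
definition Y :: "'k \<Rightarrow> nat \<times> ('l \<Rightarrow> 'x) \<times> ('k \<Rightarrow> 'y) \<times> (nat \<Rightarrow> real) \<Rightarrow> 'y" where
  "Y k \<omega> = (if fst (snd (snd \<omega>)) k \<in> YY k then fst (snd (snd \<omega>)) k else SOME y. y \<in> YY k)"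
definition W :: "nat \<times> ('l \<Rightarrow> 'x) \<times> ('k \<Rightarrow> 'y) \<times> (nat \<Rightarrow> real) \<Rightarrow> nat \<Rightarrow> real" where
  "W \<omega> = snd (snd (snd \<omega>))"
definition XY where "XY \<omega> = (\<lambda>l. X l \<omega>, \<lambda>k. Y k \<omega>)"

lemma finD: "finite D" and finYs: "finite Ys" and DY: "snd ` D \<subseteq> Ys"
proof -
  show "finite Ys" unfolding Ys by (intro finite_PiE) (auto simp: finY)
  then show "finite D" unfolding D Ys[symmetric] by (auto intro!: finite_PiE simp: finX)
  show "snd ` D \<subseteq> Ys" by (auto simp: D Ys)
qed

lemma set_joint: "set_pmf (joint_law (pX q) ch) \<subseteq> D"
  unfolding D by (rule set_joint_law) (use pXS chS in blast)+

lemma sets_W0: "sets W0 = sets borel"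
proof -
  have "sets W0 = sets (Pi\<^sub>M UNIV (\<lambda>_::nat. borel :: real measure))"
    unfolding W0_def by (rule sets_PiM_cong) auto
  then show ?thesis by (simp only: sets_PiM_equal_borel)
qed

lemma prob_W0: "prob_space W0"
  unfolding W0_def by (rule prob_space_PiM) (rule M.prob_space_axioms)

lemma reassoc_measurable: "(\<lambda>(p, w). (fst p, fst (snd p), snd (snd p), w)) \<in>
  measure_pmf base \<Otimes>\<^sub>M W0 \<rightarrow>\<^sub>M (count_space UNIV \<Otimes>\<^sub>M count_space UNIV \<Otimes>\<^sub>M count_space UNIV \<Otimes>\<^sub>M borel)"
proof -
  have 1: "(\<lambda>z. h (fst z)) \<in> measure_pmf base \<Otimes>\<^sub>M W0 \<rightarrow>\<^sub>M count_space UNIV" for h :: "_ \<Rightarrow> 'z"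
    by (rule measurable_compose[OF measurable_fst]) simp
  have 2: "snd \<in> measure_pmf base \<Otimes>\<^sub>M W0 \<rightarrow>\<^sub>M borel"
    using measurable_snd[of "measure_pmf base" W0] measurable_cong_sets[OF refl sets_W0] by blast
  show ?thesis
    unfolding case_prod_unfold by (intro measurable_Pair 1 2)
qed

lemma prob_\<Omega>: "prob_space \<Omega>"
proof -
  interpret W0: prob_space W0 by (rule prob_W0)
  interpret P: pair_prob_space "measure_pmf base" W0 ..
  show ?thesis unfolding \<Omega>_def by (rule P.prob_space_distr[OF reassoc_measurable])
qed

lemma space_\<Omega>: "space \<Omega> = UNIV"
  by (simp add: \<Omega>_def space_pair_measure)

lemma sets_\<Omega>: "sets \<Omega> = sets (count_space UNIV \<Otimes>\<^sub>M count_space UNIV \<Otimes>\<^sub>M count_space UNIV \<Otimes>\<^sub>M borel)"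
  by (simp add: \<Omega>_def)

lemma measurable_\<Omega>:
  "Q \<in> \<Omega> \<rightarrow>\<^sub>M count_space UNIV" "X l \<in> \<Omega> \<rightarrow>\<^sub>M count_space (XX l)" "Y k \<in> \<Omega> \<rightarrow>\<^sub>M count_space (YY k)" "W \<in> \<Omega> \<rightarrow>\<^sub>M borel"
proof -
  let ?N = "count_space UNIV \<Otimes>\<^sub>M count_space UNIV \<Otimes>\<^sub>M count_space UNIV \<Otimes>\<^sub>M borel ::
    (nat \<times> ('l \<Rightarrow> 'x) \<times> ('k \<Rightarrow> 'y) \<times> (nat \<Rightarrow> real)) measure"
  have 1: "fst \<in> ?N \<rightarrow>\<^sub>M count_space UNIV" by (rule measurable_fst)
  have 2: "(\<lambda>\<omega>. fst (snd \<omega>)) \<in> ?N \<rightarrow>\<^sub>M count_space UNIV" by (rule measurable_compose[OF measurable_snd measurable_fst])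
  have 3: "(\<lambda>\<omega>. fst (snd (snd \<omega>))) \<in> ?N \<rightarrow>\<^sub>M count_space UNIV"
    by (rule measurable_compose[OF measurable_compose[OF measurable_snd measurable_snd] measurable_fst])
  have 4: "(\<lambda>\<omega>. snd (snd (snd \<omega>))) \<in> ?N \<rightarrow>\<^sub>M borel"
    by (rule measurable_compose[OF measurable_compose[OF measurable_snd measurable_snd] measurable_snd])
  note c = measurable_cong_sets[OF sets_\<Omega> refl]
  show "Q \<in> \<Omega> \<rightarrow>\<^sub>M count_space UNIV" unfolding c using 1 by (simp add: Q_def[abs_def])
  show "W \<in> \<Omega> \<rightarrow>\<^sub>M borel" unfolding c using 4 by (simp add: W_def[abs_def])
  have "(\<lambda>x. if x l \<in> XX l then x l else SOME x. x \<in> XX l) \<in> count_space UNIV \<rightarrow>\<^sub>M count_space (XX l)"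
    using neX[of l] by (auto simp: some_in_eq)
  from measurable_compose[OF 2 this] show "X l \<in> \<Omega> \<rightarrow>\<^sub>M count_space (XX l)" unfolding c X_def[abs_def] .
  have "(\<lambda>y. if y k \<in> YY k then y k else SOME y. y \<in> YY k) \<in> count_space UNIV \<rightarrow>\<^sub>M count_space (YY k)"
    using neY[of k] by (auto simp: some_in_eq)
  from measurable_compose[OF 3 this] show "Y k \<in> \<Omega> \<rightarrow>\<^sub>M count_space (YY k)" unfolding c Y_def[abs_def] .
qed

lemma QXY_measurable: "(\<lambda>\<omega>. (Q \<omega>, XY \<omega>)) \<in> \<Omega> \<rightarrow>\<^sub>M count_space (UNIV \<times> D)"
proof -
  have "(\<lambda>\<omega>. \<lambda>l\<in>UNIV. X l \<omega>) \<in> \<Omega> \<rightarrow>\<^sub>M Pi\<^sub>M UNIV (\<lambda>l. count_space (XX l))"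
    by (rule measurable_restrict) (rule measurable_\<Omega>)
  then have x: "(\<lambda>\<omega>. \<lambda>l. X l \<omega>) \<in> \<Omega> \<rightarrow>\<^sub>M count_space (PiE UNIV XX)"
    by (subst (asm) count_space_PiM_finite) (auto simp: finX restrict_UNIV intro: countable_finite)
  have "(\<lambda>\<omega>. \<lambda>k\<in>UNIV. Y k \<omega>) \<in> \<Omega> \<rightarrow>\<^sub>M Pi\<^sub>M UNIV (\<lambda>k. count_space (YY k))"
    by (rule measurable_restrict) (rule measurable_\<Omega>)
  then have y: "(\<lambda>\<omega>. \<lambda>k. Y k \<omega>) \<in> \<Omega> \<rightarrow>\<^sub>M count_space (PiE UNIV YY)"
    by (subst (asm) count_space_PiM_finite) (auto simp: finY restrict_UNIV intro: countable_finite)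
  have cX: "countable (PiE UNIV XX)" and cY: "countable (PiE UNIV YY)"
    using finX finY by (auto intro!: countable_finite finite_PiE)
  have "(\<lambda>\<omega>. (Q \<omega>, XY \<omega>)) \<in> \<Omega> \<rightarrow>\<^sub>M count_space UNIV \<Otimes>\<^sub>M (count_space (PiE UNIV XX) \<Otimes>\<^sub>M count_space (PiE UNIV YY))"
    unfolding XY_def by (intro measurable_Pair measurable_\<Omega> x y)
  then show ?thesis
    unfolding D using cX cY by (simp add: pair_measure_countable)
qed

text \<open>The pair of \<open>Q\<close> and \<open>XY\<close> has countable range, so measurability
  in \<open>W\<close> may be checked for each of its values separately.\<close>

lemma composite_measurable:
  assumes "\<And>q p. p \<in> D \<Longrightarrow> (\<lambda>w. H q p w) \<in> borel \<rightarrow>\<^sub>M N"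
  shows "(\<lambda>\<omega>. H (Q \<omega>) (XY \<omega>) (W \<omega>)) \<in> \<Omega> \<rightarrow>\<^sub>M N"
proof -
  have "(\<lambda>\<omega>. (\<lambda>(q, p). H q p (W \<omega>)) ((\<lambda>\<omega>. (Q \<omega>, XY \<omega>)) \<omega>)) \<in> \<Omega> \<rightarrow>\<^sub>M N"
  proof (rule measurable_compose_countable'[OF _ QXY_measurable])
    show "countable ((UNIV :: nat set) \<times> D)" using finD by (intro countable_SIGMA) (auto intro: countable_finite)
    fix i :: "nat \<times> ('l \<Rightarrow> 'x) \<times> ('k \<Rightarrow> 'y)" assume "i \<in> UNIV \<times> D"
    then obtain q p where i: "i = (q, p)" "p \<in> D" by auto
    show "(\<lambda>\<omega>. (\<lambda>(q, p). H q p (W \<omega>)) i) \<in> \<Omega> \<rightarrow>\<^sub>M N"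
      using measurable_compose[OF measurable_\<Omega>(4) assms[OF i(2)]] by (simp add: i)
  qed
  then show ?thesis by simp
qed

lemma expectation_\<Omega>:
  fixes H :: "nat \<Rightarrow> ('l \<Rightarrow> 'x) \<times> ('k \<Rightarrow> 'y) \<Rightarrow> (nat \<Rightarrow> real) \<Rightarrow> real"
  assumes m: "\<And>q p. p \<in> D \<Longrightarrow> H q p \<in> borel_measurable borel" and b: "\<And>q p w. \<bar>H q p w\<bar> \<le> C"
  shows "(\<integral>\<omega>. H (Q \<omega>) (XY \<omega>) (W \<omega>) \<partial>\<Omega>)
    = (\<Sum>q\<in>set_pmf pQ. pmf pQ q * (\<Sum>p\<in>D. pmf (joint_law (pX q) ch) p * (\<integral>w. H q p w \<partial>W0)))"
proof -
  interpret W0: prob_space W0 by (rule prob_W0)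
  interpret P: pair_prob_space "measure_pmf base" W0 ..
  let ?r = "\<lambda>(p, w). (fst p, fst (snd p), snd (snd p), w) :: nat \<times> ('l \<Rightarrow> 'x) \<times> ('k \<Rightarrow> 'y) \<times> (nat \<Rightarrow> real)"
  let ?H = "\<lambda>\<omega>. H (Q \<omega>) (XY \<omega>) (W \<omega>)"
  have HO: "?H \<in> borel_measurable \<Omega>" by (rule composite_measurable) (rule m)
  then have HN: "?H \<in> borel_measurable (count_space UNIV \<Otimes>\<^sub>M count_space UNIV \<Otimes>\<^sub>M count_space UNIV \<Otimes>\<^sub>M borel)"
    using measurable_cong_sets[OF sets_\<Omega> refl] by blast
  have Hr: "(\<lambda>z. ?H (?r z)) \<in> borel_measurable (measure_pmf base \<Otimes>\<^sub>M W0)"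
    by (rule measurable_compose[OF reassoc_measurable HN])
  have "(\<integral>\<omega>. ?H \<omega> \<partial>\<Omega>) = (\<integral>z. ?H (?r z) \<partial>(measure_pmf base \<Otimes>\<^sub>M W0))"
    unfolding \<Omega>_def by (rule integral_distr[OF reassoc_measurable HN])
  also have "\<dots> = (\<integral>p. \<integral>w. ?H (?r (p, w)) \<partial>W0 \<partial>measure_pmf base)"
  proof (rule P.integral_fst'[symmetric])
    show "integrable (measure_pmf base \<Otimes>\<^sub>M W0) (\<lambda>z. ?H (?r z))"
      by (rule P.integrable_const_bound[of _ C, OF _ Hr]) (use b in auto)
  qed
  also have "\<dots> = (\<Sum>z\<in>set_pmf pQ \<times> D. (\<integral>w. ?H (?r (z, w)) \<partial>W0) * pmf base z)"
  proof (rule integral_measure_pmf_real)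
    show "finite (set_pmf pQ \<times> D)" using finQ finD by simp
    show "z \<in> set_pmf pQ \<times> D" if "z \<in> set_pmf base" for z
      using that set_joint unfolding base_def by fastforce
  qed
  also have "\<dots> = (\<Sum>z\<in>set_pmf pQ \<times> D. pmf pQ (fst z) * (pmf (joint_law (pX (fst z)) ch) (snd z) * (\<integral>w. H (fst z) (snd z) w \<partial>W0)))"
  proof (rule sum.cong[OF refl])
    fix z assume "z \<in> set_pmf pQ \<times> D"
    then obtain q x y where z: "z = (q, x, y)" "(x, y) \<in> D" by auto
    have xy: "\<forall>l. x l \<in> XX l" "\<forall>k. y k \<in> YY k" using z(2) by (auto simp: D PiE_iff)
    have "?H (?r (z, w)) = H q (x, y) w" for w
      using xy by (simp add: z Q_def XY_def W_def X_def Y_def)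
    moreover have "pmf base (q, x, y) = pmf pQ q * pmf (joint_law (pX q) ch) (x, y)"
    proof -
      have "pmf base (q, x, y) = pr base (\<lambda>\<omega>. (snd \<omega>, fst \<omega>)) ((x, y), q)"
        unfolding pr_def measure_pmf_single[symmetric] by (intro arg_cong[where f = "measure _"]) auto
      also have "\<dots> = pr pQ (\<lambda>q. q) q * pr (joint_law (pX q) ch) (\<lambda>p. p) (x, y)"
        unfolding base_def
        using pr_bind_pmf[of pQ "\<lambda>q. q" q "\<lambda>q. joint_law (pX q) ch" "joint_law (pX q) ch" "\<lambda>p. p" "(x, y)"] by simp
      finally show ?thesis by (simp add: pr_eq_pmf_map)
    qed
    ultimately show "(\<integral>w. ?H (?r (z, w)) \<partial>W0) * pmf base z
      = pmf pQ (fst z) * (pmf (joint_law (pX (fst z)) ch) (snd z) * (\<integral>w. H (fst z) (snd z) w \<partial>W0))"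
      by (simp add: z)
  qed
  also have "\<dots> = (\<Sum>q\<in>set_pmf pQ. \<Sum>p\<in>D. pmf pQ q * (pmf (joint_law (pX q) ch) p * (\<integral>w. H q p w \<partial>W0)))"
    by (simp add: sum.cartesian_product case_prod_unfold)
  finally show ?thesis by (simp add: sum_distrib_left)
qed

lemma integral_W0_component:
  fixes h :: "real \<Rightarrow> real"
  assumes h: "h \<in> borel_measurable borel"
  shows "(\<integral>w. h (w q) \<partial>W0) = (\<integral>t. h t \<partial>M q)"
proof -
  have "distr W0 (M q) (\<lambda>w. w q) = M q"
    unfolding W0_def by (rule distr_PiM_component) (auto intro: M.prob_space_axioms)
  moreover have "(\<lambda>w. w q) \<in> W0 \<rightarrow>\<^sub>M M q" unfolding W0_def by (rule measurable_component_singleton) simp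
  ultimately show ?thesis using integral_distr[of "\<lambda>w. w q" W0 "M q" h] h by simp
qed

lemma coordinate_measurable: "(\<lambda>w :: nat \<Rightarrow> real. w q) \<in> borel_measurable borel"
  by (rule borel_measurable_continuous_onI) (rule continuous_on_product_coordinates)

text \<open>Only the component of \<open>W\<close> with index \<open>Q\<close> enters, and given
  \<open>Q = q\<close> it has law \<open>M q\<close>.\<close>

lemma expectation_\<Omega>_letter:
  fixes H :: "nat \<Rightarrow> ('l \<Rightarrow> 'x) \<times> ('k \<Rightarrow> 'y) \<Rightarrow> real \<Rightarrow> real"
  assumes m: "\<And>q p. p \<in> D \<Longrightarrow> H q p \<in> borel_measurable borel" and b: "\<And>q p t. \<bar>H q p t\<bar> \<le> C"
  shows "(\<integral>\<omega>. H (Q \<omega>) (XY \<omega>) (W \<omega> (Q \<omega>)) \<partial>\<Omega>)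
    = (\<Sum>q\<in>set_pmf pQ. pmf pQ q * (\<Sum>p\<in>D. pmf (joint_law (pX q) ch) p * (\<integral>t. H q p t \<partial>M q)))"
proof -
  have "(\<integral>\<omega>. H (Q \<omega>) (XY \<omega>) (W \<omega> (Q \<omega>)) \<partial>\<Omega>)
    = (\<Sum>q\<in>set_pmf pQ. pmf pQ q * (\<Sum>p\<in>D. pmf (joint_law (pX q) ch) p * (\<integral>w. H q p (w q) \<partial>W0)))"
    by (rule expectation_\<Omega>[of "\<lambda>q p w. H q p (w q)", OF measurable_compose[OF coordinate_measurable m] b])
  then show ?thesis using integral_W0_component[OF m] by (simp cong: sum.cong)
qed

lemma cran_law_\<Omega>: "cran_law XX YY ch \<Omega> Q X Y W"
proof -
  have "measure \<Omega> {\<omega> \<in> space \<Omega>. Q \<omega> = q \<and> (\<forall>l. X l \<omega> = x l) \<and> (\<forall>k. Y k \<omega> = y k) \<and> W \<omega> \<in> A}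
      = pmf pQ q * (\<Prod>l\<in>UNIV. pmf (pX q l) (x l)) * pmf (ch x) y * measure W0 A"
    if A: "A \<in> sets borel" for q x y A
  proof -
    let ?H = "\<lambda>q' p w. if q' = q \<and> p = (x, y) then indicator A w else 0 :: real"
    have "measure \<Omega> {\<omega> \<in> space \<Omega>. Q \<omega> = q \<and> (\<forall>l. X l \<omega> = x l) \<and> (\<forall>k. Y k \<omega> = y k) \<and> W \<omega> \<in> A}
        = integral\<^sup>L \<Omega> (indicator {\<omega> \<in> space \<Omega>. Q \<omega> = q \<and> (\<forall>l. X l \<omega> = x l) \<and> (\<forall>k. Y k \<omega> = y k) \<and> W \<omega> \<in> A})"
      by (simp add: Int_def space_\<Omega>)
    also have "\<dots> = (\<integral>\<omega>. ?H (Q \<omega>) (XY \<omega>) (W \<omega>) \<partial>\<Omega>)"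
      by (rule Bochner_Integration.integral_cong) (auto simp: indicator_def XY_def fun_eq_iff space_\<Omega>)
    also have "\<dots> = (\<Sum>q'\<in>set_pmf pQ. pmf pQ q' * (\<Sum>p\<in>D. pmf (joint_law (pX q') ch) p * (\<integral>w. ?H q' p w \<partial>W0)))"
      by (rule expectation_\<Omega>[where C = 1]) (use A in \<open>auto simp: indicator_def\<close>)
    also have "\<dots> = (\<Sum>q'\<in>set_pmf pQ. if q' = q then pmf pQ q * (\<Sum>p\<in>D. if p = (x, y) then pmf (joint_law (pX q) ch) p * measure W0 A else 0) else 0)"
    proof (rule sum.cong[OF refl])
      fix q'
      have "(\<integral>w. indicator A w \<partial>W0) = measure W0 A" using A sets_W0 by (simp add: sets_eq_imp_space_eq[OF sets_W0])
      then show "pmf pQ q' * (\<Sum>p\<in>D. pmf (joint_law (pX q') ch) p * (\<integral>w. ?H q' p w \<partial>W0))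
        = (if q' = q then pmf pQ q * (\<Sum>p\<in>D. if p = (x, y) then pmf (joint_law (pX q) ch) p * measure W0 A else 0) else 0)"
        by (auto intro!: sum.cong)
    qed
    also have "\<dots> = pmf pQ q * (if (x, y) \<in> D then pmf (joint_law (pX q) ch) (x, y) * measure W0 A else 0)"
      using finQ finD by (simp add: sum.delta pmf_eq_0_set_pmf)
    also have "\<dots> = pmf pQ q * (pmf (joint_law (pX q) ch) (x, y) * measure W0 A)"
    proof -
      have "pmf (joint_law (pX q) ch) (x, y) = 0" if "(x, y) \<notin> D"
        using that set_joint by (auto simp: pmf_eq_0_set_pmf)
      then show ?thesis by simp
    qed
    finally show ?thesis by (simp add: pmf_joint_law mult.assoc)
  qed
  then show ?thesis
    unfolding cran_law_def
    using prob_\<Omega> measurable_\<Omega> pXS prob_W0 sets_W0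
    by (intro conjI exI[of _ pQ] exI[of _ "\<lambda>l q. pX q l"] exI[of _ "\<lambda>_. W0"]) auto
qed

definition uA :: "nat \<Rightarrow> 'k set \<Rightarrow> ('k \<Rightarrow> 'y) \<Rightarrow> real \<Rightarrow> 'k \<Rightarrow> nat \<Rightarrow> real" where
  "uA q A y t = (\<lambda>k\<in>A. U q k t (y k))"

lemma uA_measurable: "uA q A y \<in> borel \<rightarrow>\<^sub>M Pi\<^sub>M A (\<lambda>_. borel)"
  unfolding uA_def[abs_def] by (rule measurable_restrict) (rule Um)

text \<open>Extends \<open>density\<close> from events to bounded non-negative functions of the
  messages.\<close>

lemma integral_uA_density:
  fixes F :: "('k \<Rightarrow> nat \<Rightarrow> real) \<Rightarrow> real"
  assumes y: "y \<in> Ys" and F: "F \<in> borel_measurable (Pi\<^sub>M A (\<lambda>_. borel))" and F0: "\<And>u. 0 \<le> F u" and FC: "\<And>u. F u \<le> C"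
  shows "(\<integral>t. F (uA q A y t) \<partial>M q) = (\<Sum>y'\<in>Ys. \<integral>t. F (uA q A y' t) * dec q A y (uA q A y' t) \<partial>M q)"
    and "y' \<in> Ys \<Longrightarrow> integrable (M q) (\<lambda>t. F (uA q A y' t) * dec q A y (uA q A y' t))"
proof -
  let ?PA = "Pi\<^sub>M A (\<lambda>_. borel :: (nat \<Rightarrow> real) measure)"
  let ?L = "distr (M q) ?PA (uA q A y)"
  let ?d = "\<lambda>y' t. dec q A y (uA q A y' t)"
  let ?N = "\<lambda>y'. distr (density (M q) (\<lambda>t. ennreal (?d y' t))) ?PA (uA q A y')"
  have um: "uA q A y' \<in> M q \<rightarrow>\<^sub>M ?PA" for y' using uA_measurable[of q A y'] by simp
  have dm: "?d y' \<in> borel_measurable (M q)" for y' by (rule measurable_compose[OF um decm])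
  have um': "uA q A y' \<in> density (M q) (\<lambda>t. ennreal (?d y' t)) \<rightarrow>\<^sub>M ?PA" for y' using um by simp
  have i: "integrable (M q) (\<lambda>t. G (uA q A y' t) * ?d y' t)"
    if y': "y' \<in> Ys" and G: "G \<in> borel_measurable ?PA" "\<And>u. 0 \<le> G u" "\<And>u. G u \<le> c" for y' c and G :: "('k \<Rightarrow> nat \<Rightarrow> real) \<Rightarrow> real"
  proof (rule M.integrable_const_bound[of _ c])
    show "AE t in M q. norm (G (uA q A y' t) * ?d y' t) \<le> c"
      using dec1[OF y y', of q A, folded uA_def]
    proof (rule AE_mp, intro AE_I2 impI)
      fix t assume "?d y' t \<le> 1"
      then have "G (uA q A y' t) * ?d y' t \<le> G (uA q A y' t) * 1" using G(2) by (intro mult_left_mono) auto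
      then show "norm (G (uA q A y' t) * ?d y' t) \<le> c" using G(2,3) dec0 by (simp add: order_trans)
    qed
    show "(\<lambda>t. G (uA q A y' t) * ?d y' t) \<in> borel_measurable (M q)"
      by (rule borel_measurable_times[OF measurable_compose[OF um G(1)] dm])
  qed
  then show "y' \<in> Ys \<Longrightarrow> integrable (M q) (\<lambda>t. F (uA q A y' t) * ?d y' t)" using F F0 FC by blast
  have "(\<integral>\<^sup>+u. ennreal (F u) \<partial>?L) = (\<Sum>y'\<in>Ys. \<integral>\<^sup>+u. ennreal (F u) \<partial>?N y')"
  proof (rule nn_integral_eq_sum_if_measure_eq_sum[OF finYs])
    fix B assume "B \<in> sets ?L"
    then have B: "B \<in> sets ?PA" by simp
    have "emeasure ?L B = ennreal (measure (M q) {t. uA q A y t \<in> B})"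
      using B um by (subst emeasure_distr) (auto simp: M.emeasure_eq_measure vimage_def)
    also have "measure (M q) {t. uA q A y t \<in> B} = (\<Sum>y'\<in>Ys. \<integral>t. indicator B (uA q A y' t) * ?d y' t \<partial>M q)"
      using density[OF y B] by (simp add: uA_def)
    also have "ennreal \<dots> = (\<Sum>y'\<in>Ys. ennreal (\<integral>t. indicator B (uA q A y' t) * ?d y' t \<partial>M q))"
      by (rule sum_ennreal[symmetric]) (auto intro!: integral_nonneg_AE simp: dec0)
    also have "\<dots> = (\<Sum>y'\<in>Ys. emeasure (?N y') B)"
    proof (rule sum.cong[OF refl])
      fix y' assume y': "y' \<in> Ys"
      have "emeasure (?N y') B = emeasure (density (M q) (\<lambda>t. ennreal (?d y' t))) (uA q A y' -` B)"
        using B um' by (subst emeasure_distr) auto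
      also have "\<dots> = (\<integral>\<^sup>+t. ennreal (?d y' t) * indicator (uA q A y' -` B) t \<partial>M q)"
        using dm measurable_sets[OF um B, of y'] by (intro emeasure_density) auto
      also have "\<dots> = (\<integral>\<^sup>+t. ennreal (indicator B (uA q A y' t) * ?d y' t) \<partial>M q)"
        by (rule nn_integral_cong) (auto simp: indicator_def)
      also have "\<dots> = ennreal (\<integral>t. indicator B (uA q A y' t) * ?d y' t \<partial>M q)"
        by (rule nn_integral_eq_integral[OF i[OF y', of "indicator B" 1]]) (use B dec0 in \<open>auto simp: indicator_def\<close>)
      finally show "ennreal (\<integral>t. indicator B (uA q A y' t) * ?d y' t \<partial>M q) = emeasure (?N y') B" ..
    qed
    finally show "emeasure ?L B = (\<Sum>y'\<in>Ys. emeasure (?N y') B)" .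
  qed (use F in auto)
  also have "(\<integral>\<^sup>+u. ennreal (F u) \<partial>?L) = ennreal (\<integral>t. F (uA q A y t) \<partial>M q)"
  proof -
    have "(\<integral>\<^sup>+u. ennreal (F u) \<partial>?L) = (\<integral>\<^sup>+t. ennreal (F (uA q A y t)) \<partial>M q)"
      by (rule nn_integral_distr[OF um]) (use F in simp)
    also have "\<dots> = ennreal (\<integral>t. F (uA q A y t) \<partial>M q)"
      by (rule nn_integral_eq_integral, rule M.integrable_const_bound[of _ C])
         (use F0 FC measurable_compose[OF um F] in auto)
    finally show ?thesis .
  qed
  also have "(\<Sum>y'\<in>Ys. \<integral>\<^sup>+u. ennreal (F u) \<partial>?N y') = (\<Sum>y'\<in>Ys. ennreal (\<integral>t. F (uA q A y' t) * ?d y' t \<partial>M q))"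
  proof (rule sum.cong[OF refl])
    fix y' assume y': "y' \<in> Ys"
    have "(\<integral>\<^sup>+u. ennreal (F u) \<partial>?N y') = (\<integral>\<^sup>+t. ennreal (F (uA q A y' t)) \<partial>density (M q) (\<lambda>t. ennreal (?d y' t)))"
      by (rule nn_integral_distr[OF um']) (use F in simp)
    also have "\<dots> = (\<integral>\<^sup>+t. ennreal (?d y' t) * ennreal (F (uA q A y' t)) \<partial>M q)"
      by (rule nn_integral_density) (use dm measurable_compose[OF um F] in auto)
    also have "\<dots> = (\<integral>\<^sup>+t. ennreal (F (uA q A y' t) * ?d y' t) \<partial>M q)"
      by (rule nn_integral_cong) (simp add: ennreal_mult F0 dec0 mult.commute)
    also have "\<dots> = ennreal (\<integral>t. F (uA q A y' t) * ?d y' t \<partial>M q)"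
      by (rule nn_integral_eq_integral[OF i[OF y' F F0 FC]]) (simp add: F0 dec0)
    finally show "(\<integral>\<^sup>+u. ennreal (F u) \<partial>?N y') = ennreal (\<integral>t. F (uA q A y' t) * ?d y' t \<partial>M q)" .
  qed
  also have "\<dots> = ennreal (\<Sum>y'\<in>Ys. \<integral>t. F (uA q A y' t) * ?d y' t \<partial>M q)"
    by (rule sum_ennreal) (auto intro!: integral_nonneg_AE simp: F0 dec0)
  finally show "(\<integral>t. F (uA q A y t) \<partial>M q) = (\<Sum>y'\<in>Ys. \<integral>t. F (uA q A y' t) * ?d y' t \<partial>M q)"
    by (subst (asm) ennreal_inj) (auto intro!: integral_nonneg_AE sum_nonneg simp: F0 dec0)
qed

text \<open>After the change of measure all letters are integrated against the same reference laws,
  weighted by \<open>dec\<close>. Grouping by the value of \<phi> exposes the weights from which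
  conditional laws are formed.\<close>

lemma sum_integral_uA:
  fixes F :: "'a \<Rightarrow> ('k \<Rightarrow> nat \<Rightarrow> real) \<Rightarrow> real" and e :: "('l \<Rightarrow> 'x) \<times> ('k \<Rightarrow> 'y) \<Rightarrow> real"
  assumes F: "\<And>a. F a \<in> borel_measurable (Pi\<^sub>M A (\<lambda>_. borel))" and F0: "\<And>a u. 0 \<le> F a u" and FC: "\<And>a u. F a u \<le> C"
  shows "(\<Sum>p\<in>D. e p * (\<integral>t. F (\<phi> p) (uA q A (snd p) t) \<partial>M q))
    = (\<Sum>y\<in>Ys. \<integral>t. (\<Sum>a\<in>\<phi> ` D. (\<Sum>p\<in>{p\<in>D. \<phi> p = a}. e p * dec q A (snd p) (uA q A y t)) * F a (uA q A y t)) \<partial>M q)"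
    and "y \<in> Ys \<Longrightarrow> integrable (M q) (\<lambda>t. \<Sum>a\<in>\<phi> ` D. (\<Sum>p\<in>{p\<in>D. \<phi> p = a}. e p * dec q A (snd p) (uA q A y t)) * F a (uA q A y t))"
proof -
  let ?f = "\<lambda>p y t. F (\<phi> p) (uA q A y t) * dec q A (snd p) (uA q A y t)"
  have i: "integrable (M q) (?f p y)" if "p \<in> D" "y \<in> Ys" for p y
    by (rule integral_uA_density(2)[OF _ F F0 FC]) (use that DY in auto)
  have eq: "(\<Sum>a\<in>\<phi> ` D. (\<Sum>p\<in>{p\<in>D. \<phi> p = a}. e p * dec q A (snd p) (uA q A y t)) * F a (uA q A y t)) = (\<Sum>p\<in>D. e p * ?f p y t)" for y t
  proof -
    have "(\<Sum>p\<in>D. e p * ?f p y t) = (\<Sum>a\<in>\<phi> ` D. \<Sum>p\<in>{p\<in>D. \<phi> p = a}. e p * ?f p y t)"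
      by (rule sum.image_gen[OF finD])
    also have "\<dots> = (\<Sum>a\<in>\<phi> ` D. (\<Sum>p\<in>{p\<in>D. \<phi> p = a}. e p * dec q A (snd p) (uA q A y t)) * F a (uA q A y t))"
      unfolding sum_distrib_right by (intro sum.cong refl) auto
    finally show ?thesis ..
  qed
  have "(\<Sum>p\<in>D. e p * (\<integral>t. F (\<phi> p) (uA q A (snd p) t) \<partial>M q)) = (\<Sum>p\<in>D. e p * (\<Sum>y\<in>Ys. \<integral>t. ?f p y t \<partial>M q))"
  proof (rule sum.cong[OF refl])
    fix p assume "p \<in> D"
    then have "snd p \<in> Ys" using DY by auto
    then show "e p * (\<integral>t. F (\<phi> p) (uA q A (snd p) t) \<partial>M q) = e p * (\<Sum>y\<in>Ys. \<integral>t. ?f p y t \<partial>M q)"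
      using integral_uA_density(1)[OF _ F F0 FC, of "snd p" q "\<phi> p"] by simp
  qed
  also have "\<dots> = (\<Sum>y\<in>Ys. \<Sum>p\<in>D. \<integral>t. e p * ?f p y t \<partial>M q)"
    unfolding sum_distrib_left by (subst sum.swap) simp
  also have "\<dots> = (\<Sum>y\<in>Ys. \<integral>t. (\<Sum>p\<in>D. e p * ?f p y t) \<partial>M q)"
    by (intro sum.cong refl Bochner_Integration.integral_sum[symmetric]) (auto intro!: integrable_mult_right i)
  finally show "(\<Sum>p\<in>D. e p * (\<integral>t. F (\<phi> p) (uA q A (snd p) t) \<partial>M q))
    = (\<Sum>y\<in>Ys. \<integral>t. (\<Sum>a\<in>\<phi> ` D. (\<Sum>p\<in>{p\<in>D. \<phi> p = a}. e p * dec q A (snd p) (uA q A y t)) * F a (uA q A y t)) \<partial>M q)"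
    unfolding eq .
  show "y \<in> Ys \<Longrightarrow> integrable (M q) (\<lambda>t. \<Sum>a\<in>\<phi> ` D. (\<Sum>p\<in>{p\<in>D. \<phi> p = a}. e p * dec q A (snd p) (uA q A y t)) * F a (uA q A y t))"
    unfolding eq by (intro Bochner_Integration.integrable_sum integrable_mult_right i)
qed

text \<open>The unnormalised posterior weight of the letter \<open>p\<close> after the messages
  \<open>u\<close>; the channel inputs enter through the prior only, as messages depend on
  outputs.\<close>

definition wt :: "nat \<Rightarrow> 'k set \<Rightarrow> ('k \<Rightarrow> nat \<Rightarrow> real) \<Rightarrow> ('l \<Rightarrow> 'x) \<times> ('k \<Rightarrow> 'y) \<Rightarrow> real" where
  "wt q A u p = pmf (joint_law (pX q) ch) p * dec q A (snd p) u"

text \<open>The conditional probability of \<open>\<theta> = b\<close> given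
  \<open>\<phi> = a\<close>, the messages \<open>u\<close> of \<open>A\<close>, and
  \<open>Q = q\<close>.\<close>

definition cond_post :: "nat \<Rightarrow> 'k set \<Rightarrow> (('l \<Rightarrow> 'x) \<times> ('k \<Rightarrow> 'y) \<Rightarrow> 'b) \<Rightarrow> (('l \<Rightarrow> 'x) \<times> ('k \<Rightarrow> 'y) \<Rightarrow> 'a) \<Rightarrow> 'b \<Rightarrow> 'a
    \<Rightarrow> ('k \<Rightarrow> nat \<Rightarrow> real) \<Rightarrow> real" where
  "cond_post q A \<theta> \<phi> b a u = (\<Sum>p\<in>{p\<in>D. \<theta> p = b \<and> \<phi> p = a}. wt q A u p) / (\<Sum>p\<in>{p\<in>D. \<phi> p = a}. wt q A u p)"

lemma wt_nonneg: "0 \<le> wt q A u p"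
  by (simp add: wt_def dec0)

lemma cond_post_01: "0 \<le> cond_post q A \<theta> \<phi> b a u \<and> cond_post q A \<theta> \<phi> b a u \<le> 1"
proof -
  have le: "(\<Sum>p\<in>{p\<in>D. \<theta> p = b \<and> \<phi> p = a}. wt q A u p) \<le> (\<Sum>p\<in>{p\<in>D. \<phi> p = a}. wt q A u p)"
    by (rule sum_mono2) (use finD wt_nonneg in auto)
  have "0 \<le> (\<Sum>p\<in>{p\<in>D. \<theta> p = b \<and> \<phi> p = a}. wt q A u p)" by (intro sum_nonneg wt_nonneg)
  then show ?thesis using le unfolding cond_post_def by (auto simp: divide_le_eq_1 intro!: divide_nonneg_nonneg)
qed

text \<open>The product form holds for a vanishing denominator too, since non-negative weights then
  make the numerator vanish.\<close>

lemma cond_post_mult: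
  "(\<Sum>p\<in>{p\<in>D. \<phi> p = a}. wt q A u p) * cond_post q A \<theta> \<phi> b a u = (\<Sum>p\<in>{p\<in>D. \<theta> p = b \<and> \<phi> p = a}. wt q A u p)"
proof (cases "(\<Sum>p\<in>{p\<in>D. \<phi> p = a}. wt q A u p) = 0")
  case True
  moreover have "(\<Sum>p\<in>{p\<in>D. \<phi> p = a}. wt q A u p) = 0 \<longleftrightarrow> (\<forall>p\<in>{p\<in>D. \<phi> p = a}. wt q A u p = 0)"
    by (rule sum_nonneg_eq_0_iff) (use finD wt_nonneg in simp_all)
  ultimately have "(\<Sum>p\<in>{p\<in>D. \<theta> p = b \<and> \<phi> p = a}. wt q A u p) = 0" by (intro sum.neutral) auto
  then show ?thesis using True by simp
qed (simp add: cond_post_def)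

lemma cond_post_measurable: "cond_post q A \<theta> \<phi> b a \<in> borel_measurable (Pi\<^sub>M A (\<lambda>_. borel))"
  unfolding cond_post_def[abs_def] wt_def[abs_def]
  by (intro borel_measurable_divide borel_measurable_sum borel_measurable_times borel_measurable_const decm)

lemma eta_borel: "eta \<in> borel_measurable borel"
  unfolding eta_def[abs_def] by measurable

lemma posterior_entropy:
  fixes F :: "'b set" and C :: real
  assumes F: "finite F"
  shows "(\<lambda>u. \<Sum>b\<in>F. eta (cond_post q A \<theta> \<phi> b a u)) \<in> borel_measurable (Pi\<^sub>M A (\<lambda>_. borel))"
    and "0 \<le> (\<Sum>b\<in>F. eta (cond_post q A \<theta> \<phi> b a u))"
    and "(\<And>r. 0 \<le> r \<Longrightarrow> r \<le> 1 \<Longrightarrow> \<bar>eta r\<bar> \<le> C) \<Longrightarrow> (\<Sum>b\<in>F. eta (cond_post q A \<theta> \<phi> b a u)) \<le> card F * C"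
proof -
  show "(\<lambda>u. \<Sum>b\<in>F. eta (cond_post q A \<theta> \<phi> b a u)) \<in> borel_measurable (Pi\<^sub>M A (\<lambda>_. borel))"
    by (intro borel_measurable_sum measurable_compose[OF cond_post_measurable eta_borel])
  show "0 \<le> (\<Sum>b\<in>F. eta (cond_post q A \<theta> \<phi> b a u))"
  proof (intro sum_nonneg eta_nonneg)
    show "0 \<le> cond_post q A \<theta> \<phi> b a u" "cond_post q A \<theta> \<phi> b a u \<le> 1" for b using cond_post_01[of q A \<theta> \<phi> b a u] by auto
  qed
  assume C: "\<And>r. 0 \<le> r \<Longrightarrow> r \<le> 1 \<Longrightarrow> \<bar>eta r\<bar> \<le> C"
  have "eta (cond_post q A \<theta> \<phi> b a u) \<le> C" for b
    using C[of "cond_post q A \<theta> \<phi> b a u"] cond_post_01[of q A \<theta> \<phi> b a u] by linarith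
  then have "(\<Sum>b\<in>F. eta (cond_post q A \<theta> \<phi> b a u)) \<le> (\<Sum>b\<in>F. C)" by (intro sum_mono)
  then show "(\<Sum>b\<in>F. eta (cond_post q A \<theta> \<phi> b a u)) \<le> card F * C" by simp
qed

text \<open>This is \<open>weighted_eta_sum\<close> added up over the values of \<phi>. Pairs of
  values of \<theta> and \<phi> that do not occur together contribute
  \<open>eta 0 = 0\<close>.\<close>

lemma sum_posterior_entropy:
  assumes F: "finite F" "\<theta> ` D \<subseteq> F"
  shows "(\<Sum>a\<in>\<phi> ` D. (\<Sum>p\<in>{p\<in>D. \<phi> p = a}. pmf (joint_law (pX q) ch) p * dec q A (snd p) u) * (\<Sum>b\<in>F. eta (cond_post q A \<theta> \<phi> b a u)))
    = cond_weight_entropy D (\<lambda>p. pmf (joint_law (pX q) ch) p * dec q A (snd p) u) \<theta> \<phi>"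
proof -
  define w where "w b a = (\<Sum>p\<in>{p\<in>D. \<theta> p = b \<and> \<phi> p = a}. wt q A u p)" for b a
  have w0: "0 \<le> w b a" for b a unfolding w_def by (intro sum_nonneg wt_nonneg)
  have ws: "(\<Sum>b\<in>F. w b a) = (\<Sum>p\<in>{p\<in>D. \<phi> p = a}. wt q A u p)" for a
  proof -
    have "(\<Sum>p\<in>{p\<in>D. \<phi> p = a}. wt q A u p) = (\<Sum>b\<in>F. \<Sum>p\<in>{p\<in>{p\<in>D. \<phi> p = a}. \<theta> p = b}. wt q A u p)"
      by (rule sum.group[symmetric]) (use finD F in auto)
    also have "\<dots> = (\<Sum>b\<in>F. w b a)" unfolding w_def by (intro sum.cong refl) auto
    finally show ?thesis ..
  qed
  have cp: "cond_post q A \<theta> \<phi> b a u = w b a / (\<Sum>b\<in>F. w b a)" for b a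
    by (simp add: cond_post_def w_def[symmetric] ws)
  have "(\<Sum>a\<in>\<phi> ` D. (\<Sum>p\<in>{p\<in>D. \<phi> p = a}. pmf (joint_law (pX q) ch) p * dec q A (snd p) u) * (\<Sum>b\<in>F. eta (cond_post q A \<theta> \<phi> b a u)))
      = (\<Sum>a\<in>\<phi> ` D. (\<Sum>b\<in>F. w b a) * (\<Sum>b\<in>F. eta (w b a / (\<Sum>b\<in>F. w b a))))"
    unfolding cp ws[unfolded wt_def, symmetric] ..
  also have "\<dots> = (\<Sum>a\<in>\<phi> ` D. (\<Sum>b\<in>F. eta (w b a)) - eta (\<Sum>b\<in>F. w b a))"
    by (intro sum.cong refl weighted_eta_sum[OF F(1)] w0)
  also have "\<dots> = (\<Sum>a\<in>\<phi> ` D. \<Sum>b\<in>F. eta (w b a)) - weight_entropy D (wt q A u) \<phi>"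
    by (simp add: sum_subtractf weight_entropy_def ws)
  also have "(\<Sum>a\<in>\<phi> ` D. \<Sum>b\<in>F. eta (w b a)) = weight_entropy D (wt q A u) (\<lambda>p. (\<theta> p, \<phi> p))"
  proof -
    have "(\<Sum>a\<in>\<phi> ` D. \<Sum>b\<in>F. eta (w b a)) = (\<Sum>c\<in>F \<times> \<phi> ` D. eta (w (fst c) (snd c)))"
      by (subst sum.swap) (simp add: sum.cartesian_product case_prod_unfold)
    also have "\<dots> = (\<Sum>c\<in>(\<lambda>p. (\<theta> p, \<phi> p)) ` D. eta (w (fst c) (snd c)))"
    proof (rule sum.mono_neutral_right)
      show "finite (F \<times> \<phi> ` D)" using F(1) finD by simp
      show "(\<lambda>p. (\<theta> p, \<phi> p)) ` D \<subseteq> F \<times> \<phi> ` D" using F(2) by auto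
      show "\<forall>c\<in>F \<times> \<phi> ` D - (\<lambda>p. (\<theta> p, \<phi> p)) ` D. eta (w (fst c) (snd c)) = 0"
      proof
        fix c assume c: "c \<in> F \<times> \<phi> ` D - (\<lambda>p. (\<theta> p, \<phi> p)) ` D"
        then have "{p\<in>D. \<theta> p = fst c \<and> \<phi> p = snd c} = {}" by (cases c) (auto simp: image_iff)
        then have "w (fst c) (snd c) = 0" unfolding w_def by (simp only: sum.empty)
        then show "eta (w (fst c) (snd c)) = 0" by (simp add: eta_def)
      qed
    qed
    also have "\<dots> = weight_entropy D (wt q A u) (\<lambda>p. (\<theta> p, \<phi> p))"
      unfolding weight_entropy_def w_def by (intro sum.cong refl arg_cong[where f = eta]) auto
    finally show ?thesis .
  qed
  finally show ?thesis by (simp add: cond_weight_entropy_def wt_def[abs_def])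
qed

lemma integrable_table_entropy:
  "integrable (M q) (\<lambda>t. table_entropy D (pmf (joint_law (pX q) ch)) Ys (\<lambda>A y y'. dec q A y' (uA q A y t)) A \<theta> \<phi>)"
proof -
  obtain C where C: "\<And>r. 0 \<le> r \<Longrightarrow> r \<le> 1 \<Longrightarrow> \<bar>eta r\<bar> \<le> C" using eta_bounded by blast
  have F: "finite (\<theta> ` D)" using finD by simp
  show ?thesis
    unfolding table_entropy_def sum_posterior_entropy[OF F order_refl, symmetric]
    by (rule Bochner_Integration.integrable_sum, rule sum_integral_uA(2))
      (rule posterior_entropy(1)[OF F] posterior_entropy(2)[OF F] posterior_entropy(3)[OF F C] | assumption)+
qed

text \<open>One statement serves all four mutual informations of the bound. \<theta> is the first
  argument, \<phi> the part of the letter that is observed, \<open>A\<close> the set of observed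
  relays. \<open>G\<close> packs \<open>q\<close>, the value of \<phi> and the messages into the
  tuple that the definition asks for, and \<pi> evaluates the posterior from that tuple.\<close>

lemma mutual_information_eq_table:
  fixes \<theta> :: "('l \<Rightarrow> 'x) \<times> ('k \<Rightarrow> 'y) \<Rightarrow> 'b" and \<phi> :: "('l \<Rightarrow> 'x) \<times> ('k \<Rightarrow> 'y) \<Rightarrow> 'a"
    and G :: "nat \<Rightarrow> 'a \<Rightarrow> ('k \<Rightarrow> nat \<Rightarrow> real) \<Rightarrow> 'v" and \<pi> :: "'b \<Rightarrow> 'v \<Rightarrow> real"
  assumes F: "finite F" "\<theta> ` D \<subseteq> F"
    and G: "\<And>q a. a \<in> \<phi> ` D \<Longrightarrow> G q a \<in> Pi\<^sub>M A (\<lambda>_. borel) \<rightarrow>\<^sub>M T"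
    and \<pi>m: "\<And>b. b \<in> F \<Longrightarrow> \<pi> b \<in> borel_measurable T" and \<pi>01: "\<And>b v. 0 \<le> \<pi> b v \<and> \<pi> b v \<le> 1"
    and \<pi>: "\<And>q a b u. u \<in> space (Pi\<^sub>M A (\<lambda>_. borel :: (nat \<Rightarrow> real) measure)) \<Longrightarrow> \<pi> b (G q a u) = cond_post q A \<theta> \<phi> b a u"
  shows "prob_space.mutual_information \<Omega> 2 (count_space F) T (\<lambda>\<omega>. \<theta> (XY \<omega>))
      (\<lambda>\<omega>. G (Q \<omega>) (\<phi> (XY \<omega>)) (uA (Q \<omega>) A (\<lambda>k. Y k \<omega>) (W \<omega> (Q \<omega>))))
    = (\<Sum>b\<in>F. eta (measure \<Omega> {\<omega>\<in>space \<Omega>. \<theta> (XY \<omega>) = b}))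
      - (\<Sum>q\<in>set_pmf pQ. pmf pQ q * (\<integral>t. table_entropy D (pmf (joint_law (pX q) ch)) Ys
          (\<lambda>A y y'. dec q A y' (uA q A y t)) A \<theta> \<phi> \<partial>M q))"
proof -
  interpret \<Omega>: prob_space \<Omega> by (rule prob_\<Omega>)
  let ?V = "\<lambda>\<omega>. G (Q \<omega>) (\<phi> (XY \<omega>)) (uA (Q \<omega>) A (\<lambda>k. Y k \<omega>) (W \<omega> (Q \<omega>)))"
  have V_eq: "?V \<omega> = G (Q \<omega>) (\<phi> (XY \<omega>)) (uA (Q \<omega>) A (snd (XY \<omega>)) (W \<omega> (Q \<omega>)))" for \<omega>
    by (simp add: XY_def)
  have Gm: "(\<lambda>t. G q (\<phi> p) (uA q A (snd p) t)) \<in> borel \<rightarrow>\<^sub>M T" if "p \<in> D" for q p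
    by (rule measurable_compose[OF uA_measurable G]) (use that in auto)
  have Vm: "?V \<in> \<Omega> \<rightarrow>\<^sub>M T"
    unfolding V_eq
    by (rule composite_measurable[of "\<lambda>q p w. G q (\<phi> p) (uA q A (snd p) (w q))", OF measurable_compose[OF coordinate_measurable Gm]])
  have \<theta>m: "(\<lambda>\<omega>. \<theta> (XY \<omega>)) \<in> \<Omega> \<rightarrow>\<^sub>M count_space F"
    by (rule composite_measurable[of "\<lambda>q p w. \<theta> p"]) (use F(2) in auto)
  have us: "uA q A y t \<in> space (Pi\<^sub>M A (\<lambda>_. borel :: (nat \<Rightarrow> real) measure))" for q y t
    using measurable_space[OF uA_measurable] by simp
  have \<pi>u: "\<pi> b (G q a (uA q A y t)) = cond_post q A \<theta> \<phi> b a (uA q A y t)" for b q a y t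
    by (rule \<pi>[OF us])
  have post: "measure \<Omega> {\<omega>\<in>space \<Omega>. \<theta> (XY \<omega>) = b \<and> ?V \<omega> \<in> B} = \<Omega>.expectation (\<lambda>\<omega>. \<pi> b (?V \<omega>) * indicator B (?V \<omega>))"
    if b: "b \<in> F" and B: "B \<in> sets T" for b B
  proof -
    define I where "I q a u = (indicator (G q a -` B \<inter> space (Pi\<^sub>M A (\<lambda>_. borel :: (nat \<Rightarrow> real) measure))) u :: real)" for q a u
    \<comment> \<open>\<open>G q a\<close> is known to be measurable only for values
      \<open>a\<close> that \<phi> takes on \<open>D\<close>; for the others the indicator is
      replaced by zero.\<close>
    have Im: "(if a \<in> \<phi> ` D then I q a else (\<lambda>_. 0)) \<in> borel_measurable (Pi\<^sub>M A (\<lambda>_. borel))" for q a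
      using measurable_sets[OF G B, of a q] by (auto simp: I_def[abs_def])
    have I01: "0 \<le> (if a \<in> \<phi> ` D then I q a else (\<lambda>_. 0)) u" "(if a \<in> \<phi> ` D then I q a else (\<lambda>_. 0)) u \<le> 1" for q a u
      by (auto simp: I_def indicator_def)
    have Iu: "indicator B (G q a (uA q A y t)) = I q a (uA q A y t)" for q a y t
      using us by (simp add: I_def indicator_def)
    have lhs: "measure \<Omega> {\<omega>\<in>space \<Omega>. \<theta> (XY \<omega>) = b \<and> ?V \<omega> \<in> B}
        = (\<Sum>q\<in>set_pmf pQ. pmf pQ q * (\<Sum>p\<in>D. pmf (joint_law (pX q) ch) p *
            (\<integral>t. (if \<theta> p = b then 1 else 0) * indicator B (G q (\<phi> p) (uA q A (snd p) t)) \<partial>M q)))"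
    proof -
      have "measure \<Omega> {\<omega>\<in>space \<Omega>. \<theta> (XY \<omega>) = b \<and> ?V \<omega> \<in> B}
          = integral\<^sup>L \<Omega> (indicator {\<omega>\<in>space \<Omega>. \<theta> (XY \<omega>) = b \<and> ?V \<omega> \<in> B})" by (simp add: Int_def space_\<Omega>)
      also have "\<dots> = (\<integral>\<omega>. (if \<theta> (XY \<omega>) = b then 1 else 0) * indicator B (G (Q \<omega>) (\<phi> (XY \<omega>)) (uA (Q \<omega>) A (snd (XY \<omega>)) (W \<omega> (Q \<omega>)))) \<partial>\<Omega>)"
        unfolding V_eq by (rule Bochner_Integration.integral_cong) (auto simp: indicator_def space_\<Omega>)
      also have "\<dots> = (\<Sum>q\<in>set_pmf pQ. pmf pQ q * (\<Sum>p\<in>D. pmf (joint_law (pX q) ch) p *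
            (\<integral>t. (if \<theta> p = b then 1 else 0) * indicator B (G q (\<phi> p) (uA q A (snd p) t)) \<partial>M q)))"
        by (rule expectation_\<Omega>_letter[where C = 1])
           (auto simp: indicator_def intro!: borel_measurable_times measurable_compose[OF Gm borel_measurable_indicator[OF B], unfolded indicator_def])
      finally show ?thesis .
    qed
    have rhs: "\<Omega>.expectation (\<lambda>\<omega>. \<pi> b (?V \<omega>) * indicator B (?V \<omega>))
        = (\<Sum>q\<in>set_pmf pQ. pmf pQ q * (\<Sum>p\<in>D. pmf (joint_law (pX q) ch) p *
            (\<integral>t. \<pi> b (G q (\<phi> p) (uA q A (snd p) t)) * indicator B (G q (\<phi> p) (uA q A (snd p) t)) \<partial>M q)))"
      unfolding V_eq
    proof (rule expectation_\<Omega>_letter[where C = 1])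
      fix q p assume p: "p \<in> D"
      show "(\<lambda>t. \<pi> b (G q (\<phi> p) (uA q A (snd p) t)) * indicator B (G q (\<phi> p) (uA q A (snd p) t))) \<in> borel_measurable borel"
        by (intro borel_measurable_times measurable_compose[OF Gm[OF p] \<pi>m[OF b]] measurable_compose[OF Gm[OF p] borel_measurable_indicator[OF B]])
    qed (use \<pi>01 in \<open>auto simp: indicator_def\<close>)
    \<comment> \<open>The change of measure turns the event \<open>\<theta> = b\<close> into weights
      of letters; \<open>cond_post_mult\<close> writes these as total weights times the posterior,
      and the change of measure is then undone.\<close>
    have "(\<Sum>p\<in>D. pmf (joint_law (pX q) ch) p * (\<integral>t. (if \<theta> p = b then 1 else 0) * indicator B (G q (\<phi> p) (uA q A (snd p) t)) \<partial>M q))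
        = (\<Sum>p\<in>D. pmf (joint_law (pX q) ch) p * (\<integral>t. \<pi> b (G q (\<phi> p) (uA q A (snd p) t)) * indicator B (G q (\<phi> p) (uA q A (snd p) t)) \<partial>M q))"
      (is "?l = ?r") for q
    proof -
      let ?I = "\<lambda>a. if a \<in> \<phi> ` D then I q a else (\<lambda>_. 0)"
      let ?e = "\<lambda>p. pmf (joint_law (pX q) ch) p * (if \<theta> p = b then 1 else 0)"
      let ?K = "\<lambda>a u. cond_post q A \<theta> \<phi> b a u * ?I a u"
      have "?l = (\<Sum>p\<in>D. ?e p * (\<integral>t. ?I (\<phi> p) (uA q A (snd p) t) \<partial>M q))"
        by (rule sum.cong[OF refl]) (simp add: Iu)
      also have "\<dots> = (\<Sum>y\<in>Ys. \<integral>t. (\<Sum>a\<in>\<phi> ` D. (\<Sum>p\<in>{p\<in>D. \<phi> p = a}. ?e p * dec q A (snd p) (uA q A y t)) * ?I a (uA q A y t)) \<partial>M q)"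
        by (rule sum_integral_uA(1)[OF Im I01])
      also have "\<dots> = (\<Sum>y\<in>Ys. \<integral>t. (\<Sum>a\<in>\<phi> ` D. (\<Sum>p\<in>{p\<in>D. \<phi> p = a}. pmf (joint_law (pX q) ch) p * dec q A (snd p) (uA q A y t)) * ?K a (uA q A y t)) \<partial>M q)"
      proof (intro sum.cong refl Bochner_Integration.integral_cong)
        fix y t a
        have "(\<Sum>p\<in>{p\<in>D. \<phi> p = a}. ?e p * dec q A (snd p) (uA q A y t)) = (\<Sum>p\<in>{p\<in>D. \<theta> p = b \<and> \<phi> p = a}. wt q A (uA q A y t) p)"
          unfolding wt_def by (intro sum.mono_neutral_cong_right) (use finD in auto)
        also have "\<dots> = (\<Sum>p\<in>{p\<in>D. \<phi> p = a}. wt q A (uA q A y t) p) * cond_post q A \<theta> \<phi> b a (uA q A y t)"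
          by (rule cond_post_mult[symmetric])
        finally show "(\<Sum>p\<in>{p\<in>D. \<phi> p = a}. ?e p * dec q A (snd p) (uA q A y t)) * ?I a (uA q A y t)
            = (\<Sum>p\<in>{p\<in>D. \<phi> p = a}. pmf (joint_law (pX q) ch) p * dec q A (snd p) (uA q A y t)) * ?K a (uA q A y t)"
          by (simp add: wt_def)
      qed
      also have "\<dots> = (\<Sum>p\<in>D. pmf (joint_law (pX q) ch) p * (\<integral>t. ?K (\<phi> p) (uA q A (snd p) t) \<partial>M q))"
      proof (rule sum_integral_uA(1)[symmetric])
        show "?K a \<in> borel_measurable (Pi\<^sub>M A (\<lambda>_. borel))" for a by (rule borel_measurable_times[OF cond_post_measurable Im])
        show "0 \<le> ?K a u" for a u using cond_post_01[of q A \<theta> \<phi> b a u] I01(1)[of a q u] by (intro mult_nonneg_nonneg) auto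
        show "?K a u \<le> 1" for a u using cond_post_01[of q A \<theta> \<phi> b a u] I01(1)[of a q u] I01(2)[of a q u] by (intro mult_le_one) auto
      qed
      also have "\<dots> = ?r" by (rule sum.cong[OF refl]) (simp add: Iu \<pi>u)
      finally show ?thesis .
    qed
    then show ?thesis unfolding lhs rhs by simp
  qed
  have ent: "\<Omega>.expectation (\<lambda>\<omega>. \<Sum>b\<in>F. eta (\<pi> b (?V \<omega>)))
      = (\<Sum>q\<in>set_pmf pQ. pmf pQ q * (\<integral>t. table_entropy D (pmf (joint_law (pX q) ch)) Ys (\<lambda>A y y'. dec q A y' (uA q A y t)) A \<theta> \<phi> \<partial>M q))"
  proof -
    obtain C where C: "\<And>r. 0 \<le> r \<Longrightarrow> r \<le> 1 \<Longrightarrow> \<bar>eta r\<bar> \<le> C" using eta_bounded by blast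
    have bnd: "\<bar>\<Sum>b\<in>F. eta (\<pi> b v)\<bar> \<le> card F * C" for v
    proof -
      have "\<bar>\<Sum>b\<in>F. eta (\<pi> b v)\<bar> \<le> (\<Sum>b\<in>F. \<bar>eta (\<pi> b v)\<bar>)" by (rule sum_abs)
      also have "\<dots> \<le> (\<Sum>b\<in>F. C)" using \<pi>01 by (intro sum_mono C) auto
      finally show ?thesis by simp
    qed
    have "\<Omega>.expectation (\<lambda>\<omega>. \<Sum>b\<in>F. eta (\<pi> b (?V \<omega>)))
        = (\<Sum>q\<in>set_pmf pQ. pmf pQ q * (\<Sum>p\<in>D. pmf (joint_law (pX q) ch) p * (\<integral>t. (\<Sum>b\<in>F. eta (\<pi> b (G q (\<phi> p) (uA q A (snd p) t)))) \<partial>M q)))"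
      unfolding V_eq
    proof (rule expectation_\<Omega>_letter[where C = "card F * C", OF _ bnd])
      fix q p assume p: "p \<in> D"
      show "(\<lambda>t. \<Sum>b\<in>F. eta (\<pi> b (G q (\<phi> p) (uA q A (snd p) t)))) \<in> borel_measurable borel"
        by (intro borel_measurable_sum measurable_compose[OF measurable_compose[OF Gm[OF p] \<pi>m] eta_borel])
    qed
    also have "\<dots> = (\<Sum>q\<in>set_pmf pQ. pmf pQ q * (\<integral>t. table_entropy D (pmf (joint_law (pX q) ch)) Ys (\<lambda>A y y'. dec q A y' (uA q A y t)) A \<theta> \<phi> \<partial>M q))"
    proof (intro sum.cong refl arg_cong2[where f = "(*)"])
      fix q
      let ?K = "\<lambda>a u. \<Sum>b\<in>F. eta (cond_post q A \<theta> \<phi> b a u)"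
      note Km = posterior_entropy(1)[OF F(1), where q = q and A = A and \<theta> = \<theta> and \<phi> = \<phi>] and K0 = posterior_entropy(2)[OF F(1), where q = q and A = A and \<theta> = \<theta> and \<phi> = \<phi>]
        and KC = posterior_entropy(3)[OF F(1) C, where q = q and A = A and \<theta> = \<theta> and \<phi> = \<phi>]
        and pt = sum_posterior_entropy[OF F, where q = q and A = A and \<phi> = \<phi>]
      have "(\<Sum>p\<in>D. pmf (joint_law (pX q) ch) p * (\<integral>t. (\<Sum>b\<in>F. eta (\<pi> b (G q (\<phi> p) (uA q A (snd p) t)))) \<partial>M q))
          = (\<Sum>p\<in>D. pmf (joint_law (pX q) ch) p * (\<integral>t. ?K (\<phi> p) (uA q A (snd p) t) \<partial>M q))"
        by (simp add: \<pi>u)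
      also have "\<dots> = (\<Sum>y\<in>Ys. \<integral>t. (\<Sum>a\<in>\<phi> ` D. (\<Sum>p\<in>{p\<in>D. \<phi> p = a}. pmf (joint_law (pX q) ch) p * dec q A (snd p) (uA q A y t)) * ?K a (uA q A y t)) \<partial>M q)"
        by (rule sum_integral_uA(1)[OF Km K0 KC])
      also have "\<dots> = (\<integral>t. (\<Sum>y\<in>Ys. \<Sum>a\<in>\<phi> ` D. (\<Sum>p\<in>{p\<in>D. \<phi> p = a}. pmf (joint_law (pX q) ch) p * dec q A (snd p) (uA q A y t)) * ?K a (uA q A y t)) \<partial>M q)"
        by (rule Bochner_Integration.integral_sum[symmetric]) (rule sum_integral_uA(2)[OF Km K0 KC])
      also have "\<dots> = (\<integral>t. table_entropy D (pmf (joint_law (pX q) ch)) Ys (\<lambda>A y y'. dec q A y' (uA q A y t)) A \<theta> \<phi> \<partial>M q)"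
        unfolding pt table_entropy_def ..
      finally show "(\<Sum>p\<in>D. pmf (joint_law (pX q) ch) p * (\<integral>t. (\<Sum>b\<in>F. eta (\<pi> b (G q (\<phi> p) (uA q A (snd p) t)))) \<partial>M q))
          = (\<integral>t. table_entropy D (pmf (joint_law (pX q) ch)) Ys (\<lambda>A y y'. dec q A y' (uA q A y t)) A \<theta> \<phi> \<partial>M q)" .
    qed
    finally show ?thesis .
  qed
  have "\<Omega>.mutual_information 2 (count_space F) T (\<lambda>\<omega>. \<theta> (XY \<omega>)) ?V
    = (\<Sum>b\<in>F. eta (measure \<Omega> {\<omega>\<in>space \<Omega>. \<theta> (XY \<omega>) = b})) - \<Omega>.expectation (\<lambda>\<omega>. \<Sum>b\<in>F. eta (\<pi> b (?V \<omega>)))"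
    by (rule \<Omega>.mutual_information_posterior[OF F(1) \<theta>m Vm \<pi>m \<pi>01 post])
  then show ?thesis unfolding ent .
qed


section \<open>The four mutual informations of the bound\<close>

lemma PiM_alphabets:
  "(\<Pi>\<^sub>M l\<in>T. count_space (XX l)) = count_space (PiE T XX)" "(\<Pi>\<^sub>M k\<in>S. count_space (YY k)) = count_space (PiE S YY)"
  by (rule count_space_PiM_finite; use finX finY in \<open>auto intro: countable_finite\<close>)+

lemma finite_alphabets: "finite (PiE T XX)" "finite (PiE S YY)"
  by (auto intro!: finite_PiE simp: finX finY)

lemma D_restrict:
  "p \<in> D \<Longrightarrow> restrict (fst p) T \<in> PiE T XX" "p \<in> D \<Longrightarrow> restrict (snd p) S \<in> PiE S YY"
  by (auto simp: D)

definition Uv :: "'k \<Rightarrow> nat \<times> ('l \<Rightarrow> 'x) \<times> ('k \<Rightarrow> 'y) \<times> (nat \<Rightarrow> real) \<Rightarrow> nat \<Rightarrow> real" where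
  "Uv k \<omega> = U (Q \<omega>) k (W \<omega> (Q \<omega>)) (Y k \<omega>)"

text \<open>For the constructed variables this is the entropy of \<theta> given \<phi>, the messages
  of \<open>A\<close> and \<open>Q\<close>.\<close>

definition cond_ent :: "'k set \<Rightarrow> (('l \<Rightarrow> 'x) \<times> ('k \<Rightarrow> 'y) \<Rightarrow> 'b) \<Rightarrow> (('l \<Rightarrow> 'x) \<times> ('k \<Rightarrow> 'y) \<Rightarrow> 'a) \<Rightarrow> real" where
  "cond_ent A \<theta> \<phi> = (\<Sum>q\<in>set_pmf pQ. pmf pQ q * (\<integral>t. table_entropy D (pmf (joint_law (pX q) ch)) Ys
     (\<lambda>A y y'. dec q A y' (uA q A y t)) A \<theta> \<phi> \<partial>M q))"

lemma cond_post_compose_measurable: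
  assumes m: "m \<in> T \<rightarrow>\<^sub>M Pi\<^sub>M A (\<lambda>_. borel)" and q: "qf \<in> T \<rightarrow>\<^sub>M count_space UNIV"
    and a: "af \<in> T \<rightarrow>\<^sub>M count_space E" and E: "countable E"
  shows "(\<lambda>v. cond_post (qf v) A \<theta> \<phi> b (af v) (m v)) \<in> borel_measurable T"
proof -
  have 1: "(\<lambda>v. cond_post q A \<theta> \<phi> b a (m v)) \<in> borel_measurable T" for q a
    by (rule measurable_compose[OF m cond_post_measurable])
  have 2: "(\<lambda>v. cond_post q A \<theta> \<phi> b (af v) (m v)) \<in> borel_measurable T" for q
    by (rule measurable_compose_countable'[OF 1 a E])
  show ?thesis
    by (rule measurable_compose_countable'[OF 2 q]) simp
qed

text \<open>The messages of \<open>S\<close> and of its complement are two separate components of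
  the observation; \<open>?m\<close> joins them to one vector over all relays, so
  \<open>A = UNIV\<close>.\<close>

lemma mutual_information_fronthaul_all:
  "prob_space.mutual_information \<Omega> 2 (\<Pi>\<^sub>M k\<in>S. count_space (YY k))
     ((\<Pi>\<^sub>M k\<in>S. borel) \<Otimes>\<^sub>M (\<Pi>\<^sub>M l\<in>UNIV. count_space (XX l)) \<Otimes>\<^sub>M (\<Pi>\<^sub>M k\<in>-S. borel) \<Otimes>\<^sub>M count_space UNIV)
     (\<lambda>\<omega>. \<lambda>k\<in>S. Y k \<omega>) (\<lambda>\<omega>. (\<lambda>k\<in>S. Uv k \<omega>, \<lambda>l. X l \<omega>, \<lambda>k\<in>-S. Uv k \<omega>, Q \<omega>))
   = (\<Sum>b\<in>PiE S YY. eta (measure \<Omega> {\<omega>\<in>space \<Omega>. restrict (snd (XY \<omega>)) S = b}))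
     - cond_ent UNIV (\<lambda>p. restrict (snd p) S) (\<lambda>p. restrict (fst p) UNIV)"
proof -
  let ?T = "(\<Pi>\<^sub>M k\<in>S. borel :: (nat \<Rightarrow> real) measure) \<Otimes>\<^sub>M count_space (PiE UNIV XX) \<Otimes>\<^sub>M
    (\<Pi>\<^sub>M k\<in>-S. borel :: (nat \<Rightarrow> real) measure) \<Otimes>\<^sub>M count_space (UNIV :: nat set)"
  let ?\<theta> = "\<lambda>p :: ('l \<Rightarrow> 'x) \<times> ('k \<Rightarrow> 'y). restrict (snd p) S" and ?\<phi> = "\<lambda>p :: ('l \<Rightarrow> 'x) \<times> ('k \<Rightarrow> 'y). restrict (fst p) UNIV"
  let ?m = "\<lambda>v :: ('k \<Rightarrow> nat \<Rightarrow> real) \<times> ('l \<Rightarrow> 'x) \<times> ('k \<Rightarrow> nat \<Rightarrow> real) \<times> nat.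
    \<lambda>k\<in>UNIV. if k \<in> S then fst v k else fst (snd (snd v)) k"
  let ?\<pi> = "\<lambda>b v. cond_post (snd (snd (snd v))) UNIV ?\<theta> ?\<phi> b (fst (snd v)) (?m v)"
  have "prob_space.mutual_information \<Omega> 2 (count_space (PiE S YY)) ?T (\<lambda>\<omega>. ?\<theta> (XY \<omega>))
      (\<lambda>\<omega>. (\<lambda>q a u. (restrict u S, a, restrict u (-S), q)) (Q \<omega>) (?\<phi> (XY \<omega>)) (uA (Q \<omega>) UNIV (\<lambda>k. Y k \<omega>) (W \<omega> (Q \<omega>))))
    = (\<Sum>b\<in>PiE S YY. eta (measure \<Omega> {\<omega>\<in>space \<Omega>. ?\<theta> (XY \<omega>) = b})) - cond_ent UNIV ?\<theta> ?\<phi>"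
    unfolding cond_ent_def
  proof (rule mutual_information_eq_table[where \<pi> = ?\<pi>])
    show "finite (PiE S YY)" by (rule finite_alphabets(2))
    show "0 \<le> ?\<pi> b v \<and> ?\<pi> b v \<le> 1" for b v by (rule cond_post_01)
    show "?\<theta> ` D \<subseteq> PiE S YY" using D_restrict(2) by blast
    show "(\<lambda>u. (restrict u S, a, restrict u (-S), q)) \<in> Pi\<^sub>M UNIV (\<lambda>_. borel) \<rightarrow>\<^sub>M ?T" if a: "a \<in> ?\<phi> ` D" for q a
    proof (intro measurable_Pair measurable_const)
      show "a \<in> space (count_space (PiE UNIV XX))" using a by (elim imageE) (simp only: space_count_space D_restrict(1))
      show "(\<lambda>u. restrict u S) \<in> Pi\<^sub>M UNIV (\<lambda>_. borel) \<rightarrow>\<^sub>M (\<Pi>\<^sub>M k\<in>S. borel)"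
        "(\<lambda>u. restrict u (-S)) \<in> Pi\<^sub>M UNIV (\<lambda>_. borel) \<rightarrow>\<^sub>M (\<Pi>\<^sub>M k\<in>-S. borel)"
        by (rule measurable_restrict_subset; simp)+
    qed simp
    show "?\<pi> b \<in> borel_measurable ?T" for b
    proof (rule cond_post_compose_measurable)
      show "?m \<in> ?T \<rightarrow>\<^sub>M Pi\<^sub>M UNIV (\<lambda>_. borel)"
      proof (rule measurable_restrict)
        fix k
        show "(\<lambda>v. if k \<in> S then fst v k else fst (snd (snd v)) k) \<in> ?T \<rightarrow>\<^sub>M borel"
        proof (cases "k \<in> S")
          case True
          have "(\<lambda>v. fst v k) \<in> ?T \<rightarrow>\<^sub>M borel"
            by (rule measurable_compose[OF measurable_fst measurable_component_singleton[OF True]])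
          then show ?thesis using True by simp
        next
          case False
          then have "(\<lambda>v. fst (snd (snd v)) k) \<in> ?T \<rightarrow>\<^sub>M borel"
            by (intro measurable_compose[OF measurable_compose[OF measurable_compose[OF measurable_snd measurable_snd] measurable_fst] measurable_component_singleton]) simp
          then show ?thesis using False by simp
        qed
      qed
      show "(\<lambda>v. snd (snd (snd v))) \<in> ?T \<rightarrow>\<^sub>M count_space UNIV"
        by (rule measurable_compose[OF measurable_compose[OF measurable_snd measurable_snd] measurable_snd])
      show "(\<lambda>v. fst (snd v)) \<in> ?T \<rightarrow>\<^sub>M count_space (PiE UNIV XX)"
        by (rule measurable_compose[OF measurable_snd measurable_fst])
      show "countable (PiE UNIV XX)" using finite_alphabets(1) by (rule countable_finite)
    qed
    fix q a b and u :: "'k \<Rightarrow> nat \<Rightarrow> real"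
    have "?m (restrict u S, a, restrict u (-S), q) = u" by (auto simp: fun_eq_iff)
    then show "?\<pi> b (restrict u S, a, restrict u (-S), q) = cond_post q UNIV ?\<theta> ?\<phi> b a u" by (simp only: fst_conv snd_conv)
  qed
  moreover have "restrict (uA q UNIV y t) S = (\<lambda>k\<in>S. U q k t (y k))" for q y t S
    by (auto simp: uA_def fun_eq_iff)
  ultimately show ?thesis
    unfolding PiM_alphabets by (simp add: XY_def Uv_def[abs_def] restrict_UNIV)
qed

lemma mutual_information_fronthaul_rest:
  "prob_space.mutual_information \<Omega> 2 (\<Pi>\<^sub>M k\<in>S. count_space (YY k))
     ((\<Pi>\<^sub>M l\<in>UNIV. count_space (XX l)) \<Otimes>\<^sub>M (\<Pi>\<^sub>M k\<in>-S. borel) \<Otimes>\<^sub>M count_space UNIV)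
     (\<lambda>\<omega>. \<lambda>k\<in>S. Y k \<omega>) (\<lambda>\<omega>. (\<lambda>l. X l \<omega>, \<lambda>k\<in>-S. Uv k \<omega>, Q \<omega>))
   = (\<Sum>b\<in>PiE S YY. eta (measure \<Omega> {\<omega>\<in>space \<Omega>. restrict (snd (XY \<omega>)) S = b}))
     - cond_ent (-S) (\<lambda>p. restrict (snd p) S) (\<lambda>p. restrict (fst p) UNIV)"
proof -
  let ?T = "count_space (PiE UNIV XX) \<Otimes>\<^sub>M (\<Pi>\<^sub>M k\<in>-S. borel :: (nat \<Rightarrow> real) measure) \<Otimes>\<^sub>M count_space (UNIV :: nat set)"
  let ?\<theta> = "\<lambda>p :: ('l \<Rightarrow> 'x) \<times> ('k \<Rightarrow> 'y). restrict (snd p) S" and ?\<phi> = "\<lambda>p :: ('l \<Rightarrow> 'x) \<times> ('k \<Rightarrow> 'y). restrict (fst p) UNIV"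
  let ?\<pi> = "\<lambda>b v. cond_post (snd (snd v)) (-S) ?\<theta> ?\<phi> b (fst v) (fst (snd v))"
  have "prob_space.mutual_information \<Omega> 2 (count_space (PiE S YY)) ?T (\<lambda>\<omega>. ?\<theta> (XY \<omega>))
      (\<lambda>\<omega>. (\<lambda>q a u. (a, u, q)) (Q \<omega>) (?\<phi> (XY \<omega>)) (uA (Q \<omega>) (-S) (\<lambda>k. Y k \<omega>) (W \<omega> (Q \<omega>))))
    = (\<Sum>b\<in>PiE S YY. eta (measure \<Omega> {\<omega>\<in>space \<Omega>. ?\<theta> (XY \<omega>) = b})) - cond_ent (-S) ?\<theta> ?\<phi>"
    unfolding cond_ent_def
  proof (rule mutual_information_eq_table[where \<pi> = ?\<pi>])
    show "finite (PiE S YY)" by (rule finite_alphabets(2))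
    show "0 \<le> ?\<pi> b v \<and> ?\<pi> b v \<le> 1" for b v by (rule cond_post_01)
    show "?\<theta> ` D \<subseteq> PiE S YY" using D_restrict(2) by blast
    show "(\<lambda>u. (a, u, q)) \<in> Pi\<^sub>M (-S) (\<lambda>_. borel) \<rightarrow>\<^sub>M ?T" if a: "a \<in> ?\<phi> ` D" for q a
    proof (intro measurable_Pair measurable_const measurable_ident)
      show "a \<in> space (count_space (PiE UNIV XX))" using a by (elim imageE) (simp only: space_count_space D_restrict(1))
    qed simp_all
    show "?\<pi> b \<in> borel_measurable ?T" for b
    proof (rule cond_post_compose_measurable)
      show "(\<lambda>v. fst (snd v)) \<in> ?T \<rightarrow>\<^sub>M Pi\<^sub>M (-S) (\<lambda>_. borel)"
        by (rule measurable_compose[OF measurable_snd measurable_fst])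
      show "(\<lambda>v. snd (snd v)) \<in> ?T \<rightarrow>\<^sub>M count_space UNIV"
        by (rule measurable_compose[OF measurable_snd measurable_snd])
      show "fst \<in> ?T \<rightarrow>\<^sub>M count_space (PiE UNIV XX)" by (rule measurable_fst)
      show "countable (PiE UNIV XX)" using finite_alphabets(1) by (rule countable_finite)
    qed
  qed (simp only: fst_conv snd_conv)
  then show ?thesis
    unfolding PiM_alphabets by (simp add: XY_def Uv_def[abs_def] uA_def restrict_UNIV)
qed

lemma mutual_information_users_all:
  "prob_space.mutual_information \<Omega> 2 (\<Pi>\<^sub>M l\<in>T. count_space (XX l))
     ((\<Pi>\<^sub>M k\<in>-S. borel) \<Otimes>\<^sub>M (\<Pi>\<^sub>M l\<in>-T. count_space (XX l)) \<Otimes>\<^sub>M count_space UNIV)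
     (\<lambda>\<omega>. \<lambda>l\<in>T. X l \<omega>) (\<lambda>\<omega>. (\<lambda>k\<in>-S. Uv k \<omega>, \<lambda>l\<in>-T. X l \<omega>, Q \<omega>))
   = (\<Sum>b\<in>PiE T XX. eta (measure \<Omega> {\<omega>\<in>space \<Omega>. restrict (fst (XY \<omega>)) T = b}))
     - cond_ent (-S) (\<lambda>p. restrict (fst p) T) (\<lambda>p. restrict (fst p) (-T))"
proof -
  let ?T = "(\<Pi>\<^sub>M k\<in>-S. borel :: (nat \<Rightarrow> real) measure) \<Otimes>\<^sub>M count_space (PiE (-T) XX) \<Otimes>\<^sub>M count_space (UNIV :: nat set)"
  let ?\<theta> = "\<lambda>p :: ('l \<Rightarrow> 'x) \<times> ('k \<Rightarrow> 'y). restrict (fst p) T" and ?\<phi> = "\<lambda>p :: ('l \<Rightarrow> 'x) \<times> ('k \<Rightarrow> 'y). restrict (fst p) (-T)"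
  let ?\<pi> = "\<lambda>b v. cond_post (snd (snd v)) (-S) ?\<theta> ?\<phi> b (fst (snd v)) (fst v)"
  have "prob_space.mutual_information \<Omega> 2 (count_space (PiE T XX)) ?T (\<lambda>\<omega>. ?\<theta> (XY \<omega>))
      (\<lambda>\<omega>. (\<lambda>q a u. (u, a, q)) (Q \<omega>) (?\<phi> (XY \<omega>)) (uA (Q \<omega>) (-S) (\<lambda>k. Y k \<omega>) (W \<omega> (Q \<omega>))))
    = (\<Sum>b\<in>PiE T XX. eta (measure \<Omega> {\<omega>\<in>space \<Omega>. ?\<theta> (XY \<omega>) = b})) - cond_ent (-S) ?\<theta> ?\<phi>"
    unfolding cond_ent_def
  proof (rule mutual_information_eq_table[where \<pi> = ?\<pi>])
    show "finite (PiE T XX)" by (rule finite_alphabets(1))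
    show "0 \<le> ?\<pi> b v \<and> ?\<pi> b v \<le> 1" for b v by (rule cond_post_01)
    show "?\<theta> ` D \<subseteq> PiE T XX" using D_restrict(1) by blast
    show "(\<lambda>u. (u, a, q)) \<in> Pi\<^sub>M (-S) (\<lambda>_. borel) \<rightarrow>\<^sub>M ?T" if a: "a \<in> ?\<phi> ` D" for q a
    proof (intro measurable_Pair measurable_const measurable_ident)
      show "a \<in> space (count_space (PiE (-T) XX))" using a by (elim imageE) (simp only: space_count_space D_restrict(1))
    qed simp_all
    show "?\<pi> b \<in> borel_measurable ?T" for b
    proof (rule cond_post_compose_measurable)
      show "fst \<in> ?T \<rightarrow>\<^sub>M Pi\<^sub>M (-S) (\<lambda>_. borel)" by (rule measurable_fst)
      show "(\<lambda>v. snd (snd v)) \<in> ?T \<rightarrow>\<^sub>M count_space UNIV"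
        by (rule measurable_compose[OF measurable_snd measurable_snd])
      show "(\<lambda>v. fst (snd v)) \<in> ?T \<rightarrow>\<^sub>M count_space (PiE (-T) XX)"
        by (rule measurable_compose[OF measurable_snd measurable_fst])
      show "countable (PiE (-T) XX)" using finite_alphabets(1) by (rule countable_finite)
    qed
  qed (simp only: fst_conv snd_conv)
  then show ?thesis
    unfolding PiM_alphabets by (simp add: XY_def Uv_def[abs_def] uA_def)
qed

text \<open>No relay is observed: \<open>A = {}\<close>, and the only message vector is the function
  that is \<open>undefined\<close> everywhere.\<close>

lemma mutual_information_users_rest:
  "prob_space.mutual_information \<Omega> 2 (\<Pi>\<^sub>M l\<in>T. count_space (XX l))
     ((\<Pi>\<^sub>M l\<in>-T. count_space (XX l)) \<Otimes>\<^sub>M count_space UNIV) (\<lambda>\<omega>. \<lambda>l\<in>T. X l \<omega>) (\<lambda>\<omega>. (\<lambda>l\<in>-T. X l \<omega>, Q \<omega>))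
   = (\<Sum>b\<in>PiE T XX. eta (measure \<Omega> {\<omega>\<in>space \<Omega>. restrict (fst (XY \<omega>)) T = b}))
     - cond_ent {} (\<lambda>p. restrict (fst p) T) (\<lambda>p. restrict (fst p) (-T))"
proof -
  let ?T = "count_space (PiE (-T) XX) \<Otimes>\<^sub>M count_space (UNIV :: nat set)"
  let ?\<theta> = "\<lambda>p :: ('l \<Rightarrow> 'x) \<times> ('k \<Rightarrow> 'y). restrict (fst p) T" and ?\<phi> = "\<lambda>p :: ('l \<Rightarrow> 'x) \<times> ('k \<Rightarrow> 'y). restrict (fst p) (-T)"
  let ?\<pi> = "\<lambda>b v. cond_post (snd v) {} ?\<theta> ?\<phi> b (fst v) (\<lambda>_. undefined)"
  have "prob_space.mutual_information \<Omega> 2 (count_space (PiE T XX)) ?T (\<lambda>\<omega>. ?\<theta> (XY \<omega>))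
      (\<lambda>\<omega>. (\<lambda>q a u. (a, q)) (Q \<omega>) (?\<phi> (XY \<omega>)) (uA (Q \<omega>) {} (\<lambda>k. Y k \<omega>) (W \<omega> (Q \<omega>))))
    = (\<Sum>b\<in>PiE T XX. eta (measure \<Omega> {\<omega>\<in>space \<Omega>. ?\<theta> (XY \<omega>) = b})) - cond_ent {} ?\<theta> ?\<phi>"
    unfolding cond_ent_def
  proof (rule mutual_information_eq_table[where \<pi> = ?\<pi>])
    show "finite (PiE T XX)" by (rule finite_alphabets(1))
    show "0 \<le> ?\<pi> b v \<and> ?\<pi> b v \<le> 1" for b v by (rule cond_post_01)
    show "?\<theta> ` D \<subseteq> PiE T XX" using D_restrict(1) by blast
    show "(\<lambda>u. (a, q)) \<in> Pi\<^sub>M {} (\<lambda>_. borel) \<rightarrow>\<^sub>M ?T" if a: "a \<in> ?\<phi> ` D" for q a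
    proof (intro measurable_Pair measurable_const)
      show "a \<in> space (count_space (PiE (-T) XX))" using a by (elim imageE) (simp only: space_count_space D_restrict(1))
    qed simp_all
    show "?\<pi> b \<in> borel_measurable ?T" for b
    proof (rule cond_post_compose_measurable)
      show "(\<lambda>v. \<lambda>_. undefined) \<in> ?T \<rightarrow>\<^sub>M Pi\<^sub>M {} (\<lambda>_. borel)" by (rule measurable_const) (simp add: space_PiM)
      show "snd \<in> ?T \<rightarrow>\<^sub>M count_space UNIV" by (rule measurable_snd)
      show "fst \<in> ?T \<rightarrow>\<^sub>M count_space (PiE (-T) XX)" by (rule measurable_fst)
      show "countable (PiE (-T) XX)" using finite_alphabets(1) by (rule countable_finite)
    qed
    show "cond_post (snd (a, q)) {} ?\<theta> ?\<phi> b (fst (a, q)) (\<lambda>_. undefined) = cond_post q {} ?\<theta> ?\<phi> b a u"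
      if "u \<in> space (Pi\<^sub>M {} (\<lambda>_. borel))" for q a b u
      using that by (simp add: space_PiM)
  qed
  then show ?thesis
    unfolding PiM_alphabets by (simp add: XY_def)
qed

text \<open>A conditional mutual information is a difference of two mutual informations with the
  same first argument, so the entropies of that argument cancel and the terms of
  \<open>table_gain\<close> remain.\<close>

lemma information_gain:
  "- I_fronthaul XX YY \<Omega> Q X Y Uv S + I_users XX \<Omega> Q X Uv T S
    = (\<Sum>q\<in>set_pmf pQ. pmf pQ q * (\<integral>t. table_gain D (pmf (joint_law (pX q) ch)) Ys
        (\<lambda>A y y'. dec q A y' (\<lambda>k\<in>A. U q k t (y k))) T S \<partial>M q))"
proof -
  interpret \<Omega>: prob_space \<Omega> by (rule prob_\<Omega>)
  have f: "I_fronthaul XX YY \<Omega> Q X Y Uv S = cond_ent (-S) (\<lambda>p. restrict (snd p) S) (\<lambda>p. restrict (fst p) UNIV)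
      - cond_ent UNIV (\<lambda>p. restrict (snd p) S) (\<lambda>p. restrict (fst p) UNIV)"
    unfolding I_fronthaul_def \<Omega>.conditional_mutual_information_def mutual_information_fronthaul_all mutual_information_fronthaul_rest by simp
  have u: "I_users XX \<Omega> Q X Uv T S = cond_ent {} (\<lambda>p. restrict (fst p) T) (\<lambda>p. restrict (fst p) (-T))
      - cond_ent (-S) (\<lambda>p. restrict (fst p) T) (\<lambda>p. restrict (fst p) (-T))"
    unfolding I_users_def \<Omega>.conditional_mutual_information_def mutual_information_users_all mutual_information_users_rest by simp
  have gain: "(\<integral>t. table_gain D (pmf (joint_law (pX q) ch)) Ys (\<lambda>A y y'. dec q A y' (uA q A y t)) T S \<partial>M q)
    = (\<integral>t. table_entropy D (pmf (joint_law (pX q) ch)) Ys (\<lambda>A y y'. dec q A y' (uA q A y t)) UNIV (\<lambda>p. restrict (snd p) S) (\<lambda>p. restrict (fst p) UNIV) \<partial>M q)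
      - (\<integral>t. table_entropy D (pmf (joint_law (pX q) ch)) Ys (\<lambda>A y y'. dec q A y' (uA q A y t)) (-S) (\<lambda>p. restrict (snd p) S) (\<lambda>p. restrict (fst p) UNIV) \<partial>M q)
      + ((\<integral>t. table_entropy D (pmf (joint_law (pX q) ch)) Ys (\<lambda>A y y'. dec q A y' (uA q A y t)) {} (\<lambda>p. restrict (fst p) T) (\<lambda>p. restrict (fst p) (-T)) \<partial>M q)
      - (\<integral>t. table_entropy D (pmf (joint_law (pX q) ch)) Ys (\<lambda>A y y'. dec q A y' (uA q A y t)) (-S) (\<lambda>p. restrict (fst p) T) (\<lambda>p. restrict (fst p) (-T)) \<partial>M q))" for q
    unfolding table_gain_def Let_def
    by (simp only: Bochner_Integration.integral_add Bochner_Integration.integral_diff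
        Bochner_Integration.integrable_diff integrable_table_entropy)
  show ?thesis
    unfolding f u cond_ent_def uA_def[symmetric] gain
    by (simp only: distrib_left right_diff_distrib sum.distrib sum_subtractf minus_diff_eq)
qed

lemma realization:
  "\<exists>(\<Omega> :: (nat \<times> ('l \<Rightarrow> 'x) \<times> ('k \<Rightarrow> 'y) \<times> (nat \<Rightarrow> real)) measure) Q X Y W
     (f :: 'k \<Rightarrow> (nat \<Rightarrow> real) \<Rightarrow> 'y \<Rightarrow> nat \<Rightarrow> (nat \<Rightarrow> real)) V.
    cran_law XX YY ch \<Omega> Q X Y W \<and> (\<forall>k y q. (\<lambda>w. f k w y q) \<in> borel \<rightarrow>\<^sub>M borel) \<and>
    (\<forall>k. V k = (\<lambda>\<omega>. f k (W \<omega>) (Y k \<omega>) (Q \<omega>))) \<and>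
    (\<forall>T S. - I_fronthaul XX YY \<Omega> Q X Y V S + I_users XX \<Omega> Q X V T S
      = (\<Sum>q\<in>set_pmf pQ. pmf pQ q * (\<integral>t. table_gain D (pmf (joint_law (pX q) ch)) Ys
          (\<lambda>A y y'. dec q A y' (\<lambda>k\<in>A. U q k t (y k))) T S \<partial>M q)))"
proof (intro exI conjI allI)
  show "cran_law XX YY ch \<Omega> Q X Y W" by (rule cran_law_\<Omega>)
  show "(\<lambda>w :: nat \<Rightarrow> real. (\<lambda>k w y q. U q k (w q) y) k w y q) \<in> borel \<rightarrow>\<^sub>M borel" for k y q
    by (rule measurable_compose[OF coordinate_measurable Um])
  show "Uv k = (\<lambda>\<omega>. (\<lambda>k w y q. U q k (w q) y) k (W \<omega>) (Y k \<omega>) (Q \<omega>))" for k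
    by (simp add: Uv_def[abs_def])
qed (rule information_gain)

end

section \<open>Convexity and the limit of vanishing error\<close>

text \<open>A mean outside a closed convex set would violate a linear inequality that holds
  pointwise. The law \<open>p\<close> may have infinite support, as the law of a time-sharing
  sequence can.\<close>

lemma expectation_in_convex:
  fixes f :: "'a \<Rightarrow> 'b::euclidean_space"
  assumes K: "compact K" "convex K" and f: "\<And>x. x \<in> set_pmf p \<Longrightarrow> f x \<in> K"
  shows "integrable (measure_pmf p) f" and "measure_pmf.expectation p f \<in> K"
proof -
  obtain c where c: "\<And>x. x \<in> K \<Longrightarrow> norm x \<le> c"
    using compact_imp_bounded[OF K(1)] unfolding bounded_iff by blast
  show i: "integrable (measure_pmf p) f"
    by (rule measure_pmf.integrable_const_bound[of _ c]) (use c f in \<open>auto intro!: AE_pmfI\<close>)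
  show "measure_pmf.expectation p f \<in> K"
  proof (rule ccontr)
    assume "measure_pmf.expectation p f \<notin> K"
    then obtain a b where a: "a \<bullet> measure_pmf.expectation p f < b" and ab: "\<And>x. x \<in> K \<Longrightarrow> b < a \<bullet> x"
      using separating_hyperplane_closed_point[OF K(2) compact_imp_closed[OF K(1)]] by metis
    have "measure_pmf.expectation p (\<lambda>_. b) \<le> measure_pmf.expectation p (\<lambda>x. a \<bullet> f x)"
      by (rule integral_mono_AE) (use i ab f in \<open>auto intro!: AE_pmfI less_imp_le\<close>)
    also have "\<dots> = a \<bullet> measure_pmf.expectation p f" using i by (simp add: integral_inner_right)
    finally show False using a by simp
  qed
qed

text \<open>The gains for all pairs \<open>(T, S)\<close> form one vector, because a single choice
  of random variables has to serve all of them.\<close>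

definition gain_vec :: "(('l::finite \<Rightarrow> 'x) \<Rightarrow> ('k::finite \<Rightarrow> 'y) pmf) \<Rightarrow> ('l \<Rightarrow> 'x pmf) \<Rightarrow> ('k \<Rightarrow> 'y \<Rightarrow> nat) pmf
    \<Rightarrow> real ^ ('l set \<times> 'k set)" where
  "gain_vec ch p \<mu> = (\<chi> i. letter_gain (joint_law p ch) \<mu> (fst i) (snd i))"

text \<open>The vectors reached by one letter with independent inputs and a finitely supported
  table. Mixtures are left to the time-sharing variable.\<close>

definition gains :: "('l::finite \<Rightarrow> 'x set) \<Rightarrow> (('l \<Rightarrow> 'x) \<Rightarrow> ('k::finite \<Rightarrow> 'y) pmf) \<Rightarrow> (real ^ ('l set \<times> 'k set)) set" where
  "gains XX ch = {gain_vec ch p \<mu> | p \<mu>. (\<forall>l. set_pmf (p l) \<subseteq> XX l) \<and> finite (set_pmf \<mu>)}"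

lemma gain_vec_nth: "gain_vec ch p \<mu> $ (T, S) = letter_gain (joint_law p ch) \<mu> T S"
  by (simp add: gain_vec_def)

lemma bounded_gains:
  fixes XX :: "'l::finite \<Rightarrow> 'x set" and YY :: "'k::finite \<Rightarrow> 'y set"
  assumes finX: "\<And>l. finite (XX l)" and finY: "\<And>k. finite (YY k)"
    and chS: "\<And>x. (\<forall>l. x l \<in> XX l) \<Longrightarrow> set_pmf (ch x) \<subseteq> {y. \<forall>k. y k \<in> YY k}"
  shows "bounded (gains XX ch)"
proof -
  let ?Ys = "PiE UNIV YY" and ?D = "PiE UNIV XX \<times> PiE UNIV YY"
  have fin: "finite ?Ys" "finite ?D" and DY: "snd ` ?D \<subseteq> ?Ys" using finX finY by (auto intro!: finite_PiE)
  have "\<exists>c. \<forall>v\<in>gains XX ch. \<bar>v $ i\<bar> \<le> c" for i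
  proof -
    obtain T S where i: "i = (T, S)" by (cases i)
    obtain c where c: "\<And>b z. (\<And>p. p \<in> ?D \<Longrightarrow> 0 \<le> b p \<and> b p \<le> 1) \<Longrightarrow>
        (\<And>A y y'. y \<in> ?Ys \<Longrightarrow> y' \<in> ?Ys \<Longrightarrow> 0 \<le> z A y y' \<and> z A y y' \<le> 1) \<Longrightarrow> \<bar>table_gain ?D b ?Ys z T S\<bar> \<le> c"
      using table_gain_bounded[OF fin(2) DY] by blast
    have "\<bar>v $ i\<bar> \<le> c" if v: "v \<in> gains XX ch" for v
    proof -
      obtain p \<mu> where p: "\<And>l. set_pmf (p l) \<subseteq> XX l" and \<mu>: "finite (set_pmf \<mu>)" and v: "v = gain_vec ch p \<mu>"
        using v unfolding gains_def by blast
      have J: "set_pmf (joint_law p ch) \<subseteq> ?D" by (rule set_joint_law) (use p chS in blast)+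
      have tg: "\<bar>table_gain ?D (pmf (joint_law p ch)) ?Ys (post_table ?Ys \<mu> w) T S\<bar> \<le> c" for w
        by (rule c) (auto simp: pmf_le_1 post_table_def posterior_nonneg posterior_le_1 fin(1) simp del: PiE_UNIV_domain)
      have "v $ i = measure_pmf.expectation \<mu> (\<lambda>w. table_gain ?D (pmf (joint_law p ch)) ?Ys (post_table ?Ys \<mu> w) T S)"
        unfolding v i gain_vec_nth by (rule letter_gain_eq_table[OF fin(1) \<mu> fin(2) J DY])
      also have "\<bar>\<dots>\<bar> \<le> measure_pmf.expectation \<mu> (\<lambda>w. \<bar>table_gain ?D (pmf (joint_law p ch)) ?Ys (post_table ?Ys \<mu> w) T S\<bar>)"
        by (rule integral_abs_bound)
      also have "\<dots> \<le> measure_pmf.expectation \<mu> (\<lambda>w. c)"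
        by (rule integral_mono) (use tg \<mu> in \<open>auto intro: integrable_measure_pmf_finite\<close>)
      finally show ?thesis by simp
    qed
    then show ?thesis by blast
  qed
  then obtain c where c: "\<And>i v. v \<in> gains XX ch \<Longrightarrow> \<bar>v $ i\<bar> \<le> c i" by metis
  show ?thesis
  proof (rule boundedI)
    fix v assume "v \<in> gains XX ch"
    then have "(\<Sum>i\<in>UNIV. \<bar>v $ i\<bar>) \<le> (\<Sum>i\<in>UNIV. c i)" by (intro sum_mono c)
    then show "norm v \<le> (\<Sum>i\<in>UNIV. c i)" by (rule order_trans[OF norm_le_l1_cart])
  qed
qed

text \<open>Three averages stay inside the convex set \<open>K\<close>: over the conditioning
  variable of \<open>single_letter\<close>, over the letters of the block, and over the time-sharing
  sequence. The left side is affine in the error probability, so the last average produces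
  \<open>error_prob\<close>.\<close>

lemma code_gain:
  fixes XX :: "'l::finite \<Rightarrow> 'x set" and YY :: "'k::finite \<Rightarrow> 'y set"
    and c :: "('l, 'k, 'x, 'y) cran_code"
  assumes finX: "\<And>l. finite (XX l)" and finY: "\<And>k. finite (YY k)"
    and chS: "\<And>x. (\<forall>l. x l \<in> XX l) \<Longrightarrow> set_pmf (ch x) \<subseteq> {y. \<forall>k. y k \<in> YY k}"
    and C0: "\<And>k. 0 \<le> C k" and R0: "\<And>l. 0 \<le> R l"
    and valid: "cran_code_valid XX YY C R n c" and n: "0 < n"
    and K: "compact K" "convex K" "gains XX ch \<subseteq> K"
  shows "\<exists>v\<in>K. \<forall>T S. (\<Sum>t\<in>T. log 2 (num_idx n (R t))) * (1 - error_prob XX ch R n c) - 1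
    \<le> (\<Sum>s\<in>S. log 2 (num_idx n (C s))) + real n * v $ (T, S)"
proof -
  define Pm where "Pm q = (do {
     m \<leftarrow> Pi_pmf UNIV undefined (\<lambda>l. pmf_of_set {1..num_idx n (R l)});
     f \<leftarrow> Pi_pmf UNIV undefined (\<lambda>l. codebook_pmf XX R n c l q);
     y \<leftarrow> Pi_pmf {1..n} undefined (\<lambda>i. ch (\<lambda>l. encoder c l (f l) (m l) q i));
     return_pmf (m, decoder c f (\<lambda>k. relay c k (\<lambda>i\<in>{1..n}. y i k) q) q)
   })" for q
  define Pe where "Pe q = measure_pmf.prob (Pm q) {(m, m'). m' \<noteq> m}" for q
  define Pq where "Pq = Pi_pmf {1..n} undefined (\<lambda>_. time_pmf c)"
  have err: "error_prob XX ch R n c = measure_pmf.expectation Pq Pe"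
    unfolding error_prob_def message_pmf_def Pq_def Pe_def Pm_def by (rule prob_bind_pmf)
  have "\<exists>w\<in>K. \<forall>T S. (\<Sum>t\<in>T. log 2 (num_idx n (R t))) * (1 - Pe q) - 1
    \<le> (\<Sum>s\<in>S. log 2 (num_idx n (C s))) + real n * w $ (T, S)" if q: "q \<in> {1..n} \<rightarrow>\<^sub>E UNIV" for q
  proof -
    note block = oblivious_block_bound[where XX = XX and YY = YY and ch = ch and C = C and R = R and c = c and n = n and q = q,
        OF finX finY chS C0 R0 valid q, folded Pm_def Pe_def, folded joint_law_def]
    let ?B = "\<lambda>i. joint_law (\<lambda>l. input_pmf c l (q i)) ch"
    let ?P = "Pi_pmf {1..n} undefined ?B"
    let ?J = "\<lambda>A \<omega>. restrict (\<lambda>k. relay c k (\<lambda>j\<in>{1..n}. snd (\<omega> j) k) q) A"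
    let ?X = "\<lambda>A \<omega>. \<lambda>j\<in>{1..n}. restrict (fst (\<omega> j)) A"
    have "\<exists>G :: nat \<Rightarrow> ('k \<Rightarrow> 'y \<Rightarrow> nat) pmf pmf.
      (\<forall>i. finite (set_pmf (G i)) \<and> (\<forall>\<mu>\<in>set_pmf (G i). finite (set_pmf \<mu>))) \<and>
      (\<forall>T S. cond_entropy_of ?P (?J (-S)) (?X (-T)) - cond_entropy_of ?P (?J (-S)) (?X UNIV)
          - cond_entropy_of ?P (?J S) (\<lambda>\<omega>. (?J (-S) \<omega>, ?X UNIV \<omega>))
        \<le> (\<Sum>i=1..n. measure_pmf.expectation (G i) (\<lambda>\<mu>. letter_gain (?B i) \<mu> T S)))"
      by (rule single_letter[where rl = "\<lambda>k y. relay c k y q"]) (rule block(1))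
    then obtain G :: "nat \<Rightarrow> ('k \<Rightarrow> 'y \<Rightarrow> nat) pmf pmf" where
      G': "\<forall>i. finite (set_pmf (G i)) \<and> (\<forall>\<mu>\<in>set_pmf (G i). finite (set_pmf \<mu>))" and
      gain': "\<forall>T S. cond_entropy_of ?P (?J (-S)) (?X (-T)) - cond_entropy_of ?P (?J (-S)) (?X UNIV)
          - cond_entropy_of ?P (?J S) (\<lambda>\<omega>. (?J (-S) \<omega>, ?X UNIV \<omega>))
        \<le> (\<Sum>i=1..n. measure_pmf.expectation (G i) (\<lambda>\<mu>. letter_gain (?B i) \<mu> T S))"
      by (elim exE conjE)
    note G = G'[THEN spec, THEN conjunct2, THEN bspec]
    let ?g = "\<lambda>i. gain_vec ch (\<lambda>l. input_pmf c l (q i))"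
    define w where "w = (\<Sum>i=1..n. (1 / real n) *\<^sub>R measure_pmf.expectation (G i) (?g i))"
    have sup: "set_pmf (input_pmf c l j) \<subseteq> XX l" for l j using valid unfolding cran_code_valid_def by blast
    have gK: "?g i \<mu> \<in> K" if "\<mu> \<in> set_pmf (G i)" for i \<mu>
    proof (rule subsetD[OF K(3)])
      show "?g i \<mu> \<in> gains XX ch"
        unfolding gains_def
        by (intro CollectI exI[of _ "\<lambda>l. input_pmf c l (q i)"] exI[of _ \<mu>] conjI refl allI sup G[OF that])
    qed
    have eK: "measure_pmf.expectation (G i) (?g i) \<in> K" for i
      by (rule expectation_in_convex(2)[OF K(1,2) gK])
    have "w \<in> K" unfolding w_def by (rule convex_sum) (use K(2) eK n in auto)
    have wn: "real n * w $ (T, S) = (\<Sum>i=1..n. measure_pmf.expectation (G i) (\<lambda>\<mu>. letter_gain (joint_law (\<lambda>l. input_pmf c l (q i)) ch) \<mu> T S))" for T S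
    proof -
      have "measure_pmf.expectation (G i) (?g i) $ (T, S)
          = measure_pmf.expectation (G i) (\<lambda>\<mu>. letter_gain (joint_law (\<lambda>l. input_pmf c l (q i)) ch) \<mu> T S)" for i
      proof -
        have "integrable (measure_pmf (G i)) (?g i)" by (rule expectation_in_convex(1)[OF K(1,2) gK])
        from integral_bounded_linear[OF bounded_linear_vec_nth[of "(T, S)"] this] show ?thesis by (simp add: gain_vec_nth)
      qed
      then show ?thesis using n by (simp add: w_def sum_component sum_distrib_left)
    qed
    have b: "(\<Sum>t\<in>T. log 2 (num_idx n (R t))) * (1 - Pe q) - 1 \<le> (\<Sum>s\<in>S. log 2 (num_idx n (C s)))
      + (cond_entropy_of ?P (?J (-S)) (?X (-T)) - cond_entropy_of ?P (?J (-S)) (?X UNIV)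
         - cond_entropy_of ?P (?J S) (\<lambda>\<omega>. (?J (-S) \<omega>, ?X UNIV \<omega>)))" for T S
      by (rule block(2))
    have "(\<Sum>t\<in>T. log 2 (num_idx n (R t))) * (1 - Pe q) - 1 \<le> (\<Sum>s\<in>S. log 2 (num_idx n (C s))) + real n * w $ (T, S)" for T S
      using b[of T S] gain'[THEN spec[of _ T], THEN spec[of _ S]] wn[of T S] by linarith
    with \<open>w \<in> K\<close> show ?thesis by blast
  qed
  then obtain w where w: "\<And>q. q \<in> {1..n} \<rightarrow>\<^sub>E UNIV \<Longrightarrow> w q \<in> K"
    "\<And>q T S. q \<in> {1..n} \<rightarrow>\<^sub>E UNIV \<Longrightarrow> (\<Sum>t\<in>T. log 2 (num_idx n (R t))) * (1 - Pe q) - 1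
      \<le> (\<Sum>s\<in>S. log 2 (num_idx n (C s))) + real n * w q $ (T, S)"
    by metis
  have Pq: "q \<in> {1..n} \<rightarrow>\<^sub>E UNIV" if "q \<in> set_pmf Pq" for q
    using that set_Pi_pmf_subset'[of "{1..n}" undefined "\<lambda>_. time_pmf c"] unfolding Pq_def by (auto simp: PiE_dflt_def PiE_iff extensional_def)
  have iw: "integrable (measure_pmf Pq) w" and vK: "measure_pmf.expectation Pq w \<in> K"
    using expectation_in_convex[OF K(1,2), of Pq w] w(1) Pq by auto
  have iPe: "integrable (measure_pmf Pq) Pe"
    by (rule measure_pmf.integrable_const_bound[of _ 1]) (auto simp: Pe_def)
  have "(\<Sum>t\<in>T. log 2 (num_idx n (R t))) * (1 - error_prob XX ch R n c) - 1
    \<le> (\<Sum>s\<in>S. log 2 (num_idx n (C s))) + real n * measure_pmf.expectation Pq w $ (T, S)" for T S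
  proof -
    let ?H = "\<Sum>t\<in>T. log 2 (num_idx n (R t))" and ?L = "\<Sum>s\<in>S. log 2 (num_idx n (C s))"
    have iwn: "integrable (measure_pmf Pq) (\<lambda>q. w q $ (T, S))" "measure_pmf.expectation Pq (\<lambda>q. w q $ (T, S)) = measure_pmf.expectation Pq w $ (T, S)"
      by (rule integrable_bounded_linear[OF bounded_linear_vec_nth iw], rule integral_bounded_linear[OF bounded_linear_vec_nth iw])
    have "measure_pmf.expectation Pq (\<lambda>q. ?H * (1 - Pe q) - 1) \<le> measure_pmf.expectation Pq (\<lambda>q. ?L + real n * w q $ (T, S))"
      by (rule integral_mono_AE) (use iPe iwn(1) w(2) Pq in \<open>auto intro!: AE_pmfI\<close>)
    then show ?thesis using iPe iwn by (simp add: err)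
  qed
  with vK show ?thesis by blast
qed

text \<open>Error probability at most \<open>1 / Suc j\<close> and block length at least
  \<open>Suc j\<close> make every slack term a constant times \<open>1 / Suc j\<close>; compactness
  of \<open>K\<close> then supplies a limit vector without slack.\<close>

lemma achievable_gain:
  fixes XX :: "'l::finite \<Rightarrow> 'x set" and YY :: "'k::finite \<Rightarrow> 'y set" and ch :: "('l \<Rightarrow> 'x) \<Rightarrow> ('k \<Rightarrow> 'y) pmf"
  assumes finX: "\<And>l. finite (XX l)" and finY: "\<And>k. finite (YY k)"
    and chS: "\<And>x. (\<forall>l. x l \<in> XX l) \<Longrightarrow> set_pmf (ch x) \<subseteq> {y. \<forall>k. y k \<in> YY k}"
    and C0: "\<And>k. 0 \<le> C k" and R0: "\<And>l. 0 \<le> R l" and ach: "cran_achievable XX YY ch C R"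
    and K: "compact K" "convex K" "gains XX ch \<subseteq> K"
  shows "\<exists>v\<in>K. \<forall>T S. (\<Sum>t\<in>T. R t) \<le> (\<Sum>s\<in>S. C s) + v $ (T, S)"
proof -
  let ?e = "\<lambda>j. 1 / real (Suc j)"
  have "\<exists>v\<in>K. \<forall>T S. (\<Sum>t\<in>T. R t) - ((\<Sum>t\<in>T. R t) + card T + 1) * ?e j \<le> (\<Sum>s\<in>S. C s) + v $ (T, S)" for j
  proof -
    define e where "e = ?e j"
    have e0: "0 < e" and e1: "e \<le> 1" by (simp_all add: e_def)
    obtain c :: "nat \<Rightarrow> ('l, 'k, 'x, 'y) cran_code" where
      "\<forall>\<^sub>F n in sequentially. cran_code_valid XX YY C R n (c n) \<and> error_prob XX ch R n (c n) \<le> e"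
      using ach e0 unfolding cran_achievable_def by blast
    then obtain N where N: "\<And>n. N \<le> n \<Longrightarrow> cran_code_valid XX YY C R n (c n) \<and> error_prob XX ch R n (c n) \<le> e"
      unfolding eventually_sequentially by blast
    \<comment> \<open>The losses independent of the length are one bit from Fano's inequality and
      one bit of rounding for each user in \<open>T\<close>. Length at least \<open>Suc j\<close>
      makes each of them at most \<open>?e j\<close> per letter.\<close>
    define n where "n = max N (Suc j)"
    have n: "0 < n" "Suc j \<le> n" and valid: "cran_code_valid XX YY C R n (c n)" and err: "error_prob XX ch R n (c n) \<le> e"
      using N[of n] by (auto simp: n_def)
    obtain v where v: "v \<in> K" "\<And>T S. (\<Sum>t\<in>T. log 2 (num_idx n (R t))) * (1 - error_prob XX ch R n (c n)) - 1
      \<le> (\<Sum>s\<in>S. log 2 (num_idx n (C s))) + real n * v $ (T, S)"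
      using code_gain[OF finX finY chS C0 R0 valid n(1) K] by blast
    have "(\<Sum>t\<in>T. R t) - ((\<Sum>t\<in>T. R t) + card T + 1) * e \<le> (\<Sum>s\<in>S. C s) + v $ (T, S)" for T S
    proof -
      let ?H = "\<Sum>t\<in>T. log 2 (num_idx n (R t))" and ?R = "\<Sum>t\<in>T. R t" and ?C = "\<Sum>s\<in>S. C s"
      have "(\<Sum>t\<in>T. real n * R t - 1) \<le> ?H" by (intro sum_mono log_num_idx_ge R0)
      then have H: "real n * ?R - card T \<le> ?H" by (simp add: sum_subtractf sum_distrib_left)
      have "0 \<le> log 2 (real (num_idx n (R t)))" for t
        using num_idx_ge_1[OF R0[of t], of n] by (subst zero_le_log_cancel_iff) auto
      then have H0: "0 \<le> ?H" by (intro sum_nonneg) simp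
      have "(\<Sum>s\<in>S. log 2 (num_idx n (C s))) \<le> (\<Sum>s\<in>S. real n * C s)" by (intro sum_mono log_num_idx_le C0)
      then have L: "(\<Sum>s\<in>S. log 2 (num_idx n (C s))) \<le> real n * ?C" by (simp add: sum_distrib_left)
      have "(real n * ?R - card T) * (1 - e) \<le> ?H * (1 - e)" using H e1 by (intro mult_right_mono) auto
      also have "\<dots> \<le> ?H * (1 - error_prob XX ch R n (c n))" using H0 err by (intro mult_left_mono) auto
      finally have "(real n * ?R - card T) * (1 - e) - 1 \<le> real n * ?C + real n * v $ (T, S)"
        using v(2)[of T S] L by linarith
      moreover have "real n * ?R * (1 - e) - card T \<le> (real n * ?R - card T) * (1 - e)"
      proof -
        have "real (card T) * (1 - e) \<le> real (card T) * 1" using e0 by (intro mult_left_mono) auto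
        then show ?thesis by (simp add: left_diff_distrib)
      qed
      ultimately have "real n * (?R * (1 - e) - ?C - v $ (T, S)) \<le> card T + 1"
        by (simp add: algebra_simps)
      then have "?R * (1 - e) - ?C - v $ (T, S) \<le> (card T + 1) / real n"
        using n(1) by (simp add: pos_le_divide_eq mult.commute)
      also have "\<dots> \<le> (card T + 1) * e"
        
      proof -
        have "1 / real n \<le> e" using n(2) by (simp add: e_def frac_le)
        then have "(card T + 1) * (1 / real n) \<le> (card T + 1) * e" by (intro mult_left_mono) auto
        then show ?thesis by simp
      qed
      finally show ?thesis by (simp add: algebra_simps)
    qed
    with v(1) show ?thesis unfolding e_def by blast
  qed
  then obtain v where v: "\<And>j. v j \<in> K" "\<And>j T S. (\<Sum>t\<in>T. R t) - ((\<Sum>t\<in>T. R t) + card T + 1) * ?e j \<le> (\<Sum>s\<in>S. C s) + v j $ (T, S)"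
    by metis
  obtain z r where z: "z \<in> K" "strict_mono r" "(v \<circ> r) \<longlonglongrightarrow> z"
    using K(1) v(1) unfolding compact_def by metis
  have "(\<Sum>t\<in>T. R t) \<le> (\<Sum>s\<in>S. C s) + z $ (T, S)" for T S
  proof (rule LIMSEQ_le)
    have "?e \<longlonglongrightarrow> 0" by (rule LIMSEQ_Suc[OF lim_const_over_n])
    then have "(?e \<circ> r) \<longlonglongrightarrow> 0" using z(2) by (rule LIMSEQ_subseq_LIMSEQ)
    then have "(\<lambda>j. (\<Sum>t\<in>T. R t) - ((\<Sum>t\<in>T. R t) + card T + 1) * (?e \<circ> r) j)
        \<longlonglongrightarrow> (\<Sum>t\<in>T. R t) - ((\<Sum>t\<in>T. R t) + card T + 1) * 0"
      by (intro tendsto_intros)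
    then show "(\<lambda>j. (\<Sum>t\<in>T. R t) - ((\<Sum>t\<in>T. R t) + card T + 1) * (?e \<circ> r) j) \<longlonglongrightarrow> (\<Sum>t\<in>T. R t)" by simp
    show "(\<lambda>j. (\<Sum>s\<in>S. C s) + (v \<circ> r) j $ (T, S)) \<longlonglongrightarrow> (\<Sum>s\<in>S. C s) + z $ (T, S)"
      by (intro tendsto_intros z(3))
    show "\<exists>N. \<forall>j\<ge>N. (\<Sum>t\<in>T. R t) - ((\<Sum>t\<in>T. R t) + card T + 1) * (?e \<circ> r) j \<le> (\<Sum>s\<in>S. C s) + (v \<circ> r) j $ (T, S)"
      using v(2) by auto
  qed
  with z(1) show ?thesis by blast
qed

text \<open>Bundles what \<open>limit_structure\<close> provides, so that a structure can be chosen
  for every \<open>q\<close> simultaneously.\<close>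

definition realizes :: "('l::finite \<Rightarrow> 'x set) \<Rightarrow> ('k::finite \<Rightarrow> 'y set) \<Rightarrow> (('l \<Rightarrow> 'x) \<Rightarrow> ('k \<Rightarrow> 'y) pmf)
    \<Rightarrow> real ^ ('l set \<times> 'k set) \<Rightarrow> ('l \<Rightarrow> 'x pmf) \<Rightarrow> real measure \<Rightarrow> ('k \<Rightarrow> real \<Rightarrow> 'y \<Rightarrow> nat \<Rightarrow> real)
    \<Rightarrow> ('k set \<Rightarrow> ('k \<Rightarrow> 'y) \<Rightarrow> ('k \<Rightarrow> nat \<Rightarrow> real) \<Rightarrow> real) \<Rightarrow> bool" where
  "realizes XX YY ch v p M U dec \<longleftrightarrow> (\<forall>l. set_pmf (p l) \<subseteq> XX l) \<and> real_distribution M \<and>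
    (\<forall>k y. (\<lambda>t. U k t y) \<in> borel \<rightarrow>\<^sub>M borel) \<and>
    (\<forall>A y. dec A y \<in> borel_measurable (Pi\<^sub>M A (\<lambda>_. borel))) \<and> (\<forall>A y u. 0 \<le> dec A y u) \<and>
    (\<forall>A. \<forall>y\<in>PiE UNIV YY. \<forall>y'\<in>PiE UNIV YY. AE t in M. dec A y (\<lambda>k\<in>A. U k t (y' k)) \<le> 1) \<and>
    (\<forall>A. \<forall>y\<in>PiE UNIV YY. \<forall>B\<in>sets (Pi\<^sub>M A (\<lambda>_. borel)). measure M {t. (\<lambda>k\<in>A. U k t (y k)) \<in> B}
      = (\<Sum>y'\<in>PiE UNIV YY. \<integral>t. indicator B (\<lambda>k\<in>A. U k t (y' k)) * dec A y (\<lambda>k\<in>A. U k t (y' k)) \<partial>M)) \<and>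
    (\<forall>T S. v $ (T, S) = (\<integral>t. table_gain (PiE UNIV XX \<times> PiE UNIV YY) (pmf (joint_law p ch)) (PiE UNIV YY)
      (\<lambda>A y y'. dec A y' (\<lambda>k\<in>A. U k t (y k))) T S \<partial>M))"

lemma closure_gains_realizable:
  fixes XX :: "'l::finite \<Rightarrow> 'x set" and YY :: "'k::finite \<Rightarrow> 'y set"
  assumes finX: "\<And>l. finite (XX l)" and finY: "\<And>k. finite (YY k)"
    and chS: "\<And>x. (\<forall>l. x l \<in> XX l) \<Longrightarrow> set_pmf (ch x) \<subseteq> {y. \<forall>k. y k \<in> YY k}"
    and v: "v \<in> closure (gains XX ch)"
  shows "\<exists>p M U dec. realizes XX YY ch v p M U dec"
proof -
  obtain s where s: "\<And>n. s n \<in> gains XX ch" "s \<longlonglongrightarrow> v" using v unfolding closure_sequential by blast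
  then obtain p :: "nat \<Rightarrow> 'l \<Rightarrow> 'x pmf" and \<mu> :: "nat \<Rightarrow> ('k \<Rightarrow> 'y \<Rightarrow> nat) pmf" where
    p: "\<And>n l. set_pmf (p n l) \<subseteq> XX l" and \<mu>: "\<And>n. finite (set_pmf (\<mu> n))" and sn: "\<And>n. s n = gain_vec ch (p n) (\<mu> n)"
    unfolding gains_def mem_Collect_eq by metis
  have "(\<lambda>n. letter_gain (joint_law (p n) ch) (\<mu> n) T S) \<longlonglongrightarrow> v $ (T, S)" for T S
    using tendsto_vec_nth[OF s(2), of "(T, S)"] unfolding sn gain_vec_nth .
  from limit_structure[where XX = XX and YY = YY and v = "\<lambda>T S. v $ (T, S)", OF finX finY chS p \<mu> this]
  show ?thesis unfolding realizes_def by blast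
qed

theorem theorem3:
  fixes XX :: "'l::finite \<Rightarrow> 'x set"
    and YY :: "'k::finite \<Rightarrow> 'y set"
    and ch :: "('l \<Rightarrow> 'x) \<Rightarrow> ('k \<Rightarrow> 'y) pmf"
    and C :: "'k \<Rightarrow> real"
    and R :: "'l \<Rightarrow> real"
  assumes "\<And>l. finite (XX l) \<and> XX l \<noteq> {}"
    and "\<And>k. finite (YY k) \<and> YY k \<noteq> {}"
    and "\<And>x. (\<forall>l. x l \<in> XX l) \<Longrightarrow> set_pmf (ch x) \<subseteq> {y. \<forall>k. y k \<in> YY k}"
    and "\<And>k. 0 \<le> C k"
    and "\<And>l. 0 \<le> R l"
    and "cran_achievable XX YY ch C R"
  shows "\<exists>(\<Omega> :: (nat \<times> ('l \<Rightarrow> 'x) \<times> ('k \<Rightarrow> 'y) \<times> (nat \<Rightarrow> real)) measure) Q X Y W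
           (f :: 'k \<Rightarrow> (nat \<Rightarrow> real) \<Rightarrow> 'y \<Rightarrow> nat \<Rightarrow> (nat \<Rightarrow> real)) U.
      cran_law XX YY ch \<Omega> Q X Y W \<and>
      (\<forall>k y q. (\<lambda>w. f k w y q) \<in> borel \<rightarrow>\<^sub>M borel) \<and>
      (\<forall>k. U k = (\<lambda>\<omega>. f k (W \<omega>) (Y k \<omega>) (Q \<omega>))) \<and>
      (\<forall>T S. T \<noteq> {} \<longrightarrow>
         (\<Sum>t\<in>T. R t) \<le> (\<Sum>s\<in>S. C s)
             - I_fronthaul XX YY \<Omega> Q X Y U S + I_users XX \<Omega> Q X U T S)"
proof -
  have finX: "finite (XX l)" and neX: "XX l \<noteq> {}" and finY: "finite (YY k)" and neY: "YY k \<noteq> {}" for l k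
    using assms(1,2) by blast+
  note chS = assms(3)
  let ?Ys = "PiE UNIV YY" and ?D = "PiE UNIV XX \<times> PiE UNIV YY"
  have "compact (closure (gains XX ch))"
    using bounded_gains[OF finX finY chS] by (simp add: compact_closure)
  \<comment> \<open>The hull of the closure, not the closure of the hull: in finite dimension it is
    already compact, and each of its points is a finite combination of points of the closure, which
    gives \<open>Q\<close> finite support.\<close>
  then have "compact (convex hull (closure (gains XX ch)))" by (rule compact_convex_hull)
  moreover have "gains XX ch \<subseteq> convex hull (closure (gains XX ch))"
    by (rule order_trans[OF closure_subset hull_subset])
  ultimately obtain v where v: "v \<in> convex hull (closure (gains XX ch))"
    "\<And>T S. (\<Sum>t\<in>T. R t) \<le> (\<Sum>s\<in>S. C s) + v $ (T, S)"
    using achievable_gain[OF finX finY chS assms(4-6), of "convex hull (closure (gains XX ch))"] convex_convex_hull by blast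
  obtain m :: nat and u x where ux: "\<forall>i\<in>{1..m}. 0 \<le> u i \<and> x i \<in> closure (gains XX ch)" "sum u {1..m} = 1"
    and vx: "(\<Sum>i=1..m. u i *\<^sub>R x i) = v"
    using v(1) unfolding convex_hull_indexed mem_Collect_eq by (elim exE conjE) (rule that)
  have u: "\<And>i. i \<in> {1..m} \<Longrightarrow> 0 \<le> u i" "sum u {1..m} = 1" and x: "\<And>i. i \<in> {1..m} \<Longrightarrow> x i \<in> closure (gains XX ch)"
    using ux by blast+
  have m: "1 \<in> {1..m}" using u(2) by (cases m) auto
  \<comment> \<open>The locale asks for a structure at every natural number; outside
    \<open>{1..m}\<close> the first point serves, where \<open>pQ\<close> has no mass.\<close>
  define x' where "x' q = (if q \<in> {1..m} then x q else x 1)" for q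
  have x'c: "x' q \<in> closure (gains XX ch)" for q
  proof (cases "q \<in> {1..m}")
    case True
    from x[OF True] show ?thesis unfolding x'_def if_P[OF True] .
  next
    case False
    from x[OF m] show ?thesis unfolding x'_def if_not_P[OF False] .
  qed
  define pQ where "pQ = embed_pmf (\<lambda>i. if i \<in> {1..m} then u i else 0)"
  have pQ: "pmf pQ i = (if i \<in> {1..m} then u i else 0)" for i
    unfolding pQ_def
  proof (rule pmf_embed_pmf)
    have "(\<integral>\<^sup>+i. ennreal (if i \<in> {1..m} then u i else 0) \<partial>count_space UNIV) = (\<Sum>i=1..m. ennreal (if i \<in> {1..m} then u i else 0))"
      by (rule nn_integral_count_space') auto
    also have "\<dots> = ennreal (\<Sum>i=1..m. u i)" using u(1) by (subst sum_ennreal[symmetric]) auto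
    finally show "(\<integral>\<^sup>+i. ennreal (if i \<in> {1..m} then u i else 0) \<partial>count_space UNIV) = 1" using u(2) by simp
  qed (use u(1) in auto)
  have supQ: "set_pmf pQ \<subseteq> {1..m}" by (auto simp: set_pmf_iff pQ split: if_splits)
  have "\<exists>p M U dec. realizes XX YY ch (x' q) p M U dec" for q
    by (rule closure_gains_realizable) (use finX finY chS x'c in blast)+
  then obtain pX M U dec where s: "\<And>q. realizes XX YY ch (x' q) (pX q) (M q) (U q) (dec q)"
    by metis
  have s1: "\<forall>l. set_pmf (pX q l) \<subseteq> XX l" and s2: "real_distribution (M q)"
    and s3: "\<forall>k y. (\<lambda>t. U q k t y) \<in> borel \<rightarrow>\<^sub>M (borel :: (nat \<Rightarrow> real) measure)"
    and s4: "\<forall>A y. dec q A y \<in> borel_measurable (Pi\<^sub>M A (\<lambda>_. borel))" and s5: "\<forall>A y u. 0 \<le> dec q A y u"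
    and s6: "\<forall>A. \<forall>y\<in>?Ys. \<forall>y'\<in>?Ys. AE t in M q. dec q A y (\<lambda>k\<in>A. U q k t (y' k)) \<le> 1"
    and s7: "\<forall>A. \<forall>y\<in>?Ys. \<forall>B\<in>sets (Pi\<^sub>M A (\<lambda>_. borel)). measure (M q) {t. (\<lambda>k\<in>A. U q k t (y k)) \<in> B}
      = (\<Sum>y'\<in>?Ys. \<integral>t. indicator B (\<lambda>k\<in>A. U q k t (y' k)) * dec q A y (\<lambda>k\<in>A. U q k t (y' k)) \<partial>M q)"
    and s8: "\<forall>T S. x' q $ (T, S) = (\<integral>t. table_gain ?D (pmf (joint_law (pX q) ch)) ?Ys (\<lambda>A y y'. dec q A y' (\<lambda>k\<in>A. U q k t (y k))) T S \<partial>M q)"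
    for q
    using s[of q] unfolding realizes_def by (-) (elim conjE, assumption)+
  have finQ': "finite (set_pmf pQ)" using supQ by (rule finite_subset) simp
  interpret real_structure XX YY ch pQ pX M U dec ?Ys ?D
    by (rule real_structure.intro, rule finX, rule neX, rule finY, rule neY, erule chS, rule finQ', rule s1[THEN spec],
      rule s2, rule s3[THEN spec, THEN spec], rule s4[THEN spec, THEN spec], rule s5[THEN spec, THEN spec, THEN spec],
      erule (1) s6[THEN spec, THEN bspec, THEN bspec], erule (1) s7[THEN spec, THEN bspec, THEN bspec], rule refl, rule refl)
  \<comment> \<open>The law of \<open>Q\<close> consists of the weights of the convex combination,
    so averaging over \<open>Q\<close> gives back \<open>v\<close>.\<close>
  have "(\<Sum>q\<in>set_pmf pQ. pmf pQ q * x' q $ (T, S)) = v $ (T, S)" for T S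
  proof -
    have "(\<Sum>q\<in>set_pmf pQ. pmf pQ q * x' q $ (T, S)) = (\<Sum>q=1..m. pmf pQ q * x' q $ (T, S))"
      by (rule sum.mono_neutral_left) (use supQ in \<open>auto simp: set_pmf_iff\<close>)
    also have "\<dots> = (\<Sum>q=1..m. u q * x q $ (T, S))" by (rule sum.cong) (auto simp: pQ x'_def)
    finally show ?thesis by (simp add: vx[symmetric] sum_component)
  qed
  then have gain: "(\<Sum>q\<in>set_pmf pQ. pmf pQ q * (\<integral>t. table_gain ?D (pmf (joint_law (pX q) ch)) ?Ys
      (\<lambda>A y y'. dec q A y' (\<lambda>k\<in>A. U q k t (y k))) T S \<partial>M q)) = v $ (T, S)" for T S
    unfolding s8[THEN spec, THEN spec, symmetric] .
  obtain \<Omega> :: "(nat \<times> ('l \<Rightarrow> 'x) \<times> ('k \<Rightarrow> 'y) \<times> (nat \<Rightarrow> real)) measure" and Q X Y W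
     and f :: "'k \<Rightarrow> (nat \<Rightarrow> real) \<Rightarrow> 'y \<Rightarrow> nat \<Rightarrow> (nat \<Rightarrow> real)" and V where
    r: "cran_law XX YY ch \<Omega> Q X Y W" "\<forall>k y q. (\<lambda>w. f k w y q) \<in> borel \<rightarrow>\<^sub>M borel"
      "\<forall>k. V k = (\<lambda>\<omega>. f k (W \<omega>) (Y k \<omega>) (Q \<omega>))"
    and I: "\<And>T S. - I_fronthaul XX YY \<Omega> Q X Y V S + I_users XX \<Omega> Q X V T S = v $ (T, S)"
    using realization unfolding gain by blast
  have "(\<Sum>t\<in>T. R t) \<le> (\<Sum>s\<in>S. C s) - I_fronthaul XX YY \<Omega> Q X Y V S + I_users XX \<Omega> Q X V T S" for T S
    using v(2)[of T S] I[of S T] by linarith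
  with r show ?thesis by blast
qed

end
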